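(* Let $K$ be a commutative unital ring. Cyclic homology of $CF_\infty$-modules, $X\mapsto HC(X)$, $f\mapsto HC(f)$, determines a functor $HC:CF_\infty(K)\to GrM(K)$ from the category $CF_\infty(K)$ of $CF_\infty$-modules over $K$ to the category $GrM(K)$ of graded $K$-modules. This functor sends homotopy equivalences of $CF_\infty$-modules to isomorphisms of graded modules.
   Context: All modules are $K$-modules and all maps are $K$-linear. A differential (bigraded) module $(X,d)$ is a bigraded module $X=\{X_{n,m}\}_{n\ge 0,m\ge 0}$ with a differential $d:X_{*,\bullet}\to X_{*,\bullet-1}$ of bidegree $(0,-1)$, $d^2=0$. For a map $\varphi$ of bigraded modules of bidegree $(a,b)$ put $d(\varphi)=d\varphi-(-1)^{a+b}\varphi d$. Combinatorial notation. For integers $0\le i_1<\dots<i_k$ and $\sigma\in\Sigma_k$, let $(\sigma(i_1),\dots,\sigma(i_k))$ be the $k$-tuple obtained by permuting the components of $(i_1,\dots,i_k)$ by $\sigma$. Put $\widehat{\sigma(i_s)}=\sigma(i_s)-\alpha(\sigma(i_s))$, where $\alpha(\sigma(i_s))$ is the number of elements of $(\sigma(i_1),\dots,\sigma(i_k))$ to the right of $\sigma(i_s)$ that are smaller than $\sigma(i_s)$. $\mathrm{sign}(\sigma)\in\{0,1\}$ is the parity of $\sigma$. $I_\sigma$ is the set of all partitions of $(\widehat{\sigma(i_1)},\dots,\widehat{\sigma(i_k)})$ into two tuples $(\widehat{\sigma(i_1)},\dots,\widehat{\sigma(i_m)})$ and $(\widehat{\sigma(i_{m+1})},\dots,\widehat{\sigma(i_k)})$,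 $1\le m\le k-1$, both strictly increasing. $I'_\sigma$ is the analogous set with $0\le m\le k$ allowed (the empty tuple is written $(\,\,)$). An $F_\infty$-module $(X,d,\partial)$ is a differential module $(X,d)$ with maps $\partial=\{\partial_{(i_1,\dots,i_k)}:X_{n,\bullet}\to X_{n-k,\bullet+k-1}\}$, $1\le k\le n$, $0\le i_1<\dots<i_k\le n$, satisfying $$d(\partial_{(i_1,\dots,i_k)})=\sum_{\sigma\in\Sigma_k}\sum_{I_\sigma}(-1)^{\mathrm{sign}(\sigma)+1}\partial_{(\widehat{\sigma(i_1)},\dots,\widehat{\sigma(i_m)})}\,\partial_{(\widehat{\sigma(i_{m+1})},\dots,\widehat{\sigma(i_k)})}.$$ A $CF_\infty$-module $(X,d,\partial,t)$ is an $F_\infty$-module with maps $t=\{t_n:X_{n,\bullet}\to X_{n,\bullet}\}_{n\ge 0}$ such that $dt_n=t_nd$, $t_n^{n+1}=1$, and $\partial_{(i_1,\dots,i_k)}t_n=t_{n-k}\partial_{(i_1-1,\dots,i_k-1)}$ if $i_1>0$, $\partial_{(i_1,\dots,i_k)}t_n=(-1)^{k-1}\partial_{(i_2-1,\dots,i_k-1,n)}$ if $i_1=0$. A morphism of $F_\infty$-modules $f:X\to Y$ is a family $f=\{f_{(i_1,\dots,i_k)}:X_{n,\bullet}\to Y_{n-k,\bullet+k}\}$, $0\le k\le n$, $0\le i_1<\dots<i_k\le n$, such that $d(f_{(\,\,)})=0$ and for $k\ge 1$ $$d(f_{(i_1,\dots,i_k)})=-\partial_{(i_1,\dots,i_k)}f_{(\,\,)}+f_{(\,\,)}\partial_{(i_1,\dots,i_k)}+\sum_{\sigma\in\Sigma_k}\sum_{I_\sigma}(-1)^{\mathrm{sign}(\sigma)+1}\Big(\partial_{(\widehat{\sigma(i_1)},\dots,\widehat{\sigma(i_m)})}f_{(\widehat{\sigma(i_{m+1})},\dots,\widehat{\sigma(i_k)})}-f_{(\widehat{\sigma(i_1)},\dots,\widehat{\sigma(i_m)})}\partial_{(\widehat{\sigma(i_{m+1})},\dots,\widehat{\sigma(i_k)})}\Big).$$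 A morphism of $CF_\infty$-modules is a morphism of $F_\infty$-modules with $f_{(\,\,)}t_n=t_nf_{(\,\,)}$ and, for $k\ge 1$, $f_{(i_1,\dots,i_k)}t_n=t_{n-k}f_{(i_1-1,\dots,i_k-1)}$ if $i_1>0$, $f_{(i_1,\dots,i_k)}t_n=(-1)^{k-1}f_{(i_2-1,\dots,i_k-1,n)}$ if $i_1=0$. Composition is $$(gf)_{(i_1,\dots,i_k)}=\sum_{\sigma\in\Sigma_k}\sum_{I'_\sigma}(-1)^{\mathrm{sign}(\sigma)}g_{(\widehat{\sigma(i_1)},\dots,\widehat{\sigma(i_m)})}f_{(\widehat{\sigma(i_{m+1})},\dots,\widehat{\sigma(i_k)})},\qquad (gf)_{(\,\,)}=g_{(\,\,)}f_{(\,\,)},$$ and the identity $1_X$ has $(1_X)_{(\,\,)}=\mathrm{id}_X$ and all other components $0$. This gives the category $CF_\infty(K)$. A homotopy between morphisms of $CF_\infty$-modules $f,g:X\to Y$ is a family $h=\{h_{(i_1,\dots,i_k)}:X_{n,\bullet}\to Y_{n-k,\bullet+k+1}\}$, $0\le k\le n$, $0\le i_1<\dots<i_k\le n$, such that $d(h_{(\,\,)})=f_{(\,\,)}-g_{(\,\,)}$, for $k\ge 1$ $$d(h_{(i_1,\dots,i_k)})=f_{(i_1,\dots,i_k)}-g_{(i_1,\dots,i_k)}-\partial_{(i_1,\dots,i_k)}h_{(\,\,)}-h_{(\,\,)}\partial_{(i_1,\dots,i_k)}+\sum_{\sigma\in\Sigma_k}\sum_{I_\sigma}(-1)^{\mathrm{sign}(\sigma)+1}\Big(\partial_{(\widehat{\sigma(i_1)},\dots,\widehat{\sigma(i_m)})}h_{(\widehat{\sigma(i_{m+1})},\dots,\widehat{\sigma(i_k)})}+h_{(\widehat{\sigma(i_1)},\dots,\widehat{\sigma(i_m)})}\partial_{(\widehat{\sigma(i_{m+1})},\dots,\widehat{\sigma(i_k)})}\Big),$$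 and $h_{(\,\,)}t_n=t_nh_{(\,\,)}$, and for $k\ge 1$: $h_{(i_1,\dots,i_k)}t_n=t_{n-k}h_{(i_1-1,\dots,i_k-1)}$ if $i_1>0$, $h_{(i_1,\dots,i_k)}t_n=(-1)^{k-1}h_{(i_2-1,\dots,i_k-1,n)}$ if $i_1=0$. Two morphisms are homotopic if there is a homotopy between them (an equivalence relation). A morphism $f:X\to Y$ of $CF_\infty$-modules is a homotopy equivalence if there is a morphism $g:Y\to X$ of $CF_\infty$-modules with $gf$ homotopic to $1_X$ and $fg$ homotopic to $1_Y$. Cyclic homology. For a $CF_\infty$-module $(X,d,\partial,t)$ and $q\in\{0,1\}$ put $d_q^0=d$ and $d_q^k=\sum_{0\le i_1<\dots<i_k\le n-q}(-1)^{i_1+\dots+i_k}\partial_{(i_1,\dots,i_k)}:X_{n,\bullet}\to X_{n-k,\bullet+k-1}$ for $k\ge 1$. Put $T_n=(-1)^nt_n$ and $N_n=1+T_n+\dots+T_n^n$ on $X_{n,\bullet}$. Let $\overline X_n=\bigoplus_{k=0}^nX_{k,n-k}$, $b=\sum_i d_0^i$, $b'=\sum_i d_1^i:\overline X_n\to\overline X_{n-1}$, and let $\overline T_n,\overline N_n:\overline X_n\to\overline X_n$ act on the summand $X_{k,n-k}$ by $T_k$, $N_k$. These define a chain bicomplex $(C(\overline X),D_1,D_2)$: $C(\overline X)_{n,m}=\overline X_n$ for $n,m\ge 0$; $D_1:C(\overline X)_{n,m}\to C(\overline X)_{n,m-1}$ (for $m\ge 1$; zero for $m=0$) is $1-\overline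 T_n$ for $m$ odd and $\overline N_n$ for $m$ even; $D_2:C(\overline X)_{n,m}\to C(\overline X)_{n-1,m}$ is $b$ for $m$ even and $-b'$ for $m$ odd. $HC(X)$ is the graded homology of the total complex $(\mathrm{Tot}(C(\overline X)),D)$, $D=D_1+D_2$, $\mathrm{Tot}_r=\bigoplus_{n+m=r}C(\overline X)_{n,m}$. For a morphism $f:X\to Y$ of $CF_\infty$-modules and $q\in\{0,1\}$, put $f_q^k=\sum_{0\le i_1<\dots<i_k\le n-q}(-1)^{i_1+\dots+i_k}f_{(i_1,\dots,i_k)}:X_{n,\bullet}\to Y_{n-k,\bullet+k}$ ($k\ge 0$; $f_q^0=f_{(\,\,)}$) and $\overline f_q=\sum_{k}f_q^k:\overline X_n\to\overline Y_n$. Let $C(f):C(\overline X)_{n,m}\to C(\overline Y)_{n,m}$ be $\overline f_0$ for $m$ even and $\overline f_1$ for $m$ odd; it is a map of chain bicomplexes. $HC(f):HC(X)\to HC(Y)$ is the map induced by $C(f)$ on the homology of the total complexes. *)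

theory Defs
  imports "HOL-Algebra.Module" "HOL-Algebra.AbelCoset" "HOL-Combinatorics.Permutations"
begin

section \<open>Categories and functors\<close>

record ('o, 'm) category =
  Obj :: "'o set"
  Hom :: "'o \<Rightarrow> 'o \<Rightarrow> 'm set"
  Ident :: "'o \<Rightarrow> 'm"
  Comp :: "'o \<Rightarrow> 'o \<Rightarrow> 'o \<Rightarrow> 'm \<Rightarrow> 'm \<Rightarrow> 'm"

text \<open>\<open>Comp C X Y Z g f\<close> is the composite of \<open>f : X \<rightarrow> Y\<close> and \<open>g : Y \<rightarrow> Z\<close>.\<close>

definition is_category :: "('o, 'm) category \<Rightarrow> bool" where
  "is_category C \<longleftrightarrow>
     (\<forall>X \<in> Obj C. Ident C X \<in> Hom C X X) \<and>
     (\<forall>X \<in> Obj C. \<forall>Y \<in> Obj C. \<forall>Z \<in> Obj C. \<forall>f \<in> Hom C X Y. \<forall>g \<in> Hom C Y Z.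
        Comp C X Y Z g f \<in> Hom C X Z) \<and>
     (\<forall>X \<in> Obj C. \<forall>Y \<in> Obj C. \<forall>f \<in> Hom C X Y.
        Comp C X X Y f (Ident C X) = f \<and> Comp C X Y Y (Ident C Y) f = f) \<and>
     (\<forall>W \<in> Obj C. \<forall>X \<in> Obj C. \<forall>Y \<in> Obj C. \<forall>Z \<in> Obj C.
        \<forall>f \<in> Hom C W X. \<forall>g \<in> Hom C X Y. \<forall>h \<in> Hom C Y Z.
        Comp C W X Z (Comp C X Y Z h g) f = Comp C W Y Z h (Comp C W X Y g f))"

definition is_functor ::
  "('o, 'm) category \<Rightarrow> ('p, 'n) category \<Rightarrow> ('o \<Rightarrow> 'p) \<Rightarrow> ('o \<Rightarrow> 'o \<Rightarrow> 'm \<Rightarrow> 'n) \<Rightarrow> bool" where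
  "is_functor C D F0 F1 \<longleftrightarrow>
     is_category C \<and> is_category D \<and>
     (\<forall>X \<in> Obj C. F0 X \<in> Obj D) \<and>
     (\<forall>X \<in> Obj C. \<forall>Y \<in> Obj C. \<forall>f \<in> Hom C X Y. F1 X Y f \<in> Hom D (F0 X) (F0 Y)) \<and>
     (\<forall>X \<in> Obj C. F1 X X (Ident C X) = Ident D (F0 X)) \<and>
     (\<forall>X \<in> Obj C. \<forall>Y \<in> Obj C. \<forall>Z \<in> Obj C. \<forall>f \<in> Hom C X Y. \<forall>g \<in> Hom C Y Z.
        F1 X Z (Comp C X Y Z g f) = Comp D (F0 X) (F0 Y) (F0 Z) (F1 Y Z g) (F1 X Y f))"

definition is_isomorphism :: "('o, 'm) category \<Rightarrow> 'o \<Rightarrow> 'o \<Rightarrow> 'm \<Rightarrow> bool" where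
  "is_isomorphism C X Y f \<longleftrightarrow>
     X \<in> Obj C \<and> Y \<in> Obj C \<and> f \<in> Hom C X Y \<and>
     (\<exists>g \<in> Hom C Y X. Comp C X Y X g f = Ident C X \<and> Comp C Y X Y f g = Ident C Y)"


section \<open>Linear maps, graded modules, finite direct sums, homology\<close>

definition linear_maps ::
  "('k, 'r) ring_scheme \<Rightarrow> ('k, 'a) module \<Rightarrow> ('k, 'b) module \<Rightarrow> ('a \<Rightarrow> 'b) set" where
  "linear_maps K M N = {f \<in> carrier M \<rightarrow> carrier N.
     (\<forall>x \<in> carrier M. \<forall>y \<in> carrier M. f (x \<oplus>\<^bsub>M\<^esub> y) = f x \<oplus>\<^bsub>N\<^esub> f y) \<and>
     (\<forall>a \<in> carrier K. \<forall>x \<in> carrier M. f (a \<odot>\<^bsub>M\<^esub> x) = a \<odot>\<^bsub>N\<^esub> f x)}"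

text \<open>Arrows are functions normalised to be \<open>undefined\<close> outside the carrier, so that
  equality of arrows is equality of maps.\<close>

definition GrM_cat ::
  "('k, 'r) ring_scheme \<Rightarrow> (nat \<Rightarrow> ('k, 'a) module, nat \<Rightarrow> 'a \<Rightarrow> 'a) category" where
  "GrM_cat K = \<lparr>
     Obj = {M. \<forall>r. module K (M r)},
     Hom = (\<lambda>M N. {f. \<forall>r. f r \<in> linear_maps K (M r) (N r) \<inter> extensional (carrier (M r))}),
     Ident = (\<lambda>M r. \<lambda>x \<in> carrier (M r). x),
     Comp = (\<lambda>L M N g f r. \<lambda>x \<in> carrier (L r). g r (f r x)) \<rparr>"

text \<open>The ring multiplication slots of a \<open>module\<close> record play no role for modules;
  they are left unspecified in the constructions below.\<close>

definition direct_sum :: "'i set \<Rightarrow> ('i \<Rightarrow> ('k, 'a) module) \<Rightarrow> ('k, 'i \<Rightarrow> 'a) module"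
  \<comment> \<open>only used for finite index sets, where direct sum and product agree\<close> where
  "direct_sum I M = \<lparr>
     carrier = (\<Pi>\<^sub>E i \<in> I. carrier (M i)),
     monoid.mult = undefined, one = undefined,
     zero = (\<lambda>i \<in> I. \<zero>\<^bsub>M i\<^esub>),
     add = (\<lambda>x y. \<lambda>i \<in> I. x i \<oplus>\<^bsub>M i\<^esub> y i),
     smult = (\<lambda>a x. \<lambda>i \<in> I. a \<odot>\<^bsub>M i\<^esub> x i) \<rparr>"

definition subquotient :: "('k, 'a) module \<Rightarrow> 'a set \<Rightarrow> 'a set \<Rightarrow> ('k, 'a set) module"
  \<comment> \<open>the module \<open>Z / B\<close> of cosets, for submodules \<open>B \<subseteq> Z\<close> of \<open>M\<close>\<close> where
  "subquotient M Z B = \<lparr>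
     carrier = (\<lambda>z. B +>\<^bsub>M\<^esub> z) ` Z,
     monoid.mult = undefined, one = undefined,
     zero = B,
     add = (\<lambda>U V. U <+>\<^bsub>M\<^esub> V),
     smult = (\<lambda>a U. \<Union>z \<in> U. B +>\<^bsub>M\<^esub> (a \<odot>\<^bsub>M\<^esub> z)) \<rparr>"

text \<open>A complex concentrated in degrees \<open>r \<ge> 0\<close> is given by modules \<open>C r\<close> and maps
  \<open>D r : C r \<rightarrow> C (r - 1)\<close> for \<open>r \<ge> 1\<close>; \<open>D 0\<close> is never used.\<close>

definition cycles :: "(nat \<Rightarrow> ('k, 'a) module) \<Rightarrow> (nat \<Rightarrow> 'a \<Rightarrow> 'a) \<Rightarrow> nat \<Rightarrow> 'a set" where
  "cycles C D r = {z \<in> carrier (C r). r = 0 \<or> D r z = \<zero>\<^bsub>C (r - 1)\<^esub>}"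

definition boundaries :: "(nat \<Rightarrow> ('k, 'a) module) \<Rightarrow> (nat \<Rightarrow> 'a \<Rightarrow> 'a) \<Rightarrow> nat \<Rightarrow> 'a set" where
  "boundaries C D r = D (Suc r) ` carrier (C (Suc r))"

definition homology ::
  "(nat \<Rightarrow> ('k, 'a) module) \<Rightarrow> (nat \<Rightarrow> 'a \<Rightarrow> 'a) \<Rightarrow> nat \<Rightarrow> ('k, 'a set) module" where
  "homology C D r = subquotient (C r) (cycles C D r) (boundaries C D r)"

text \<open>The map \<open>[z] \<mapsto> [\<phi> z]\<close>; on a coset \<open>U\<close> all members of the union coincide when \<open>\<phi>\<close>
  is a chain map.\<close>

definition homology_map ::
  "(nat \<Rightarrow> ('k, 'a) module) \<Rightarrow> (nat \<Rightarrow> 'a \<Rightarrow> 'a) \<Rightarrow> (nat \<Rightarrow> ('k, 'b) module) \<Rightarrow> (nat \<Rightarrow> 'b \<Rightarrow> 'b) \<Rightarrow>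
   (nat \<Rightarrow> 'a \<Rightarrow> 'b) \<Rightarrow> nat \<Rightarrow> 'a set \<Rightarrow> 'b set" where
  "homology_map C D C' D' \<phi> r =
     (\<lambda>U \<in> carrier (homology C D r). \<Union>z \<in> U. boundaries C' D' r +>\<^bsub>C' r\<^esub> \<phi> r z)"


section \<open>Permuted tuples\<close>

text \<open>Tuples \<open>(i\<^sub>1, \<dots>, i\<^sub>k)\<close> are lists, with positions counted from 0. \<open>hat J\<close> is the
  hatted tuple of the permuted tuple \<open>J = (\<sigma>(i\<^sub>1), \<dots>, \<sigma>(i\<^sub>k))\<close>; since the entries of \<open>J\<close> are
  distinct, the subtraction does not truncate.\<close>

definition hat :: "nat list \<Rightarrow> nat list" where
  "hat J = map (\<lambda>s. J ! s - card {r. s < r \<and> r < length J \<and> J ! r < J ! s}) [0..<length J]"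

text \<open>A partition in \<open>I\<^sub>\<sigma>\<close> or \<open>I'\<^sub>\<sigma>\<close> is represented by the length \<open>m\<close> of its left part.\<close>

definition splits' :: "nat list \<Rightarrow> nat set" where
  "splits' J = {m. m \<le> length J \<and>
     sorted_wrt (<) (take m (hat J)) \<and> sorted_wrt (<) (drop m (hat J))}"

definition splits :: "nat list \<Rightarrow> nat set" where
  "splits J = {m \<in> splits' J. 1 \<le> m \<and> m + 1 \<le> length J}"

text \<open>\<open>perm_sum M S c I \<phi>\<close> is the sum over \<open>\<sigma>\<close> and over the partitions \<open>(A, B)\<close> singled out by
  \<open>S\<close> of \<open>c (-1)\<^bsup>sign \<sigma>\<^esup> \<phi> A B\<close>. Note that \<open>sign \<sigma>\<close> in the library is \<open>1\<close> or \<open>-1\<close>, not a parity.\<close>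

definition perm_sum ::
  "('k, 'a) module \<Rightarrow> (nat list \<Rightarrow> nat set) \<Rightarrow> int \<Rightarrow> nat list \<Rightarrow>
   (nat list \<Rightarrow> nat list \<Rightarrow> 'a) \<Rightarrow> 'a" where
  "perm_sum M S c I \<phi> =
     (\<Oplus>\<^bsub>M\<^esub>\<sigma> \<in> {\<sigma>. \<sigma> permutes {..<length I}}. \<Oplus>\<^bsub>M\<^esub>m \<in> S (permute_list \<sigma> I).
        [(c * sign \<sigma>)] \<cdot>\<^bsub>M\<^esub> \<phi> (take m (hat (permute_list \<sigma> I))) (drop m (hat (permute_list \<sigma> I))))"

definition tuple :: "nat \<Rightarrow> nat list \<Rightarrow> bool"
  \<comment> \<open>\<open>0 \<le> k \<le> n\<close> and \<open>0 \<le> i\<^sub>1 < \<dots> < i\<^sub>k \<le> n\<close>\<close> where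
  "tuple n I \<longleftrightarrow> length I \<le> n \<and> sorted_wrt (<) I \<and> (\<forall>i \<in> set I. i \<le> n)"


section \<open>Differential modules, \<open>F\<^sub>\<infinity>\<close>-modules and \<open>CF\<^sub>\<infinity>\<close>-modules\<close>

text \<open>The second degree ranges over the integers, with zero modules in negative degrees, so that
  maps lowering it need no case distinction. A map of the form
  \<open>X\<^bsub>n,\<bullet>\<^esub> \<rightarrow> Y\<^bsub>n',\<bullet>+b\<^esub>\<close> is a family indexed by the second degree of its source, and
  \<open>fac X I n m\<close> is the component \<open>\<partial>\<^sub>I\<close> starting at \<open>X\<^bsub>n,m\<^esub>\<close>, constrained only when \<open>I\<close> is a
  nonempty admissible tuple.\<close>

record ('k, 'a) diff_module =
  grd :: "nat \<Rightarrow> int \<Rightarrow> ('k, 'a) module"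
  dif :: "nat \<Rightarrow> int \<Rightarrow> 'a \<Rightarrow> 'a"

record ('k, 'a) F_module = "('k, 'a) diff_module" +
  fac :: "nat list \<Rightarrow> nat \<Rightarrow> int \<Rightarrow> 'a \<Rightarrow> 'a"

record ('k, 'a) CF_module = "('k, 'a) F_module" +
  cyc :: "nat \<Rightarrow> int \<Rightarrow> 'a \<Rightarrow> 'a"

definition is_diff_module ::
  "('k, 'r) ring_scheme \<Rightarrow> ('k, 'a, 'x) diff_module_scheme \<Rightarrow> bool" where
  "is_diff_module K X \<longleftrightarrow>
     (\<forall>n m. module K (grd X n m)) \<and>
     (\<forall>n m. m < 0 \<longrightarrow> carrier (grd X n m) = {\<zero>\<^bsub>grd X n m\<^esub>}) \<and>
     (\<forall>n m. dif X n m \<in> linear_maps K (grd X n m) (grd X n (m - 1))) \<and>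
     (\<forall>n m. \<forall>x \<in> carrier (grd X n m). dif X n (m - 1) (dif X n m x) = \<zero>\<^bsub>grd X n (m - 2)\<^esub>)"

text \<open>\<open>hom_diff X Y n n' b \<phi> m x\<close> is \<open>d(\<phi>)(x)\<close> for \<open>\<phi> : X\<^bsub>n,\<bullet>\<^esub> \<rightarrow> Y\<^bsub>n',\<bullet>+b\<^esub>\<close>, a map of bidegree
  \<open>(n' - n, b)\<close>, and \<open>x \<in> X\<^bsub>n,m\<^esub>\<close>.\<close>

definition hom_diff ::
  "('k, 'a, 'x) diff_module_scheme \<Rightarrow> ('k, 'b, 'y) diff_module_scheme \<Rightarrow> nat \<Rightarrow> nat \<Rightarrow> int \<Rightarrow>
   (int \<Rightarrow> 'a \<Rightarrow> 'b) \<Rightarrow> int \<Rightarrow> 'a \<Rightarrow> 'b" where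
  "hom_diff X Y n n' b \<phi> m x =
     dif Y n' (m + b) (\<phi> m x) \<ominus>\<^bsub>grd Y n' (m + b - 1)\<^esub>
     [(if even (int n' - int n + b) then 1 else - 1 :: int)] \<cdot>\<^bsub>grd Y n' (m + b - 1)\<^esub>
       \<phi> (m - 1) (dif X n m x)"

definition is_F_module :: "('k, 'r) ring_scheme \<Rightarrow> ('k, 'a, 'x) F_module_scheme \<Rightarrow> bool" where
  "is_F_module K X \<longleftrightarrow>
     is_diff_module K X \<and>
     (\<forall>n m I. tuple n I \<and> I \<noteq> [] \<longrightarrow>
        fac X I n m \<in>
          linear_maps K (grd X n m) (grd X (n - length I) (m + int (length I) - 1))) \<and>
     (\<forall>n m I. \<forall>x \<in> carrier (grd X n m). tuple n I \<and> I \<noteq> [] \<longrightarrow>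
        hom_diff X X n (n - length I) (int (length I) - 1) (fac X I n) m x =
        perm_sum (grd X (n - length I) (m + int (length I) - 2)) splits (- 1) I
          (\<lambda>A B. fac X A (n - length B) (m + int (length B) - 1) (fac X B n m x)))"

text \<open>The compatibility with \<open>t\<close> of the component \<open>\<phi>\<^sub>I\<close>, \<open>k = length I \<ge> 1\<close>, of a family
  \<open>\<phi>\<^sub>I : X\<^bsub>n,\<bullet>\<^esub> \<rightarrow> Y\<^bsub>n-k,\<bullet>+k+b\<^esub>\<close>, evaluated at \<open>x \<in> X\<^bsub>n,m\<^esub>\<close>. It is shared by the maps
  \<open>\<partial>\<close> (\<open>b = -1\<close>), morphisms (\<open>b = 0\<close>) and homotopies (\<open>b = 1\<close>).\<close>

definition cyclic_compatible ::
  "('k, 'a) CF_module \<Rightarrow> ('k, 'b) CF_module \<Rightarrow> int \<Rightarrow> (nat list \<Rightarrow> nat \<Rightarrow> int \<Rightarrow> 'a \<Rightarrow> 'b) \<Rightarrow>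
   nat list \<Rightarrow> nat \<Rightarrow> int \<Rightarrow> 'a \<Rightarrow> bool" where
  "cyclic_compatible X Y b \<phi> I n m x \<longleftrightarrow>
     (if hd I > 0
      then \<phi> I n m (cyc X n m x) =
           cyc Y (n - length I) (m + int (length I) + b) (\<phi> (map (\<lambda>i. i - 1) I) n m x)
      else \<phi> I n m (cyc X n m x) =
           [((- 1 :: int) ^ (length I - 1))] \<cdot>\<^bsub>grd Y (n - length I) (m + int (length I) + b)\<^esub>
             \<phi> (map (\<lambda>i. i - 1) (tl I) @ [n]) n m x)"

definition is_CF_module :: "('k, 'r) ring_scheme \<Rightarrow> ('k, 'a) CF_module \<Rightarrow> bool" where
  "is_CF_module K X \<longleftrightarrow>
     is_F_module K X \<and>
     (\<forall>n m. cyc X n m \<in> linear_maps K (grd X n m) (grd X n m)) \<and>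
     (\<forall>n m. \<forall>x \<in> carrier (grd X n m).
        dif X n m (cyc X n m x) = cyc X n (m - 1) (dif X n m x) \<and>
        (cyc X n m ^^ (n + 1)) x = x \<and>
        (\<forall>I. tuple n I \<and> I \<noteq> [] \<longrightarrow> cyclic_compatible X X (- 1) (fac X) I n m x))"


section \<open>Morphisms, composition and homotopies\<close>

definition is_F_morphism ::
  "('k, 'r) ring_scheme \<Rightarrow> ('k, 'a, 'x) F_module_scheme \<Rightarrow> ('k, 'b, 'y) F_module_scheme \<Rightarrow>
   (nat list \<Rightarrow> nat \<Rightarrow> int \<Rightarrow> 'a \<Rightarrow> 'b) \<Rightarrow> bool" where
  "is_F_morphism K X Y f \<longleftrightarrow>
     (\<forall>n m I. tuple n I \<longrightarrow>
        f I n m \<in> linear_maps K (grd X n m) (grd Y (n - length I) (m + int (length I)))) \<and>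
     (\<forall>n m. \<forall>x \<in> carrier (grd X n m). hom_diff X Y n n 0 (f [] n) m x = \<zero>\<^bsub>grd Y n (m - 1)\<^esub>) \<and>
     (\<forall>n m I. \<forall>x \<in> carrier (grd X n m). tuple n I \<and> I \<noteq> [] \<longrightarrow>
        (let k = length I; M = grd Y (n - k) (m + int k - 1) in
         hom_diff X Y n (n - k) (int k) (f I n) m x =
         (\<ominus>\<^bsub>M\<^esub> fac Y I n m (f [] n m x))
         \<oplus>\<^bsub>M\<^esub> f [] (n - k) (m + int k - 1) (fac X I n m x)
         \<oplus>\<^bsub>M\<^esub> perm_sum M splits (- 1) I (\<lambda>A B.
             fac Y A (n - length B) (m + int (length B)) (f B n m x)
             \<ominus>\<^bsub>M\<^esub> f A (n - length B) (m + int (length B) - 1) (fac X B n m x))))"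

definition is_CF_morphism ::
  "('k, 'r) ring_scheme \<Rightarrow> ('k, 'a) CF_module \<Rightarrow> ('k, 'b) CF_module \<Rightarrow>
   (nat list \<Rightarrow> nat \<Rightarrow> int \<Rightarrow> 'a \<Rightarrow> 'b) \<Rightarrow> bool" where
  "is_CF_morphism K X Y f \<longleftrightarrow>
     is_F_morphism K X Y f \<and>
     (\<forall>n m. \<forall>x \<in> carrier (grd X n m).
        f [] n m (cyc X n m x) = cyc Y n m (f [] n m x) \<and>
        (\<forall>I. tuple n I \<and> I \<noteq> [] \<longrightarrow> cyclic_compatible X Y 0 f I n m x))"

text \<open>A family \<open>f\<close> carries no information at inadmissible tuples and outside the carriers; these
  values are fixed so that equality of families is equality of all components.\<close>

definition normalised ::
  "('k, 'a) CF_module \<Rightarrow> (nat list \<Rightarrow> nat \<Rightarrow> int \<Rightarrow> 'a \<Rightarrow> 'b) \<Rightarrow> bool" where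
  "normalised X f \<longleftrightarrow>
     (\<forall>n m I. if tuple n I then f I n m \<in> extensional (carrier (grd X n m))
              else f I n m = (\<lambda>_. undefined))"

definition normalise ::
  "('k, 'a) CF_module \<Rightarrow> (nat list \<Rightarrow> nat \<Rightarrow> int \<Rightarrow> 'a \<Rightarrow> 'b) \<Rightarrow>
   nat list \<Rightarrow> nat \<Rightarrow> int \<Rightarrow> 'a \<Rightarrow> 'b" where
  "normalise X f =
     (\<lambda>I n m. if tuple n I then restrict (f I n m) (carrier (grd X n m)) else (\<lambda>_. undefined))"

definition CF_comp ::
  "('k, 'a) CF_module \<Rightarrow> ('k, 'b) CF_module \<Rightarrow> ('k, 'c) CF_module \<Rightarrow>
   (nat list \<Rightarrow> nat \<Rightarrow> int \<Rightarrow> 'b \<Rightarrow> 'c) \<Rightarrow> (nat list \<Rightarrow> nat \<Rightarrow> int \<Rightarrow> 'a \<Rightarrow> 'b) \<Rightarrow>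
   nat list \<Rightarrow> nat \<Rightarrow> int \<Rightarrow> 'a \<Rightarrow> 'c" where
  "CF_comp X Y Z g f = normalise X (\<lambda>I n m x.
     if I = [] then g [] n m (f [] n m x)
     else perm_sum (grd Z (n - length I) (m + int (length I))) splits' 1 I
            (\<lambda>A B. g A (n - length B) (m + int (length B)) (f B n m x)))"

definition CF_ident ::
  "('k, 'a) CF_module \<Rightarrow> nat list \<Rightarrow> nat \<Rightarrow> int \<Rightarrow> 'a \<Rightarrow> 'a" where
  "CF_ident X = normalise X (\<lambda>I n m x.
     if I = [] then x else \<zero>\<^bsub>grd X (n - length I) (m + int (length I))\<^esub>)"

definition CF_cat ::
  "('k, 'r) ring_scheme \<Rightarrow>
   (('k, 'a) CF_module, nat list \<Rightarrow> nat \<Rightarrow> int \<Rightarrow> 'a \<Rightarrow> 'a) category" where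
  "CF_cat K = \<lparr>
     Obj = {X. is_CF_module K X},
     Hom = (\<lambda>X Y. {f. is_CF_morphism K X Y f \<and> normalised X f}),
     Ident = CF_ident,
     Comp = CF_comp \<rparr>"

definition is_homotopy ::
  "('k, 'r) ring_scheme \<Rightarrow> ('k, 'a) CF_module \<Rightarrow> ('k, 'b) CF_module \<Rightarrow>
   (nat list \<Rightarrow> nat \<Rightarrow> int \<Rightarrow> 'a \<Rightarrow> 'b) \<Rightarrow> (nat list \<Rightarrow> nat \<Rightarrow> int \<Rightarrow> 'a \<Rightarrow> 'b) \<Rightarrow>
   (nat list \<Rightarrow> nat \<Rightarrow> int \<Rightarrow> 'a \<Rightarrow> 'b) \<Rightarrow> bool" where
  "is_homotopy K X Y f g h \<longleftrightarrow>
     (\<forall>n m I. tuple n I \<longrightarrow>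
        h I n m \<in> linear_maps K (grd X n m) (grd Y (n - length I) (m + int (length I) + 1))) \<and>
     (\<forall>n m. \<forall>x \<in> carrier (grd X n m).
        hom_diff X Y n n 1 (h [] n) m x = f [] n m x \<ominus>\<^bsub>grd Y n m\<^esub> g [] n m x) \<and>
     (\<forall>n m I. \<forall>x \<in> carrier (grd X n m). tuple n I \<and> I \<noteq> [] \<longrightarrow>
        (let k = length I; M = grd Y (n - k) (m + int k) in
         hom_diff X Y n (n - k) (int k + 1) (h I n) m x =
         (f I n m x \<ominus>\<^bsub>M\<^esub> g I n m x
            \<ominus>\<^bsub>M\<^esub> fac Y I n (m + 1) (h [] n m x)
            \<ominus>\<^bsub>M\<^esub> h [] (n - k) (m + int k - 1) (fac X I n m x))
         \<oplus>\<^bsub>M\<^esub> perm_sum M splits (- 1) I (\<lambda>A B.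
             fac Y A (n - length B) (m + int (length B) + 1) (h B n m x)
             \<oplus>\<^bsub>M\<^esub> h A (n - length B) (m + int (length B) - 1) (fac X B n m x)))) \<and>
     (\<forall>n m. \<forall>x \<in> carrier (grd X n m).
        h [] n m (cyc X n m x) = cyc Y n (m + 1) (h [] n m x) \<and>
        (\<forall>I. tuple n I \<and> I \<noteq> [] \<longrightarrow> cyclic_compatible X Y 1 h I n m x))"

definition homotopic ::
  "('k, 'r) ring_scheme \<Rightarrow> ('k, 'a) CF_module \<Rightarrow> ('k, 'b) CF_module \<Rightarrow>
   (nat list \<Rightarrow> nat \<Rightarrow> int \<Rightarrow> 'a \<Rightarrow> 'b) \<Rightarrow> (nat list \<Rightarrow> nat \<Rightarrow> int \<Rightarrow> 'a \<Rightarrow> 'b) \<Rightarrow> bool" where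
  "homotopic K X Y f g \<longleftrightarrow> (\<exists>h. is_homotopy K X Y f g h)"

definition is_homotopy_equivalence ::
  "('k, 'r) ring_scheme \<Rightarrow> ('k, 'a) CF_module \<Rightarrow> ('k, 'a) CF_module \<Rightarrow>
   (nat list \<Rightarrow> nat \<Rightarrow> int \<Rightarrow> 'a \<Rightarrow> 'a) \<Rightarrow> bool" where
  "is_homotopy_equivalence K X Y f \<longleftrightarrow>
     X \<in> Obj (CF_cat K) \<and> Y \<in> Obj (CF_cat K) \<and> f \<in> Hom (CF_cat K) X Y \<and>
     (\<exists>g \<in> Hom (CF_cat K) Y X.
        homotopic K X X (CF_comp X Y X g f) (CF_ident X) \<and>
        homotopic K Y Y (CF_comp Y X Y f g) (CF_ident Y))"


section \<open>Cyclic homology\<close>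

definition tuples_upto :: "nat \<Rightarrow> nat \<Rightarrow> nat \<Rightarrow> nat list set"
  \<comment> \<open>\<open>0 \<le> i\<^sub>1 < \<dots> < i\<^sub>k \<le> n - q\<close>, where \<open>n - q\<close> may be negative\<close> where
  "tuples_upto q k n = {I. length I = k \<and> sorted_wrt (<) I \<and> (\<forall>i \<in> set I. i + q \<le> n)}"

definition dq :: "('k, 'a) CF_module \<Rightarrow> nat \<Rightarrow> nat \<Rightarrow> nat \<Rightarrow> int \<Rightarrow> 'a \<Rightarrow> 'a"
  \<comment> \<open>\<open>d\<^sub>q\<^sup>k : X\<^bsub>n,m\<^esub> \<rightarrow> X\<^bsub>n-k,m+k-1\<^esub>\<close>\<close> where
  "dq X q k n m x =
     (if k = 0 then dif X n m x
      else \<Oplus>\<^bsub>grd X (n - k) (m + int k - 1)\<^esub>I \<in> tuples_upto q k n.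
             [((- 1 :: int) ^ sum_list I)] \<cdot>\<^bsub>grd X (n - k) (m + int k - 1)\<^esub> fac X I n m x)"

definition fq ::
  "('k, 'b) CF_module \<Rightarrow> (nat list \<Rightarrow> nat \<Rightarrow> int \<Rightarrow> 'a \<Rightarrow> 'b) \<Rightarrow> nat \<Rightarrow> nat \<Rightarrow> nat \<Rightarrow> int \<Rightarrow> 'a \<Rightarrow> 'b"
  \<comment> \<open>\<open>f\<^sub>q\<^sup>k : X\<^bsub>n,m\<^esub> \<rightarrow> Y\<^bsub>n-k,m+k\<^esub>\<close>\<close> where
  "fq Y f q k n m x =
     (if k = 0 then f [] n m x
      else \<Oplus>\<^bsub>grd Y (n - k) (m + int k)\<^esub>I \<in> tuples_upto q k n.
             [((- 1 :: int) ^ sum_list I)] \<cdot>\<^bsub>grd Y (n - k) (m + int k)\<^esub> f I n m x)"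

definition bar :: "('k, 'a) CF_module \<Rightarrow> nat \<Rightarrow> ('k, nat \<Rightarrow> 'a) module" where
  "bar X n = direct_sum {..n} (\<lambda>k. grd X k (int (n - k)))"

text \<open>\<open>bar_b X 0 n\<close> is \<open>b\<close> and \<open>bar_b X 1 n\<close> is \<open>b'\<close>, both from \<open>bar X n\<close> to \<open>bar X (n - 1)\<close> for
  \<open>n \<ge> 1\<close>. The component in the summand \<open>X\<^bsub>j,n-1-j\<^esub>\<close> collects the \<open>d\<^sub>q\<^sup>i\<close> starting at the summand
  \<open>X\<^bsub>j+i,n-j-i\<^esub>\<close>.\<close>

definition bar_b :: "('k, 'a) CF_module \<Rightarrow> nat \<Rightarrow> nat \<Rightarrow> (nat \<Rightarrow> 'a) \<Rightarrow> nat \<Rightarrow> 'a" where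
  "bar_b X q n v = (\<lambda>j \<in> {..n - 1}.
     \<Oplus>\<^bsub>grd X j (int (n - 1 - j))\<^esub>i \<in> {..n - j}. dq X q i (j + i) (int (n - j - i)) (v (j + i)))"

definition bar_map ::
  "('k, 'b) CF_module \<Rightarrow> (nat list \<Rightarrow> nat \<Rightarrow> int \<Rightarrow> 'a \<Rightarrow> 'b) \<Rightarrow> nat \<Rightarrow> nat \<Rightarrow>
   (nat \<Rightarrow> 'a) \<Rightarrow> nat \<Rightarrow> 'b" where
  "bar_map Y f q n v = (\<lambda>j \<in> {..n}.
     \<Oplus>\<^bsub>grd Y j (int (n - j))\<^esub>i \<in> {..n - j}. fq Y f q i (j + i) (int (n - j - i)) (v (j + i)))"

definition T_map :: "('k, 'a) CF_module \<Rightarrow> nat \<Rightarrow> int \<Rightarrow> 'a \<Rightarrow> 'a" where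
  "T_map X n m x = [((- 1 :: int) ^ n)] \<cdot>\<^bsub>grd X n m\<^esub> cyc X n m x"

definition N_map :: "('k, 'a) CF_module \<Rightarrow> nat \<Rightarrow> int \<Rightarrow> 'a \<Rightarrow> 'a" where
  "N_map X n m x = (\<Oplus>\<^bsub>grd X n m\<^esub>j \<in> {..n}. (T_map X n m ^^ j) x)"

definition bar_T :: "('k, 'a) CF_module \<Rightarrow> nat \<Rightarrow> (nat \<Rightarrow> 'a) \<Rightarrow> nat \<Rightarrow> 'a" where
  "bar_T X n v = (\<lambda>k \<in> {..n}. T_map X k (int (n - k)) (v k))"

definition bar_N :: "('k, 'a) CF_module \<Rightarrow> nat \<Rightarrow> (nat \<Rightarrow> 'a) \<Rightarrow> nat \<Rightarrow> 'a" where
  "bar_N X n v = (\<lambda>k \<in> {..n}. N_map X k (int (n - k)) (v k))"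

text \<open>The bicomplex has \<open>C\<^bsub>n,m\<^esub> = bar X n\<close>; \<open>D1 X n m\<close> starts at \<open>C\<^bsub>n,m\<^esub>\<close> with \<open>m \<ge> 1\<close>, and
  \<open>D2 X n m\<close> at \<open>C\<^bsub>n,m\<^esub>\<close> with \<open>n \<ge> 1\<close>.\<close>

definition D1 :: "('k, 'a) CF_module \<Rightarrow> nat \<Rightarrow> nat \<Rightarrow> (nat \<Rightarrow> 'a) \<Rightarrow> nat \<Rightarrow> 'a" where
  "D1 X n m v = (if odd m then v \<ominus>\<^bsub>bar X n\<^esub> bar_T X n v else bar_N X n v)"

definition D2 :: "('k, 'a) CF_module \<Rightarrow> nat \<Rightarrow> nat \<Rightarrow> (nat \<Rightarrow> 'a) \<Rightarrow> nat \<Rightarrow> 'a" where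
  "D2 X n m v = (if even m then bar_b X 0 n v else \<ominus>\<^bsub>bar X (n - 1)\<^esub> bar_b X 1 n v)"

text \<open>An element of the total complex in degree \<open>r\<close> is a family \<open>v\<close> with
  \<open>v n \<in> C\<^bsub>n,r-n\<^esub>\<close> for \<open>n \<le> r\<close>. The component of its differential in \<open>C\<^bsub>n,r-1-n\<^esub>\<close> receives
  \<open>D\<^sub>1\<close> from \<open>C\<^bsub>n,r-n\<^esub>\<close> and \<open>D\<^sub>2\<close> from \<open>C\<^bsub>n+1,r-1-n\<^esub>\<close>.\<close>

definition Tot :: "('k, 'a) CF_module \<Rightarrow> nat \<Rightarrow> ('k, nat \<Rightarrow> nat \<Rightarrow> 'a) module" where
  "Tot X r = direct_sum {..r} (bar X)"

definition Tot_diff ::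
  "('k, 'a) CF_module \<Rightarrow> nat \<Rightarrow> (nat \<Rightarrow> nat \<Rightarrow> 'a) \<Rightarrow> nat \<Rightarrow> nat \<Rightarrow> 'a" where
  "Tot_diff X r v = (\<lambda>n \<in> {..r - 1}.
     D1 X n (r - n) (v n) \<oplus>\<^bsub>bar X n\<^esub> D2 X (n + 1) (r - 1 - n) (v (n + 1)))"

definition Tot_map ::
  "('k, 'b) CF_module \<Rightarrow> (nat list \<Rightarrow> nat \<Rightarrow> int \<Rightarrow> 'a \<Rightarrow> 'b) \<Rightarrow> nat \<Rightarrow>
   (nat \<Rightarrow> nat \<Rightarrow> 'a) \<Rightarrow> nat \<Rightarrow> nat \<Rightarrow> 'b" where
  "Tot_map Y f r v = (\<lambda>n \<in> {..r}. bar_map Y f (if even (r - n) then 0 else 1) n (v n))"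

definition HC :: "('k, 'a) CF_module \<Rightarrow> nat \<Rightarrow> ('k, (nat \<Rightarrow> nat \<Rightarrow> 'a) set) module" where
  "HC X = homology (Tot X) (Tot_diff X)"

definition HC_map ::
  "('k, 'a) CF_module \<Rightarrow> ('k, 'b) CF_module \<Rightarrow> (nat list \<Rightarrow> nat \<Rightarrow> int \<Rightarrow> 'a \<Rightarrow> 'b) \<Rightarrow>
   nat \<Rightarrow> (nat \<Rightarrow> nat \<Rightarrow> 'a) set \<Rightarrow> (nat \<Rightarrow> nat \<Rightarrow> 'b) set" where
  "HC_map X Y f = homology_map (Tot X) (Tot_diff X) (Tot Y) (Tot_diff Y) (Tot_map Y f)"

end

theory Submission
  imports Defs
begin

text \<open>All signs and permutations in the definitions can be made to disappear, and what is left is the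
formal algebra of twisted complexes together with one bijection on cyclic words.

A tuple \<open>i\<^sub>1 < \<dots> < i\<^sub>k\<close> is a finite set \<open>S\<close>. A permutation \<open>\<sigma>\<close> of it, together with a cut of the hatted
tuple into two increasing blocks, is the same as a subset \<open>B \<subseteq> S\<close>, the underlying set of the right-hand
block (\<open>bij_betw_splits\<close>): the right-hand block is not changed by hatting, while hatting renumbers the
complement \<open>S - B\<close> by closing the gaps left by \<open>B\<close>. The number of inversions of \<open>\<sigma>\<close> is the amount by
which hatting lowers the sum of the entries (\<open>crossings_sign\<close>). Hence for the signed components
\<open>(-1)\<^bsup>\<Sum>S\<^esup> \<phi>\<^sub>S\<close>, all sums over \<open>I\<^sub>\<sigma>\<close> and \<open>I'\<^sub>\<sigma>\<close> become the sign-free convolution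
\<open>(\<phi> * \<psi>)\<^sub>S = \<Sum>\<^bsub>B \<subseteq> S\<^esub> \<phi>\<^bsub>hat(S - B)\<^esub> \<psi>\<^sub>B\<close> (\<open>perm_sum_conv\<close>). With the convention \<open>\<partial>\<^bsub>()\<^esub> = d\<close>, the
structure equation of an \<open>F\<^sub>\<infinity>\<close>-module reads \<open>\<partial> * \<partial> = 0\<close>, a morphism satisfies \<open>\<partial> * f = f * \<partial>\<close>, a homotopy
satisfies \<open>\<partial> * h + h * \<partial> = f - g\<close>, and composition of morphisms is convolution. Closing gaps in two steps is
the same as closing them at once, so convolution is associative (\<open>conv_assoc\<close>), which gives the
category.

Summing the components over all subsets \<open>S\<close> of \<open>{0..n-q}\<close> turns convolution into composition
(\<open>bar_comp_conv\<close>), because \<open>(A, B) \<mapsto> (hat A, B)\<close> is a bijection from pairs of disjoint subsets to pairs of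
index sets of composable maps. So \<open>b\<^sup>2 = 0\<close>, \<open>b'\<^sup>2 = 0\<close>, and the passage from \<open>f\<close> to \<open>f\<^sub>q\<close> respects compositions, identities and
homotopies.

For \<open>T = (-1)\<^sup>n t\<close> the cyclic relations lose their signs as well: \<open>\<phi>\<^sub>S T\<close> is \<open>\<phi>\<^bsub>rot S\<^esub>\<close> if \<open>0 \<in> S\<close> and
\<open>T \<phi>\<^bsub>rot S\<^esub>\<close> otherwise, where \<open>rot\<close> is the rotation of \<open>{0..n}\<close>. Summing over \<open>S\<close> gives
\<open>\<phi>\<^sub>0 (1 - T) = (1 - T) \<phi>\<^sub>1\<close> at once (\<open>cyclic_one_minus\<close>), and \<open>\<phi>\<^sub>1 N = N \<phi>\<^sub>0\<close> by counting rotations of subsets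
(\<open>cyclic_norm\<close>). These identities hold for \<open>\<partial>\<close>, for morphisms and for homotopies alike. They make
\<open>C(X)\<close> a bicomplex and \<open>C(f)\<close> a map of bicomplexes, and a homotopy \<open>h\<close> yields a homotopy of the total
complexes, equal to \<open>h\<^sub>0\<close> in even and \<open>-h\<^sub>1\<close> in odd columns (\<open>cyclic_bicomplex_homotopy\<close>). Hence homotopic
morphisms induce equal maps in cyclic homology, and homotopy equivalences become isomorphisms.\<close>

section \<open>Linear maps and finite sums\<close>

lemma module_abelian_group: "module K M \<Longrightarrow> abelian_group M"
  by (simp add: module.axioms(2))

lemma linear_mapsI:
  assumes "\<And>x. x \<in> carrier M \<Longrightarrow> f x \<in> carrier N"
    and "\<And>x y. x \<in> carrier M \<Longrightarrow> y \<in> carrier M \<Longrightarrow> f (x \<oplus>\<^bsub>M\<^esub> y) = f x \<oplus>\<^bsub>N\<^esub> f y"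
    and "\<And>a x. a \<in> carrier K \<Longrightarrow> x \<in> carrier M \<Longrightarrow> f (a \<odot>\<^bsub>M\<^esub> x) = a \<odot>\<^bsub>N\<^esub> f x"
  shows "f \<in> linear_maps K M N"
  using assms by (auto simp: linear_maps_def)

lemma lin_closed: "f \<in> linear_maps K M N \<Longrightarrow> x \<in> carrier M \<Longrightarrow> f x \<in> carrier N"
  by (auto simp: linear_maps_def)

lemma lin_add: "f \<in> linear_maps K M N \<Longrightarrow> x \<in> carrier M \<Longrightarrow> y \<in> carrier M \<Longrightarrow>
    f (x \<oplus>\<^bsub>M\<^esub> y) = f x \<oplus>\<^bsub>N\<^esub> f y"
  by (auto simp: linear_maps_def)

lemma lin_smult: "f \<in> linear_maps K M N \<Longrightarrow> a \<in> carrier K \<Longrightarrow> x \<in> carrier M \<Longrightarrow>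
    f (a \<odot>\<^bsub>M\<^esub> x) = a \<odot>\<^bsub>N\<^esub> f x"
  by (auto simp: linear_maps_def)

lemma linear_maps_cong:
  assumes "module K M" "\<And>x. x \<in> carrier M \<Longrightarrow> f x = g x"
  shows "f \<in> linear_maps K M N \<longleftrightarrow> g \<in> linear_maps K M N"
proof -
  interpret module K M by fact
  show ?thesis using assms(2) by (auto simp: linear_maps_def Pi_iff)
qed

lemma lin_abelian_group_hom:
  assumes "module K M" "module K N" "f \<in> linear_maps K M N"
  shows "abelian_group_hom M N f"
proof -
  interpret M: module K M by fact
  interpret N: module K N by fact
  show ?thesis
    using assms(3)
    by (intro abelian_group_homI M.M.abelian_group_axioms N.M.abelian_group_axioms
        group_hom.intro group_hom_axioms.intro M.M.a_group N.M.a_group)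
       (auto simp: linear_maps_def hom_def)
qed

lemma lin_zero:
  assumes "module K M" "module K N" "f \<in> linear_maps K M N"
  shows "f \<zero>\<^bsub>M\<^esub> = \<zero>\<^bsub>N\<^esub>"
  using abelian_group_hom.hom_zero[OF lin_abelian_group_hom[OF assms]] .

lemma lin_neg:
  assumes "module K M" "module K N" "f \<in> linear_maps K M N" "x \<in> carrier M"
  shows "f (\<ominus>\<^bsub>M\<^esub> x) = \<ominus>\<^bsub>N\<^esub> f x"
  using abelian_group_hom.hom_a_inv[OF lin_abelian_group_hom[OF assms(1-3)] assms(4)] .

lemma lin_minus:
  assumes "module K M" "module K N" "f \<in> linear_maps K M N" "x \<in> carrier M" "y \<in> carrier M"
  shows "f (x \<ominus>\<^bsub>M\<^esub> y) = f x \<ominus>\<^bsub>N\<^esub> f y"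
proof -
  interpret M: module K M by fact
  show ?thesis
    using assms by (simp add: a_minus_def lin_add lin_neg)
qed

lemma lin_finsum:
  assumes "module K M" "module K N" "f \<in> linear_maps K M N" "g \<in> A \<rightarrow> carrier M"
  shows "f (finsum M g A) = finsum N (\<lambda>i. f (g i)) A"
proof -
  interpret M: module K M by fact
  interpret N: module K N by fact
  show ?thesis using assms(4)
  proof (induction A rule: infinite_finite_induct)
    case (insert x F)
    have "f (finsum M g (insert x F)) = f (g x \<oplus>\<^bsub>M\<^esub> finsum M g F)"
      using insert by (subst M.M.finsum_insert) auto
    also have "\<dots> = f (g x) \<oplus>\<^bsub>N\<^esub> f (finsum M g F)"
      using insert.prems by (intro lin_add[OF assms(3)]) (auto intro: M.M.finsum_closed)
    also have "\<dots> = finsum N (\<lambda>i. f (g i)) (insert x F)"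
      using insert assms(3) by (subst N.M.finsum_insert) (auto simp: lin_closed Pi_def)
    finally show ?case .
  qed (use lin_zero[OF assms(1-3)] in \<open>simp_all add: M.M.finsum_infinite N.M.finsum_infinite\<close>)
qed

context
  fixes K :: "('k, 'r) ring_scheme" and M :: "('k, 'a) module"
  assumes M: "module K M"
begin

interpretation M: module K M by (rule M)

lemma int_act_closed [simp]: "x \<in> carrier M \<Longrightarrow> [(c::int)] \<cdot>\<^bsub>M\<^esub> x \<in> carrier M"
  by (rule M.M.add.int_pow_closed)

lemma int_act_one: "x \<in> carrier M \<Longrightarrow> [(1::int)] \<cdot>\<^bsub>M\<^esub> x = x"
  by (simp)

lemma int_act_neg_one: "x \<in> carrier M \<Longrightarrow> [(-1::int)] \<cdot>\<^bsub>M\<^esub> x = \<ominus>\<^bsub>M\<^esub> x"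
  using M.M.add.int_pow_neg[of x 1] by (simp add: a_inv_def)

lemma int_act_act: "x \<in> carrier M \<Longrightarrow> [(c::int)] \<cdot>\<^bsub>M\<^esub> ([(d::int)] \<cdot>\<^bsub>M\<^esub> x) = [(c * d)] \<cdot>\<^bsub>M\<^esub> x"
  using M.M.add.int_pow_pow[of x c d] by (simp add: mult.commute)

lemma int_act_add: "x \<in> carrier M \<Longrightarrow> y \<in> carrier M \<Longrightarrow>
    [(c::int)] \<cdot>\<^bsub>M\<^esub> (x \<oplus>\<^bsub>M\<^esub> y) = [c] \<cdot>\<^bsub>M\<^esub> x \<oplus>\<^bsub>M\<^esub> [c] \<cdot>\<^bsub>M\<^esub> y"
  using M.M.add.int_pow_distrib[of x y c] by simp

lemma int_act_linear: "(\<lambda>x. [(c::int)] \<cdot>\<^bsub>M\<^esub> x) \<in> linear_maps K M M"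
proof (rule linear_mapsI)
  fix a x assume ax: "a \<in> carrier K" "x \<in> carrier M"
  have nat: "[(n::nat)] \<cdot>\<^bsub>M\<^esub> (a \<odot>\<^bsub>M\<^esub> x) = a \<odot>\<^bsub>M\<^esub> ([n] \<cdot>\<^bsub>M\<^esub> x)" for n
    using ax by (induction n) (auto simp: M.smult_r_distr)
  show "[c] \<cdot>\<^bsub>M\<^esub> (a \<odot>\<^bsub>M\<^esub> x) = a \<odot>\<^bsub>M\<^esub> ([c] \<cdot>\<^bsub>M\<^esub> x)"
  proof (cases "c \<ge> 0")
    case True
    then show ?thesis using nat by (simp add: add_pow_int_ge)
  next
    case False
    then show ?thesis using nat ax by (simp add: add_pow_int_lt M.smult_r_minus)
  qed
qed (auto simp: int_act_add)

end

lemma lin_int_act: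
  assumes "module K M" "module K N" "f \<in> linear_maps K M N" "x \<in> carrier M"
  shows "f ([(c::int)] \<cdot>\<^bsub>M\<^esub> x) = [c] \<cdot>\<^bsub>N\<^esub> f x"
proof -
  interpret M: module K M by fact
  interpret N: module K N by fact
  have nat: "f ([(n::nat)] \<cdot>\<^bsub>M\<^esub> x) = [n] \<cdot>\<^bsub>N\<^esub> f x" for n
    using assms by (induction n) (auto simp: lin_zero lin_add)
  show ?thesis
  proof (cases "c \<ge> 0")
    case True
    then show ?thesis using nat by (simp add: add_pow_int_ge)
  next
    case False
    then show ?thesis using nat assms by (simp add: add_pow_int_lt lin_neg)
  qed
qed

subsection \<open>Closure properties of linear maps\<close>

lemma lin_id: "(\<lambda>x. x) \<in> linear_maps K M M"
  by (auto simp: linear_maps_def)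

lemma lin_comp:
  assumes "f \<in> linear_maps K L M" "g \<in> linear_maps K M N"
  shows "(\<lambda>x. g (f x)) \<in> linear_maps K L N"
  using assms by (auto simp: linear_maps_def Pi_iff)

lemma lin_const_zero:
  assumes "module K N"
  shows "(\<lambda>x. \<zero>\<^bsub>N\<^esub>) \<in> linear_maps K M N"
proof -
  interpret module K N by fact
  show ?thesis by (rule linear_mapsI) auto
qed

lemma lin_sum_two:
  assumes "module K N" "f \<in> linear_maps K M N" "g \<in> linear_maps K M N"
  shows "(\<lambda>x. f x \<oplus>\<^bsub>N\<^esub> g x) \<in> linear_maps K M N"
proof -
  interpret module K N by fact
  show ?thesis
    using assms(2,3) lin_closed[OF assms(2)] lin_closed[OF assms(3)]
    by (intro linear_mapsI) (auto simp: lin_add lin_smult smult_r_distr M.a_ac)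
qed

lemma lin_negate:
  assumes "module K N" "f \<in> linear_maps K M N"
  shows "(\<lambda>x. \<ominus>\<^bsub>N\<^esub> f x) \<in> linear_maps K M N"
proof -
  interpret module K N by fact
  show ?thesis
    using assms(2) lin_closed[OF assms(2)]
    by (intro linear_mapsI) (auto simp: lin_add lin_smult smult_r_minus M.minus_add)
qed

lemma lin_difference:
  assumes "module K N" "f \<in> linear_maps K M N" "g \<in> linear_maps K M N"
  shows "(\<lambda>x. f x \<ominus>\<^bsub>N\<^esub> g x) \<in> linear_maps K M N"
  unfolding a_minus_def by (intro lin_sum_two lin_negate assms)

lemma lin_finsum_maps:
  assumes "module K M" "module K N" "\<And>i. i \<in> A \<Longrightarrow> f i \<in> linear_maps K M N"
  shows "(\<lambda>x. finsum N (\<lambda>i. f i x) A) \<in> linear_maps K M N"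
proof -
  interpret M: module K M by fact
  interpret N: module K N by fact
  have cl: "f i x \<in> carrier N" if "i \<in> A" "x \<in> carrier M" for i x
    using lin_closed[OF assms(3)] that by blast
  show ?thesis
  proof (cases "finite A")
    case True
    show ?thesis
    proof (rule linear_mapsI)
      fix x y assume xy: "x \<in> carrier M" "y \<in> carrier M"
      have "finsum N (\<lambda>i. f i (x \<oplus>\<^bsub>M\<^esub> y)) A = finsum N (\<lambda>i. f i x \<oplus>\<^bsub>N\<^esub> f i y) A"
        using xy cl by (intro N.M.finsum_cong') (auto simp: lin_add[OF assms(3)])
      then show "finsum N (\<lambda>i. f i (x \<oplus>\<^bsub>M\<^esub> y)) A = finsum N (\<lambda>i. f i x) A \<oplus>\<^bsub>N\<^esub> finsum N (\<lambda>i. f i y) A"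
        using xy cl by (subst N.M.finsum_addf[symmetric]) auto
    next
      fix a x assume ax: "a \<in> carrier K" "x \<in> carrier M"
      have "finsum N (\<lambda>i. f i (a \<odot>\<^bsub>M\<^esub> x)) A = finsum N (\<lambda>i. a \<odot>\<^bsub>N\<^esub> f i x) A"
        using ax cl by (intro N.M.finsum_cong') (auto simp: lin_smult[OF assms(3)])
      then show "finsum N (\<lambda>i. f i (a \<odot>\<^bsub>M\<^esub> x)) A = a \<odot>\<^bsub>N\<^esub> finsum N (\<lambda>i. f i x) A"
        using ax cl True by (subst N.finsum_smult_ldistr) auto
    qed (use cl in \<open>auto intro!: N.M.finsum_closed\<close>)
  next
    case False
    then show ?thesis
      using lin_const_zero[OF assms(2)] by (simp add: N.M.finsum_infinite)
  qed
qed

lemma lin_funpow: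
  assumes "f \<in> linear_maps K M M"
  shows "f ^^ j \<in> linear_maps K M M"
  by (induction j) (use assms lin_id[of K M] in \<open>auto simp: id_def comp_def intro: lin_comp\<close>)

subsection \<open>Finite sums\<close>

context abelian_group
begin

lemma finsum_Sigma:
  assumes "finite A" "\<And>i. i \<in> A \<Longrightarrow> finite (B i)"
    and "\<And>i j. i \<in> A \<Longrightarrow> j \<in> B i \<Longrightarrow> f i j \<in> carrier G"
  shows "finsum G (\<lambda>i. finsum G (f i) (B i)) A = finsum G (\<lambda>(i, j). f i j) (Sigma A B)"
  using assms
proof (induction A rule: finite_induct)
  case (insert a A)
  have fib: "finsum G (\<lambda>(i, j). f i j) (Pair a ` B a) = finsum G (f a) (B a)"
    using insert.prems by (subst finsum_reindex) (auto simp: inj_on_def)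
  have "Sigma (insert a A) B = Pair a ` B a \<union> Sigma A B" by auto
  then have "finsum G (\<lambda>(i, j). f i j) (Sigma (insert a A) B) =
      finsum G (\<lambda>(i, j). f i j) (Pair a ` B a) \<oplus> finsum G (\<lambda>(i, j). f i j) (Sigma A B)"
    using insert by (simp only:) (rule finsum_Un_disjoint, auto)
  then show ?case
    using insert fib by (subst finsum_insert) (auto intro!: finsum_closed)
qed simp

lemma finsum_bij:
  assumes "bij_betw h A B" "\<And>x. x \<in> A \<Longrightarrow> g (h x) = f x" "\<And>x. x \<in> A \<Longrightarrow> f x \<in> carrier G"
  shows "finsum G f A = finsum G g B"
proof -
  have B: "B = h ` A" and inj: "inj_on h A" using assms(1) by (auto simp: bij_betw_def)
  have "finsum G g (h ` A) = finsum G (\<lambda>x. g (h x)) A"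
    using assms(2,3) inj by (intro finsum_reindex) auto
  also have "\<dots> = finsum G f A"
    using assms(2,3) by (intro finsum_cong') auto
  finally show ?thesis by (simp add: B)
qed

lemma finsum_neutral:
  assumes "finite B" "A \<subseteq> B" "\<And>i. i \<in> B - A \<Longrightarrow> f i = \<zero>" "\<And>i. i \<in> B \<Longrightarrow> f i \<in> carrier G"
  shows "finsum G f A = finsum G f B"
  using assms by (intro add.finprod_mono_neutral_cong_left) auto

lemma finsum_difference:
  assumes "f \<in> A \<rightarrow> carrier G" "g \<in> A \<rightarrow> carrier G"
  shows "finsum G (\<lambda>i. f i \<ominus> g i) A = finsum G f A \<ominus> finsum G g A"
proof -
  have z: "\<zero> \<ominus> \<zero> = \<zero>" by (metis minus_eq r_neg zero_closed)
  show ?thesis using assms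
proof (induction A rule: infinite_finite_induct)
  case (insert x F)
  then have c: "f x \<in> carrier G" "g x \<in> carrier G" "finsum G f F \<in> carrier G" "finsum G g F \<in> carrier G"
    by (auto intro!: finsum_closed)
  have "finsum G (\<lambda>i. f i \<ominus> g i) (insert x F) = (f x \<ominus> g x) \<oplus> (finsum G f F \<ominus> finsum G g F)"
    using insert by (subst finsum_insert) (auto simp: Pi_iff)
  also have "\<dots> = (f x \<oplus> finsum G f F) \<ominus> (g x \<oplus> finsum G g F)"
    using c by (simp add: minus_eq minus_add a_ac)
  finally show ?case
    using insert by (simp add: finsum_insert Pi_iff)
qed (simp_all add: finsum_infinite finsum_empty z)
qed

lemma finsum_int_act:
  assumes "f \<in> A \<rightarrow> carrier G"
  shows "finsum G (\<lambda>i. [(c::int)] \<cdot> f i) A = [c] \<cdot> finsum G f A"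
  using assms
proof (induction A rule: infinite_finite_induct)
  case (insert x F)
  then show ?case
    by (simp add: finsum_insert Pi_iff add.int_pow_distrib add.int_pow_closed finsum_closed)
qed (auto simp: add.int_pow_one)

lemma minus_eq_zero_iff:
  "a \<in> carrier G \<Longrightarrow> b \<in> carrier G \<Longrightarrow> a \<ominus> b = \<zero> \<longleftrightarrow> a = b"
  by (metis add.inv_closed minus_eq minus_minus minus_equality r_neg)

lemma minus_eq_iff:
  "a \<in> carrier G \<Longrightarrow> b \<in> carrier G \<Longrightarrow> c \<in> carrier G \<Longrightarrow> a \<ominus> b = c \<longleftrightarrow> a = b \<oplus> c"
  by (metis a_comm add.inv_solve_right minus_eq)

end

section \<open>Hatted tuples as unshuffles\<close>

subsection \<open>Inversions\<close>

definition pairs :: "nat \<Rightarrow> (nat \<times> nat) set" where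
  "pairs k = {(i, j). i < j \<and> j < k}"

definition ord_sgn :: "nat \<Rightarrow> nat \<Rightarrow> int" where
  "ord_sgn a b = (if a < b then 1 else if a = b then 0 else -1)"

definition inv_sgn :: "nat \<Rightarrow> (nat \<Rightarrow> nat) \<Rightarrow> int" where
  "inv_sgn k p = (\<Prod>(i, j) \<in> pairs k. ord_sgn (p i) (p j))"

lemma finite_pairs [simp]: "finite (pairs k)"
  by (rule finite_subset[of _ "{..<k} \<times> {..<k}"]) (auto simp: pairs_def)

text \<open>The symmetric function \<open>t a b\<close> compares the order of \<open>a, b\<close> before and after \<open>p\<close>, so its product over
all pairs may be taken along \<open>q\<close>; this makes the product of comparison signs multiplicative.\<close>

lemma inv_sgn_compose:
  assumes p: "p permutes {..<k}" and q: "q permutes {..<k}"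
  shows "inv_sgn k (p \<circ> q) = inv_sgn k p * inv_sgn k q"
proof -
  define t where "t a b = ord_sgn (p a) (p b) * ord_sgn a b" for a b
  have inj: "p a = p b \<longleftrightarrow> a = b" "q a = q b \<longleftrightarrow> a = b" for a b
    using permutes_inj[OF p] permutes_inj[OF q] by (auto dest: injD)
  have sym: "t a b = t b a" for a b by (auto simp: t_def ord_sgn_def)
  have qim: "q a < k \<longleftrightarrow> a < k" for a using permutes_in_image[OF q] by auto
  have q': "inv_into UNIV q permutes {..<k}" using permutes_inv[OF q] .
  have q'im: "inv_into UNIV q a < k \<longleftrightarrow> a < k" for a using permutes_in_image[OF q'] by auto
  have inj': "inv_into UNIV q a = inv_into UNIV q b \<longleftrightarrow> a = b" for a b
    using permutes_inj[OF q'] by (auto dest: injD)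
  define srt where "srt = (\<lambda>(a::nat, b). (min a b, max a b))"
  have swap: "q a < q b \<or> q b < q a" "inv_into UNIV q a < inv_into UNIV q b \<or> inv_into UNIV q b < inv_into UNIV q a"
    if "a < b" for a b
    using that inj(2)[of a b] inj'[of a b] by linarith+
  have "(\<Prod>(i, j) \<in> pairs k. t (q i) (q j)) = (\<Prod>(i, j) \<in> pairs k. t i j)"
    by (rule prod.reindex_bij_witness[of _ "\<lambda>(i, j). srt (inv_into UNIV q i, inv_into UNIV q j)" "\<lambda>(i, j). srt (q i, q j)"])
       (auto simp: pairs_def srt_def min_def max_def permutes_inverses[OF q] qim q'im sym
          not_le le_less inj inj' split: if_splits dest: swap)
  moreover have "(\<Prod>(i, j) \<in> pairs k. ord_sgn (p (q i)) (p (q j))) =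
      (\<Prod>(i, j) \<in> pairs k. t (q i) (q j)) * inv_sgn k q"
    unfolding inv_sgn_def prod.distrib[symmetric]
    by (intro prod.cong refl) (auto simp: t_def ord_sgn_def inj pairs_def)
  moreover have "(\<Prod>(i, j) \<in> pairs k. t i j) = inv_sgn k p"
    unfolding inv_sgn_def by (intro prod.cong refl) (auto simp: t_def ord_sgn_def pairs_def)
  ultimately show ?thesis by (simp add: inv_sgn_def)
qed

lemma inv_sgn_eq:
  assumes p: "p permutes {..<k}"
  shows "inv_sgn k p = (-1) ^ card {(i, j). i < j \<and> j < k \<and> p j < p i}"
proof -
  have inj: "p a = p b \<longleftrightarrow> a = b" for a b
    using permutes_inj[OF p] by (auto dest: injD)
  let ?I = "{(i, j). i < j \<and> j < k \<and> p j < p i}"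
  have sub: "?I \<subseteq> pairs k" by (auto simp: pairs_def)
  have "inv_sgn k p = (\<Prod>x \<in> pairs k. if x \<in> ?I then -1 else 1)"
    unfolding inv_sgn_def
    by (intro prod.cong refl) (auto simp: ord_sgn_def pairs_def inj not_less order.order_iff_strict split: if_splits)
  also have "\<dots> = (\<Prod>x \<in> ?I. -1)"
    using sub by (intro prod.mono_neutral_cong_right) auto
  finally show ?thesis by simp
qed

text \<open>The transposition of \<open>a < b\<close> inverts \<open>(a, j)\<close> for \<open>a < j \<le> b\<close> and \<open>(i, b)\<close> for \<open>a < i < b\<close>, an odd number of pairs.\<close>

lemma inv_sgn_transpose:
  assumes "a < b" "b < k"
  shows "inv_sgn k (transpose a b) = -1"
proof -
  have "{(i, j). i < j \<and> j < k \<and> transpose a b j < transpose a b i} =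
      ({a} \<times> {a<..b}) \<union> ({a<..<b} \<times> {b})"
    using assms by (auto simp: transpose_def split: if_splits)
  moreover have "card (({a} \<times> {a<..b}) \<union> ({a<..<b} \<times> {b})) = 2 * (b - a - 1) + 1"
    using assms by (subst card_Un_disjoint) (auto simp: card_cartesian_product)
  ultimately show ?thesis
    using assms by (subst inv_sgn_eq) (auto simp: permutes_swap_id)
qed

lemma sign_eq_inversions:
  fixes p :: "nat \<Rightarrow> nat"
  assumes "p permutes {..<k}"
  shows "sign p = (-1) ^ card {(i, j). i < j \<and> j < k \<and> p j < p i}"
proof -
  have "p permutes {..<k} \<and> sign p = inv_sgn k p"
    using assms finite_lessThan
  proof (induction rule: permutes_induct)
    case id
    have "inv_sgn k id = 1"
      unfolding inv_sgn_def by (intro prod.neutral) (auto simp: pairs_def ord_sgn_def)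
    then show ?case using permutes_id[of "{..<k}"] by (simp add: id_def)
  next
    case (swap a b p)
    have ps: "p permutes {..<k}" using swap by simp
    have ts: "transpose a b permutes {..<k}" using swap by (intro permutes_swap_id) auto
    have "inv_sgn k (transpose a b) = -1"
    proof (cases "a < b")
      case True
      then show ?thesis using swap by (intro inv_sgn_transpose) auto
    next
      case False
      then have "b < a" using swap by auto
      then show ?thesis using swap inv_sgn_transpose[of b a k] by (simp add: transpose_commute)
    qed
    moreover have "permutation p" using ps by (auto simp: permutation_permutes)
    ultimately show ?case
      using swap inv_sgn_compose[OF ts ps] permutes_compose[OF ps ts]
        sign_compose[OF permutation_swap_id[of a b], of p]
      by (simp add: sign_swap_id comp_def)
  qed
  then show ?thesis using inv_sgn_eq assms by simp
qed

subsection \<open>Closing the gaps left by a deleted set\<close>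

text \<open>The value of \<open>a\<close> after the elements of \<open>B\<close> have been removed and the remaining numbers pushed
together; for \<open>a\<close> in the left-hand block and \<open>B\<close> the right-hand block this is the hatted entry.\<close>

definition hatn :: "nat set \<Rightarrow> nat \<Rightarrow> nat" where
  "hatn B a = a - card (B \<inter> {..<a})"

lemma card_below_le: "card (B \<inter> {..<a}) \<le> a"
  using card_mono[of "{..<a}" "B \<inter> {..<a}"] by simp

lemma hatn_strict_mono:
  assumes "a < a'" "a \<notin> B"
  shows "hatn B a < hatn B a'"
proof -
  have "B \<inter> {..<a'} \<subseteq> (B \<inter> {..<a}) \<union> (B \<inter> {a<..<a'})"
    using assms(2) by (auto intro: linorder_neqE_nat)
  then have "card (B \<inter> {..<a'}) \<le> card ((B \<inter> {..<a}) \<union> (B \<inter> {a<..<a'}))"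
    by (intro card_mono) auto
  also have "\<dots> \<le> card (B \<inter> {..<a}) + card (B \<inter> {a<..<a'})"
    by (rule card_Un_le)
  finally have "card (B \<inter> {..<a'}) \<le> card (B \<inter> {..<a}) + card (B \<inter> {a<..<a'})" .
  moreover have "card (B \<inter> {a<..<a'}) \<le> a' - a - 1"
    using card_mono[of "{a<..<a'}" "B \<inter> {a<..<a'}"] by simp
  ultimately show ?thesis
    using assms card_below_le[of B a] by (simp add: hatn_def)
qed

lemma hatn_less_iff: "a \<notin> B \<Longrightarrow> a' \<notin> B \<Longrightarrow> hatn B a < hatn B a' \<longleftrightarrow> a < a'"
  by (metis hatn_strict_mono less_asym linorder_neqE_nat)

lemma inj_on_hatn: "B \<inter> A = {} \<Longrightarrow> inj_on (hatn B) A"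
  by (rule inj_onI) (metis hatn_less_iff disjoint_iff linorder_neqE_nat less_irrefl)

lemma hatn_image_subset:
  assumes "B \<subseteq> {..<m}" "A \<subseteq> {..<m}" "A \<inter> B = {}"
  shows "hatn B ` A \<subseteq> {..<m - card B}"
proof
  fix x assume "x \<in> hatn B ` A"
  then obtain a where a: "a \<in> A" "x = hatn B a" by auto
  then have am: "a < m" "a \<notin> B" using assms by auto
  have "B \<subseteq> (B \<inter> {..<a}) \<union> (B \<inter> {a<..<m})"
  proof
    fix x assume "x \<in> B"
    then have "x < m" "x \<noteq> a" using assms(1) am(2) by auto
    then show "x \<in> (B \<inter> {..<a}) \<union> (B \<inter> {a<..<m})" using \<open>x \<in> B\<close> by auto
  qed
  then have "card B \<le> card ((B \<inter> {..<a}) \<union> (B \<inter> {a<..<m}))"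
    by (intro card_mono) auto
  also have "\<dots> \<le> card (B \<inter> {..<a}) + card (B \<inter> {a<..<m})"
    by (rule card_Un_le)
  finally have "card B \<le> card (B \<inter> {..<a}) + card (B \<inter> {a<..<m})" .
  moreover have "card (B \<inter> {a<..<m}) \<le> m - a - 1"
    using card_mono[of "{a<..<m}" "B \<inter> {a<..<m}"] by simp
  ultimately show "x \<in> {..<m - card B}"
    using a am card_below_le[of B a] by (auto simp: hatn_def)
qed

text \<open>The mechanism behind the totalisation: what remains of \<open>{..<m}\<close> after removing \<open>B\<close> is renumbered
onto a full initial segment, so subsets disjoint from \<open>B\<close> correspond to arbitrary index sets of the
next map.\<close>

lemma hatn_image:
  assumes "B \<subseteq> {..<m}"
  shows "hatn B ` ({..<m} - B) = {..<m - card B}"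
proof (rule card_subset_eq)
  show "hatn B ` ({..<m} - B) \<subseteq> {..<m - card B}"
    using assms by (intro hatn_image_subset) auto
  have "finite B" using assms finite_subset by blast
  then show "card (hatn B ` ({..<m} - B)) = card {..<m - card B}"
    using assms by (subst card_image) (auto simp: inj_on_hatn card_Diff_subset)
qed simp

lemma card_hatn_image: "B \<inter> A = {} \<Longrightarrow> card (hatn B ` A) = card A"
  by (intro card_image inj_on_hatn)

text \<open>Removing \<open>C\<close> and then what has become of \<open>B\<close> is removing \<open>B \<union> C\<close>; associativity of convolution rests on this.\<close>

lemma hatn_hatn:
  assumes "B \<inter> C = {}" "a \<notin> B" "a \<notin> C"
  shows "hatn (hatn C ` B) (hatn C a) = hatn (B \<union> C) a"
proof -
  have "hatn C ` B \<inter> {..<hatn C a} = hatn C ` (B \<inter> {..<a})"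
    using assms by (auto simp: hatn_less_iff disjoint_iff)
  then have "card (hatn C ` B \<inter> {..<hatn C a}) = card (B \<inter> {..<a})"
    using assms by (subst card_hatn_image[symmetric, of C "B \<inter> {..<a}"]) auto
  moreover have "card ((B \<union> C) \<inter> {..<a}) = card (B \<inter> {..<a}) + card (C \<inter> {..<a})"
    using assms by (subst card_Un_disjoint[symmetric]) (auto intro: arg_cong[where f = card])
  ultimately show ?thesis by (simp add: hatn_def)
qed

lemma hatn_empty [simp]: "hatn {} a = a"
  by (simp add: hatn_def)

text \<open>For complementary blocks this is the number of inversions of the unshuffle.\<close>

definition crossings :: "nat set \<Rightarrow> nat set \<Rightarrow> nat" where
  "crossings A B = card {(a, b). a \<in> A \<and> b \<in> B \<and> b < a}"

lemma sum_hatn: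
  assumes "finite A" "finite B"
  shows "\<Sum> A = (\<Sum>a\<in>A. hatn B a) + crossings A B"
proof -
  have "{(a, b). a \<in> A \<and> b \<in> B \<and> b < a} = Sigma A (\<lambda>a. B \<inter> {..<a})" by auto
  then have "crossings A B = (\<Sum>a\<in>A. card (B \<inter> {..<a}))"
    using assms by (simp add: crossings_def)
  moreover have "\<Sum> A = (\<Sum>a\<in>A. hatn B a + card (B \<inter> {..<a}))"
    by (intro sum.cong refl) (simp add: hatn_def card_below_le)
  ultimately show ?thesis by (simp add: sum.distrib)
qed

text \<open>Each entry \<open>a\<close> of \<open>S - B\<close> is lowered by the number of its crossings, so the sign of the unshuffle is
  the quotient of the two signs of index sums.\<close>

lemma crossings_sign:
  assumes "finite S" "B \<subseteq> S"
  shows "(-1 :: int) ^ \<Sum> S * (-1) ^ crossings (S - B) B =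
    (-1) ^ \<Sum> (hatn B ` (S - B)) * (-1) ^ \<Sum> B"
proof -
  have fin: "finite (S - B)" "finite B" using assms finite_subset by auto
  have "\<Sum> S = \<Sum> (S - B) + \<Sum> B"
    using assms fin by (metis sum.subset_diff)
  moreover have "\<Sum> (hatn B ` (S - B)) = (\<Sum>a\<in>S - B. hatn B a)"
    by (subst sum.reindex) (auto simp: inj_on_hatn)
  ultimately have "\<Sum> S + crossings (S - B) B = \<Sum> (hatn B ` (S - B)) + \<Sum> B + 2 * crossings (S - B) B"
    using sum_hatn[OF fin] by simp
  then have "(-1 :: int) ^ (\<Sum> S + crossings (S - B) B) =
      (-1) ^ (\<Sum> (hatn B ` (S - B)) + \<Sum> B + 2 * crossings (S - B) B)"
    by (simp only:)
  then show ?thesis by (simp add: power_add)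
qed

subsection \<open>Hatted tuples\<close>

abbreviation sl :: "nat set \<Rightarrow> nat list" where
  "sl \<equiv> sorted_list_of_set"

lemma length_hat [simp]: "length (hat J) = length J"
  by (simp add: hat_def)

text \<open>At an ascent the two counts that hatting subtracts differ by less than the entries do, at a descent by
at most as much. So hatting neither creates nor destroys ascents, and the hatted blocks are increasing
if and only if the blocks themselves are.\<close>

lemma hat_Suc_less_iff:
  assumes "distinct J" "Suc s < length J"
  shows "hat J ! s < hat J ! Suc s \<longleftrightarrow> J ! s < J ! Suc s"
proof -
  define x y where "x = J ! s" and "y = J ! Suc s"
  define c where "c s = {r. s < r \<and> r < length J \<and> J ! r < J ! s}" for s
  define btw where "btw u v = {r. Suc s < r \<and> r < length J \<and> u < J ! r \<and> J ! r < v}" for u v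
  have fin: "finite (c s)" "finite (btw u v)" for s u v
    by (auto simp: c_def btw_def)
  have inj: "inj_on ((!) J) {r. r < length J}"
    using assms by (auto simp: inj_on_def nth_eq_iff_index_eq)
  have cle: "card (c s) \<le> J ! s" for s
    using card_inj_on_le[of "(!) J" "c s" "{..<J ! s}"] inj_on_subset[OF inj, of "c s"]
    by (auto simp: c_def)
  have btwle: "card (btw u v) \<le> v - u - 1" for u v
    proof -
    have "inj_on ((!) J) (btw u v)"
      by (rule inj_on_subset[OF inj]) (auto simp: btw_def)
    then have "card (btw u v) \<le> card {u<..<v}"
      by (rule card_inj_on_le) (auto simp: btw_def)
    then show ?thesis by simp
  qed
  have hs: "hat J ! s = x - card (c s)" "hat J ! Suc s = y - card (c (Suc s))"
    using assms by (simp_all add: hat_def c_def x_def y_def)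
  have ne: "J ! r \<noteq> x" "J ! r \<noteq> y" if "Suc s < r" "r < length J" for r
    using assms that by (auto simp: x_def y_def nth_eq_iff_index_eq)
  have "x \<noteq> y" using assms by (auto simp: x_def y_def nth_eq_iff_index_eq)
  then consider "x < y" | "y < x" by linarith
  then show ?thesis
  proof cases
    case 1
    have "c (Suc s) \<subseteq> c s \<union> btw x y"
    proof
      fix r assume r: "r \<in> c (Suc s)"
      then have "J ! r \<noteq> x" using ne by (auto simp: c_def)
      then show "r \<in> c s \<union> btw x y" using r by (auto simp: c_def btw_def x_def y_def)
    qed
    then have "card (c (Suc s)) \<le> card (c s \<union> btw x y)" using fin by (intro card_mono) auto
    also have "\<dots> \<le> card (c s) + (y - x - 1)" using card_Un_le[of "c s" "btw x y"] btwle[of x y] by simp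
    finally have "hat J ! s < hat J ! Suc s" using 1 cle[of s] hs by (simp add: x_def[symmetric])
    then show ?thesis using 1 by (simp add: x_def y_def)
  next
    case 2
    have "c s \<subseteq> insert (Suc s) (c (Suc s) \<union> btw y x)"
    proof
      fix r assume r: "r \<in> c s"
      show "r \<in> insert (Suc s) (c (Suc s) \<union> btw y x)"
      proof (cases "r = Suc s")
        case False
        then have "Suc s < r" using r by (auto simp: c_def)
        moreover have "J ! r \<noteq> y" using ne(2) r calculation by (auto simp: c_def)
        ultimately show ?thesis using r by (auto simp: c_def btw_def x_def y_def)
      qed simp
    qed
    then have "card (c s) \<le> card (insert (Suc s) (c (Suc s) \<union> btw y x))"
      using fin by (intro card_mono) auto
    also have "\<dots> \<le> Suc (card (c (Suc s) \<union> btw y x))"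
      by (rule card_insert_le_m1) auto
    also have "\<dots> \<le> Suc (card (c (Suc s)) + (x - y - 1))"
      using card_Un_le[of "c (Suc s)" "btw y x"] btwle[of y x] by simp
    finally have "\<not> hat J ! s < hat J ! Suc s" using 2 cle[of "Suc s"] hs by (simp add: y_def[symmetric])
    then show ?thesis using 2 by (simp add: x_def y_def)
  qed
qed

lemma sorted_take_hat:
  assumes "distinct J" "m \<le> length J"
  shows "sorted_wrt (<) (take m (hat J)) \<longleftrightarrow> sorted_wrt (<) (take m J)"
  using assms by (auto simp: sorted_wrt_iff_nth_Suc_transp hat_Suc_less_iff)

lemma sorted_drop_hat:
  assumes "distinct J" "m \<le> length J"
  shows "sorted_wrt (<) (drop m (hat J)) \<longleftrightarrow> sorted_wrt (<) (drop m J)"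
  using assms hat_Suc_less_iff[of J "m + i" for i]
  by (auto simp: sorted_wrt_iff_nth_Suc_transp)

lemma splits'_iff:
  "distinct J \<Longrightarrow> m \<in> splits' J \<longleftrightarrow>
     m \<le> length J \<and> sorted_wrt (<) (take m J) \<and> sorted_wrt (<) (drop m J)"
  using sorted_take_hat[of J m] sorted_drop_hat[of J m] by (auto simp: splits'_def)

lemma sorted_less_eq_sl: "sorted_wrt (<) xs \<Longrightarrow> xs = sl (set xs)"
  by (metis sorted_list_of_set.idem_if_sorted_distinct strict_sorted_iff)

text \<open>Nothing smaller stands to the right of an entry of the last, increasing block, so that block is fixed;
an entry of the first block is only passed by smaller entries of the last one.\<close>

lemma hat_append:
  assumes A: "finite A" and B: "finite B" and AB: "A \<inter> B = {}"
  shows "hat (sl A @ sl B) = sl (hatn B ` A) @ sl B"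
proof -
  let ?J = "sl A @ sl B"
  have setA: "sl A ! i \<in> A" if "i < card A" for i
    using A that by (metis nth_mem set_sorted_list_of_set length_sorted_list_of_set)
  have setB: "sl B ! i \<in> B" if "i < card B" for i
    using B that by (metis nth_mem set_sorted_list_of_set length_sorted_list_of_set)
  have mono: "sl C ! i < sl C ! j \<longleftrightarrow> i < j" if "i < card C" "j < card C" for C i j
  proof -
    have "sorted_wrt (<) (sl C)" by (rule strict_sorted_list_of_set)
    then show ?thesis using that
      by (metis length_sorted_list_of_set linorder_neqE_nat less_asym less_irrefl sorted_wrt_nth_less)
  qed
  have 1: "hat ?J ! s = (map (hatn B) (sl A) @ sl B) ! s" if s: "s < length ?J" for s
  proof (cases "s < card A")
    case True
    have "card {r. s < r \<and> r < length ?J \<and> ?J ! r < ?J ! s} = card (B \<inter> {..<?J ! s})"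
    proof (rule bij_betw_same_card)
      show "bij_betw ((!) ?J) {r. s < r \<and> r < length ?J \<and> ?J ! r < ?J ! s} (B \<inter> {..<?J ! s})"
        unfolding bij_betw_def
      proof
        have "distinct ?J" using A B AB by auto
        then show "inj_on ((!) ?J) {r. s < r \<and> r < length ?J \<and> ?J ! r < ?J ! s}"
          by (auto simp: inj_on_def nth_eq_iff_index_eq)
        show "(!) ?J ` {r. s < r \<and> r < length ?J \<and> ?J ! r < ?J ! s} = B \<inter> {..<?J ! s}"
        proof (intro equalityI subsetI)
          fix x assume "x \<in> (!) ?J ` {r. s < r \<and> r < length ?J \<and> ?J ! r < ?J ! s}"
          then obtain r where r: "x = ?J ! r" "s < r" "r < length ?J" "?J ! r < ?J ! s" by auto
          have "\<not> r < card A" using r True mono[of r A s] by (auto simp: nth_append)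
          then show "x \<in> B \<inter> {..<?J ! s}" using r setB[of "r - card A"] by (auto simp: nth_append)
        next
          fix x assume x: "x \<in> B \<inter> {..<?J ! s}"
          then have "x \<in> set (sl B)" using B by simp
          then obtain i where i: "i < length (sl B)" "x = sl B ! i" by (metis in_set_conv_nth)
          show "x \<in> (!) ?J ` {r. s < r \<and> r < length ?J \<and> ?J ! r < ?J ! s}"
            by (rule image_eqI[of _ _ "card A + i"]) (use x i True in \<open>auto simp: nth_append\<close>)
        qed
      qed
    qed
    then show ?thesis using True s by (simp add: hat_def nth_append hatn_def)
  next
    case False
    have "{r. s < r \<and> r < length ?J \<and> ?J ! r < ?J ! s} = {}"
      using False mono[of "_ - card A" B "s - card A"] s by (auto simp: nth_append)
    then show ?thesis using False s by (simp add: hat_def nth_append del: Collect_empty_eq)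
  qed
  have "sorted_wrt (<) (map (hatn B) (sl A))"
  proof -
    have "sorted_wrt (<) (sl A)" by (rule strict_sorted_list_of_set)
    then show ?thesis unfolding sorted_wrt_map
      by (rule sorted_wrt_mono_rel[rotated]) (use A AB in \<open>auto simp: hatn_less_iff disjoint_iff\<close>)
  qed
  then have "map (hatn B) (sl A) = sl (hatn B ` A)"
    using A sorted_less_eq_sl by fastforce
  moreover have "hat ?J = map (hatn B) (sl A) @ sl B"
    using 1 by (intro nth_equalityI) auto
  ultimately show ?thesis by simp
qed

text \<open>A permutation together with an admissible cut is the same thing as a subset of the
  entries: the one that forms the right-hand block.\<close>

lemma split_blocks:
  assumes I: "sorted_wrt (<) I" and \<sigma>: "\<sigma> permutes {..<length I}"
    and m: "m \<in> splits' (permute_list \<sigma> I)" and B: "B = set (drop m (permute_list \<sigma> I))"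
  shows "B \<subseteq> set I" "permute_list \<sigma> I = sl (set I - B) @ sl B" "m = card (set I - B)"
    "take m (hat (permute_list \<sigma> I)) = sl (hatn B ` (set I - B))"
    "drop m (hat (permute_list \<sigma> I)) = sl B"
    "sign \<sigma> = (-1) ^ crossings (set I - B) B"
proof -
  let ?J = "permute_list \<sigma> I"
  have dI: "distinct I" using I by (simp add: strict_sorted_iff)
  have dJ: "distinct ?J" using dI \<sigma> by simp
  have setJ: "set ?J = set I" using \<sigma> by simp
  show BI: "B \<subseteq> set I" using B setJ set_drop_subset by metis
  have srt: "m \<le> length ?J" "sorted_wrt (<) (take m ?J)" "sorted_wrt (<) (drop m ?J)"
    using m dJ by (auto simp: splits'_iff)
  have "set (take m ?J) \<inter> B = {}" "set (take m ?J) \<union> B = set I"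
    using dJ B setJ by (metis append_take_drop_id distinct_append, metis append_take_drop_id set_append)
  then have A: "set (take m ?J) = set I - B" by auto
  have t: "take m ?J = sl (set I - B)" "drop m ?J = sl B"
    using sorted_less_eq_sl[OF srt(2)] sorted_less_eq_sl[OF srt(3)] A B by auto
  then show J: "?J = sl (set I - B) @ sl B" by (metis append_take_drop_id)
  have "length (take m ?J) = card (set I - B)" using t by simp
  then show mc: "m = card (set I - B)" using srt(1) by simp
  have h: "hat ?J = sl (hatn B ` (set I - B)) @ sl B"
    unfolding J using BI finite_subset[OF BI] by (intro hat_append) auto
  have len: "length (sl (hatn B ` (set I - B))) = m"
    using mc by (simp add: card_hatn_image)
  show "take m (hat ?J) = sl (hatn B ` (set I - B))" "drop m (hat ?J) = sl B"
    unfolding h using len by simp_all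
  have lenI: "length I = length ?J" by simp
  have Jn: "?J ! i = I ! \<sigma> i" if "i < length I" for i
    using \<sigma> that by (simp add: permute_list_nth)
  have \<sigma>l: "\<sigma> i < length I" if "i < length I" for i
    using permutes_in_image[OF \<sigma>] that by auto
  have Imono: "I ! i < I ! j \<longleftrightarrow> i < j" if "i < length I" "j < length I" for i j
    using I that by (metis linorder_neqE_nat less_asym less_irrefl sorted_wrt_nth_less)
  have "card {(i, j). i < j \<and> j < length I \<and> \<sigma> j < \<sigma> i} =
      card {(a, b). a \<in> set I - B \<and> b \<in> B \<and> b < a}"
  proof (rule bij_betw_same_card)
    show "bij_betw (\<lambda>(i, j). (?J ! i, ?J ! j)) {(i, j). i < j \<and> j < length I \<and> \<sigma> j < \<sigma> i}
        {(a, b). a \<in> set I - B \<and> b \<in> B \<and> b < a}"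
      unfolding bij_betw_def
    proof
      show "inj_on (\<lambda>(i, j). (?J ! i, ?J ! j)) {(i, j). i < j \<and> j < length I \<and> \<sigma> j < \<sigma> i}"
        using dJ by (auto simp: inj_on_def nth_eq_iff_index_eq)
      show "(\<lambda>(i, j). (?J ! i, ?J ! j)) ` {(i, j). i < j \<and> j < length I \<and> \<sigma> j < \<sigma> i} =
        {(a, b). a \<in> set I - B \<and> b \<in> B \<and> b < a}"
      proof (intro equalityI subsetI)
        fix x assume "x \<in> (\<lambda>(i, j). (?J ! i, ?J ! j)) ` {(i, j). i < j \<and> j < length I \<and> \<sigma> j < \<sigma> i}"
        then obtain i j where x: "x = (?J ! i, ?J ! j)" and ij: "i < j" "j < length I" "\<sigma> j < \<sigma> i" by auto
        have lt: "?J ! j < ?J ! i" using ij \<sigma>l by (simp add: Jn Imono)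
        have "i < m"
        proof (rule ccontr)
          assume "\<not> i < m"
          then have "drop m ?J ! (i - m) < drop m ?J ! (j - m)"
            using ij srt by (intro sorted_wrt_nth_less[of "(<)"]) auto
          then show False using lt \<open>\<not> i < m\<close> ij srt by simp
        qed
        moreover have "m \<le> j"
        proof (rule ccontr)
          assume "\<not> m \<le> j"
          then have "take m ?J ! i < take m ?J ! j"
            using ij srt by (intro sorted_wrt_nth_less[of "(<)"]) auto
          then show False using lt \<open>\<not> m \<le> j\<close> ij by simp
        qed
        ultimately have "?J ! i \<in> set (take m ?J)" "?J ! j \<in> set (drop m ?J)"
          using ij srt by (auto simp: in_set_conv_nth intro: exI[of _ i] exI[of _ "j - m"])
        then show "x \<in> {(a, b). a \<in> set I - B \<and> b \<in> B \<and> b < a}"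
          using x lt A B by auto
      next
        fix x assume "x \<in> {(a, b). a \<in> set I - B \<and> b \<in> B \<and> b < a}"
        then obtain a b where x: "x = (a, b)" and ab: "a \<in> set (take m ?J)" "b \<in> set (drop m ?J)" "b < a"
          using A B by auto
        obtain i where i: "i < m" "i < length ?J" "a = ?J ! i"
          using ab(1) by (auto simp: in_set_conv_nth)
        obtain j where "j < length (drop m ?J)" "b = drop m ?J ! j"
          using ab(2) by (metis in_set_conv_nth)
        then have j: "m + j < length ?J" "b = ?J ! (m + j)" by auto
        have "\<sigma> (m + j) < \<sigma> i" using i j ab(3) \<sigma>l by (simp add: Jn Imono)
        then show "x \<in> (\<lambda>(i, j). (?J ! i, ?J ! j)) ` {(i, j). i < j \<and> j < length I \<and> \<sigma> j < \<sigma> i}"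
          using x i j by (intro image_eqI[of _ _ "(i, m + j)"]) auto
      qed
    qed
  qed
  then show "sign \<sigma> = (-1) ^ crossings (set I - B) B"
    using sign_eq_inversions[OF \<sigma>] by (simp add: crossings_def)
qed

lemma split_of_subset:
  assumes I: "sorted_wrt (<) I" and B: "B \<subseteq> set I"
  obtains \<sigma> where "\<sigma> permutes {..<length I}" "card (set I - B) \<in> splits' (permute_list \<sigma> I)"
    "set (drop (card (set I - B)) (permute_list \<sigma> I)) = B"
proof -
  have fB: "finite B" using B finite_subset by blast
  have dI: "distinct I" using I by (simp add: strict_sorted_iff)
  let ?J = "sl (set I - B) @ sl B"
  have dJ: "distinct ?J" using fB by auto
  have "set ?J = set I" using B fB by auto
  then have "mset ?J = mset I" using dI dJ set_eq_iff_mset_eq_distinct by blast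
  then obtain \<sigma> where \<sigma>: "\<sigma> permutes {..<length I}" "permute_list \<sigma> I = ?J"
    by (rule mset_eq_permutation)
  show thesis
    by (rule that[OF \<sigma>(1)]) (use \<sigma> dJ fB in \<open>auto simp: splits'_iff\<close>)
qed

lemma bij_betw_splits:
  assumes I: "sorted_wrt (<) I"
  shows "bij_betw (\<lambda>(\<sigma>, m). set (drop m (permute_list \<sigma> I)))
    (Sigma {\<sigma>. \<sigma> permutes {..<length I}} (\<lambda>\<sigma>. splits' (permute_list \<sigma> I))) (Pow (set I))"
    (is "bij_betw ?f ?D _")
  unfolding bij_betw_def
proof
  have dI: "distinct I" using I by (simp add: strict_sorted_iff)
  show "inj_on ?f ?D"
  proof (rule inj_onI)
    fix x y assume "x \<in> ?D" "y \<in> ?D" "?f x = ?f y"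
    then obtain \<sigma> m \<tau> n where xy: "x = (\<sigma>, m)" "y = (\<tau>, n)" and
      p: "\<sigma> permutes {..<length I}" "\<tau> permutes {..<length I}"
         "m \<in> splits' (permute_list \<sigma> I)" "n \<in> splits' (permute_list \<tau> I)" and
      eq: "set (drop m (permute_list \<sigma> I)) = set (drop n (permute_list \<tau> I))"
      by auto
    note 1 = split_blocks[OF I p(1,3) refl] and 2 = split_blocks[OF I p(2,4) refl]
    have mn: "m = n" using 1(3) 2(3) eq by simp
    have J: "permute_list \<sigma> I = permute_list \<tau> I" using 1(2) 2(2) eq by simp
    have "\<sigma> i = \<tau> i" for i
    proof (cases "i < length I")
      case True
      have "I ! \<sigma> i = I ! \<tau> i"
        using J True p by (metis permute_list_nth)
      then show ?thesis
        using True dI permutes_in_image[OF p(1), of i] permutes_in_image[OF p(2), of i]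
        by (simp add: nth_eq_iff_index_eq)
    next
      case False
      then show ?thesis using p by (simp add: permutes_not_in)
    qed
    then show "x = y" using mn xy by auto
  qed
  show "?f ` ?D = Pow (set I)"
  proof (intro equalityI subsetI)
    fix B assume "B \<in> ?f ` ?D"
    then obtain \<sigma> m where "\<sigma> permutes {..<length I}" "m \<in> splits' (permute_list \<sigma> I)"
      "B = set (drop m (permute_list \<sigma> I))" by auto
    then show "B \<in> Pow (set I)" using split_blocks(1)[OF I] by blast
  next
    fix B assume "B \<in> Pow (set I)"
    then obtain \<sigma> where "\<sigma> permutes {..<length I}" "card (set I - B) \<in> splits' (permute_list \<sigma> I)"
      "set (drop (card (set I - B)) (permute_list \<sigma> I)) = B"
      using split_of_subset[OF I] by blast
    then show "B \<in> ?f ` ?D" by (intro image_eqI[of _ _ "(\<sigma>, card (set I - B))"]) auto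
  qed
qed

lemma bij_betw_splits_proper:
  assumes I: "sorted_wrt (<) I"
  shows "bij_betw (\<lambda>(\<sigma>, m). set (drop m (permute_list \<sigma> I)))
    (Sigma {\<sigma>. \<sigma> permutes {..<length I}} (\<lambda>\<sigma>. splits (permute_list \<sigma> I))) (Pow (set I) - {{}, set I})"
proof (rule bij_betw_subset[OF bij_betw_splits[OF I]])
  show "(SIGMA \<sigma>:{\<sigma>. \<sigma> permutes {..<length I}}. splits (permute_list \<sigma> I)) \<subseteq>
    (SIGMA \<sigma>:{\<sigma>. \<sigma> permutes {..<length I}}. splits' (permute_list \<sigma> I))"
    by (auto simp: splits_def)
  let ?f = "\<lambda>(\<sigma>, m). set (drop m (permute_list \<sigma> I))"
  have dI: "distinct I" using I by (simp add: strict_sorted_iff)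
  have key: "m \<in> splits (permute_list \<sigma> I) \<longleftrightarrow>
      set (drop m (permute_list \<sigma> I)) \<noteq> {} \<and> set (drop m (permute_list \<sigma> I)) \<noteq> set I"
    if p: "\<sigma> permutes {..<length I}" "m \<in> splits' (permute_list \<sigma> I)" for \<sigma> m
  proof -
    note b = split_blocks[OF I p refl]
    let ?B = "set (drop m (permute_list \<sigma> I))"
    have "m \<le> length I" using p by (auto simp: splits'_def)
    moreover have "?B = {} \<longleftrightarrow> length I \<le> m" by simp
    moreover have "?B = set I \<longleftrightarrow> m = 0" using b(1,3) by (auto simp: card_eq_0_iff)
    ultimately show ?thesis using p(2) by (auto simp: splits_def)
  qed
  have full: "?f ` (SIGMA \<sigma>:{\<sigma>. \<sigma> permutes {..<length I}}. splits' (permute_list \<sigma> I)) = Pow (set I)"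
    using bij_betw_splits[OF I] by (simp add: bij_betw_def)
  show "?f ` (SIGMA \<sigma>:{\<sigma>. \<sigma> permutes {..<length I}}. splits (permute_list \<sigma> I)) = Pow (set I) - {{}, set I}"
  proof (intro equalityI subsetI)
    fix B assume "B \<in> ?f ` (SIGMA \<sigma>:{\<sigma>. \<sigma> permutes {..<length I}}. splits (permute_list \<sigma> I))"
    then obtain \<sigma> m where p: "\<sigma> permutes {..<length I}" "m \<in> splits (permute_list \<sigma> I)"
      "B = set (drop m (permute_list \<sigma> I))" by auto
    then have "m \<in> splits' (permute_list \<sigma> I)" by (simp add: splits_def)
    then show "B \<in> Pow (set I) - {{}, set I}"
      using key[OF p(1)] split_blocks(1)[OF I p(1)] p by auto
  next
    fix B assume B: "B \<in> Pow (set I) - {{}, set I}"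
    then have "B \<in> ?f ` (SIGMA \<sigma>:{\<sigma>. \<sigma> permutes {..<length I}}. splits' (permute_list \<sigma> I))"
      using full by auto
    then obtain \<sigma> m where "\<sigma> permutes {..<length I}" "m \<in> splits' (permute_list \<sigma> I)"
      "B = set (drop m (permute_list \<sigma> I))" by auto
    then show "B \<in> ?f ` (SIGMA \<sigma>:{\<sigma>. \<sigma> permutes {..<length I}}. splits (permute_list \<sigma> I))"
      using key[of \<sigma> m] B by (intro image_eqI[of _ _ "(\<sigma>, m)"]) auto
  qed
qed

text \<open>Both ranges of cuts, with and without empty blocks, are handled at once: \<open>R\<close> is the set of right-hand
blocks that the cuts in \<open>P\<close> produce.\<close>

lemma perm_sum_eq_subsets:
  assumes M: "abelian_group M" and I: "sorted_wrt (<) I"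
    and bij: "bij_betw (\<lambda>(\<sigma>, m). set (drop m (permute_list \<sigma> I)))
      (Sigma {\<sigma>. \<sigma> permutes {..<length I}} (\<lambda>\<sigma>. P (permute_list \<sigma> I))) R"
    and sub: "\<And>J. P J \<subseteq> splits' J"
    and \<phi>: "\<And>B. B \<in> R \<Longrightarrow> \<phi> (sl (hatn B ` (set I - B))) (sl B) \<in> carrier M"
  shows "perm_sum M P c I \<phi> =
    (\<Oplus>\<^bsub>M\<^esub>B \<in> R. [(c * (-1) ^ crossings (set I - B) B)] \<cdot>\<^bsub>M\<^esub> \<phi> (sl (hatn B ` (set I - B))) (sl B))"
proof -
  interpret M: abelian_group M by fact
  let ?D = "Sigma {\<sigma>. \<sigma> permutes {..<length I}} (\<lambda>\<sigma>. P (permute_list \<sigma> I))"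
  let ?B = "\<lambda>\<sigma> m. set (drop m (permute_list \<sigma> I))"
  let ?g = "\<lambda>B. [(c * (-1) ^ crossings (set I - B) B)] \<cdot>\<^bsub>M\<^esub> \<phi> (sl (hatn B ` (set I - B))) (sl B)"
  have summand: "[(c * sign \<sigma>)] \<cdot>\<^bsub>M\<^esub> \<phi> (take m (hat (permute_list \<sigma> I))) (drop m (hat (permute_list \<sigma> I)))
      = ?g (?B \<sigma> m)" if "\<sigma> permutes {..<length I}" "m \<in> P (permute_list \<sigma> I)" for \<sigma> m
    using split_blocks(4-6)[OF I that(1) subsetD[OF sub that(2)] refl] by simp
  have R: "?B \<sigma> m \<in> R" if "\<sigma> permutes {..<length I}" "m \<in> P (permute_list \<sigma> I)" for \<sigma> m
    using bij that by (auto simp: bij_betw_def)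
  have cl: "?g B \<in> carrier M" if "B \<in> R" for B
    using \<phi>[OF that] by (rule M.add.int_pow_closed)
  have "finite (splits' J)" for J by (rule finite_subset[of _ "{..length J}"]) (auto simp: splits'_def)
  then have fin: "finite (P J)" for J using sub finite_subset by blast
  have "perm_sum M P c I \<phi> = (\<Oplus>\<^bsub>M\<^esub>\<sigma> \<in> {\<sigma>. \<sigma> permutes {..<length I}}. \<Oplus>\<^bsub>M\<^esub>m \<in> P (permute_list \<sigma> I). ?g (?B \<sigma> m))"
    unfolding perm_sum_def
    using summand cl[OF R]
    by (intro M.finsum_cong' refl funcsetI M.finsum_closed) auto
  also have "\<dots> = finsum M (\<lambda>(\<sigma>, m). ?g (?B \<sigma> m)) ?D"
    using cl[OF R] fin by (intro M.finsum_Sigma) (auto simp: finite_permutations)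
  also have "\<dots> = (\<Oplus>\<^bsub>M\<^esub>B \<in> R. ?g B)"
    using cl[OF R] by (intro M.finsum_bij[OF bij]) auto
  finally show ?thesis .
qed

lemmas perm_sum_splits' = perm_sum_eq_subsets[OF _ _ bij_betw_splits subset_refl]

lemma perm_sum_splits:
  assumes "abelian_group M" "sorted_wrt (<) I"
    and "\<And>B. B \<subseteq> set I \<Longrightarrow> \<phi> (sl (hatn B ` (set I - B))) (sl B) \<in> carrier M"
  shows "perm_sum M splits c I \<phi> = (\<Oplus>\<^bsub>M\<^esub>B \<in> Pow (set I) - {{}, set I}.
    [(c * (-1) ^ crossings (set I - B) B)] \<cdot>\<^bsub>M\<^esub> \<phi> (sl (hatn B ` (set I - B))) (sl B))"
  by (rule perm_sum_eq_subsets[OF assms(1,2) bij_betw_splits_proper[OF assms(2)]])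
     (use assms(3) in \<open>auto simp: splits_def\<close>)

section \<open>Homology of complexes of modules\<close>

definition is_submodule :: "('k, 'r) ring_scheme \<Rightarrow> ('k, 'a) module \<Rightarrow> 'a set \<Rightarrow> bool" where
  "is_submodule K M B \<longleftrightarrow> B \<subseteq> carrier M \<and> \<zero>\<^bsub>M\<^esub> \<in> B \<and>
     (\<forall>x \<in> B. \<forall>y \<in> B. x \<oplus>\<^bsub>M\<^esub> y \<in> B) \<and> (\<forall>a \<in> carrier K. \<forall>x \<in> B. a \<odot>\<^bsub>M\<^esub> x \<in> B)"

lemma submodule_abelian_subgroup:
  assumes "module K M" "is_submodule K M B"
  shows "abelian_subgroup B M"
proof -
  interpret M: module K M by fact
  have "\<ominus>\<^bsub>M\<^esub> x \<in> B" if "x \<in> B" for x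
  proof -
    have "x \<in> carrier M" using assms that by (auto simp: is_submodule_def)
    then have "\<ominus>\<^bsub>M\<^esub> x = (\<ominus>\<^bsub>K\<^esub> \<one>\<^bsub>K\<^esub>) \<odot>\<^bsub>M\<^esub> x"
      by (simp add: M.smult_l_minus)
    moreover have "\<ominus>\<^bsub>K\<^esub> \<one>\<^bsub>K\<^esub> \<in> carrier K" by simp
    ultimately show ?thesis using assms that by (metis is_submodule_def)
  qed
  then have "subgroup B (add_monoid M)"
    using assms by (intro M.M.add.subgroupI) (auto simp: is_submodule_def a_inv_def)
  then show ?thesis
    by (intro abelian_subgroupI3 M.M.abelian_group_axioms) (auto simp: additive_subgroup_def)
qed

text \<open>Cosets of submodules are compared through differences, which is how boundaries enter below.\<close>

lemma coset_eq_iff: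
  assumes "module K M" "is_submodule K M B" "x \<in> carrier M" "y \<in> carrier M"
  shows "B +>\<^bsub>M\<^esub> x = B +>\<^bsub>M\<^esub> y \<longleftrightarrow> x \<ominus>\<^bsub>M\<^esub> y \<in> B"
proof -
  interpret M: module K M by fact
  interpret B: abelian_subgroup B M using submodule_abelian_subgroup assms(1,2) .
  have "x \<ominus>\<^bsub>M\<^esub> y \<in> B \<longleftrightarrow> x \<in> B +>\<^bsub>M\<^esub> y"
    using assms(3,4) by (simp add: B.a_rcos_module a_minus_def)
  also have "\<dots> \<longleftrightarrow> B +>\<^bsub>M\<^esub> x = B +>\<^bsub>M\<^esub> y"
    using assms(3,4) B.a_rcos_self[of x] M.M.a_repr_independence[of x B y] B.a_subgroup by metis
  finally show ?thesis by simp
qed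

lemma coset_memD:
  assumes "module K M" "is_submodule K M B" "x \<in> carrier M" "w \<in> B +>\<^bsub>M\<^esub> x"
  shows "w \<in> carrier M" "w \<ominus>\<^bsub>M\<^esub> x \<in> B"
proof -
  interpret M: module K M by fact
  interpret B: abelian_subgroup B M using submodule_abelian_subgroup assms(1,2) .
  show w: "w \<in> carrier M"
    using M.M.a_r_coset_subset_G[of B x] B.a_subset assms by auto
  then show "w \<ominus>\<^bsub>M\<^esub> x \<in> B" using assms by (simp add: B.a_rcos_module a_minus_def)
qed

lemma coset_self:
  assumes "module K M" "is_submodule K M B" "x \<in> carrier M"
  shows "x \<in> B +>\<^bsub>M\<^esub> x"
proof -
  interpret B: abelian_subgroup B M using submodule_abelian_subgroup assms(1,2) .
  show ?thesis using B.a_rcos_self assms(3) .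
qed

lemma coset_UN:
  assumes "module K M" "is_submodule K M B" "x \<in> carrier M"
    and "\<And>w. w \<in> carrier M \<Longrightarrow> w \<ominus>\<^bsub>M\<^esub> x \<in> B \<Longrightarrow> F w = F x"
  shows "(\<Union>w \<in> B +>\<^bsub>M\<^esub> x. F w) = F x"
  using coset_self[OF assms(1-3)] coset_memD[OF assms(1-3)] assms(4) by blast

lemma subquotient_zero:
  assumes "module K M" "is_submodule K M B"
  shows "\<zero>\<^bsub>subquotient M Z B\<^esub> = B +>\<^bsub>M\<^esub> \<zero>\<^bsub>M\<^esub>"
proof -
  interpret M: module K M by fact
  show ?thesis using assms(2) by (simp add: subquotient_def is_submodule_def)
qed

lemma subquotient_add:
  assumes "module K M" "is_submodule K M B" "x \<in> carrier M" "y \<in> carrier M"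
  shows "(B +>\<^bsub>M\<^esub> x) \<oplus>\<^bsub>subquotient M Z B\<^esub> (B +>\<^bsub>M\<^esub> y) = B +>\<^bsub>M\<^esub> (x \<oplus>\<^bsub>M\<^esub> y)"
proof -
  interpret B: abelian_subgroup B M using submodule_abelian_subgroup assms(1,2) .
  show ?thesis using assms by (simp add: subquotient_def B.a_rcos_sum)
qed

lemma subquotient_smult:
  assumes "module K M" "is_submodule K M B" "x \<in> carrier M" "a \<in> carrier K"
  shows "a \<odot>\<^bsub>subquotient M Z B\<^esub> (B +>\<^bsub>M\<^esub> x) = B +>\<^bsub>M\<^esub> (a \<odot>\<^bsub>M\<^esub> x)"
proof -
  interpret M: module K M by fact
  have "B +>\<^bsub>M\<^esub> (a \<odot>\<^bsub>M\<^esub> w) = B +>\<^bsub>M\<^esub> (a \<odot>\<^bsub>M\<^esub> x)" if w: "w \<in> carrier M" "w \<ominus>\<^bsub>M\<^esub> x \<in> B" for w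
  proof -
    have "a \<odot>\<^bsub>M\<^esub> w \<ominus>\<^bsub>M\<^esub> a \<odot>\<^bsub>M\<^esub> x = a \<odot>\<^bsub>M\<^esub> (w \<ominus>\<^bsub>M\<^esub> x)"
      using w assms(3,4) by (simp add: a_minus_def M.smult_r_distr M.smult_r_minus)
    also have "\<dots> \<in> B" using w(2) assms(2,4) by (simp add: is_submodule_def)
    finally show ?thesis using w assms by (simp add: coset_eq_iff)
  qed
  then show ?thesis
    unfolding subquotient_def
    using coset_UN[OF assms(1-3), of "\<lambda>w. B +>\<^bsub>M\<^esub> (a \<odot>\<^bsub>M\<^esub> w)"] by simp
qed

lemmas subquotient_ops = subquotient_zero subquotient_add subquotient_smult

lemma carrier_subquotient: "carrier (subquotient M Z B) = (\<lambda>z. B +>\<^bsub>M\<^esub> z) ` Z"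
  by (simp add: subquotient_def)

lemma subquotient_module:
  assumes M: "module K M" and Z: "is_submodule K M Z" and B: "is_submodule K M B"
  shows "module K (subquotient M Z B)"
proof -
  interpret M: module K M by fact
  interpret Z: abelian_subgroup Z M using submodule_abelian_subgroup M Z .
  let ?Q = "subquotient M Z B" and ?q = "\<lambda>z. B +>\<^bsub>M\<^esub> z"
  note ops = subquotient_ops[OF M B, where Z = Z]
  have Zc: "z \<in> carrier M" if "z \<in> Z" for z using Z that by (auto simp: is_submodule_def)
  have Zs: "a \<odot>\<^bsub>M\<^esub> z \<in> Z" if "a \<in> carrier K" "z \<in> Z" for a z using Z that by (auto simp: is_submodule_def)
  show ?thesis
  proof (rule moduleI)
    show "cring K" by (rule M.R.is_cring)
    show "abelian_group ?Q"
    proof (rule abelian_groupI)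
      fix U assume "U \<in> carrier ?Q"
      then obtain z where z: "z \<in> Z" "U = ?q z" by (auto simp: carrier_subquotient)
      then have "?q (\<ominus>\<^bsub>M\<^esub> z) \<in> carrier ?Q" "?q (\<ominus>\<^bsub>M\<^esub> z) \<oplus>\<^bsub>?Q\<^esub> U = \<zero>\<^bsub>?Q\<^esub>"
        using Zc[OF z(1)] by (auto simp: carrier_subquotient ops M.M.l_neg)
      then show "\<exists>V \<in> carrier ?Q. V \<oplus>\<^bsub>?Q\<^esub> U = \<zero>\<^bsub>?Q\<^esub>" by blast
    qed (auto simp: carrier_subquotient ops Zc M.M.a_ac)
  qed (auto simp: carrier_subquotient ops Zc Zs M.smult_l_distr M.smult_r_distr M.smult_assoc1)
qed

text \<open>Complexes and chain maps in the convention of \<^const>\<open>cycles\<close> and \<^const>\<open>boundaries\<close>.\<close>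

definition is_complex :: "('k, 'r) ring_scheme \<Rightarrow> (nat \<Rightarrow> ('k, 'a) module) \<Rightarrow> (nat \<Rightarrow> 'a \<Rightarrow> 'a) \<Rightarrow> bool" where
  "is_complex K C D \<longleftrightarrow> (\<forall>r. module K (C r)) \<and>
     (\<forall>r. D (Suc r) \<in> linear_maps K (C (Suc r)) (C r)) \<and>
     (\<forall>r. \<forall>x \<in> carrier (C (Suc (Suc r))). D (Suc r) (D (Suc (Suc r)) x) = \<zero>\<^bsub>C r\<^esub>)"

definition is_chain_map ::
  "('k, 'r) ring_scheme \<Rightarrow> (nat \<Rightarrow> ('k, 'a) module) \<Rightarrow> (nat \<Rightarrow> 'a \<Rightarrow> 'a) \<Rightarrow>
   (nat \<Rightarrow> ('k, 'b) module) \<Rightarrow> (nat \<Rightarrow> 'b \<Rightarrow> 'b) \<Rightarrow> (nat \<Rightarrow> 'a \<Rightarrow> 'b) \<Rightarrow> bool" where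
  "is_chain_map K C D C' D' \<phi> \<longleftrightarrow> (\<forall>r. \<phi> r \<in> linear_maps K (C r) (C' r)) \<and>
     (\<forall>r. \<forall>x \<in> carrier (C (Suc r)). \<phi> r (D (Suc r) x) = D' (Suc r) (\<phi> (Suc r) x))"

lemma cycles_submodule:
  assumes "is_complex K C D"
  shows "is_submodule K (C r) (cycles C D r)"
proof -
  interpret M: module K "C r" using assms by (simp add: is_complex_def)
  show ?thesis
  proof (cases r)
    case 0
    then show ?thesis
      using M.M.zero_closed M.M.a_closed M.smult_closed by (auto simp: is_submodule_def cycles_def)
  next
    case (Suc s)
    interpret S: module K "C (Suc s)" using assms by (simp add: is_complex_def)
    interpret N: module K "C s" using assms by (simp add: is_complex_def)
    have D: "D (Suc s) \<in> linear_maps K (C (Suc s)) (C s)" using assms by (auto simp: is_complex_def)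
    show ?thesis
      using Suc lin_zero[OF S.module_axioms N.module_axioms D]
      by (auto simp: is_submodule_def cycles_def lin_add[OF D] lin_smult[OF D])
  qed
qed

lemma boundaries_submodule:
  assumes "is_complex K C D"
  shows "is_submodule K (C r) (boundaries C D r)"
proof -
  interpret M: module K "C r" using assms by (simp add: is_complex_def)
  interpret N: module K "C (Suc r)" using assms by (simp add: is_complex_def)
  have D: "D (Suc r) \<in> linear_maps K (C (Suc r)) (C r)" using assms by (auto simp: is_complex_def)
  have 1: "\<zero>\<^bsub>C r\<^esub> = D (Suc r) \<zero>\<^bsub>C (Suc r)\<^esub>"
    using lin_zero[OF N.module_axioms M.module_axioms D] by simp
  show ?thesis
    unfolding is_submodule_def boundaries_def
  proof (intro conjI ballI)
    show "\<zero>\<^bsub>C r\<^esub> \<in> D (Suc r) ` carrier (C (Suc r))" unfolding 1 by blast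
  qed (auto simp: lin_closed[OF D] simp flip: lin_add[OF D] lin_smult[OF D])
qed

lemma homology_module:
  assumes "is_complex K C D"
  shows "module K (homology C D r)"
  unfolding homology_def
  using assms by (intro subquotient_module cycles_submodule boundaries_submodule) (auto simp: is_complex_def)

lemma carrier_homology:
  "carrier (homology C D r) = (\<lambda>z. boundaries C D r +>\<^bsub>C r\<^esub> z) ` cycles C D r"
  by (simp add: homology_def carrier_subquotient)

lemma chain_map_cycles:
  assumes "is_complex K C D" "is_complex K C' D'" "is_chain_map K C D C' D' \<phi>" "z \<in> cycles C D r"
  shows "\<phi> r z \<in> cycles C' D' r"
proof (cases r)
  case 0
  then show ?thesis using assms(3,4) by (auto simp: cycles_def is_chain_map_def intro: lin_closed)
next
  case (Suc s)
  have z: "z \<in> carrier (C (Suc s))" "D (Suc s) z = \<zero>\<^bsub>C s\<^esub>" using assms(4) Suc by (auto simp: cycles_def)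
  have l: "\<phi> t \<in> linear_maps K (C t) (C' t)" for t using assms(3) by (auto simp: is_chain_map_def)
  have "D' (Suc s) (\<phi> (Suc s) z) = \<phi> s (D (Suc s) z)" using assms(3) z(1) by (simp add: is_chain_map_def)
  also have "\<dots> = \<zero>\<^bsub>C' s\<^esub>"
    using assms(1,2) lin_zero[OF _ _ l[of s]] z by (simp add: is_complex_def)
  finally show ?thesis using Suc z by (auto simp: cycles_def lin_closed[OF l])
qed

text \<open>The union over a coset in the definition of the induced map has a single value, because chain maps
send boundaries to boundaries.\<close>

lemma homology_map_coset:
  assumes C: "is_complex K C D" and C': "is_complex K C' D'" and \<phi>: "is_chain_map K C D C' D' \<phi>"
    and z: "z \<in> cycles C D r"
  shows "homology_map C D C' D' \<phi> r (boundaries C D r +>\<^bsub>C r\<^esub> z) =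
    boundaries C' D' r +>\<^bsub>C' r\<^esub> \<phi> r z"
proof -
  have M: "module K (C r)" and M': "module K (C' r)" using C C' by (auto simp: is_complex_def)
  note B = boundaries_submodule[OF C, of r] and B' = boundaries_submodule[OF C', of r]
  have l: "\<phi> t \<in> linear_maps K (C t) (C' t)" for t using \<phi> by (auto simp: is_chain_map_def)
  have zc: "z \<in> carrier (C r)" using z by (auto simp: cycles_def)
  have "boundaries C' D' r +>\<^bsub>C' r\<^esub> \<phi> r w = boundaries C' D' r +>\<^bsub>C' r\<^esub> \<phi> r z"
    if w: "w \<in> carrier (C r)" "w \<ominus>\<^bsub>C r\<^esub> z \<in> boundaries C D r" for w
  proof -
    obtain u where u: "u \<in> carrier (C (Suc r))" "w \<ominus>\<^bsub>C r\<^esub> z = D (Suc r) u"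
      using w by (auto simp: boundaries_def)
    have "\<phi> r w \<ominus>\<^bsub>C' r\<^esub> \<phi> r z = \<phi> r (w \<ominus>\<^bsub>C r\<^esub> z)" using lin_minus[OF M M' l w(1) zc] by simp
    also have "\<dots> = D' (Suc r) (\<phi> (Suc r) u)" using u \<phi> by (auto simp: is_chain_map_def)
    also have "\<dots> \<in> boundaries C' D' r" using u by (auto simp: boundaries_def lin_closed[OF l])
    finally show ?thesis using coset_eq_iff[OF M' B'] w zc by (auto simp: lin_closed[OF l])
  qed
  then show ?thesis
    using z coset_UN[OF M B zc, of "\<lambda>w. boundaries C' D' r +>\<^bsub>C' r\<^esub> \<phi> r w"]
    by (simp add: homology_map_def carrier_homology)
qed

lemma homology_map_linear:
  assumes C: "is_complex K C D" and C': "is_complex K C' D'" and \<phi>: "is_chain_map K C D C' D' \<phi>"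
  shows "homology_map C D C' D' \<phi> r \<in>
    linear_maps K (homology C D r) (homology C' D' r) \<inter> extensional (carrier (homology C D r))"
proof
  show "homology_map C D C' D' \<phi> r \<in> extensional (carrier (homology C D r))"
    by (simp add: homology_map_def)
  have M: "module K (C r)" and M': "module K (C' r)" using C C' by (auto simp: is_complex_def)
  interpret M: module K "C r" by fact
  note Z = cycles_submodule[OF C, of r]
  have l: "\<phi> t \<in> linear_maps K (C t) (C' t)" for t using \<phi> by (auto simp: is_chain_map_def)
  note map = homology_map_coset[OF C C' \<phi>]
  note ops = subquotient_ops[OF M boundaries_submodule[OF C], where Z = "cycles C D r", folded homology_def]
  note ops' = subquotient_ops[OF M' boundaries_submodule[OF C'], where Z = "cycles C' D' r", folded homology_def]
  have Zc: "z \<in> carrier (C r)" if "z \<in> cycles C D r" for z using that by (auto simp: cycles_def)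
  have Z1: "x \<oplus>\<^bsub>C r\<^esub> y \<in> cycles C D r" "a \<in> carrier K \<Longrightarrow> a \<odot>\<^bsub>C r\<^esub> x \<in> cycles C D r"
    if "x \<in> cycles C D r" "y \<in> cycles C D r" for a x y
    using that Z by (auto simp: is_submodule_def)
  show "homology_map C D C' D' \<phi> r \<in> linear_maps K (homology C D r) (homology C' D' r)"
    by (rule linear_mapsI)
       (auto simp: carrier_homology map ops ops' Zc Z1 lin_closed[OF l] lin_add[OF l] lin_smult[OF l]
         intro: chain_map_cycles[OF C C' \<phi>])
qed

lemma homology_map_ident:
  assumes C: "is_complex K C D"
    and \<phi>: "\<And>z. z \<in> carrier (C r) \<Longrightarrow> \<phi> r z = z"
  shows "homology_map C D C D \<phi> r = (\<lambda>U \<in> carrier (homology C D r). U)"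
proof
  fix U
  have M: "module K (C r)" using C by (auto simp: is_complex_def)
  note B = boundaries_submodule[OF C, of r]
  show "homology_map C D C D \<phi> r U = (\<lambda>U \<in> carrier (homology C D r). U) U"
  proof (cases "U \<in> carrier (homology C D r)")
    case True
    then obtain z where z: "z \<in> cycles C D r" "U = boundaries C D r +>\<^bsub>C r\<^esub> z"
      by (auto simp: carrier_homology)
    have zc: "z \<in> carrier (C r)" using z by (auto simp: cycles_def)
    have "(\<Union>w \<in> U. boundaries C D r +>\<^bsub>C r\<^esub> \<phi> r w) = boundaries C D r +>\<^bsub>C r\<^esub> \<phi> r z"
      unfolding z(2) by (rule coset_UN[OF M B zc]) (use zc \<phi> coset_eq_iff[OF M B] in auto)
    then show ?thesis using True z zc \<phi> by (simp add: homology_map_def)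
  qed (simp add: homology_map_def)
qed

lemma homology_map_comp:
  assumes C: "is_complex K C D" and C': "is_complex K C' D'" and C'': "is_complex K C'' D''"
    and \<phi>: "is_chain_map K C D C' D' \<phi>" and \<psi>: "is_chain_map K C' D' C'' D'' \<psi>"
    and \<chi>: "is_chain_map K C D C'' D'' \<chi>"
    and eq: "\<And>z. z \<in> carrier (C r) \<Longrightarrow> \<chi> r z = \<psi> r (\<phi> r z)"
  shows "homology_map C D C'' D'' \<chi> r =
    (\<lambda>U \<in> carrier (homology C D r). homology_map C' D' C'' D'' \<psi> r (homology_map C D C' D' \<phi> r U))"
proof
  fix U
  show "homology_map C D C'' D'' \<chi> r U =
    (\<lambda>U \<in> carrier (homology C D r). homology_map C' D' C'' D'' \<psi> r (homology_map C D C' D' \<phi> r U)) U"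
  proof (cases "U \<in> carrier (homology C D r)")
    case True
    then obtain z where z: "z \<in> cycles C D r" "U = boundaries C D r +>\<^bsub>C r\<^esub> z"
      by (auto simp: carrier_homology)
    then have zc: "z \<in> carrier (C r)" by (auto simp: cycles_def)
    show ?thesis
      using True zc z
      by (simp add: homology_map_coset[OF C C'' \<chi>] homology_map_coset[OF C C' \<phi>]
          homology_map_coset[OF C' C'' \<psi>] chain_map_cycles[OF C C' \<phi>] eq)
  qed (simp add: homology_map_def)
qed

text \<open>It suffices to compare on cycles, so a chain homotopy only has to be evaluated there.\<close>

lemma homology_map_eq:
  assumes C: "is_complex K C D" and C': "is_complex K C' D'"
    and \<phi>: "is_chain_map K C D C' D' \<phi>" and \<psi>: "is_chain_map K C D C' D' \<psi>"
    and eq: "\<And>z. z \<in> cycles C D r \<Longrightarrow> \<phi> r z \<ominus>\<^bsub>C' r\<^esub> \<psi> r z \<in> boundaries C' D' r"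
  shows "homology_map C D C' D' \<phi> r = homology_map C D C' D' \<psi> r"
proof
  fix U
  have M': "module K (C' r)" using C' by (auto simp: is_complex_def)
  show "homology_map C D C' D' \<phi> r U = homology_map C D C' D' \<psi> r U"
  proof (cases "U \<in> carrier (homology C D r)")
    case True
    then obtain z where z: "z \<in> cycles C D r" "U = boundaries C D r +>\<^bsub>C r\<^esub> z"
      by (auto simp: carrier_homology)
    have "\<phi> r z \<in> carrier (C' r)" "\<psi> r z \<in> carrier (C' r)"
      using chain_map_cycles[OF C C' \<phi> z(1)] chain_map_cycles[OF C C' \<psi> z(1)] by (auto simp: cycles_def)
    then show ?thesis
      using z eq[OF z(1)]
      by (simp add: homology_map_coset[OF C C' \<phi>] homology_map_coset[OF C C' \<psi>]
          coset_eq_iff[OF M' boundaries_submodule[OF C']])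
  qed (simp add: homology_map_def)
qed

lemma GrM_category:
  fixes K :: "('k, 'r) ring_scheme"
  shows "is_category (GrM_cat K :: (nat \<Rightarrow> ('k, 'a) module, nat \<Rightarrow> 'a \<Rightarrow> 'a) category)"
  unfolding is_category_def GrM_cat_def
proof (simp, intro conjI allI impI ballI)
  fix M :: "nat \<Rightarrow> ('k, 'a) module" and r
  show "(\<lambda>x\<in>carrier (M r). x) \<in> linear_maps K (M r) (M r)" if "\<forall>r. module K (M r)"
    using linear_maps_cong[of K "M r" "\<lambda>x\<in>carrier (M r). x" "\<lambda>x. x" "M r"] that by (simp add: lin_id)
next
  fix L M N :: "nat \<Rightarrow> ('k, 'a) module" and f g r
  assume "\<forall>r. module K (L r)" and
    "\<forall>r. f r \<in> linear_maps K (L r) (M r) \<and> f r \<in> extensional (carrier (L r))" and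
    "\<forall>r. g r \<in> linear_maps K (M r) (N r) \<and> g r \<in> extensional (carrier (M r))"
  then show "(\<lambda>x\<in>carrier (L r). g r (f r x)) \<in> linear_maps K (L r) (N r)"
    using linear_maps_cong[of K "L r" "\<lambda>x\<in>carrier (L r). g r (f r x)" "\<lambda>x. g r (f r x)" "N r"]
      lin_comp[of "f r" K "L r" "M r" "g r" "N r"] by simp
next
  fix M N :: "nat \<Rightarrow> ('k, 'a) module" and f
  assume f: "\<forall>r. f r \<in> linear_maps K (M r) (N r) \<and> f r \<in> extensional (carrier (M r))"
  show "(\<lambda>r. \<lambda>x\<in>carrier (M r). f r (if x \<in> carrier (M r) then x else undefined)) = f"
    using f by (auto simp: fun_eq_iff extensional_def restrict_def)
  show "(\<lambda>r. \<lambda>x\<in>carrier (M r). if f r x \<in> carrier (N r) then f r x else undefined) = f"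
    using f by (auto simp: fun_eq_iff extensional_def restrict_def dest: lin_closed)
next
  fix L M N P :: "nat \<Rightarrow> ('k, 'a) module" and f g h
  assume f: "\<forall>r. f r \<in> linear_maps K (L r) (M r) \<and> f r \<in> extensional (carrier (L r))"
  show "(\<lambda>r. \<lambda>x\<in>carrier (L r). if f r x \<in> carrier (M r) then h r (g r (f r x)) else undefined) =
       (\<lambda>r. \<lambda>x\<in>carrier (L r). h r (if x \<in> carrier (L r) then g r (f r x) else undefined))"
    using f by (auto simp: fun_eq_iff restrict_def dest: lin_closed)
qed

subsection \<open>Direct sums\<close>

lemma direct_sum_simps [simp]:
  "carrier (direct_sum I M) = (\<Pi>\<^sub>E i \<in> I. carrier (M i))"
  "\<zero>\<^bsub>direct_sum I M\<^esub> = (\<lambda>i \<in> I. \<zero>\<^bsub>M i\<^esub>)"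
  "x \<oplus>\<^bsub>direct_sum I M\<^esub> y = (\<lambda>i \<in> I. x i \<oplus>\<^bsub>M i\<^esub> y i)"
  "a \<odot>\<^bsub>direct_sum I M\<^esub> x = (\<lambda>i \<in> I. a \<odot>\<^bsub>M i\<^esub> x i)"
  by (simp_all add: direct_sum_def)

lemma direct_sum_module:
  assumes K: "cring K" and M: "\<And>i. i \<in> I \<Longrightarrow> module K (M i)"
  shows "module K (direct_sum I M)"
proof -
  note ag = module_abelian_group[OF M]
  have neg: "\<exists>y \<in> carrier (direct_sum I M). y \<oplus>\<^bsub>direct_sum I M\<^esub> x = \<zero>\<^bsub>direct_sum I M\<^esub>"
    if "x \<in> carrier (direct_sum I M)" for x
    by (rule bexI[of _ "\<lambda>i \<in> I. \<ominus>\<^bsub>M i\<^esub> x i"])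
       (use that ag in \<open>auto simp: fun_eq_iff PiE_iff abelian_group.l_neg abelian_group.a_inv_closed\<close>)
  have pt: "u \<oplus>\<^bsub>M i\<^esub> v \<in> carrier (M i)" "u \<oplus>\<^bsub>M i\<^esub> v \<oplus>\<^bsub>M i\<^esub> w = u \<oplus>\<^bsub>M i\<^esub> (v \<oplus>\<^bsub>M i\<^esub> w)"
    "u \<oplus>\<^bsub>M i\<^esub> v = v \<oplus>\<^bsub>M i\<^esub> u" "\<zero>\<^bsub>M i\<^esub> \<oplus>\<^bsub>M i\<^esub> u = u" "\<zero>\<^bsub>M i\<^esub> \<in> carrier (M i)"
    if "i \<in> I" "u \<in> carrier (M i)" "v \<in> carrier (M i)" "w \<in> carrier (M i)" for i u v w
    using abelian_groupE[OF ag[OF that(1)]] that by auto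
  have "abelian_group (direct_sum I M)"
  proof (rule abelian_groupI)
    fix x y z assume "x \<in> carrier (direct_sum I M)" "y \<in> carrier (direct_sum I M)" "z \<in> carrier (direct_sum I M)"
    then have c: "x i \<in> carrier (M i)" "y i \<in> carrier (M i)" "z i \<in> carrier (M i)" if "i \<in> I" for i
      using that by auto
    show "x \<oplus>\<^bsub>direct_sum I M\<^esub> y \<in> carrier (direct_sum I M)"
      using pt(1)[OF _ c(1) c(2) c(3)] by auto
    show "x \<oplus>\<^bsub>direct_sum I M\<^esub> y \<oplus>\<^bsub>direct_sum I M\<^esub> z = x \<oplus>\<^bsub>direct_sum I M\<^esub> (y \<oplus>\<^bsub>direct_sum I M\<^esub> z)"
      unfolding direct_sum_simps by (rule restrict_ext) (simp add: pt(2)[OF _ c(1) c(2) c(3)])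
    show "x \<oplus>\<^bsub>direct_sum I M\<^esub> y = y \<oplus>\<^bsub>direct_sum I M\<^esub> x"
      unfolding direct_sum_simps by (rule restrict_ext) (rule pt(3)[OF _ c(1) c(2) c(3)])
  next
    fix x assume "x \<in> carrier (direct_sum I M)"
    then show "\<zero>\<^bsub>direct_sum I M\<^esub> \<oplus>\<^bsub>direct_sum I M\<^esub> x = x"
      by (auto simp: fun_eq_iff restrict_def PiE_iff extensional_def pt(4))
  qed (use neg ag in \<open>auto intro: abelian_groupE\<close>)
  then show ?thesis
  proof (intro moduleI K)
    fix a b x y assume h: "a \<in> carrier K" "b \<in> carrier K" "x \<in> carrier (direct_sum I M)" "y \<in> carrier (direct_sum I M)"
    have i: "x i \<in> carrier (M i)" "y i \<in> carrier (M i)" if "i \<in> I" for i using h that by auto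
    show "a \<odot>\<^bsub>direct_sum I M\<^esub> x \<in> carrier (direct_sum I M)"
      using h i by (auto intro: module.smult_closed[OF M])
    show "(a \<oplus>\<^bsub>K\<^esub> b) \<odot>\<^bsub>direct_sum I M\<^esub> x = a \<odot>\<^bsub>direct_sum I M\<^esub> x \<oplus>\<^bsub>direct_sum I M\<^esub> b \<odot>\<^bsub>direct_sum I M\<^esub> x"
      using h M i by (auto simp: fun_eq_iff module.smult_l_distr)
    show "a \<odot>\<^bsub>direct_sum I M\<^esub> (x \<oplus>\<^bsub>direct_sum I M\<^esub> y) = a \<odot>\<^bsub>direct_sum I M\<^esub> x \<oplus>\<^bsub>direct_sum I M\<^esub> a \<odot>\<^bsub>direct_sum I M\<^esub> y"
      using h i by (auto simp: fun_eq_iff module.smult_r_distr[OF M])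
    show "(a \<otimes>\<^bsub>K\<^esub> b) \<odot>\<^bsub>direct_sum I M\<^esub> x = a \<odot>\<^bsub>direct_sum I M\<^esub> (b \<odot>\<^bsub>direct_sum I M\<^esub> x)"
      using h M i by (auto simp: fun_eq_iff module.smult_assoc1)
  next
    fix x assume h: "x \<in> carrier (direct_sum I M)"
    then show "\<one>\<^bsub>K\<^esub> \<odot>\<^bsub>direct_sum I M\<^esub> x = x"
      using M by (auto simp: fun_eq_iff restrict_def PiE_iff extensional_def module.smult_one)
  qed
qed

lemma direct_sum_neg:
  assumes "module K (direct_sum I M)" "\<And>i. i \<in> I \<Longrightarrow> module K (M i)" "x \<in> carrier (direct_sum I M)" "i \<in> I"
  shows "(\<ominus>\<^bsub>direct_sum I M\<^esub> x) i = \<ominus>\<^bsub>M i\<^esub> x i"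
proof -
  interpret S: module K "direct_sum I M" by fact
  interpret N: module K "M i" using assms by blast
  have c: "\<ominus>\<^bsub>direct_sum I M\<^esub> x \<in> carrier (direct_sum I M)" using assms(3) by (rule S.M.a_inv_closed)
  have "\<ominus>\<^bsub>direct_sum I M\<^esub> x \<oplus>\<^bsub>direct_sum I M\<^esub> x = \<zero>\<^bsub>direct_sum I M\<^esub>" using assms(3) by (rule S.M.l_neg)
  then have "(\<ominus>\<^bsub>direct_sum I M\<^esub> x) i \<oplus>\<^bsub>M i\<^esub> x i = \<zero>\<^bsub>M i\<^esub>"
    using assms(4) by (auto simp: fun_eq_iff restrict_def dest: spec[of _ i])
  then show ?thesis
    using assms(3,4) c by (intro N.M.minus_equality[symmetric]) auto
qed

lemma direct_sum_minus:
  assumes "module K (direct_sum I M)" "\<And>i. i \<in> I \<Longrightarrow> module K (M i)"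
    "x \<in> carrier (direct_sum I M)" "y \<in> carrier (direct_sum I M)" "i \<in> I"
  shows "(x \<ominus>\<^bsub>direct_sum I M\<^esub> y) i = x i \<ominus>\<^bsub>M i\<^esub> y i"
  using assms direct_sum_neg[OF assms(1,2,4,5)] by (simp add: a_minus_def)

lemma linear_into_direct_sum:
  assumes "module K L" "\<And>i. i \<in> I \<Longrightarrow> (\<lambda>x. f x i) \<in> linear_maps K L (M i)"
    and "\<And>x. x \<in> carrier L \<Longrightarrow> f x \<in> extensional I"
  shows "f \<in> linear_maps K L (direct_sum I M)"
proof -
  interpret L: module K L by fact
  show ?thesis
  proof (rule linear_mapsI)
    fix x assume x: "x \<in> carrier L"
    then show "f x \<in> carrier (direct_sum I M)"
      using assms(3) lin_closed[OF assms(2)] by (auto simp: PiE_iff)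
    fix y assume y: "y \<in> carrier L"
    show "f (x \<oplus>\<^bsub>L\<^esub> y) = f x \<oplus>\<^bsub>direct_sum I M\<^esub> f y"
    proof (rule extensionalityI[of _ I])
      show "f (x \<oplus>\<^bsub>L\<^esub> y) \<in> extensional I" using x y assms(3) by blast
    qed (use lin_add[OF assms(2) x y] in auto)
  next
    fix a x assume ax: "a \<in> carrier K" "x \<in> carrier L"
    show "f (a \<odot>\<^bsub>L\<^esub> x) = a \<odot>\<^bsub>direct_sum I M\<^esub> f x"
    proof (rule extensionalityI[of _ I])
      show "f (a \<odot>\<^bsub>L\<^esub> x) \<in> extensional I" using ax assms(3) by blast
    qed (use lin_smult[OF assms(2) ax] in auto)
  qed
qed

lemma linear_at_component:
  assumes "i \<in> I" "g \<in> linear_maps K (M i) N"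
  shows "(\<lambda>v. g (v i)) \<in> linear_maps K (direct_sum I M) N"
  using assms(1)
  by (intro linear_mapsI) (auto simp: PiE_iff lin_closed[OF assms(2)] lin_add[OF assms(2)] lin_smult[OF assms(2)])

subsection \<open>Total complexes\<close>

text \<open>Bicomplexes whose modules \<open>C\<^bsub>n,m\<^esub>\<close> do not depend on \<open>m\<close>.\<close>

definition is_bicomplex ::
  "('k, 'r) ring_scheme \<Rightarrow> (nat \<Rightarrow> ('k, 'a) module) \<Rightarrow> (nat \<Rightarrow> nat \<Rightarrow> 'a \<Rightarrow> 'a) \<Rightarrow>
   (nat \<Rightarrow> nat \<Rightarrow> 'a \<Rightarrow> 'a) \<Rightarrow> bool" where
  "is_bicomplex K C d1 d2 \<longleftrightarrow>
     (\<forall>n. module K (C n)) \<and>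
     (\<forall>n m. d1 n m \<in> linear_maps K (C n) (C n)) \<and>
     (\<forall>n m. d2 (Suc n) m \<in> linear_maps K (C (Suc n)) (C n)) \<and>
     (\<forall>n m. \<forall>x \<in> carrier (C n). d1 n (Suc m) (d1 n (Suc (Suc m)) x) = \<zero>\<^bsub>C n\<^esub>) \<and>
     (\<forall>n m. \<forall>x \<in> carrier (C (Suc (Suc n))). d2 (Suc n) m (d2 (Suc (Suc n)) m x) = \<zero>\<^bsub>C n\<^esub>) \<and>
     (\<forall>n m. \<forall>x \<in> carrier (C (Suc n)).
        d1 n (Suc m) (d2 (Suc n) (Suc m) x) \<oplus>\<^bsub>C n\<^esub> d2 (Suc n) m (d1 (Suc n) (Suc m) x) = \<zero>\<^bsub>C n\<^esub>)"

definition tot :: "(nat \<Rightarrow> ('k, 'a) module) \<Rightarrow> nat \<Rightarrow> ('k, nat \<Rightarrow> 'a) module" where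
  "tot C r = direct_sum {..r} C"

definition tot_diff ::
  "(nat \<Rightarrow> ('k, 'a) module) \<Rightarrow> (nat \<Rightarrow> nat \<Rightarrow> 'a \<Rightarrow> 'a) \<Rightarrow> (nat \<Rightarrow> nat \<Rightarrow> 'a \<Rightarrow> 'a) \<Rightarrow>
   nat \<Rightarrow> (nat \<Rightarrow> 'a) \<Rightarrow> nat \<Rightarrow> 'a" where
  "tot_diff C d1 d2 r v = (\<lambda>n \<in> {..r - 1}.
     d1 n (r - n) (v n) \<oplus>\<^bsub>C n\<^esub> d2 (n + 1) (r - 1 - n) (v (n + 1)))"

definition tot_map :: "(nat \<Rightarrow> nat \<Rightarrow> 'a \<Rightarrow> 'b) \<Rightarrow> nat \<Rightarrow> (nat \<Rightarrow> 'a) \<Rightarrow> nat \<Rightarrow> 'b" where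
  "tot_map F r v = (\<lambda>n \<in> {..r}. F n (r - n) (v n))"

lemma tot_module:
  assumes "is_bicomplex K C d1 d2"
  shows "module K (tot C r)"
proof -
  have M: "module K (C n)" for n using assms by (simp add: is_bicomplex_def)
  then have "cring K" by (auto simp: module_def)
  then show ?thesis unfolding tot_def by (intro direct_sum_module M)
qed

lemma tot_complex:
  assumes bi: "is_bicomplex K C d1 d2"
  shows "is_complex K (tot C) (tot_diff C d1 d2)"
proof -
  have M: "module K (C n)" for n using bi by (simp add: is_bicomplex_def)
  have d1: "d1 n m \<in> linear_maps K (C n) (C n)" for n m using bi by (simp add: is_bicomplex_def)
  have d2: "d2 (Suc n) m \<in> linear_maps K (C (Suc n)) (C n)" for n m using bi by (simp add: is_bicomplex_def)
  show ?thesis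
    unfolding is_complex_def
  proof (intro conjI allI ballI)
    fix r
    show "module K (tot C r)" using bi by (rule tot_module)
    show "tot_diff C d1 d2 (Suc r) \<in> linear_maps K (tot C (Suc r)) (tot C r)"
      unfolding tot_def tot_diff_def
    proof (rule linear_into_direct_sum)
      show "module K (direct_sum {..Suc r} C)" using tot_module[OF bi] by (simp add: tot_def)
      fix n assume n: "n \<in> {..r}"
      then show "(\<lambda>v. (\<lambda>n\<in>{..Suc r - 1}. d1 n (Suc r - n) (v n) \<oplus>\<^bsub>C n\<^esub> d2 (n + 1) (Suc r - 1 - n) (v (n + 1))) n)
          \<in> linear_maps K (direct_sum {..Suc r} C) (C n)"
        using lin_sum_two[OF M[of n] linear_at_component[of n "{..Suc r}" "d1 n (Suc r - n)" K C "C n"]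
            linear_at_component[of "Suc n" "{..Suc r}" "d2 (Suc n) (r - n)" K C "C n"]] d1 d2
        by simp
    qed simp
  next
    fix r v assume v: "v \<in> carrier (tot C (Suc (Suc r)))"
    then have vc: "v n \<in> carrier (C n)" if "n \<le> Suc (Suc r)" for n using that by (auto simp: tot_def)
    let ?D = "tot_diff C d1 d2"
    have "?D (Suc r) (?D (Suc (Suc r)) v) n = \<zero>\<^bsub>C n\<^esub>" if n: "n \<le> r" for n
    proof -
      interpret C: module K "C n" by (rule M)
      define m where "m = r - n"
      have m: "Suc r - n = Suc m" "Suc (Suc r) - n = Suc (Suc m)" using n by (auto simp: m_def)
      let ?a = "v n" and ?b = "v (Suc n)" and ?c = "v (Suc (Suc n))"
      have c: "?a \<in> carrier (C n)" "?b \<in> carrier (C (Suc n))" "?c \<in> carrier (C (Suc (Suc n)))"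
        using n vc by auto
      have e1: "d1 n (Suc m) (d1 n (Suc (Suc m)) ?a \<oplus>\<^bsub>C n\<^esub> d2 (Suc n) (Suc m) ?b) =
          d1 n (Suc m) (d2 (Suc n) (Suc m) ?b)"
        using c bi lin_closed[OF d1] lin_closed[OF d2] by (simp add: lin_add[OF d1] is_bicomplex_def)
      have e2: "d2 (Suc n) m (d1 (Suc n) (Suc m) ?b \<oplus>\<^bsub>C (Suc n)\<^esub> d2 (Suc (Suc n)) m ?c) =
          d2 (Suc n) m (d1 (Suc n) (Suc m) ?b)"
        using c bi lin_closed[OF d1] lin_closed[OF d2] by (simp add: lin_add[OF d2] is_bicomplex_def)
      have "?D (Suc r) (?D (Suc (Suc r)) v) n =
        d1 n (Suc m) (d1 n (Suc (Suc m)) ?a \<oplus>\<^bsub>C n\<^esub> d2 (Suc n) (Suc m) ?b) \<oplus>\<^bsub>C n\<^esub>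
        d2 (Suc n) m (d1 (Suc n) (Suc m) ?b \<oplus>\<^bsub>C (Suc n)\<^esub> d2 (Suc (Suc n)) m ?c)"
        using n m by (simp add: tot_diff_def m_def)
      also have "\<dots> = \<zero>\<^bsub>C n\<^esub>"
        unfolding e1 e2 using bi c by (simp add: is_bicomplex_def)
      finally show ?thesis .
    qed
    then show "?D (Suc r) (?D (Suc (Suc r)) v) = \<zero>\<^bsub>tot C r\<^esub>"
      by (auto simp: tot_def tot_diff_def fun_eq_iff)
  qed
qed

definition is_bicomplex_map where
  "is_bicomplex_map K C d1 d2 C' d1' d2' F \<longleftrightarrow>
     (\<forall>n m. F n m \<in> linear_maps K (C n) (C' n)) \<and>
     (\<forall>n m. \<forall>x \<in> carrier (C n). F n m (d1 n (Suc m) x) = d1' n (Suc m) (F n (Suc m) x)) \<and>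
     (\<forall>n m. \<forall>x \<in> carrier (C (Suc n)). F n m (d2 (Suc n) m x) = d2' (Suc n) m (F (Suc n) m x))"

lemma tot_chain_map:
  assumes bi: "is_bicomplex K C d1 d2" and bi': "is_bicomplex K C' d1' d2'"
    and F: "is_bicomplex_map K C d1 d2 C' d1' d2' F"
  shows "is_chain_map K (tot C) (tot_diff C d1 d2) (tot C') (tot_diff C' d1' d2') (tot_map F)"
proof -
  have d1: "d1 n m \<in> linear_maps K (C n) (C n)" for n m using bi by (simp add: is_bicomplex_def)
  have d2: "d2 (Suc n) m \<in> linear_maps K (C (Suc n)) (C n)" for n m using bi by (simp add: is_bicomplex_def)
  have Fl: "F n m \<in> linear_maps K (C n) (C' n)" for n m using F by (simp add: is_bicomplex_map_def)
  show ?thesis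
    unfolding is_chain_map_def
  proof (intro conjI allI ballI)
    fix r
    show "tot_map F r \<in> linear_maps K (tot C r) (tot C' r)"
      unfolding tot_def tot_map_def
    proof (rule linear_into_direct_sum)
      show "module K (direct_sum {..r} C)" using tot_module[OF bi] by (simp add: tot_def)
      show "(\<lambda>v. (\<lambda>n\<in>{..r}. F n (r - n) (v n)) n) \<in> linear_maps K (direct_sum {..r} C) (C' n)" if "n \<in> {..r}" for n
        using that linear_at_component[of n "{..r}" "F n (r - n)" K C "C' n"] Fl by simp
    qed simp
  next
    fix r v assume v: "v \<in> carrier (tot C (Suc r))"
    then have vc: "v n \<in> carrier (C n)" if "n \<le> Suc r" for n using that by (auto simp: tot_def)
    show "tot_map F r (tot_diff C d1 d2 (Suc r) v) = tot_diff C' d1' d2' (Suc r) (tot_map F (Suc r) v)"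
    proof
      fix n
      show "tot_map F r (tot_diff C d1 d2 (Suc r) v) n = tot_diff C' d1' d2' (Suc r) (tot_map F (Suc r) v) n"
        using vc[of n] vc[of "Suc n"] F lin_closed[OF d1] lin_closed[OF d2]
        by (auto simp: tot_map_def tot_diff_def lin_add[OF Fl] Suc_diff_le is_bicomplex_map_def)
    qed
  qed
qed

text \<open>A homotopy \<open>H\<close> raises the first degree; it anticommutes with \<open>d1\<close> and bounds the difference
  of two bicomplex maps with respect to \<open>d2\<close>.\<close>

definition is_bicomplex_homotopy where
  "is_bicomplex_homotopy K C d1 d2 C' d1' d2' F G H \<longleftrightarrow>
     (\<forall>n m. H n m \<in> linear_maps K (C n) (C' (Suc n))) \<and>
     (\<forall>n m. \<forall>x \<in> carrier (C n).
        d1' (Suc n) (Suc m) (H n (Suc m) x) \<oplus>\<^bsub>C' (Suc n)\<^esub> H n m (d1 n (Suc m) x) = \<zero>\<^bsub>C' (Suc n)\<^esub>) \<and>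
     (\<forall>m. \<forall>x \<in> carrier (C 0). d2' (Suc 0) m (H 0 m x) = F 0 m x \<ominus>\<^bsub>C' 0\<^esub> G 0 m x) \<and>
     (\<forall>n m. \<forall>x \<in> carrier (C (Suc n)).
        d2' (Suc (Suc n)) m (H (Suc n) m x) \<oplus>\<^bsub>C' (Suc n)\<^esub> H n m (d2 (Suc n) m x) =
        F (Suc n) m x \<ominus>\<^bsub>C' (Suc n)\<^esub> G (Suc n) m x)"

text \<open>The homotopy formula on a cycle: the terms \<open>p\<close> and \<open>q\<close>, in which the homotopy is applied to the two parts
of the differential of the cycle, cancel each other.\<close>

lemma (in abelian_group) homotopy_cancel:
  assumes "a \<in> carrier G" "b \<in> carrier G" "p \<in> carrier G" "q \<in> carrier G" "y \<in> carrier G"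
    and "a \<oplus> p = \<zero>" "b \<oplus> q = y" "p \<oplus> q = \<zero>"
  shows "a \<oplus> b = y"
proof -
  have "a \<oplus> b = (a \<oplus> b) \<oplus> (p \<oplus> q)" using assms by simp
  also have "\<dots> = (a \<oplus> p) \<oplus> (b \<oplus> q)" using assms(1-5) by (simp add: a_ac)
  finally show ?thesis using assms by simp
qed

lemma tot_homotopy:
  assumes bi: "is_bicomplex K C d1 d2" and bi': "is_bicomplex K C' d1' d2'"
    and F: "is_bicomplex_map K C d1 d2 C' d1' d2' F" and G: "is_bicomplex_map K C d1 d2 C' d1' d2' G"
    and H: "is_bicomplex_homotopy K C d1 d2 C' d1' d2' F G H"
    and z: "z \<in> cycles (tot C) (tot_diff C d1 d2) r"
  shows "tot_map F r z \<ominus>\<^bsub>tot C' r\<^esub> tot_map G r z \<in> boundaries (tot C') (tot_diff C' d1' d2') r"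
proof -
  have M: "module K (C n)" for n using bi by (simp add: is_bicomplex_def)
  have M': "module K (C' n)" for n using bi' by (simp add: is_bicomplex_def)
  have d1: "d1 n m \<in> linear_maps K (C n) (C n)" for n m using bi by (simp add: is_bicomplex_def)
  have d2: "d2 (Suc n) m \<in> linear_maps K (C (Suc n)) (C n)" for n m using bi by (simp add: is_bicomplex_def)
  have d1': "d1' n m \<in> linear_maps K (C' n) (C' n)" for n m using bi' by (simp add: is_bicomplex_def)
  have d2': "d2' (Suc n) m \<in> linear_maps K (C' (Suc n)) (C' n)" for n m using bi' by (simp add: is_bicomplex_def)
  have Hl: "H n m \<in> linear_maps K (C n) (C' (Suc n))" for n m using H by (simp add: is_bicomplex_homotopy_def)
  have Fl: "F n m \<in> linear_maps K (C n) (C' n)" "G n m \<in> linear_maps K (C n) (C' n)" for n m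
    using F G by (auto simp: is_bicomplex_map_def)
  have zc: "z n \<in> carrier (C n)" if "n \<le> r" for n using z that by (auto simp: cycles_def tot_def)
  define h where "h = (\<lambda>n \<in> {..Suc r}. if n = 0 then \<zero>\<^bsub>C' 0\<^esub> else H (n - 1) (Suc r - n) (z (n - 1)))"
  have hc: "h \<in> carrier (tot C' (Suc r))"
  proof -
    have "h n \<in> carrier (C' n)" if "n \<le> Suc r" for n
    proof (cases n)
      case 0
      then show ?thesis using module_abelian_group[OF M'[of 0]] by (simp add: h_def abelian_groupE)
    next
      case (Suc k)
      then show ?thesis using that lin_closed[OF Hl zc[of k]] by (simp add: h_def)
    qed
    then show ?thesis by (auto simp: tot_def h_def PiE_iff)
  qed
  have Fc: "tot_map F r z \<in> carrier (tot C' r)" "tot_map G r z \<in> carrier (tot C' r)"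
    using zc by (auto simp: tot_def tot_map_def lin_closed[OF Fl(1)] lin_closed[OF Fl(2)])
  have comp: "tot_diff C' d1' d2' (Suc r) h n = (tot_map F r z \<ominus>\<^bsub>tot C' r\<^esub> tot_map G r z) n"
    if n: "n \<le> r" for n
  proof -
    interpret C': module K "C' n" by (rule M')
    have rhs: "(tot_map F r z \<ominus>\<^bsub>tot C' r\<^esub> tot_map G r z) n = F n (r - n) (z n) \<ominus>\<^bsub>C' n\<^esub> G n (r - n) (z n)"
      using n Fc direct_sum_minus[of K "{..r}" C'] tot_module[OF bi', of r] M'
      by (simp add: tot_def tot_map_def)
    have lhs: "tot_diff C' d1' d2' (Suc r) h n =
        d1' n (Suc r - n) (h n) \<oplus>\<^bsub>C' n\<^esub> d2' (Suc n) (r - n) (H n (r - n) (z n))"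
      using n by (simp add: tot_diff_def h_def)
    show ?thesis
    proof (cases n)
      case 0
      have "d1' 0 (Suc r) \<zero>\<^bsub>C' 0\<^esub> = \<zero>\<^bsub>C' 0\<^esub>" by (rule lin_zero[OF M' M' d1'])
      then show ?thesis
        unfolding lhs rhs
        using 0 H zc[of 0] lin_closed[OF Fl(1)] lin_closed[OF Fl(2)] C'.M.minus_closed C'.M.l_zero
        by (simp add: h_def is_bicomplex_homotopy_def)
    next
      case (Suc k)
      define m where "m = r - n"
      have m: "r - k = Suc m" "Suc r - n = Suc m" using Suc n by (auto simp: m_def)
      have c: "z k \<in> carrier (C k)" "z (Suc k) \<in> carrier (C (Suc k))" using zc n Suc by auto
      have "tot_diff C d1 d2 r z = \<zero>\<^bsub>tot C (r - 1)\<^esub>"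
        using z n Suc by (auto simp: cycles_def)
      moreover have "k \<le> r - 1" using n Suc by simp
      ultimately have "tot_diff C d1 d2 r z k = \<zero>\<^bsub>C k\<^esub>" by (simp add: tot_def)
      then have "d1 k (Suc m) (z k) \<oplus>\<^bsub>C k\<^esub> d2 (Suc k) m (z (Suc k)) = \<zero>\<^bsub>C k\<^esub>"
        using n Suc m \<open>k \<le> r - 1\<close> by (simp add: tot_diff_def m_def)
      then have pq: "H k m (d1 k (Suc m) (z k)) \<oplus>\<^bsub>C' n\<^esub> H k m (d2 (Suc k) m (z (Suc k))) = \<zero>\<^bsub>C' n\<^esub>"
        using lin_zero[OF M M' Hl, of k m] c Suc
        by (simp add: lin_closed[OF d1] lin_closed[OF d2] flip: lin_add[OF Hl])
      have hn: "h n = H k (Suc m) (z k)" using Suc n m by (simp add: h_def m_def Suc_diff_le)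
      note pq
      moreover have "d1' (Suc k) (Suc m) (H k (Suc m) (z k)) \<oplus>\<^bsub>C' n\<^esub> H k m (d1 k (Suc m) (z k)) = \<zero>\<^bsub>C' n\<^esub>"
        "d2' (Suc (Suc k)) m (H (Suc k) m (z (Suc k))) \<oplus>\<^bsub>C' n\<^esub> H k m (d2 (Suc k) m (z (Suc k))) =
          F (Suc k) m (z (Suc k)) \<ominus>\<^bsub>C' n\<^esub> G (Suc k) m (z (Suc k))"
        using H c unfolding is_bicomplex_homotopy_def Suc by blast+
      moreover have "d1' (Suc k) (Suc m) (H k (Suc m) (z k)) \<in> carrier (C' n)"
        "H k m (d1 k (Suc m) (z k)) \<in> carrier (C' n)"
        unfolding Suc by (rule lin_closed[OF d1' lin_closed[OF Hl c(1)]], rule lin_closed[OF Hl lin_closed[OF d1 c(1)]])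
      moreover have "d2' (Suc (Suc k)) m (H (Suc k) m (z (Suc k))) \<in> carrier (C' n)"
        "H k m (d2 (Suc k) m (z (Suc k))) \<in> carrier (C' n)"
        unfolding Suc by (rule lin_closed[OF d2' lin_closed[OF Hl c(2)]], rule lin_closed[OF Hl lin_closed[OF d2 c(2)]])
      moreover have "F (Suc k) m (z (Suc k)) \<ominus>\<^bsub>C' n\<^esub> G (Suc k) m (z (Suc k)) \<in> carrier (C' n)"
        unfolding Suc using c(2) C'.M.minus_closed lin_closed[OF Fl(1)] lin_closed[OF Fl(2)] Suc by simp
      ultimately have "d1' (Suc k) (Suc m) (H k (Suc m) (z k)) \<oplus>\<^bsub>C' n\<^esub>
          d2' (Suc (Suc k)) m (H (Suc k) m (z (Suc k))) = F (Suc k) m (z (Suc k)) \<ominus>\<^bsub>C' n\<^esub> G (Suc k) m (z (Suc k))"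
        by - (rule C'.M.homotopy_cancel[where p = "H k m (d1 k (Suc m) (z k))" and q = "H k m (d2 (Suc k) m (z (Suc k)))"]; assumption)
      then show ?thesis
        unfolding lhs rhs m m_def[symmetric] hn using Suc by simp
    qed
  qed
  have "tot_diff C' d1' d2' (Suc r) h = tot_map F r z \<ominus>\<^bsub>tot C' r\<^esub> tot_map G r z"
  proof (rule extensionalityI[of _ "{..r}"])
    show "tot_diff C' d1' d2' (Suc r) h \<in> extensional {..r}" by (simp add: tot_diff_def)
    have "tot_map F r z \<ominus>\<^bsub>tot C' r\<^esub> tot_map G r z \<in> carrier (tot C' r)"
      using Fc abelian_group.minus_closed[OF module_abelian_group[OF tot_module[OF bi']]] by blast
    then show "tot_map F r z \<ominus>\<^bsub>tot C' r\<^esub> tot_map G r z \<in> extensional {..r}" by (auto simp: tot_def PiE_iff)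
  qed (use comp in auto)
  then show ?thesis using hc by (auto simp: boundaries_def intro: image_eqI[of _ _ h])
qed

section \<open>Families of maps indexed by finite sets\<close>

text \<open>The sets \<open>S\<close> that index a component starting in simplicial degree \<open>n\<close>. The full set \<open>{..n}\<close> is excluded,
since that component would end in degree \<open>-1\<close>.\<close>

definition adm :: "nat \<Rightarrow> nat set \<Rightarrow> bool" where
  "adm n S \<longleftrightarrow> S \<subseteq> {..n} \<and> card S \<le> n"

text \<open>The second index \<open>p\<close> is the total degree. With it the degree of the target is \<open>p + b\<close> for every \<open>S\<close>:
\<open>\<partial>\<close>, morphisms and homotopies are the families with \<open>b = -1, 0, 1\<close>.\<close>

definition is_family ::
  "('k, 'r) ring_scheme \<Rightarrow> (nat \<Rightarrow> int \<Rightarrow> ('k, 'a) module) \<Rightarrow> (nat \<Rightarrow> int \<Rightarrow> ('k, 'b) module) \<Rightarrow> int \<Rightarrow>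
   (nat set \<Rightarrow> nat \<Rightarrow> int \<Rightarrow> 'a \<Rightarrow> 'b) \<Rightarrow> bool" where
  "is_family K U V b \<phi> \<longleftrightarrow>
     (\<forall>n p S. adm n S \<longrightarrow> \<phi> S n p \<in> linear_maps K (U n p) (V (n - card S) (p + b)))"

text \<open>Here \<open>\<psi>\<close> has degree \<open>b\<close> and the convolution has degree \<open>c\<close>. The degrees are arguments because they cannot
be read off from functions that are total in \<open>p\<close>.\<close>

definition conv ::
  "(nat \<Rightarrow> int \<Rightarrow> ('k, 'c) module) \<Rightarrow> int \<Rightarrow> int \<Rightarrow> (nat set \<Rightarrow> nat \<Rightarrow> int \<Rightarrow> 'b \<Rightarrow> 'c) \<Rightarrow>
   (nat set \<Rightarrow> nat \<Rightarrow> int \<Rightarrow> 'a \<Rightarrow> 'b) \<Rightarrow> nat set \<Rightarrow> nat \<Rightarrow> int \<Rightarrow> 'a \<Rightarrow> 'c" where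
  "conv W b c \<phi> \<psi> S n p x =
     (\<Oplus>\<^bsub>W (n - card S) (p + c)\<^esub>B \<in> Pow S. \<phi> (hatn B ` (S - B)) (n - card B) (p + b) (\<psi> B n p x))"

lemma adm_finite: "adm n S \<Longrightarrow> finite S"
  by (auto simp: adm_def intro: finite_subset)

lemma adm_subset: "adm n S \<Longrightarrow> B \<subseteq> S \<Longrightarrow> adm n B"
  using adm_finite[of n S] card_mono[of S B] by (auto simp: adm_def)

lemma adm_rest:
  assumes "adm n S" "B \<subseteq> S"
  shows "adm (n - card B) (hatn B ` (S - B))" "card (hatn B ` (S - B)) = card S - card B"
    "n - card B - card (hatn B ` (S - B)) = n - card S"
proof -
  have fin: "finite S" "finite B" using adm_finite[OF assms(1)] assms(2) finite_subset by auto
  show c: "card (hatn B ` (S - B)) = card S - card B"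
    using assms fin by (subst card_hatn_image) (auto simp: card_Diff_subset)
  have le: "card B \<le> card S" "card S \<le> n" using assms fin by (auto simp: adm_def card_mono)
  have "hatn B ` (S - B) \<subseteq> {..<Suc n - card B}"
    using assms by (intro hatn_image_subset) (auto simp: adm_def)
  then show "adm (n - card B) (hatn B ` (S - B))"
    using le c by (auto simp: adm_def Suc_diff_le)
  show "n - card B - card (hatn B ` (S - B)) = n - card S" using c le by simp
qed

lemma family_lin:
  "is_family K U V b \<phi> \<Longrightarrow> adm n S \<Longrightarrow> m = n - card S \<Longrightarrow> p' = p + b \<Longrightarrow>
     \<phi> S n p \<in> linear_maps K (U n p) (V m p')"
  by (auto simp: is_family_def)

lemma conv_term_linear:
  assumes "is_family K U V b \<psi>" "is_family K V W a \<phi>" "c = a + b" "adm n S" "B \<subseteq> S"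
  shows "(\<lambda>x. \<phi> (hatn B ` (S - B)) (n - card B) (p + b) (\<psi> B n p x)) \<in>
    linear_maps K (U n p) (W (n - card S) (p + c))"
  using assms adm_rest[OF assms(4,5)] adm_subset[OF assms(4,5)]
  by (intro lin_comp[OF family_lin[OF assms(1)] family_lin[OF assms(2)]]) auto

lemma conv_family:
  assumes "is_family K U V b \<psi>" "is_family K V W a \<phi>" "c = a + b"
    and U: "\<And>n p. module K (U n p)" and W: "\<And>n p. module K (W n p)"
  shows "is_family K U W c (conv W b c \<phi> \<psi>)"
  unfolding is_family_def conv_def
  by (intro allI impI lin_finsum_maps U W conv_term_linear[OF assms(1-3)]) auto

lemma conv_cong:
  assumes "\<And>n p. module K (W n p)" "adm n S" "x \<in> carrier (U n p)"
    and \<psi>: "\<And>B. B \<subseteq> S \<Longrightarrow> \<psi> B n p x = \<psi>' B n p x"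
    and \<phi>: "\<And>B y. B \<subseteq> S \<Longrightarrow> y \<in> carrier (V (n - card B) (p + b)) \<Longrightarrow>
      \<phi> (hatn B ` (S - B)) (n - card B) (p + b) y = \<phi>' (hatn B ` (S - B)) (n - card B) (p + b) y"
    and fam: "is_family K U V b \<psi>'" "is_family K V W a \<phi>'" "c = a + b"
  shows "conv W b c \<phi> \<psi> S n p x = conv W b c \<phi>' \<psi>' S n p x"
proof -
  interpret W: module K "W (n - card S) (p + c)" by (rule assms(1))
  have "\<psi>' B n p x \<in> carrier (V (n - card B) (p + b))" if "B \<subseteq> S" for B
    using lin_closed[OF family_lin[OF fam(1) adm_subset[OF assms(2) that] refl refl] assms(3)] .
  then show ?thesis
    unfolding conv_def
    using assms(3) \<psi> \<phi> lin_closed[OF conv_term_linear[OF fam assms(2)]]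
    by (intro W.M.finsum_cong') auto
qed

text \<open>Both sides are the sum over chains \<open>C \<subseteq> D \<subseteq> S\<close> of the composite whose three factors are indexed by the
renumbered sets \<open>S - D\<close>, \<open>D - C\<close> and \<open>C\<close>.\<close>

lemma conv_assoc:
  assumes fam: "is_family K U V r \<chi>" "is_family K V W s \<psi>" "is_family K W Z t \<phi>"
    and deg: "u = r + s" "v = s + t" "w = r + s + t"
    and mods: "\<And>n p. module K (U n p)" "\<And>n p. module K (V n p)" "\<And>n p. module K (W n p)" "\<And>n p. module K (Z n p)"
    and S: "adm n S" and x: "x \<in> carrier (U n p)"
  shows "conv Z u w \<phi> (conv W r u \<psi> \<chi>) S n p x = conv Z r w (conv Z s v \<phi> \<psi>) \<chi> S n p x"
proof -
  interpret Z: module K "Z (n - card S) (p + w)" by (rule mods)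
  have fS: "finite S" using S by (rule adm_finite)
  define T where "T C D = \<phi> (hatn D ` (S - D)) (n - card D) (p + u)
      (\<psi> (hatn C ` (D - C)) (n - card C) (p + r) (\<chi> C n p x))" for C D
  have inner: "(\<psi> (hatn C ` (D - C)) (n - card C) (p + r) (\<chi> C n p x)) \<in> carrier (W (n - card D) (p + u))"
    if "C \<subseteq> D" "D \<subseteq> S" for C D
    using lin_closed[OF conv_term_linear[OF fam(1,2) _ adm_subset[OF S that(2)] that(1)] x, of u] deg by simp
  have outer: "\<phi> (hatn D ` (S - D)) (n - card D) (p + u) \<in>
      linear_maps K (W (n - card D) (p + u)) (Z (n - card S) (p + w))" if "D \<subseteq> S" for D
    using adm_rest[OF S that] deg by (intro family_lin[OF fam(3)]) auto
  have Tc: "T C D \<in> carrier (Z (n - card S) (p + w))" if "C \<subseteq> D" "D \<subseteq> S" for C D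
    unfolding T_def using lin_closed[OF outer[OF that(2)] inner[OF that]] .
  have "conv Z u w \<phi> (conv W r u \<psi> \<chi>) S n p x =
      (\<Oplus>\<^bsub>Z (n - card S) (p + w)\<^esub>D \<in> Pow S. \<Oplus>\<^bsub>Z (n - card S) (p + w)\<^esub>C \<in> Pow D. T C D)"
    unfolding conv_def[of Z u w] conv_def[of W r u] T_def
  proof (rule Z.M.finsum_cong')
    fix D assume D: "D \<in> Pow S"
    show "\<phi> (hatn D ` (S - D)) (n - card D) (p + u)
        (\<Oplus>\<^bsub>W (n - card D) (p + u)\<^esub>B\<in>Pow D. \<psi> (hatn B ` (D - B)) (n - card B) (p + r) (\<chi> B n p x)) =
      (\<Oplus>\<^bsub>Z (n - card S) (p + w)\<^esub>C\<in>Pow D. \<phi> (hatn D ` (S - D)) (n - card D) (p + u)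
          (\<psi> (hatn C ` (D - C)) (n - card C) (p + r) (\<chi> C n p x)))"
      using D inner by (intro lin_finsum[OF mods(3) mods(4) outer]) auto
  qed (use Tc in \<open>auto simp: T_def intro!: Z.M.finsum_closed\<close>)
  also have "\<dots> = finsum (Z (n - card S) (p + w)) (\<lambda>(D, C). T C D) (Sigma (Pow S) Pow)"
    using fS Tc by (intro Z.M.finsum_Sigma) (auto intro: finite_subset)
  also have "\<dots> = finsum (Z (n - card S) (p + w)) (\<lambda>(C, D). T C D) (Sigma (Pow S) (\<lambda>C. {D. C \<subseteq> D \<and> D \<subseteq> S}))"
    using Tc
    by (intro Z.M.finsum_bij[where h = "\<lambda>(D, C). (C, D)"])
       (auto simp: bij_betw_def inj_on_def image_iff)
  also have "\<dots> = (\<Oplus>\<^bsub>Z (n - card S) (p + w)\<^esub>C \<in> Pow S. finsum (Z (n - card S) (p + w)) (T C) {D. C \<subseteq> D \<and> D \<subseteq> S})"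
    using fS Tc by (intro Z.M.finsum_Sigma[symmetric]) (auto intro: finite_subset[of _ "Pow S"])
  also have "\<dots> = conv Z r w (conv Z s v \<phi> \<psi>) \<chi> S n p x"
    unfolding conv_def[of Z r w]
  proof (rule Z.M.finsum_cong')
    fix C assume C: "C \<in> Pow S"
    let ?S' = "hatn C ` (S - C)"
    have fC: "finite C" using C fS finite_subset by auto
    have inj: "inj_on (hatn C) (S - C)" by (rule inj_on_hatn) auto
    have idx: "n - card C - card ?S' = n - card S" "p + r + v = p + w"
      using adm_rest[OF S] C deg by auto
    have D: "T C D = \<phi> (hatn (hatn C ` (D - C)) ` (?S' - hatn C ` (D - C))) (n - card C - card (hatn C ` (D - C)))
        (p + r + s) (\<psi> (hatn C ` (D - C)) (n - card C) (p + r) (\<chi> C n p x))"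
      if "C \<subseteq> D" "D \<subseteq> S" for D
    proof -
      have "?S' - hatn C ` (D - C) = hatn C ` (S - D)"
        using inj that by (auto simp: inj_on_def)
      moreover have "hatn (hatn C ` (D - C)) ` hatn C ` (S - D) = hatn D ` (S - D)"
        unfolding image_image
      proof (rule image_cong[OF refl])
        fix a assume "a \<in> S - D"
        then have "hatn (hatn C ` (D - C)) (hatn C a) = hatn ((D - C) \<union> C) a"
          using that by (intro hatn_hatn) auto
        then show "hatn (hatn C ` (D - C)) (hatn C a) = hatn D a" using that by (simp add: Un_absorb2)
      qed
      moreover have "n - card C - card (hatn C ` (D - C)) = n - card D"
        using adm_rest[OF adm_subset[OF S that(2)] that(1)] by simp
      ultimately show ?thesis using deg by (simp add: T_def add.assoc)
    qed
    have "bij_betw (\<lambda>D. hatn C ` (D - C)) {D. C \<subseteq> D \<and> D \<subseteq> S} (Pow ?S')"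
      unfolding bij_betw_def
    proof
      show "inj_on (\<lambda>D. hatn C ` (D - C)) {D. C \<subseteq> D \<and> D \<subseteq> S}"
      proof (rule inj_onI)
        fix D D' assume h: "D \<in> {D. C \<subseteq> D \<and> D \<subseteq> S}" "D' \<in> {D. C \<subseteq> D \<and> D \<subseteq> S}" "hatn C ` (D - C) = hatn C ` (D' - C)"
        then have "D - C \<subseteq> S - C" "D' - C \<subseteq> S - C" by auto
        then have "D - C = D' - C" using inj_on_image_eq_iff[OF inj] h(3) by metis
        then show "D = D'" using h by auto
      qed
      show "(\<lambda>D. hatn C ` (D - C)) ` {D. C \<subseteq> D \<and> D \<subseteq> S} = Pow ?S'"
      proof (intro equalityI subsetI)
        fix E assume "E \<in> Pow ?S'"
        then obtain A where "A \<subseteq> S - C" "E = hatn C ` A" by (auto simp: subset_image_iff)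
        then show "E \<in> (\<lambda>D. hatn C ` (D - C)) ` {D. C \<subseteq> D \<and> D \<subseteq> S}"
          using C by (intro image_eqI[of _ _ "A \<union> C"]) (auto intro!: arg_cong[where f = "image (hatn C)"])
      qed auto
    qed
    then show "finsum (Z (n - card S) (p + w)) (T C) {D. C \<subseteq> D \<and> D \<subseteq> S} =
        conv Z s v \<phi> \<psi> ?S' (n - card C) (p + r) (\<chi> C n p x)"
      unfolding conv_def[of Z s v] idx
    proof (rule Z.M.finsum_bij)
      fix D assume D': "D \<in> {D. C \<subseteq> D \<and> D \<subseteq> S}"
      then show "T C D \<in> carrier (Z (n - card S) (p + w))" using Tc by auto
      show "\<phi> (hatn (hatn C ` (D - C)) ` (?S' - hatn C ` (D - C))) (n - card C - card (hatn C ` (D - C)))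
          (p + r + s) (\<psi> (hatn C ` (D - C)) (n - card C) (p + r) (\<chi> C n p x)) = T C D"
        using D D' by simp
    qed
  next
    show "(\<lambda>C. conv Z s v \<phi> \<psi> (hatn C ` (S - C)) (n - card C) (p + r) (\<chi> C n p x)) \<in> Pow S \<rightarrow> carrier (Z (n - card S) (p + w))"
    proof
      fix C assume "C \<in> Pow S"
      moreover have "is_family K V Z v (conv Z s v \<phi> \<psi>)"
        using conv_family[OF fam(2,3) _ mods(2,4), of v] deg by simp
      ultimately show "conv Z s v \<phi> \<psi> (hatn C ` (S - C)) (n - card C) (p + r) (\<chi> C n p x) \<in>
          carrier (Z (n - card S) (p + w))"
        using lin_closed[OF conv_term_linear[OF fam(1) _ _ S, where c = w and B = C and a = v] x] deg by simp
    qed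
  qed simp
  finally show ?thesis .
qed

subsection \<open>Totalisation\<close>

text \<open>The components that contribute to the summand \<open>j\<close> from summands up to \<open>N\<close>. The
interval \<open>{..<k + 1 - q}\<close> is \<open>{0..k-q}\<close> with an integer upper bound, so it is empty for \<open>k = 0\<close>, \<open>q = 1\<close>.\<close>

definition bar_index :: "nat \<Rightarrow> nat \<Rightarrow> nat \<Rightarrow> (nat \<times> nat set) set" where
  "bar_index q N j = Sigma {j..N} (\<lambda>k. {S. S \<subseteq> {..<k + 1 - q} \<and> card S = k - j})"

text \<open>The component in the summand \<open>j\<close> of the totalisation. It is kept unrestricted in \<open>j\<close>, and with a
free bound \<open>N\<close>, so that iterated totalisations have a common bound although their sources have
different numbers of summands.\<close>

definition bar_comp ::
  "nat \<Rightarrow> (nat \<Rightarrow> int \<Rightarrow> ('k, 'b) module) \<Rightarrow> int \<Rightarrow> (nat set \<Rightarrow> nat \<Rightarrow> int \<Rightarrow> 'a \<Rightarrow> 'b) \<Rightarrow>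
   nat \<Rightarrow> int \<Rightarrow> (nat \<Rightarrow> 'a) \<Rightarrow> nat \<Rightarrow> 'b" where
  "bar_comp q V b \<phi> N p v j = finsum (V j (p + b)) (\<lambda>(k, S). \<phi> S k p (v k)) (bar_index q N j)"

lemma finite_bar_index [simp]: "finite (bar_index q N j)"
  unfolding bar_index_def
  by (intro finite_SigmaI finite_atLeastAtMost) (auto intro: finite_subset[OF _ finite_Pow_iff[THEN iffD2, OF finite_lessThan]])

lemma bar_index_adm: "(k, S) \<in> bar_index q N j \<Longrightarrow> adm k S \<and> k - card S = j \<and> j \<le> k \<and> k \<le> N"
  by (force simp: bar_index_def adm_def)

lemma bar_comp_term:
  assumes "is_family K U V b \<phi>" "(k, S) \<in> bar_index q N j"
  shows "\<phi> S k p \<in> linear_maps K (U k p) (V j (p + b))"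
  using family_lin[OF assms(1)] bar_index_adm[OF assms(2)] by auto

lemma bar_comp_closed:
  assumes "is_family K U V b \<phi>" "\<And>n p. module K (V n p)" "\<And>k. k \<le> N \<Longrightarrow> v k \<in> carrier (U k p)"
  shows "bar_comp q V b \<phi> N p v j \<in> carrier (V j (p + b))"
proof -
  interpret V: module K "V j (p + b)" by (rule assms(2))
  have "\<phi> S k p (v k) \<in> carrier (V j (p + b))" if "(k, S) \<in> bar_index q N j" for k S
    using lin_closed[OF bar_comp_term[OF assms(1) that]] assms(3) bar_index_adm[OF that] by auto
  then show ?thesis
    unfolding bar_comp_def by (intro V.M.finsum_closed) auto
qed

lemma bar_comp_cong:
  assumes "is_family K U V b \<phi>" "\<And>n p. module K (V n p)" "\<And>k. k \<le> N \<Longrightarrow> v k \<in> carrier (U k p)"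
    and "\<And>k S. adm k S \<Longrightarrow> k \<le> N \<Longrightarrow> \<phi>' S k p (v' k) = \<phi> S k p (v k)"
  shows "bar_comp q V b \<phi>' N p v' j = bar_comp q V b \<phi> N p v j"
proof -
  interpret V: module K "V j (p + b)" by (rule assms(2))
  have "\<phi> S k p (v k) \<in> carrier (V j (p + b))" "\<phi>' S k p (v' k) = \<phi> S k p (v k)" if "(k, S) \<in> bar_index q N j" for k S
    using lin_closed[OF bar_comp_term[OF assms(1) that]] assms(3,4) bar_index_adm[OF that] by auto
  then show ?thesis
    unfolding bar_comp_def by (intro V.M.finsum_cong') auto
qed

text \<open>Both uses concern a vector that vanishes beyond \<open>N\<close>: because the modules above the diagonal are zero, or
because no component reaches these summands.\<close>

lemma bar_comp_bound:
  assumes fam: "is_family K U V b \<phi>" and mods: "\<And>n p. module K (U n p)" "\<And>n p. module K (V n p)"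
    and v: "\<And>k. k \<le> N' \<Longrightarrow> v k \<in> carrier (U k p)"
    and zero: "\<And>k. N < k \<Longrightarrow> k \<le> N' \<Longrightarrow> v k = \<zero>\<^bsub>U k p\<^esub>" and le: "N \<le> N'"
  shows "bar_comp q V b \<phi> N' p v j = bar_comp q V b \<phi> N p v j"
proof -
  interpret V: module K "V j (p + b)" by (rule mods)
  have cl: "\<phi> S k p (v k) \<in> carrier (V j (p + b))" if "(k, S) \<in> bar_index q N' j" for k S
    using that bar_index_adm[OF that] lin_closed[OF bar_comp_term[OF fam that]] v by auto
  have "bar_index q N j \<subseteq> bar_index q N' j" using le by (auto simp: bar_index_def)
  moreover have "\<phi> S k p (v k) = \<zero>\<^bsub>V j (p + b)\<^esub>" if kS: "(k, S) \<in> bar_index q N' j - bar_index q N j" for k S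
  proof -
    have kS': "(k, S) \<in> bar_index q N' j" and "N < k" "k \<le> N'" using kS by (auto simp: bar_index_def)
    then have "v k = \<zero>\<^bsub>U k p\<^esub>" using zero[of k] by simp
    then show ?thesis using lin_zero[OF mods(1) mods(2) bar_comp_term[OF fam kS']] by simp
  qed
  ultimately show ?thesis
    unfolding bar_comp_def using cl
    by (intro V.M.finsum_neutral[symmetric]) auto
qed

text \<open>A set \<open>S \<subseteq> {0..k-q}\<close> with a subset \<open>B\<close> is the same as \<open>B \<subseteq> {0..k-q}\<close> together with a subset of
\<open>{0..l-q}\<close>, where \<open>l = k - card B\<close>, namely the renumbered \<open>S - B\<close>. So no term of either side is left over.\<close>

lemma bar_comp_conv:
  assumes fam: "is_family K U V r \<psi>" "is_family K V W s \<phi>" and c: "c = r + s"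
    and mods: "\<And>n p. module K (U n p)" "\<And>n p. module K (V n p)" "\<And>n p. module K (W n p)"
    and v: "\<And>k. k \<le> N \<Longrightarrow> v k \<in> carrier (U k p)"
  shows "bar_comp q W c (conv W r c \<phi> \<psi>) N p v j = bar_comp q W s \<phi> N (p + r) (bar_comp q V r \<psi> N p v) j"
proof -
  interpret W: module K "W j (p + c)" by (rule mods)
  have pc: "p + r + s = p + c" using c by simp
  define T where "T = (\<lambda>l A k B. \<phi> A l (p + r) (\<psi> B k p (v k)))"
  have Tin: "\<psi> B k p (v k) \<in> carrier (V l (p + r))" if "(k, B) \<in> bar_index q N l" for k B l
    using lin_closed[OF bar_comp_term[OF fam(1) that]] v bar_index_adm[OF that] by auto
  have Tout: "\<phi> A l (p + r) \<in> linear_maps K (V l (p + r)) (W j (p + c))" if "(l, A) \<in> bar_index q N j" for l A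
    using bar_comp_term[OF fam(2) that, of "p + r"] pc by simp
  have Tc: "T l A k B \<in> carrier (W j (p + c))" if "(l, A) \<in> bar_index q N j" "(k, B) \<in> bar_index q N l" for l A k B
    unfolding T_def using lin_closed[OF Tout[OF that(1)] Tin[OF that(2)]] .
  define h where "h = (\<lambda>((k::nat, S), B). ((k - card B, hatn B ` (S - B)), (k, B)))"
  have hin: "(k - card B, hatn B ` (S - B)) \<in> bar_index q N j" "(k, B) \<in> bar_index q N (k - card B)"
    if kS: "(k, S) \<in> bar_index q N j" and B: "B \<subseteq> S" for k S B
  proof -
    have a: "adm k S" "k - card S = j" "j \<le> k" "k \<le> N" using bar_index_adm[OF kS] by auto
    have S: "S \<subseteq> {..<k + 1 - q}" "card S = k - j" using kS by (auto simp: bar_index_def)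
    note r = adm_rest[OF a(1) B]
    have le: "card B \<le> card S" using B adm_finite[OF a(1)] by (simp add: card_mono)
    have "hatn B ` (S - B) \<subseteq> {..<k + 1 - q - card B}"
      using S B by (intro hatn_image_subset) auto
    moreover have "k + 1 - q - card B = k - card B + 1 - q" using le S by simp
    ultimately show "(k - card B, hatn B ` (S - B)) \<in> bar_index q N j"
      using r le S a by (auto simp: bar_index_def)
    show "(k, B) \<in> bar_index q N (k - card B)" using le S a B by (auto simp: bar_index_def)
  qed
  have bij: "bij_betw h (Sigma (bar_index q N j) (\<lambda>(k, S). Pow S)) (Sigma (bar_index q N j) (\<lambda>(l, A). bar_index q N l))"
    unfolding bij_betw_def
  proof
    show "inj_on h (Sigma (bar_index q N j) (\<lambda>(k, S). Pow S))"
    proof (rule inj_onI)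
      fix x y assume "x \<in> Sigma (bar_index q N j) (\<lambda>(k, S). Pow S)" "y \<in> Sigma (bar_index q N j) (\<lambda>(k, S). Pow S)" "h x = h y"
      then obtain k S B S' where xy: "x = ((k, S), B)" "y = ((k, S'), B)" "B \<subseteq> S" "B \<subseteq> S'"
        and eq: "hatn B ` (S - B) = hatn B ` (S' - B)"
        by (auto simp: h_def)
      have "inj_on (hatn B) (- B)" by (rule inj_on_hatn) auto
      then have "S - B = S' - B" using eq inj_on_image_eq_iff[of "hatn B" "- B" "S - B" "S' - B"] by auto
      then show "x = y" using xy by auto
    qed
    show "h ` Sigma (bar_index q N j) (\<lambda>(k, S). Pow S) = Sigma (bar_index q N j) (\<lambda>(l, A). bar_index q N l)"
    proof (intro equalityI subsetI)
      fix y assume "y \<in> h ` Sigma (bar_index q N j) (\<lambda>(k, S). Pow S)"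
      then show "y \<in> Sigma (bar_index q N j) (\<lambda>(l, A). bar_index q N l)" using hin by (auto simp: h_def)
    next
      fix y assume "y \<in> Sigma (bar_index q N j) (\<lambda>(l, A). bar_index q N l)"
      then obtain l A k B where y: "y = ((l, A), (k, B))" and lA: "(l, A) \<in> bar_index q N j" and kB: "(k, B) \<in> bar_index q N l"
        by auto
      have A: "A \<subseteq> {..<l + 1 - q}" "card A = l - j" "j \<le> l" using lA by (auto simp: bar_index_def)
      have B: "B \<subseteq> {..<k + 1 - q}" "card B = k - l" "l \<le> k" "k \<le> N" using kB by (auto simp: bar_index_def)
      have "A \<subseteq> hatn B ` ({..<k + 1 - q} - B)" using hatn_image[OF B(1)] A B by auto
      then obtain A' where A': "A' \<subseteq> {..<k + 1 - q} - B" "A = hatn B ` A'" by (auto simp: subset_image_iff)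
      have fin: "finite A'" "finite B" using A' B finite_subset by blast+
      have "card A' = card A" using A' by (subst A'(2), subst card_hatn_image) auto
      moreover have "card (A' \<union> B) = card A' + card B" using fin A' by (intro card_Un_disjoint) auto
      ultimately have "(k, A' \<union> B) \<in> bar_index q N j" using A A' B by (auto simp: bar_index_def)
      moreover have "A' \<union> B - B = A'" using A' by auto
      ultimately show "y \<in> h ` Sigma (bar_index q N j) (\<lambda>(k, S). Pow S)"
        using y A' B by (intro image_eqI[of _ _ "((k, A' \<union> B), B)"]) (auto simp: h_def)
    qed
  qed
  have fP: "finite (Pow S)" if "(k, S) \<in> bar_index q N j" for k S
    using bar_index_adm[OF that] adm_finite by auto
  have "bar_comp q W c (conv W r c \<phi> \<psi>) N p v j =
      finsum (W j (p + c)) (\<lambda>(k, S). finsum (W j (p + c)) (\<lambda>B. T (k - card B) (hatn B ` (S - B)) k B) (Pow S)) (bar_index q N j)"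
    unfolding bar_comp_def
  proof (rule W.M.finsum_cong')
    show "(\<lambda>(k, S). finsum (W j (p + c)) (\<lambda>B. T (k - card B) (hatn B ` (S - B)) k B) (Pow S)) \<in> bar_index q N j \<rightarrow> carrier (W j (p + c))"
      using Tc[OF hin] by (auto intro!: W.M.finsum_closed)
    show "(case i of (k, S) \<Rightarrow> conv W r c \<phi> \<psi> S k p (v k)) =
      (case i of (k, S) \<Rightarrow> finsum (W j (p + c)) (\<lambda>B. T (k - card B) (hatn B ` (S - B)) k B) (Pow S))" if "i \<in> bar_index q N j" for i
      using that bar_index_adm[of "fst i" "snd i"] by (auto simp: conv_def T_def split: prod.splits)
  qed simp
  also have "\<dots> = finsum (W j (p + c)) (\<lambda>((k, S), B). T (k - card B) (hatn B ` (S - B)) k B) (Sigma (bar_index q N j) (\<lambda>(k, S). Pow S))"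
    using Tc[OF hin] fP
    by (subst W.M.finsum_Sigma[symmetric]) (auto simp: case_prod_unfold)
  also have "\<dots> = finsum (W j (p + c)) (\<lambda>((l, A), (k, B)). T l A k B) (Sigma (bar_index q N j) (\<lambda>(l, A). bar_index q N l))"
    using Tc[OF hin] by (intro W.M.finsum_bij[OF bij]) (auto simp: h_def)
  also have "\<dots> = finsum (W j (p + c)) (\<lambda>(l, A). finsum (W j (p + c)) (\<lambda>(k, B). T l A k B) (bar_index q N l)) (bar_index q N j)"
    using Tc by (subst W.M.finsum_Sigma[symmetric]) (auto simp: case_prod_unfold)
  also have "\<dots> = bar_comp q W s \<phi> N (p + r) (bar_comp q V r \<psi> N p v) j"
    unfolding bar_comp_def pc
  proof (rule W.M.finsum_cong')
    fix i assume i: "i \<in> bar_index q N j"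
    obtain l A where lA: "i = (l, A)" by (cases i)
    have "\<phi> A l (p + r) (finsum (V l (p + r)) (\<lambda>(k, B). \<psi> B k p (v k)) (bar_index q N l)) =
        finsum (W j (p + c)) (\<lambda>y. \<phi> A l (p + r) (case y of (k, B) \<Rightarrow> \<psi> B k p (v k))) (bar_index q N l)"
      using i lA Tin by (intro lin_finsum[OF mods(2,3) Tout]) auto
    then show "(case i of (l, A) \<Rightarrow> finsum (W j (p + c)) (\<lambda>(k, B). T l A k B) (bar_index q N l)) =
      (case i of (l, A) \<Rightarrow> \<phi> A l (p + r) (finsum (V l (p + r)) (\<lambda>(k, B). \<psi> B k p (v k)) (bar_index q N l)))"
      using lA by (simp add: T_def case_prod_unfold)
  next
    show "(\<lambda>(l, A). \<phi> A l (p + r) (finsum (V l (p + r)) (\<lambda>(k, B). \<psi> B k p (v k)) (bar_index q N l))) \<in> bar_index q N j \<rightarrow> carrier (W j (p + c))"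
    proof clarify
      fix l A assume lA: "(l, A) \<in> bar_index q N j"
      interpret V: module K "V l (p + r)" by (rule mods)
      have "finsum (V l (p + r)) (\<lambda>(k, B). \<psi> B k p (v k)) (bar_index q N l) \<in> carrier (V l (p + r))"
        using Tin by (intro V.M.finsum_closed) auto
      then show "\<phi> A l (p + r) (finsum (V l (p + r)) (\<lambda>(k, B). \<psi> B k p (v k)) (bar_index q N l)) \<in> carrier (W j (p + c))"
        by (rule lin_closed[OF Tout[OF lA]])
    qed
  qed simp
  finally show ?thesis .
qed

section \<open>Cyclic operators\<close>

text \<open>The cyclic rotation \<open>i \<mapsto> i - 1\<close> modulo \<open>n + 1\<close>.\<close>

definition rot :: "nat \<Rightarrow> nat \<Rightarrow> nat" where
  "rot n i = (if i = 0 then n else i - 1)"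

lemma rot_le [simp]: "i \<le> n \<Longrightarrow> rot n i \<le> n"
  by (auto simp: rot_def)

lemma inj_on_rot: "S \<subseteq> {..n} \<Longrightarrow> inj_on (rot n) S"
  by (auto simp: inj_on_def rot_def split: if_splits)

lemma card_rot: "S \<subseteq> {..n} \<Longrightarrow> card (rot n ` S) = card S"
  by (intro card_image inj_on_rot)

lemma adm_rot: "adm n S \<Longrightarrow> adm n (rot n ` S) \<and> card (rot n ` S) = card S"
  by (auto simp: adm_def card_rot)

lemma hatn_eq_0_iff: "0 \<notin> B \<Longrightarrow> hatn B a = 0 \<longleftrightarrow> a = 0"
proof -
  assume "0 \<notin> B"
  then have "B \<inter> {..<a} \<subseteq> {1..<a}" by (auto simp: Suc_le_eq intro: gr0I)
  then have "card (B \<inter> {..<a}) \<le> a - 1" using card_mono[of "{1..<a}"] by fastforce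
  then show ?thesis by (auto simp: hatn_def)
qed

text \<open>Deleting and rotating commute up to a rotation of the remaining word, which is absent exactly when
the letter \<open>0\<close>, the one that moves to the end, is among the deleted ones.\<close>

lemma hatn_rot:
  assumes B: "B \<subseteq> {..n}" and a: "a \<le> n" "a \<notin> B"
  shows "hatn (rot n ` B) (rot n a) = (if 0 \<in> B then hatn B a else rot (n - card B) (hatn B a))"
proof (cases "a = 0")
  case True
  then have "0 \<notin> B" using a by simp
  have "rot n ` B \<subseteq> {..<n}"
  proof
    fix y assume "y \<in> rot n ` B"
    then obtain b where "b \<in> B" "y = rot n b" by auto
    then show "y \<in> {..<n}" using \<open>0 \<notin> B\<close> B by (cases b) (auto simp: rot_def)
  qed
  then have "rot n ` B \<inter> {..<n} = rot n ` B" by auto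
  then show ?thesis using True \<open>0 \<notin> B\<close> B by (simp add: hatn_def rot_def[of _ 0] card_rot)
next
  case False
  have eq: "rot n ` B \<inter> {..<a - 1} = (\<lambda>b. b - 1) ` (B \<inter> {0<..<a})"
  proof (intro equalityI subsetI)
    fix y assume "y \<in> rot n ` B \<inter> {..<a - 1}"
    then obtain b where b: "b \<in> B" "y = rot n b" "rot n b < a - 1" by auto
    then have "b \<noteq> 0" "b < a" using a by (auto simp: rot_def split: if_splits)
    then show "y \<in> (\<lambda>b. b - 1) ` (B \<inter> {0<..<a})" using b by (auto simp: rot_def)
  next
    fix y assume "y \<in> (\<lambda>b. b - 1) ` (B \<inter> {0<..<a})"
    then obtain b where "b \<in> B" "0 < b" "b < a" "y = b - 1" by auto
    then show "y \<in> rot n ` B \<inter> {..<a - 1}" by (auto simp: rot_def intro!: image_eqI[of _ _ b])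
  qed
  have c: "card (rot n ` B \<inter> {..<a - 1}) = card (B \<inter> {0<..<a})"
    unfolding eq by (intro card_image) (auto simp: inj_on_def)
  show ?thesis
  proof (cases "0 \<in> B")
    case True
    have "B \<inter> {..<a} = insert 0 (B \<inter> {0<..<a})" using True False by auto
    then have "card (B \<inter> {..<a}) = Suc (card (B \<inter> {0<..<a}))" by simp
    then show ?thesis using True False c by (simp add: hatn_def rot_def)
  next
    case F: False
    have "B \<inter> {..<a} = B \<inter> {0<..<a}" using F by (auto intro: gr0I)
    moreover have "hatn B a \<noteq> 0" using F False by (simp add: hatn_eq_0_iff)
    ultimately show ?thesis using F False c by (simp add: hatn_def rot_def)
  qed
qed

text \<open>The cyclic relations in terms of \<open>T = (-1)\<^sup>n t\<close> and of signed components: the sign \<open>(-1)\<^bsup>k-1\<^esup>\<close> is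
absorbed by the sign of \<open>T\<close> and the change of the index sum under rotation.\<close>

definition is_cyclic ::
  "(nat \<Rightarrow> int \<Rightarrow> ('k, 'a) module) \<Rightarrow> (nat \<Rightarrow> int \<Rightarrow> 'a \<Rightarrow> 'a) \<Rightarrow> (nat \<Rightarrow> int \<Rightarrow> 'b \<Rightarrow> 'b) \<Rightarrow> int \<Rightarrow>
   (nat set \<Rightarrow> nat \<Rightarrow> int \<Rightarrow> 'a \<Rightarrow> 'b) \<Rightarrow> bool" where
  "is_cyclic U T T' b \<phi> \<longleftrightarrow> (\<forall>n p S. \<forall>x \<in> carrier (U n p). adm n S \<longrightarrow>
     \<phi> S n p (T n p x) = (if 0 \<in> S then \<phi> (rot n ` S) n p x
                          else T' (n - card S) (p + b) (\<phi> (rot n ` S) n p x)))"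

text \<open>Compare term by term along \<open>B \<mapsto> rot B\<close>. Moving \<open>T\<close> through \<open>\<psi>\<^sub>B\<close> consumes it if \<open>0 \<in> B\<close>; otherwise it meets
the left factor, whose index set contains \<open>0\<close> if and only if \<open>S\<close> does.\<close>

lemma conv_cyclic:
  assumes fam: "is_family K U V r \<psi>" "is_family K V W s \<phi>" and c: "c = r + s"
    and mods: "\<And>n p. module K (U n p)" "\<And>n p. module K (V n p)" "\<And>n p. module K (W n p)"
    and T: "\<And>n p. T n p \<in> linear_maps K (U n p) (U n p)" "\<And>n p. T' n p \<in> linear_maps K (V n p) (V n p)"
      "\<And>n p. T'' n p \<in> linear_maps K (W n p) (W n p)"
    and cyc: "is_cyclic U T T' r \<psi>" "is_cyclic V T' T'' s \<phi>"
  shows "is_cyclic U T T'' c (conv W r c \<phi> \<psi>)"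
  unfolding is_cyclic_def
proof (intro allI ballI impI)
  fix n p S x assume x: "x \<in> carrier (U n p)" and S: "adm n S"
  interpret W: module K "W (n - card S) (p + c)" by (rule mods)
  have Sn: "S \<subseteq> {..n}" using S by (simp add: adm_def)
  let ?R = "rot n ` S"
  have R: "adm n ?R" and cR: "card ?R = card S" using adm_rot[OF S] by auto
  have inj: "inj_on (rot n) S" using Sn by (rule inj_on_rot)
  define g where "g B = \<phi> (hatn B ` (?R - B)) (n - card B) (p + r) (\<psi> B n p x)" for B
  have gc: "g B \<in> carrier (W (n - card S) (p + c))" if "B \<subseteq> ?R" for B
    unfolding g_def
    using lin_closed[OF conv_term_linear[OF fam(1,2) _ R that] x, of c] c cR by simp
  have tm: "\<phi> (hatn B ` (S - B)) (n - card B) (p + r) (\<psi> B n p (T n p x)) =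
      (if 0 \<in> S then g (rot n ` B) else T'' (n - card S) (p + c) (g (rot n ` B)))" if B: "B \<subseteq> S" for B
  proof -
    have aB: "adm n B" using adm_subset[OF S B] .
    have Bn: "B \<subseteq> {..n}" using B Sn by auto
    have cB: "card (rot n ` B) = card B" using Bn by (rule card_rot)
    let ?A = "hatn B ` (S - B)"
    note aA = adm_rest[OF S B]
    have diff: "?R - rot n ` B = rot n ` (S - B)"
      using inj B by (auto simp: inj_on_def)
    have A': "hatn (rot n ` B) ` (?R - rot n ` B) = (if 0 \<in> B then ?A else rot (n - card B) ` ?A)"
      unfolding diff image_image using hatn_rot[OF Bn] Sn by (auto intro!: image_cong)
    have y: "\<psi> (rot n ` B) n p x \<in> carrier (V (n - card B) (p + r))"
      using lin_closed[OF family_lin[OF fam(1) _ refl refl] x, of "rot n ` B"] adm_rot[OF aB] by simp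
    have \<psi>: "\<psi> B n p (T n p x) = (if 0 \<in> B then \<psi> (rot n ` B) n p x
        else T' (n - card B) (p + r) (\<psi> (rot n ` B) n p x))"
      using cyc(1) x aB by (auto simp: is_cyclic_def)
    show ?thesis
    proof (cases "0 \<in> B")
      case True
      then show ?thesis using B A' \<psi> cB by (auto simp: g_def)
    next
      case False
      have "0 \<in> ?A \<longleftrightarrow> 0 \<in> S" using False hatn_eq_0_iff[OF False] by (auto simp: image_iff)
      then have "\<phi> ?A (n - card B) (p + r) (T' (n - card B) (p + r) (\<psi> (rot n ` B) n p x)) =
         (if 0 \<in> S then \<phi> (rot (n - card B) ` ?A) (n - card B) (p + r) (\<psi> (rot n ` B) n p x)
          else T'' (n - card S) (p + c) (\<phi> (rot (n - card B) ` ?A) (n - card B) (p + r) (\<psi> (rot n ` B) n p x)))"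
        using cyc(2) y aA(1) aA(3) c by (simp add: is_cyclic_def add.assoc)
      then show ?thesis using False A' \<psi> cB by (simp add: g_def)
    qed
  qed
  have bij: "bij_betw (image (rot n)) (Pow S) (Pow ?R)"
    using inj by (intro bij_betw_Pow) (simp add: bij_betw_def)
  have eq: "conv W r c \<phi> \<psi> ?R n p x = (\<Oplus>\<^bsub>W (n - card S) (p + c)\<^esub>B \<in> Pow S. g (rot n ` B))"
    unfolding conv_def cR g_def[symmetric]
    using gc by (intro W.M.finsum_bij[OF bij, symmetric]) (auto intro!: gc)
  show "conv W r c \<phi> \<psi> S n p (T n p x) = (if 0 \<in> S then conv W r c \<phi> \<psi> ?R n p x
      else T'' (n - card S) (p + c) (conv W r c \<phi> \<psi> ?R n p x))"
  proof (cases "0 \<in> S")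
    case True
    then show ?thesis
      unfolding eq unfolding conv_def
      using tm gc by (auto intro!: W.M.finsum_cong' gc)
  next
    case False
    have "T'' (n - card S) (p + c) (\<Oplus>\<^bsub>W (n - card S) (p + c)\<^esub>B \<in> Pow S. g (rot n ` B)) =
        (\<Oplus>\<^bsub>W (n - card S) (p + c)\<^esub>B \<in> Pow S. T'' (n - card S) (p + c) (g (rot n ` B)))"
      by (rule lin_finsum[OF mods(3) mods(3) T(3)]) (auto intro!: gc)
    then show ?thesis
      using False unfolding eq unfolding conv_def
      using tm by (auto intro!: W.M.finsum_cong' lin_closed[OF T(3)] gc)
  qed
qed

subsection \<open>The cyclic operators and the two totalisations\<close>

definition ksub :: "nat \<Rightarrow> nat \<Rightarrow> nat \<Rightarrow> nat set set" where
  "ksub q n c = {S. S \<subseteq> {..<n + 1 - q} \<and> card S = c}"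

lemma finite_ksub [simp]: "finite (ksub q n c)"
  unfolding ksub_def by (rule finite_subset[of _ "Pow {..<n + 1 - q}"]) auto

lemma ksub_adm: "S \<in> ksub q n c \<Longrightarrow> c \<le> n \<Longrightarrow> adm n S \<and> card S = c"
  by (force simp: ksub_def adm_def)

text \<open>Rotation sends the sets containing \<open>0\<close> to those containing \<open>n\<close>, whose terms cancel against the same
terms without \<open>T\<close>, and the sets without \<open>0\<close> to the subsets of \<open>{..<n}\<close>.\<close>

lemma cyclic_one_minus:
  assumes fam: "is_family K U V b \<phi>"
    and mods: "\<And>n p. module K (U n p)" "\<And>n p. module K (V n p)"
    and T: "\<And>n p. T n p \<in> linear_maps K (U n p) (U n p)" "\<And>n p. T' n p \<in> linear_maps K (V n p) (V n p)"
    and cyc: "is_cyclic U T T' b \<phi>"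
    and x: "x \<in> carrier (U n p)" and c: "c \<le> n"
  defines "M \<equiv> V (n - c) (p + b)"
  shows "(\<Oplus>\<^bsub>M\<^esub>S \<in> ksub 0 n c. \<phi> S n p (x \<ominus>\<^bsub>U n p\<^esub> T n p x)) =
    (\<Oplus>\<^bsub>M\<^esub>S \<in> ksub 1 n c. \<phi> S n p x) \<ominus>\<^bsub>M\<^esub> T' (n - c) (p + b) (\<Oplus>\<^bsub>M\<^esub>S \<in> ksub 1 n c. \<phi> S n p x)"
proof -
  have M: "module K M" unfolding M_def by (rule mods)
  interpret M: module K M by (rule M)
  let ?T = "T' (n - c) (p + b)"
  have T': "?T \<in> linear_maps K M M" unfolding M_def by (rule T)
  have \<phi>l: "\<phi> S n p \<in> linear_maps K (U n p) M" if "S \<in> ksub q n c" for S q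
    using family_lin[OF fam] ksub_adm[OF that c] by (auto simp: M_def)
  have Tx: "T n p x \<in> carrier (U n p)" using lin_closed[OF T(1) x] .
  define A0 A1 where "A0 = {S \<in> ksub 0 n c. 0 \<in> S}" and "A1 = {S \<in> ksub 0 n c. 0 \<notin> S}"
  have sub: "ksub 1 n c \<subseteq> ksub 0 n c" by (auto simp: ksub_def)
  have kn: "S \<subseteq> {..n}" if "S \<in> ksub q n c" for S q using that by (force simp: ksub_def)
  have inj: "inj_on (image (rot n)) (ksub 0 n c)"
  proof (rule inj_onI)
    fix S S' assume h: "S \<in> ksub 0 n c" "S' \<in> ksub 0 n c" "rot n ` S = rot n ` S'"
    show "S = S'"
      using inj_on_image_eq_iff[OF inj_on_rot[OF subset_refl] kn[OF h(1)] kn[OF h(2)]] h(3) by simp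
  qed
  have rk: "rot n ` S \<in> ksub 0 n c" if "S \<in> ksub 0 n c" for S
    using that kn[OF that] card_rot[of S n] rot_le[of _ n] by (auto simp: ksub_def less_Suc_eq_le)
  have full: "image (rot n) ` ksub 0 n c = ksub 0 n c"
    using rk inj by (intro card_subset_eq) (auto simp: card_image)
  have nrot: "n \<in> rot n ` S \<longleftrightarrow> 0 \<in> S" if "S \<in> ksub 0 n c" for S
    using kn[OF that] by (force simp: rot_def image_iff)
  have k1: "S \<in> ksub 1 n c \<longleftrightarrow> S \<in> ksub 0 n c \<and> n \<notin> S" for S
    by (auto simp: ksub_def less_Suc_eq subset_iff)
  have b0: "bij_betw (image (rot n)) A0 (ksub 0 n c - ksub 1 n c)"
    unfolding bij_betw_def
  proof
    show "inj_on (image (rot n)) A0" using inj by (rule inj_on_subset) (auto simp: A0_def)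
    show "image (rot n) ` A0 = ksub 0 n c - ksub 1 n c"
    proof (intro equalityI subsetI)
      fix R assume R: "R \<in> ksub 0 n c - ksub 1 n c"
      then obtain S where "S \<in> ksub 0 n c" "R = rot n ` S" using full by (metis DiffD1 imageE)
      then show "R \<in> image (rot n) ` A0" using R nrot k1 by (auto simp: A0_def)
    qed (use rk nrot k1 in \<open>auto simp: A0_def\<close>)
  qed
  have b1: "bij_betw (image (rot n)) A1 (ksub 1 n c)"
    unfolding bij_betw_def
  proof
    show "inj_on (image (rot n)) A1" using inj by (rule inj_on_subset) (auto simp: A1_def)
    show "image (rot n) ` A1 = ksub 1 n c"
    proof (intro equalityI subsetI)
      fix R assume R: "R \<in> ksub 1 n c"
      then obtain S where "S \<in> ksub 0 n c" "R = rot n ` S" using full k1 by (metis imageE)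
      then show "R \<in> image (rot n) ` A1" using R nrot k1 by (auto simp: A1_def)
    qed (use rk nrot k1 in \<open>auto simp: A1_def\<close>)
  qed
  define y where "y = (\<Oplus>\<^bsub>M\<^esub>S \<in> ksub 1 n c. \<phi> S n p x)"
  define z where "z = (\<Oplus>\<^bsub>M\<^esub>S \<in> ksub 0 n c - ksub 1 n c. \<phi> S n p x)"
  have cl: "\<phi> S n p x \<in> carrier M" if "S \<in> ksub q n c" for S q using lin_closed[OF \<phi>l[OF that] x] .
  have clT: "\<phi> S n p (T n p x) \<in> carrier M" if "S \<in> ksub q n c" for S q using lin_closed[OF \<phi>l[OF that] Tx] .
  have yz: "y \<in> carrier M" "z \<in> carrier M"
    unfolding y_def z_def using cl by (auto intro!: M.M.finsum_closed)
  have "ksub 0 n c = ksub 1 n c \<union> (ksub 0 n c - ksub 1 n c)" using sub by auto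
  then have s0: "(\<Oplus>\<^bsub>M\<^esub>S \<in> ksub 0 n c. \<phi> S n p x) = y \<oplus>\<^bsub>M\<^esub> z"
    unfolding y_def z_def using cl by (subst M.M.finsum_Un_disjoint[symmetric]) auto
  have A01: "ksub 0 n c = A0 \<union> A1" "A0 \<inter> A1 = {}" "finite A0" "finite A1"
    by (auto simp: A0_def A1_def)
  have e0: "(\<Oplus>\<^bsub>M\<^esub>S \<in> A0. \<phi> S n p (T n p x)) = z"
    unfolding z_def
  proof (rule M.M.finsum_bij[OF b0])
    fix S assume S: "S \<in> A0"
    then have "S \<in> ksub 0 n c" "0 \<in> S" by (auto simp: A0_def)
    then show "\<phi> (rot n ` S) n p x = \<phi> S n p (T n p x)"
      using cyc x ksub_adm[OF _ c] by (auto simp: is_cyclic_def)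
    show "\<phi> S n p (T n p x) \<in> carrier M" using clT \<open>S \<in> ksub 0 n c\<close> .
  qed
  have "(\<Oplus>\<^bsub>M\<^esub>S \<in> A1. \<phi> S n p (T n p x)) = (\<Oplus>\<^bsub>M\<^esub>S \<in> ksub 1 n c. ?T (\<phi> S n p x))"
  proof (rule M.M.finsum_bij[OF b1])
    fix S assume S: "S \<in> A1"
    then have "S \<in> ksub 0 n c" "0 \<notin> S" by (auto simp: A1_def)
    then show "?T (\<phi> (rot n ` S) n p x) = \<phi> S n p (T n p x)"
      using cyc x ksub_adm[OF _ c] by (auto simp: is_cyclic_def M_def)
    show "\<phi> S n p (T n p x) \<in> carrier M" using clT \<open>S \<in> ksub 0 n c\<close> .
  qed
  also have "\<dots> = ?T y" unfolding y_def using cl by (intro lin_finsum[OF M M T', symmetric]) auto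
  finally have e1: "(\<Oplus>\<^bsub>M\<^esub>S \<in> A1. \<phi> S n p (T n p x)) = ?T y" .
  have sT: "(\<Oplus>\<^bsub>M\<^esub>S \<in> ksub 0 n c. \<phi> S n p (T n p x)) = z \<oplus>\<^bsub>M\<^esub> ?T y"
    unfolding A01(1) using clT A01
    by (subst M.M.finsum_Un_disjoint) (auto simp: e0 e1)
  have Ty: "?T y \<in> carrier M" using lin_closed[OF T' yz(1)] .
  have "(\<Oplus>\<^bsub>M\<^esub>S \<in> ksub 0 n c. \<phi> S n p (x \<ominus>\<^bsub>U n p\<^esub> T n p x)) =
      (\<Oplus>\<^bsub>M\<^esub>S \<in> ksub 0 n c. \<phi> S n p x \<ominus>\<^bsub>M\<^esub> \<phi> S n p (T n p x))"
    using cl clT by (intro M.M.finsum_cong') (auto simp: lin_minus[OF mods(1) M \<phi>l x Tx] intro!: M.M.minus_closed)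
  also have "\<dots> = (y \<oplus>\<^bsub>M\<^esub> z) \<ominus>\<^bsub>M\<^esub> (z \<oplus>\<^bsub>M\<^esub> ?T y)"
    using cl clT by (subst M.M.finsum_difference) (auto simp: s0 sT)
  also have "\<dots> = y \<ominus>\<^bsub>M\<^esub> ?T y"
  proof -
    have "(y \<oplus>\<^bsub>M\<^esub> z) \<ominus>\<^bsub>M\<^esub> (z \<oplus>\<^bsub>M\<^esub> ?T y) = y \<oplus>\<^bsub>M\<^esub> (z \<oplus>\<^bsub>M\<^esub> (\<ominus>\<^bsub>M\<^esub> z \<oplus>\<^bsub>M\<^esub> \<ominus>\<^bsub>M\<^esub> ?T y))"
      using yz Ty by (simp add: a_minus_def M.M.minus_add M.M.a_assoc)
    also have "z \<oplus>\<^bsub>M\<^esub> (\<ominus>\<^bsub>M\<^esub> z \<oplus>\<^bsub>M\<^esub> \<ominus>\<^bsub>M\<^esub> ?T y) = \<ominus>\<^bsub>M\<^esub> ?T y"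
      using yz Ty by (simp add: M.M.r_neg1 M.M.r_neg2)
    finally show ?thesis by (simp add: a_minus_def)
  qed
  finally show ?thesis by (simp add: y_def)
qed

definition norm_op :: "('k, 'a) module \<Rightarrow> nat \<Rightarrow> ('a \<Rightarrow> 'a) \<Rightarrow> 'a \<Rightarrow> 'a" where
  "norm_op M n T x = (\<Oplus>\<^bsub>M\<^esub>j \<in> {..n}. (T ^^ j) x)"

lemma norm_op_linear:
  assumes "module K M" "T \<in> linear_maps K M M"
  shows "norm_op M n T \<in> linear_maps K M M"
  unfolding norm_op_def[abs_def] using assms by (intro lin_finsum_maps lin_funpow) auto

lemma rot_pow:
  assumes "i \<le> n" "j \<le> Suc n"
  shows "(rot n ^^ j) i = (if j \<le> i then i - j else i + Suc n - j)"
  using assms(2)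
proof (induction j)
  case (Suc j)
  then show ?case using assms(1) by (auto simp: rot_def)
qed simp

lemma rot_pow_le: "i \<le> n \<Longrightarrow> (rot n ^^ j) i \<le> n"
  by (induction j) auto

lemma inj_on_rot_pow: "inj_on (rot n ^^ j) {..n}"
proof (induction j)
  case (Suc j)
  have "inj_on (rot n) ((rot n ^^ j) ` {..n})" by (rule inj_on_rot) (auto intro: rot_pow_le)
  then show ?case using comp_inj_on[OF Suc] by (simp add: comp_def)
qed auto

text \<open>Each of the \<open>j\<close> rotations either consumes a factor \<open>T\<close> or moves it to the left; the latter happens for the
numbers below \<open>j\<close> that are not in \<open>S\<close>.\<close>

lemma cyclic_pow:
  assumes fam: "is_family K U V b \<phi>"
    and T: "\<And>n p. T n p \<in> linear_maps K (U n p) (U n p)"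
    and cyc: "is_cyclic U T T' b \<phi>"
    and S: "adm n S" and j: "j \<le> Suc n" and x: "x \<in> carrier (U n p)"
  shows "\<phi> S n p ((T n p ^^ j) x) =
    (T' (n - card S) (p + b) ^^ card ({..<j} - S)) (\<phi> ((rot n ^^ j) ` S) n p x)"
  using j x
proof (induction j arbitrary: x)
  case (Suc j)
  let ?R = "(rot n ^^ j) ` S"
  have Sn: "S \<subseteq> {..n}" using S by (simp add: adm_def)
  have cR: "card ?R = card S" using inj_on_subset[OF inj_on_rot_pow Sn] by (rule card_image)
  have R: "adm n ?R" using S cR Sn rot_pow_le by (auto simp: adm_def)
  have zero: "0 \<in> ?R \<longleftrightarrow> j \<in> S"
  proof
    assume "0 \<in> ?R"
    then obtain i where i: "i \<in> S" "(rot n ^^ j) i = 0" by auto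
    then have "i = j" using Sn Suc.prems rot_pow[of i n j] by (auto split: if_splits)
    then show "j \<in> S" using i by simp
  next
    assume "j \<in> S"
    then show "0 \<in> ?R" using Suc.prems rot_pow[of j n j] by (intro image_eqI[of _ _ j]) auto
  qed
  have Tx: "T n p x \<in> carrier (U n p)" using lin_closed[OF T Suc.prems(2)] .
  have "\<phi> S n p ((T n p ^^ Suc j) x) = \<phi> S n p ((T n p ^^ j) (T n p x))"
    by (simp add: funpow_swap1)
  also have "\<dots> = (T' (n - card S) (p + b) ^^ card ({..<j} - S)) (\<phi> ?R n p (T n p x))"
    using Suc Tx by simp
  also have "\<phi> ?R n p (T n p x) = (if j \<in> S then \<phi> (rot n ` ?R) n p x
      else T' (n - card S) (p + b) (\<phi> (rot n ` ?R) n p x))"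
    using cyc R Suc.prems zero cR by (auto simp: is_cyclic_def)
  also have "rot n ` ?R = (rot n ^^ Suc j) ` S" by (auto simp: image_image)
  also have "card ({..<Suc j} - S) = (if j \<in> S then card ({..<j} - S) else Suc (card ({..<j} - S)))"
  proof -
    have "{..<Suc j} - S = (if j \<in> S then {..<j} - S else insert j ({..<j} - S))"
      by (auto simp: less_Suc_eq)
    then show ?thesis by auto
  qed
  then have "(T' (n - card S) (p + b) ^^ card ({..<j} - S)) (if j \<in> S then \<phi> ((rot n ^^ Suc j) ` S) n p x
      else T' (n - card S) (p + b) (\<phi> ((rot n ^^ Suc j) ` S) n p x)) =
      (T' (n - card S) (p + b) ^^ card ({..<Suc j} - S)) (\<phi> ((rot n ^^ Suc j) ` S) n p x)"
    by (simp add: funpow_swap1)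
  finally show ?case .
qed simp

lemma card_ksub: "card (ksub q n c) = (n + 1 - q) choose c"
  using n_subsets[of "{..<n + 1 - q}" c] by (simp add: ksub_def)

text \<open>The bijection behind \<open>b' N = N b\<close>. After \<open>j\<close> rotations the letter \<open>n\<close>, which is not in \<open>S\<close>, stands at
\<open>n - j\<close>, and the exponent of \<open>T\<close> counts the gaps to the right of it. So the exponent and the rotated set
determine \<open>j\<close>, hence \<open>S\<close>; surjectivity then follows from
\<open>(n + 1) \<cdot> (n choose c) = (n + 1 - c) \<cdot> (n + 1 choose c)\<close>.\<close>

lemma rotation_bij:
  assumes c: "c \<le> n"
  shows "bij_betw (\<lambda>(S, j). (card ({..<j} - S), (rot n ^^ j) ` S))
    (ksub 1 n c \<times> {..n}) ({..n - c} \<times> ksub 0 n c)"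
proof -
  let ?h = "\<lambda>(S, j). (card ({..<j} - S), (rot n ^^ j) ` S)"
  have S: "S \<subseteq> {..n}" "n \<notin> S" "card S = c" "finite S" if "S \<in> ksub 1 n c" for S
    using that finite_subset[of S "{..<n}"] by (auto simp: ksub_def)
  have into: "?h ` (ksub 1 n c \<times> {..n}) \<subseteq> {..n - c} \<times> ksub 0 n c"
  proof (rule image_subsetI)
    fix i assume "i \<in> ksub 1 n c \<times> {..n}"
    then obtain S j where i: "i = (S, j)" and Sj: "S \<in> ksub 1 n c" "j \<in> {..n}" by auto
    have "card ({..<j} - S) \<le> card ({..<n} - S)" using Sj by (intro card_mono) auto
    also have "\<dots> = n - c" using Sj S[OF Sj(1)] by (subst card_Diff_subset) (auto simp: ksub_def)
    finally have "card ({..<j} - S) \<le> n - c" .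
    moreover have "card ((rot n ^^ j) ` S) = c"
      using S[OF Sj(1)] inj_on_subset[OF inj_on_rot_pow] by (subst card_image) auto
    moreover have "(rot n ^^ j) ` S \<subseteq> {..n}" using S[OF Sj(1)] rot_pow_le by auto
    ultimately show "?h i \<in> {..n - c} \<times> ksub 0 n c"
      using i by (auto simp: ksub_def less_Suc_eq_le)
  qed
  have gaps: "card (({..n} - (rot n ^^ j) ` S) \<inter> {n - j<..}) = card ({..<j} - S)"
    and gap: "n - j \<notin> (rot n ^^ j) ` S" if Sj: "S \<in> ksub 1 n c" "j \<le> n" for S j
  proof -
    note S = S[OF Sj(1)]
    have inj: "inj_on (rot n ^^ j) {..n}" by (rule inj_on_rot_pow)
    have full: "(rot n ^^ j) ` {..n} = {..n}"
      using inj rot_pow_le by (intro card_subset_eq) (auto simp: card_image)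
    have "(rot n ^^ j) n = n - j" using Sj rot_pow[of n n j] by simp
    then show "n - j \<notin> (rot n ^^ j) ` S"
      using S inj by (metis atMost_iff inj_on_image_mem_iff order_refl)
    have "{..n} - (rot n ^^ j) ` S = (rot n ^^ j) ` ({..n} - S)"
      using inj_on_image_set_diff[OF inj, of "{..n}" S] S full by auto
    then have "({..n} - (rot n ^^ j) ` S) \<inter> {n - j<..} = (rot n ^^ j) ` ({..<j} - S)"
      using Sj rot_pow[of _ n j] by (auto simp: image_iff split: if_splits)
    moreover have "card ((rot n ^^ j) ` ({..<j} - S)) = card ({..<j} - S)"
      using Sj by (intro card_image inj_on_subset[OF inj]) auto
    ultimately show "card (({..n} - (rot n ^^ j) ` S) \<inter> {n - j<..}) = card ({..<j} - S)" by simp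
  qed
  (* With a larger j the letter stands further left and has its old position as an additional gap
     to its right, so equal rotated sets would have different gap counts. *)
  have less: False if "S \<in> ksub 1 n c" "S' \<in> ksub 1 n c" "j < j'" "j' \<le> n"
    "card ({..<j} - S) = card ({..<j'} - S')" "(rot n ^^ j) ` S = (rot n ^^ j') ` S'" for S S' j j'
  proof -
    let ?G = "{..n} - (rot n ^^ j) ` S"
    have "n - j \<notin> (rot n ^^ j) ` S" using that(3,4) by (intro gap[OF that(1)]) simp
    then have "insert (n - j) (?G \<inter> {n - j<..}) \<subseteq> ?G \<inter> {n - j'<..}"
      using that(3,4) by auto
    then have "card (insert (n - j) (?G \<inter> {n - j<..})) \<le> card (?G \<inter> {n - j'<..})"
      by (intro card_mono) auto
    then have "Suc (card (?G \<inter> {n - j<..})) \<le> card (?G \<inter> {n - j'<..})" by simp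
    then show False using gaps[OF that(1), of j] gaps[OF that(2), of j'] that by simp
  qed
  have inj: "inj_on ?h (ksub 1 n c \<times> {..n})"
  proof (rule inj_onI)
    fix x y assume "x \<in> ksub 1 n c \<times> {..n}" "y \<in> ksub 1 n c \<times> {..n}" "?h x = ?h y"
    then obtain S j S' j' where xy: "x = (S, j)" "y = (S', j')" "S \<in> ksub 1 n c" "S' \<in> ksub 1 n c" "j \<le> n" "j' \<le> n"
      and eq: "card ({..<j} - S) = card ({..<j'} - S')" "(rot n ^^ j) ` S = (rot n ^^ j') ` S'"
      by auto
    have "j = j'" using less[of S S' j j'] less[of S' S j' j] xy eq by (metis linorder_neqE_nat)
    moreover have "S = S'"
      using inj_on_image_eq_iff[OF inj_on_rot_pow[of j n] S(1) S(1), of S S'] xy eq calculation by auto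
    ultimately show "x = y" using xy by simp
  qed
  have "Suc (n - c) * (Suc n choose c) = (n choose c) * Suc n"
    using binomial_absorb_comp[of "Suc n" c] c by (simp add: Suc_diff_le mult.commute)
  then have "card (ksub 1 n c \<times> {..n}) = card ({..n - c} \<times> ksub 0 n c)"
    by (simp add: card_cartesian_product card_ksub)
  then have "?h ` (ksub 1 n c \<times> {..n}) = {..n - c} \<times> ksub 0 n c"
    using into inj by (intro card_subset_eq) (auto simp: card_image)
  then show ?thesis using inj by (simp add: bij_betw_def)
qed

lemma cyclic_norm:
  assumes fam: "is_family K U V b \<phi>"
    and mods: "\<And>n p. module K (U n p)" "\<And>n p. module K (V n p)"
    and T: "\<And>n p. T n p \<in> linear_maps K (U n p) (U n p)" "\<And>n p. T' n p \<in> linear_maps K (V n p) (V n p)"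
    and cyc: "is_cyclic U T T' b \<phi>"
    and x: "x \<in> carrier (U n p)" and c: "c \<le> n"
  defines "M \<equiv> V (n - c) (p + b)"
  shows "(\<Oplus>\<^bsub>M\<^esub>S \<in> ksub 1 n c. \<phi> S n p (norm_op (U n p) n (T n p) x)) =
    norm_op M (n - c) (T' (n - c) (p + b)) (\<Oplus>\<^bsub>M\<^esub>S \<in> ksub 0 n c. \<phi> S n p x)"
proof -
  have M: "module K M" unfolding M_def by (rule mods)
  interpret M: module K M by (rule M)
  let ?T = "T' (n - c) (p + b)"
  have T': "?T ^^ j \<in> linear_maps K M M" for j unfolding M_def by (intro lin_funpow T)
  have \<phi>l: "\<phi> S n p \<in> linear_maps K (U n p) M" if "S \<in> ksub q n c" for S q
    using family_lin[OF fam] ksub_adm[OF that c] by (auto simp: M_def)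
  have Tx: "(T n p ^^ j) x \<in> carrier (U n p)" for j using lin_closed[OF lin_funpow[OF T(1)] x] .
  have cl: "\<phi> S n p x \<in> carrier M" if "S \<in> ksub q n c" for S q using lin_closed[OF \<phi>l[OF that] x] .
  have clT: "\<phi> S n p ((T n p ^^ j) x) \<in> carrier M" if "S \<in> ksub q n c" for S q j
    using lin_closed[OF \<phi>l[OF that] Tx] .
  have "(\<Oplus>\<^bsub>M\<^esub>S \<in> ksub 1 n c. \<phi> S n p (norm_op (U n p) n (T n p) x)) =
      (\<Oplus>\<^bsub>M\<^esub>S \<in> ksub 1 n c. \<Oplus>\<^bsub>M\<^esub>j \<in> {..n}. \<phi> S n p ((T n p ^^ j) x))"
  proof (rule M.M.finsum_cong')
    fix S assume "S \<in> ksub 1 n c"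
    then show "\<phi> S n p (norm_op (U n p) n (T n p) x) = (\<Oplus>\<^bsub>M\<^esub>j \<in> {..n}. \<phi> S n p ((T n p ^^ j) x))"
      unfolding norm_op_def using Tx by (intro lin_finsum[OF mods(1) M \<phi>l]) auto
  qed (use clT in \<open>auto intro!: M.M.finsum_closed\<close>)
  also have "\<dots> = finsum M (\<lambda>(S, j). \<phi> S n p ((T n p ^^ j) x)) (ksub 1 n c \<times> {..n})"
    using clT by (intro M.M.finsum_Sigma) auto
  also have "\<dots> = finsum M (\<lambda>(a, S). (?T ^^ a) (\<phi> S n p x)) ({..n - c} \<times> ksub 0 n c)"
  proof (rule M.M.finsum_bij[OF rotation_bij[OF c]])
    fix i assume i: "i \<in> ksub 1 n c \<times> {..n}"
    obtain S j where Sj: "i = (S, j)" "S \<in> ksub 1 n c" "j \<le> n" using i by auto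
    have "adm n S" "card S = c" using ksub_adm[OF Sj(2) c] by auto
    then have "\<phi> S n p ((T n p ^^ j) x) = (?T ^^ card ({..<j} - S)) (\<phi> ((rot n ^^ j) ` S) n p x)"
      using cyclic_pow[OF fam T(1) cyc, of n S j x p] Sj x by simp
    then show "(case (case i of (S, j) \<Rightarrow> (card ({..<j} - S), (rot n ^^ j) ` S)) of (a, S) \<Rightarrow> (?T ^^ a) (\<phi> S n p x)) =
        (case i of (S, j) \<Rightarrow> \<phi> S n p ((T n p ^^ j) x))"
      using Sj by simp
    show "(case i of (S, j) \<Rightarrow> \<phi> S n p ((T n p ^^ j) x)) \<in> carrier M"
      using Sj clT by simp
  qed
  also have "\<dots> = (\<Oplus>\<^bsub>M\<^esub>a \<in> {..n - c}. \<Oplus>\<^bsub>M\<^esub>S \<in> ksub 0 n c. (?T ^^ a) (\<phi> S n p x))"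
    using lin_closed[OF T' cl] by (intro M.M.finsum_Sigma[symmetric]) auto
  also have "\<dots> = norm_op M (n - c) ?T (\<Oplus>\<^bsub>M\<^esub>S \<in> ksub 0 n c. \<phi> S n p x)"
    unfolding norm_op_def
  proof (rule M.M.finsum_cong')
    fix a
    show "(\<Oplus>\<^bsub>M\<^esub>S \<in> ksub 0 n c. (?T ^^ a) (\<phi> S n p x)) = (?T ^^ a) (\<Oplus>\<^bsub>M\<^esub>S \<in> ksub 0 n c. \<phi> S n p x)"
      using cl by (intro lin_finsum[OF M M T', symmetric]) auto
  next
    have "(\<Oplus>\<^bsub>M\<^esub>S \<in> ksub 0 n c. \<phi> S n p x) \<in> carrier M" using cl by (intro M.M.finsum_closed) auto
    then show "(\<lambda>i. (?T ^^ i) (\<Oplus>\<^bsub>M\<^esub>S \<in> ksub 0 n c. \<phi> S n p x)) \<in> {..n - c} \<rightarrow> carrier M"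
      using lin_closed[OF T'] by auto
  qed simp
  finally show ?thesis .
qed

text \<open>Multiplication by \<open>T\<close> permutes the summands of the norm cyclically.\<close>

lemma norm_op_one_minus:
  assumes M: "module K M" and T: "T \<in> linear_maps K M M" and period: "\<And>x. x \<in> carrier M \<Longrightarrow> (T ^^ Suc n) x = x"
    and x: "x \<in> carrier M"
  shows "norm_op M n T x \<ominus>\<^bsub>M\<^esub> T (norm_op M n T x) = \<zero>\<^bsub>M\<^esub>"
    "norm_op M n T (x \<ominus>\<^bsub>M\<^esub> T x) = \<zero>\<^bsub>M\<^esub>"
proof -
  interpret M: module K M by (rule M)
  have Tj: "(T ^^ j) x \<in> carrier M" for j using lin_closed[OF lin_funpow[OF T] x] .
  have Tx: "T x \<in> carrier M" using lin_closed[OF T x] .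
  have Nx: "norm_op M n T x \<in> carrier M" using lin_closed[OF norm_op_linear[OF M T] x] .
  have "T (norm_op M n T x) = (\<Oplus>\<^bsub>M\<^esub>j \<in> {..n}. T ((T ^^ j) x))"
    unfolding norm_op_def using Tj by (intro lin_finsum[OF M M T]) auto
  also have "\<dots> = (\<Oplus>\<^bsub>M\<^esub>j \<in> {..n}. (T ^^ j) x)"
  proof (rule M.M.finsum_bij[where h = "\<lambda>j. if j = n then 0 else Suc j"])
    show "bij_betw (\<lambda>j. if j = n then 0 else Suc j) {..n} {..n}"
      by (rule bij_betw_byWitness[where f' = "\<lambda>j. if j = 0 then n else j - 1"]) auto
    fix j assume "j \<in> {..n}"
    show "(T ^^ (if j = n then 0 else Suc j)) x = T ((T ^^ j) x)" using period[OF x] by auto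
    show "T ((T ^^ j) x) \<in> carrier M" using Tj[of "Suc j"] by simp
  qed
  finally have TN: "T (norm_op M n T x) = norm_op M n T x" by (simp add: norm_op_def)
  have NT: "norm_op M n T (T x) = T (norm_op M n T x)"
    unfolding norm_op_def using Tj
    by (subst lin_finsum[OF M M T]) (auto simp: funpow_swap1)
  show "norm_op M n T x \<ominus>\<^bsub>M\<^esub> T (norm_op M n T x) = \<zero>\<^bsub>M\<^esub>"
    using Nx TN by (simp add: M.M.minus_eq_zero_iff)
  show "norm_op M n T (x \<ominus>\<^bsub>M\<^esub> T x) = \<zero>\<^bsub>M\<^esub>"
    using Nx TN NT lin_minus[OF M M norm_op_linear[OF M T] x Tx] by (simp add: M.M.minus_eq_zero_iff)
qed

section \<open>The bicomplex of a cyclic family\<close>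

text \<open>The second condition says that the modules vanish in negative internal degree \<open>p - n\<close>.\<close>

definition cyclic_data ::
  "('k, 'r) ring_scheme \<Rightarrow> (nat \<Rightarrow> int \<Rightarrow> ('k, 'a) module) \<Rightarrow> (nat \<Rightarrow> int \<Rightarrow> 'a \<Rightarrow> 'a) \<Rightarrow> bool" where
  "cyclic_data K U T \<longleftrightarrow> (\<forall>n p. module K (U n p)) \<and>
     (\<forall>n p. p < int n \<longrightarrow> carrier (U n p) = {\<zero>\<^bsub>U n p\<^esub>}) \<and>
     (\<forall>n p. T n p \<in> linear_maps K (U n p) (U n p)) \<and>
     (\<forall>n p. \<forall>x \<in> carrier (U n p). (T n p ^^ Suc n) x = x)"

lemma cyclic_dataD:
  assumes "cyclic_data K U T"
  shows "module K (U n p)" "p < int n \<Longrightarrow> carrier (U n p) = {\<zero>\<^bsub>U n p\<^esub>}"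
    "T n p \<in> linear_maps K (U n p) (U n p)" "x \<in> carrier (U n p) \<Longrightarrow> (T n p ^^ Suc n) x = x"
  using assms by (auto simp: cyclic_data_def)

definition dsum :: "(nat \<Rightarrow> int \<Rightarrow> ('k, 'a) module) \<Rightarrow> nat \<Rightarrow> ('k, nat \<Rightarrow> 'a) module" where
  "dsum U n = direct_sum {..n} (\<lambda>k. U k (int n))"

definition bar_op ::
  "nat \<Rightarrow> (nat \<Rightarrow> int \<Rightarrow> ('k, 'b) module) \<Rightarrow> int \<Rightarrow> (nat set \<Rightarrow> nat \<Rightarrow> int \<Rightarrow> 'a \<Rightarrow> 'b) \<Rightarrow>
   nat \<Rightarrow> nat \<Rightarrow> (nat \<Rightarrow> 'a) \<Rightarrow> nat \<Rightarrow> 'b" where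
  "bar_op q V b \<phi> n n' v = (\<lambda>j \<in> {..n'}. bar_comp q V b \<phi> n (int n) v j)"

definition cyc_T :: "(nat \<Rightarrow> int \<Rightarrow> 'a \<Rightarrow> 'a) \<Rightarrow> nat \<Rightarrow> (nat \<Rightarrow> 'a) \<Rightarrow> nat \<Rightarrow> 'a" where
  "cyc_T T n v = (\<lambda>k \<in> {..n}. T k (int n) (v k))"

definition cyc_N ::
  "(nat \<Rightarrow> int \<Rightarrow> ('k, 'a) module) \<Rightarrow> (nat \<Rightarrow> int \<Rightarrow> 'a \<Rightarrow> 'a) \<Rightarrow> nat \<Rightarrow> (nat \<Rightarrow> 'a) \<Rightarrow> nat \<Rightarrow> 'a" where
  "cyc_N U T n v = (\<lambda>k \<in> {..n}. norm_op (U k (int n)) k (T k (int n)) (v k))"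

lemma dsum_module: "cyclic_data K U T \<Longrightarrow> module K (dsum U n)"
  unfolding dsum_def using cyclic_dataD(1)[of K U T]
  by (intro direct_sum_module) (auto simp: module_def)

lemma dsum_component: "v \<in> carrier (dsum U n) \<Longrightarrow> k \<le> n \<Longrightarrow> v k \<in> carrier (U k (int n))"
  by (auto simp: dsum_def)

lemma dsum_eqI:
  assumes "v \<in> extensional {..n}" "w \<in> extensional {..n}" "\<And>k. k \<le> n \<Longrightarrow> v k = w k"
  shows "v = w"
  using assms by (intro extensionalityI[of _ "{..n}"]) auto

lemma dsum_ext: "v \<in> carrier (dsum U n) \<Longrightarrow> v \<in> extensional {..n}"
  by (auto simp: dsum_def PiE_iff)

lemma linear_into_dsum:
  assumes "cyclic_data K U T" "\<And>j. j \<le> n' \<Longrightarrow> (\<lambda>v. f v j) \<in> linear_maps K (dsum U n) (V j (int n'))"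
    and "\<And>v. f v \<in> extensional {..n'}"
  shows "f \<in> linear_maps K (dsum U n) (dsum V n')"
  unfolding dsum_def[of V]
  using assms by (intro linear_into_direct_sum dsum_module[OF assms(1)]) auto

lemma linear_dsum_component:
  assumes "k \<le> n" "g \<in> linear_maps K (U k (int n)) N"
  shows "(\<lambda>v. g (v k)) \<in> linear_maps K (dsum U n) N"
  unfolding dsum_def using assms by (intro linear_at_component) auto

lemma dsum_minus:
  assumes "cyclic_data K U T" "v \<in> carrier (dsum U n)" "w \<in> carrier (dsum U n)" "k \<le> n"
  shows "(v \<ominus>\<^bsub>dsum U n\<^esub> w) k = v k \<ominus>\<^bsub>U k (int n)\<^esub> w k"
  using assms dsum_module[OF assms(1), of n] cyclic_dataD(1)[OF assms(1)] unfolding dsum_def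
  by (intro direct_sum_minus) auto

lemma bar_op_linear:
  assumes U: "cyclic_data K U T" and V: "cyclic_data K V T'" and fam: "is_family K U V b \<phi>"
    and n': "int n' = int n + b"
  shows "bar_op q V b \<phi> n n' \<in> linear_maps K (dsum U n) (dsum V n')"
proof (rule linear_into_dsum[OF U])
  fix j assume j: "j \<le> n'"
  have "(\<lambda>v. bar_comp q V b \<phi> n (int n) v j) \<in> linear_maps K (dsum U n) (V j (int n'))"
    unfolding bar_comp_def n'[symmetric]
  proof (rule lin_finsum_maps[OF dsum_module[OF U] cyclic_dataD(1)[OF V]])
    fix i assume i: "i \<in> bar_index q n j"
    obtain k S where kS: "i = (k, S)" by (cases i)
    then show "(\<lambda>v. case i of (k, S) \<Rightarrow> \<phi> S k (int n) (v k)) \<in> linear_maps K (dsum U n) (V j (int n'))"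
      using linear_dsum_component[of k n "\<phi> S k (int n)" K U "V j (int n')"] bar_comp_term[OF fam, of k S q n j "int n"]
        bar_index_adm[of k S q n j] i n' by simp
  qed
  then show "(\<lambda>v. bar_op q V b \<phi> n n' v j) \<in> linear_maps K (dsum U n) (V j (int n'))"
    using j by (simp add: bar_op_def)
qed (simp add: bar_op_def)

lemma bar_op_cong:
  assumes "is_family K U V b \<phi>" "cyclic_data K V T'" "v \<in> carrier (dsum U n)"
    and "\<And>k S x. adm k S \<Longrightarrow> k \<le> n \<Longrightarrow> x \<in> carrier (U k (int n)) \<Longrightarrow> \<phi>' S k (int n) x = \<phi> S k (int n) x"
  shows "bar_op q V b \<phi>' n n' v = bar_op q V b \<phi> n n' v"
  unfolding bar_op_def
  using assms dsum_component[OF assms(3)]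
  by (intro restrict_ext bar_comp_cong[OF assms(1) cyclic_dataD(1)[OF assms(2)]]) auto

text \<open>The intermediate module has \<open>n' = n + r\<close> as its last summand. Summands between \<open>n\<close> and \<open>n'\<close> contribute
nothing: if \<open>n' < n\<close> the modules there are zero, and if \<open>n < n'\<close> no component of \<open>\<psi>\<close> reaches them.\<close>

lemma bar_op_conv:
  assumes U: "cyclic_data K U T" and V: "cyclic_data K V T'" and W: "cyclic_data K W T''"
    and fam: "is_family K U V r \<psi>" "is_family K V W s \<phi>"
    and c: "c = r + s" and n': "int n' = int n + r" and v: "v \<in> carrier (dsum U n)"
  shows "bar_op q W s \<phi> n' n'' (bar_op q V r \<psi> n n' v) = bar_op q W c (conv W r c \<phi> \<psi>) n n'' v"
proof -
  note mods = cyclic_dataD(1)[OF U] cyclic_dataD(1)[OF V] cyclic_dataD(1)[OF W]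
  let ?w = "bar_comp q V r \<psi> n (int n) v"
  have vc: "v k \<in> carrier (U k (int n))" if "k \<le> n" for k using dsum_component[OF v that] .
  have wc: "?w k \<in> carrier (V k (int n'))" for k
    using bar_comp_closed[OF fam(1) mods(2) vc] n' by simp
  have "bar_comp q W s \<phi> n' (int n') (bar_op q V r \<psi> n n' v) j = bar_comp q W c (conv W r c \<phi> \<psi>) n (int n) v j" for j
  proof -
    have "bar_comp q W s \<phi> n' (int n') (bar_op q V r \<psi> n n' v) j = bar_comp q W s \<phi> n' (int n') ?w j"
      using wc by (intro bar_comp_cong[OF fam(2) mods(3)]) (auto simp: bar_op_def)
    also have "\<dots> = bar_comp q W s \<phi> n (int n') ?w j"
    proof (cases "n' \<le> n")
      case True
      have "?w k = \<zero>\<^bsub>V k (int n')\<^esub>" if "n' < k" for k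
        using wc[of k] cyclic_dataD(2)[OF V, of "int n'" k] that by simp
      then show ?thesis using wc True by (intro bar_comp_bound[OF fam(2) mods(2,3), symmetric]) auto
    next
      case False
      have "?w k = \<zero>\<^bsub>V k (int n')\<^esub>" if "n < k" for k
      proof -
        interpret V: module K "V k (int n')" by (rule mods)
        have "bar_index q n k = {}" using that by (auto simp: bar_index_def)
        then show ?thesis using n' by (simp add: bar_comp_def flip: n')
      qed
      then show ?thesis using wc False by (intro bar_comp_bound[OF fam(2) mods(2,3)]) auto
    qed
    also have "\<dots> = bar_comp q W c (conv W r c \<phi> \<psi>) n (int n) v j"
      using bar_comp_conv[OF fam c mods vc, of n q j] n' by simp
    finally show ?thesis .
  qed
  then show ?thesis by (simp add: bar_op_def)
qed

lemma bar_op_zero: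
  assumes W: "cyclic_data K W T''" and v: "v \<in> carrier (dsum U n)" and n': "int n' = int n + c"
    and zero: "\<And>k S x. adm k S \<Longrightarrow> x \<in> carrier (U k (int n)) \<Longrightarrow> \<phi> S k (int n) x = \<zero>\<^bsub>W (k - card S) (int n + c)\<^esub>"
  shows "bar_op q W c \<phi> n n' v = \<zero>\<^bsub>dsum W n'\<^esub>"
  unfolding bar_op_def dsum_def direct_sum_simps
proof (rule restrict_ext)
  fix j assume "j \<in> {..n'}"
  interpret W: module K "W j (int n + c)" by (rule cyclic_dataD(1)[OF W])
  show "bar_comp q W c \<phi> n (int n) v j = \<zero>\<^bsub>W j (int n')\<^esub>"
    unfolding bar_comp_def n'
    using zero dsum_component[OF v] bar_index_adm by (intro W.M.add.finprod_one_eqI) fastforce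
qed

text \<open>Grouping by the source summand \<open>k\<close> isolates sums over subsets of fixed size, to which the cyclic
identities for a single degree apply.\<close>

lemma bar_comp_split:
  assumes fam: "is_family K U V b \<phi>" and V: "module K (V j (p + b))"
    and v: "\<And>k. k \<le> N \<Longrightarrow> v k \<in> carrier (U k p)"
  shows "bar_comp q V b \<phi> N p v j =
    (\<Oplus>\<^bsub>V j (p + b)\<^esub>k \<in> {j..N}. \<Oplus>\<^bsub>V j (p + b)\<^esub>S \<in> ksub q k (k - j). \<phi> S k p (v k))"
    "\<And>k. k \<in> {j..N} \<Longrightarrow> (\<Oplus>\<^bsub>V j (p + b)\<^esub>S \<in> ksub q k (k - j). \<phi> S k p (v k)) \<in> carrier (V j (p + b))"
proof -
  interpret V: module K "V j (p + b)" by (rule V)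
  have cl: "\<phi> S k p (v k) \<in> carrier (V j (p + b))" if "k \<in> {j..N}" "S \<in> ksub q k (k - j)" for k S
  proof -
    have "(k, S) \<in> bar_index q N j" using that by (auto simp: bar_index_def ksub_def)
    then show ?thesis using lin_closed[OF bar_comp_term[OF fam]] v that by auto
  qed
  have idx: "bar_index q N j = Sigma {j..N} (\<lambda>k. ksub q k (k - j))" by (simp add: bar_index_def ksub_def)
  show "bar_comp q V b \<phi> N p v j =
    (\<Oplus>\<^bsub>V j (p + b)\<^esub>k \<in> {j..N}. \<Oplus>\<^bsub>V j (p + b)\<^esub>S \<in> ksub q k (k - j). \<phi> S k p (v k))"
    unfolding bar_comp_def idx using cl by (intro V.M.finsum_Sigma[symmetric]) auto
  show "(\<Oplus>\<^bsub>V j (p + b)\<^esub>S \<in> ksub q k (k - j). \<phi> S k p (v k)) \<in> carrier (V j (p + b))" if "k \<in> {j..N}" for k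
    using cl that by (intro V.M.finsum_closed) auto
qed

lemma cyc_T_linear: "cyclic_data K U T \<Longrightarrow> cyc_T T n \<in> linear_maps K (dsum U n) (dsum U n)"
  by (rule linear_into_dsum)
     (auto simp: cyc_T_def intro: linear_dsum_component cyclic_dataD(3))

lemma cyc_N_linear: "cyclic_data K U T \<Longrightarrow> cyc_N U T n \<in> linear_maps K (dsum U n) (dsum U n)"
  by (rule linear_into_dsum)
     (auto simp: cyc_N_def intro: linear_dsum_component norm_op_linear cyclic_dataD(1,3))

lemma bar_op_one_minus:
  assumes U: "cyclic_data K U T" and V: "cyclic_data K V T'"
    and fam: "is_family K U V b \<phi>" and cyc: "is_cyclic U T T' b \<phi>"
    and n': "int n' = int n + b" and v: "v \<in> carrier (dsum U n)"
  defines "w \<equiv> bar_op 1 V b \<phi> n n' v"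
  shows "bar_op 0 V b \<phi> n n' (v \<ominus>\<^bsub>dsum U n\<^esub> cyc_T T n v) = w \<ominus>\<^bsub>dsum V n'\<^esub> cyc_T T' n' w"
proof (rule dsum_eqI[where n = n'])
  interpret V': module K "dsum V n'" by (rule dsum_module[OF V])
  interpret U': module K "dsum U n" by (rule dsum_module[OF U])
  have w: "w \<in> carrier (dsum V n')" unfolding w_def by (rule lin_closed[OF bar_op_linear[OF U V fam n'] v])
  have Tw: "cyc_T T' n' w \<in> carrier (dsum V n')" by (rule lin_closed[OF cyc_T_linear[OF V] w])
  have Tv: "cyc_T T n v \<in> carrier (dsum U n)" by (rule lin_closed[OF cyc_T_linear[OF U] v])
  show "w \<ominus>\<^bsub>dsum V n'\<^esub> cyc_T T' n' w \<in> extensional {..n'}"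
    using dsum_ext V'.M.minus_closed[OF w Tw] by blast
  show "bar_op 0 V b \<phi> n n' (v \<ominus>\<^bsub>dsum U n\<^esub> cyc_T T n v) \<in> extensional {..n'}" by (simp add: bar_op_def)
  fix j assume j: "j \<le> n'"
  note mods = cyclic_dataD(1)[OF U] cyclic_dataD(1)[OF V]
  let ?M = "V j (int n + b)" and ?T = "T' j (int n + b)"
  interpret M: module K ?M by (rule mods)
  let ?u = "v \<ominus>\<^bsub>dsum U n\<^esub> cyc_T T n v"
  have u: "?u \<in> carrier (dsum U n)" using v Tv by (rule U'.M.minus_closed)
  have uk: "?u k = v k \<ominus>\<^bsub>U k (int n)\<^esub> T k (int n) (v k)" if "k \<le> n" for k
    using dsum_minus[OF U v Tv that] that by (simp add: cyc_T_def)
  define y where "y k = (\<Oplus>\<^bsub>?M\<^esub>S \<in> ksub 1 k (k - j). \<phi> S k (int n) (v k))" for k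
  have y: "y k \<in> carrier ?M" if "k \<in> {j..n}" for k
    unfolding y_def using bar_comp_split(2)[where V = V, OF fam mods(2) dsum_component[OF v] that] by simp
  have Ty: "?T (y k) \<in> carrier ?M" if "k \<in> {j..n}" for k
    using lin_closed[OF cyclic_dataD(3)[OF V] y[OF that]] .
  have wj: "w j = (\<Oplus>\<^bsub>?M\<^esub>k \<in> {j..n}. y k)"
    unfolding w_def y_def bar_op_def using j bar_comp_split(1)[where V = V, OF fam mods(2) dsum_component[OF v]] by simp
  have "bar_op 0 V b \<phi> n n' ?u j =
      (\<Oplus>\<^bsub>?M\<^esub>k \<in> {j..n}. \<Oplus>\<^bsub>?M\<^esub>S \<in> ksub 0 k (k - j). \<phi> S k (int n) (?u k))"
    using j bar_comp_split(1)[where V = V, OF fam mods(2) dsum_component[OF u]] by (simp add: bar_op_def)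
  also have "\<dots> = (\<Oplus>\<^bsub>?M\<^esub>k \<in> {j..n}. y k \<ominus>\<^bsub>?M\<^esub> ?T (y k))"
  proof (rule M.M.finsum_cong')
    fix k assume k: "k \<in> {j..n}"
    then have "k - (k - j) = j" by simp
    then show "(\<Oplus>\<^bsub>?M\<^esub>S \<in> ksub 0 k (k - j). \<phi> S k (int n) (?u k)) = y k \<ominus>\<^bsub>?M\<^esub> ?T (y k)"
      using k uk cyclic_one_minus[OF fam mods cyclic_dataD(3)[OF U] cyclic_dataD(3)[OF V] cyc dsum_component[OF v, of k], of "k - j"]
      by (simp add: y_def)
  qed (use y Ty in \<open>auto intro!: M.M.minus_closed\<close>)
  also have "\<dots> = w j \<ominus>\<^bsub>?M\<^esub> (\<Oplus>\<^bsub>?M\<^esub>k \<in> {j..n}. ?T (y k))"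
    unfolding wj using y Ty by (intro M.M.finsum_difference) auto
  also have "(\<Oplus>\<^bsub>?M\<^esub>k \<in> {j..n}. ?T (y k)) = ?T (w j)"
    unfolding wj using y by (intro lin_finsum[OF mods(2) mods(2) cyclic_dataD(3)[OF V], symmetric]) auto
  also have "w j \<ominus>\<^bsub>?M\<^esub> ?T (w j) = (w \<ominus>\<^bsub>dsum V n'\<^esub> cyc_T T' n' w) j"
    using dsum_minus[OF V w Tw j] j n' by (simp add: cyc_T_def)
  finally show "bar_op 0 V b \<phi> n n' ?u j = (w \<ominus>\<^bsub>dsum V n'\<^esub> cyc_T T' n' w) j" .
qed

lemma bar_op_norm:
  assumes U: "cyclic_data K U T" and V: "cyclic_data K V T'"
    and fam: "is_family K U V b \<phi>" and cyc: "is_cyclic U T T' b \<phi>"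
    and n': "int n' = int n + b" and v: "v \<in> carrier (dsum U n)"
  shows "bar_op 1 V b \<phi> n n' (cyc_N U T n v) = cyc_N V T' n' (bar_op 0 V b \<phi> n n' v)"
proof (rule dsum_eqI[where n = n'])
  show "bar_op 1 V b \<phi> n n' (cyc_N U T n v) \<in> extensional {..n'}" by (simp add: bar_op_def)
  show "cyc_N V T' n' (bar_op 0 V b \<phi> n n' v) \<in> extensional {..n'}" by (simp add: cyc_N_def)
  fix j assume j: "j \<le> n'"
  note mods = cyclic_dataD(1)[OF U] cyclic_dataD(1)[OF V]
  let ?M = "V j (int n + b)" and ?T = "T' j (int n + b)"
  interpret M: module K ?M by (rule mods)
  have N: "norm_op ?M j ?T \<in> linear_maps K ?M ?M" by (intro norm_op_linear mods cyclic_dataD(3)[OF V])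
  have Nv: "cyc_N U T n v \<in> carrier (dsum U n)" by (rule lin_closed[OF cyc_N_linear[OF U] v])
  define y where "y k = (\<Oplus>\<^bsub>?M\<^esub>S \<in> ksub 0 k (k - j). \<phi> S k (int n) (v k))" for k
  have y: "y k \<in> carrier ?M" if "k \<in> {j..n}" for k
    unfolding y_def using bar_comp_split(2)[where V = V, OF fam mods(2) dsum_component[OF v] that] by simp
  have "bar_op 1 V b \<phi> n n' (cyc_N U T n v) j =
      (\<Oplus>\<^bsub>?M\<^esub>k \<in> {j..n}. \<Oplus>\<^bsub>?M\<^esub>S \<in> ksub 1 k (k - j). \<phi> S k (int n) (cyc_N U T n v k))"
    using j bar_comp_split(1)[where V = V, OF fam mods(2) dsum_component[OF Nv]] by (simp add: bar_op_def)
  also have "\<dots> = (\<Oplus>\<^bsub>?M\<^esub>k \<in> {j..n}. norm_op ?M j ?T (y k))"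
  proof (rule M.M.finsum_cong')
    fix k assume k: "k \<in> {j..n}"
    then have "k - (k - j) = j" by simp
    then show "(\<Oplus>\<^bsub>?M\<^esub>S \<in> ksub 1 k (k - j). \<phi> S k (int n) (cyc_N U T n v k)) = norm_op ?M j ?T (y k)"
      using k cyclic_norm[OF fam mods cyclic_dataD(3)[OF U] cyclic_dataD(3)[OF V] cyc dsum_component[OF v, of k], of "k - j"]
      by (simp add: y_def cyc_N_def)
  qed (use y lin_closed[OF N] in auto)
  also have "\<dots> = norm_op ?M j ?T (\<Oplus>\<^bsub>?M\<^esub>k \<in> {j..n}. y k)"
    using y by (intro lin_finsum[OF mods(2) mods(2) N, symmetric]) auto
  also have "(\<Oplus>\<^bsub>?M\<^esub>k \<in> {j..n}. y k) = bar_op 0 V b \<phi> n n' v j"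
    unfolding y_def bar_op_def using j bar_comp_split(1)[where V = V, OF fam mods(2) dsum_component[OF v]] by simp
  also have "norm_op ?M j ?T (bar_op 0 V b \<phi> n n' v j) = cyc_N V T' n' (bar_op 0 V b \<phi> n n' v) j"
    using j n' by (simp add: cyc_N_def)
  finally show "bar_op 1 V b \<phi> n n' (cyc_N U T n v) j = cyc_N V T' n' (bar_op 0 V b \<phi> n n' v) j" .
qed

lemma cyc_one_minus_norm:
  assumes U: "cyclic_data K U T" and v: "v \<in> carrier (dsum U n)"
  shows "cyc_N U T n v \<ominus>\<^bsub>dsum U n\<^esub> cyc_T T n (cyc_N U T n v) = \<zero>\<^bsub>dsum U n\<^esub>"
    "cyc_N U T n (v \<ominus>\<^bsub>dsum U n\<^esub> cyc_T T n v) = \<zero>\<^bsub>dsum U n\<^esub>"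
proof -
  interpret U: module K "dsum U n" by (rule dsum_module[OF U])
  have Tv: "cyc_T T n v \<in> carrier (dsum U n)" by (rule lin_closed[OF cyc_T_linear[OF U] v])
  have Nv: "cyc_N U T n v \<in> carrier (dsum U n)" by (rule lin_closed[OF cyc_N_linear[OF U] v])
  have TNv: "cyc_T T n (cyc_N U T n v) \<in> carrier (dsum U n)" by (rule lin_closed[OF cyc_T_linear[OF U] Nv])
  have vk: "v k \<in> carrier (U k (int n))" if "k \<le> n" for k using dsum_component[OF v that] .
  have z: "\<zero>\<^bsub>dsum U n\<^esub> \<in> extensional {..n}" by (simp add: dsum_def)
  show "cyc_N U T n v \<ominus>\<^bsub>dsum U n\<^esub> cyc_T T n (cyc_N U T n v) = \<zero>\<^bsub>dsum U n\<^esub>"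
  proof (rule dsum_eqI[OF _ z])
    show "cyc_N U T n v \<ominus>\<^bsub>dsum U n\<^esub> cyc_T T n (cyc_N U T n v) \<in> extensional {..n}"
      using dsum_ext U.M.minus_closed[OF Nv TNv] by blast
    fix k assume k: "k \<le> n"
    then show "(cyc_N U T n v \<ominus>\<^bsub>dsum U n\<^esub> cyc_T T n (cyc_N U T n v)) k = \<zero>\<^bsub>dsum U n\<^esub> k"
      using dsum_minus[OF U Nv TNv k] norm_op_one_minus(1)[OF cyclic_dataD(1)[OF U] cyclic_dataD(3)[OF U] cyclic_dataD(4)[OF U] vk[OF k]]
      by (simp add: cyc_N_def cyc_T_def dsum_def)
  qed
  show "cyc_N U T n (v \<ominus>\<^bsub>dsum U n\<^esub> cyc_T T n v) = \<zero>\<^bsub>dsum U n\<^esub>"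
  proof (rule dsum_eqI[OF _ z])
    fix k assume k: "k \<le> n"
    then show "cyc_N U T n (v \<ominus>\<^bsub>dsum U n\<^esub> cyc_T T n v) k = \<zero>\<^bsub>dsum U n\<^esub> k"
      using dsum_minus[OF U v Tv k] norm_op_one_minus(2)[OF cyclic_dataD(1)[OF U] cyclic_dataD(3)[OF U] cyclic_dataD(4)[OF U] vk[OF k]]
      by (simp add: cyc_N_def cyc_T_def dsum_def)
  qed (simp add: cyc_N_def)
qed

definition cyc_d1 where
  "cyc_d1 U T n (m :: nat) v = (if odd m then v \<ominus>\<^bsub>dsum U n\<^esub> cyc_T T n v else cyc_N U T n v)"

definition cyc_d2 where
  "cyc_d2 U \<Delta> n (m :: nat) v = (if even m then bar_op 0 U (- 1) \<Delta> n (n - 1) v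
     else \<ominus>\<^bsub>dsum U (n - 1)\<^esub> bar_op 1 U (- 1) \<Delta> n (n - 1) v)"

lemma cyc_d1_linear: "cyclic_data K U T \<Longrightarrow> cyc_d1 U T n m \<in> linear_maps K (dsum U n) (dsum U n)"
  unfolding cyc_d1_def[abs_def] using cyc_N_linear
  by (cases "even m") (auto intro!: lin_difference dsum_module lin_id cyc_T_linear)

lemma cyc_d2_linear:
  assumes "cyclic_data K U T" "is_family K U U (- 1) \<Delta>"
  shows "cyc_d2 U \<Delta> (Suc n) m \<in> linear_maps K (dsum U (Suc n)) (dsum U n)"
proof -
  have "bar_op q U (- 1) \<Delta> (Suc n) n \<in> linear_maps K (dsum U (Suc n)) (dsum U n)" for q
    by (rule bar_op_linear[OF assms(1,1,2)]) simp
  then show ?thesis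
    unfolding cyc_d2_def[abs_def]
    by (cases "even m") (auto intro!: lin_negate dsum_module[OF assms(1)])
qed

theorem cyclic_bicomplex:
  assumes U: "cyclic_data K U T" and fam: "is_family K U U (- 1) \<Delta>"
    and sq: "\<And>n p S x. adm n S \<Longrightarrow> x \<in> carrier (U n p) \<Longrightarrow>
      conv U (- 1) (- 2) \<Delta> \<Delta> S n p x = \<zero>\<^bsub>U (n - card S) (p - 2)\<^esub>"
    and cyc: "is_cyclic U T T (- 1) \<Delta>"
  shows "is_bicomplex K (dsum U) (cyc_d1 U T) (cyc_d2 U \<Delta>)"
  unfolding is_bicomplex_def
proof (intro conjI allI ballI)
  fix n m :: nat
  show M: "module K (dsum U n)" for n by (rule dsum_module[OF U])
  have L: "bar_op q U (- 1) \<Delta> (Suc n) n \<in> linear_maps K (dsum U (Suc n)) (dsum U n)" for q n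
    by (rule bar_op_linear[OF U U fam]) simp
  interpret C: module K "dsum U n" by (rule M)
  show "cyc_d1 U T n m \<in> linear_maps K (dsum U n) (dsum U n)" by (rule cyc_d1_linear[OF U])
  show "cyc_d2 U \<Delta> (Suc n) m \<in> linear_maps K (dsum U (Suc n)) (dsum U n)" by (rule cyc_d2_linear[OF U fam])
  show "cyc_d1 U T n (Suc m) (cyc_d1 U T n (Suc (Suc m)) v) = \<zero>\<^bsub>dsum U n\<^esub>" if "v \<in> carrier (dsum U n)" for v
    using cyc_one_minus_norm[OF U that] by (simp add: cyc_d1_def)
  show "cyc_d2 U \<Delta> (Suc n) m (cyc_d2 U \<Delta> (Suc (Suc n)) m v) = \<zero>\<^bsub>dsum U n\<^esub>"
    if v: "v \<in> carrier (dsum U (Suc (Suc n)))" for v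
  proof -
    have "bar_op q U (- 1) \<Delta> (Suc n) n (bar_op q U (- 1) \<Delta> (Suc (Suc n)) (Suc n) v) = \<zero>\<^bsub>dsum U n\<^esub>" for q
    proof -
      have "bar_op q U (- 1) \<Delta> (Suc n) n (bar_op q U (- 1) \<Delta> (Suc (Suc n)) (Suc n) v) =
          bar_op q U (- 2) (conv U (- 1) (- 2) \<Delta> \<Delta>) (Suc (Suc n)) n v"
        by (rule bar_op_conv[OF U U U fam fam _ _ v]) auto
      also have "\<dots> = \<zero>\<^bsub>dsum U n\<^esub>"
        by (rule bar_op_zero[OF U v]) (use sq in \<open>auto\<close>)
      finally show ?thesis .
    qed
    then show ?thesis
      using lin_neg[OF M M L lin_closed[OF L v]] lin_closed[OF L v]
      by (simp add: cyc_d2_def C.M.minus_minus)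
  qed
  show "cyc_d1 U T n (Suc m) (cyc_d2 U \<Delta> (Suc n) (Suc m) v) \<oplus>\<^bsub>dsum U n\<^esub>
      cyc_d2 U \<Delta> (Suc n) m (cyc_d1 U T (Suc n) (Suc m) v) = \<zero>\<^bsub>dsum U n\<^esub>"
    if v: "v \<in> carrier (dsum U (Suc n))" for v
  proof (cases "even m")
    case True
    let ?w = "bar_op 1 U (- 1) \<Delta> (Suc n) n v"
    have w: "?w \<in> carrier (dsum U n)" by (rule lin_closed[OF L v])
    have D: "(\<lambda>v. v \<ominus>\<^bsub>dsum U n\<^esub> cyc_T T n v) \<in> linear_maps K (dsum U n) (dsum U n)"
      by (intro lin_difference M lin_id cyc_T_linear[OF U])
    have "\<ominus>\<^bsub>dsum U n\<^esub> ?w \<ominus>\<^bsub>dsum U n\<^esub> cyc_T T n (\<ominus>\<^bsub>dsum U n\<^esub> ?w) =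
        \<ominus>\<^bsub>dsum U n\<^esub> (?w \<ominus>\<^bsub>dsum U n\<^esub> cyc_T T n ?w)"
      using lin_neg[OF M M D w] .
    moreover have "bar_op 0 U (- 1) \<Delta> (Suc n) n (v \<ominus>\<^bsub>dsum U (Suc n)\<^esub> cyc_T T (Suc n) v) =
        ?w \<ominus>\<^bsub>dsum U n\<^esub> cyc_T T n ?w"
      by (rule bar_op_one_minus[OF U U fam cyc _ v]) simp
    ultimately show ?thesis
      using True C.M.l_neg lin_closed[OF D w] by (simp add: cyc_d1_def cyc_d2_def)
  next
    case False
    have "bar_op 1 U (- 1) \<Delta> (Suc n) n (cyc_N U T (Suc n) v) = cyc_N U T n (bar_op 0 U (- 1) \<Delta> (Suc n) n v)"
      by (rule bar_op_norm[OF U U fam cyc _ v]) simp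
    then show ?thesis
      using False C.M.r_neg lin_closed[OF cyc_N_linear[OF U] lin_closed[OF L v]]
      by (simp add: cyc_d1_def cyc_d2_def)
  qed
qed

theorem cyclic_bicomplex_map:
  assumes U: "cyclic_data K U T" and V: "cyclic_data K V T'"
    and dU: "is_family K U U (- 1) \<Delta>" and dV: "is_family K V V (- 1) \<Delta>'"
    and fam: "is_family K U V 0 \<phi>" and cyc: "is_cyclic U T T' 0 \<phi>"
    and comm: "\<And>n p S x. adm n S \<Longrightarrow> x \<in> carrier (U n p) \<Longrightarrow>
      conv V 0 (- 1) \<Delta>' \<phi> S n p x = conv V (- 1) (- 1) \<phi> \<Delta> S n p x"
  shows "is_bicomplex_map K (dsum U) (cyc_d1 U T) (cyc_d2 U \<Delta>) (dsum V) (cyc_d1 V T') (cyc_d2 V \<Delta>')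
    (\<lambda>n m. bar_op (if even m then 0 else 1) V 0 \<phi> n n)"
  unfolding is_bicomplex_map_def
proof (intro conjI allI ballI)
  fix n m :: nat
  have L: "bar_op q V 0 \<phi> n n \<in> linear_maps K (dsum U n) (dsum V n)" for q n
    by (rule bar_op_linear[OF U V fam]) simp
  show "bar_op (if even m then 0 else 1) V 0 \<phi> n n \<in> linear_maps K (dsum U n) (dsum V n)" by (rule L)
  show "bar_op (if even m then 0 else 1) V 0 \<phi> n n (cyc_d1 U T n (Suc m) v) =
      cyc_d1 V T' n (Suc m) (bar_op (if even (Suc m) then 0 else 1) V 0 \<phi> n n v)" if v: "v \<in> carrier (dsum U n)" for v
    using bar_op_one_minus[OF U V fam cyc _ v, of n] bar_op_norm[OF U V fam cyc _ v, of n]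
    by (auto simp: cyc_d1_def)
  show "bar_op (if even m then 0 else 1) V 0 \<phi> n n (cyc_d2 U \<Delta> (Suc n) m v) =
      cyc_d2 V \<Delta>' (Suc n) m (bar_op (if even m then 0 else 1) V 0 \<phi> (Suc n) (Suc n) v)"
    if v: "v \<in> carrier (dsum U (Suc n))" for v
  proof -
    have LU: "bar_op q U (- 1) \<Delta> (Suc n) n \<in> linear_maps K (dsum U (Suc n)) (dsum U n)" for q
      by (rule bar_op_linear[OF U U dU]) simp
    have "bar_op q V 0 \<phi> n n (bar_op q U (- 1) \<Delta> (Suc n) n v) =
        bar_op q V (- 1) \<Delta>' (Suc n) n (bar_op q V 0 \<phi> (Suc n) (Suc n) v)" for q
    proof -
      have "bar_op q V 0 \<phi> n n (bar_op q U (- 1) \<Delta> (Suc n) n v) =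
          bar_op q V (- 1) (conv V (- 1) (- 1) \<phi> \<Delta>) (Suc n) n v"
        by (rule bar_op_conv[OF U U V dU fam _ _ v]) auto
      also have "\<dots> = bar_op q V (- 1) (conv V 0 (- 1) \<Delta>' \<phi>) (Suc n) n v"
      proof (rule bar_op_cong[OF _ V v])
        show "is_family K U V (- 1) (conv V 0 (- 1) \<Delta>' \<phi>)"
          by (rule conv_family[OF fam dV _ cyclic_dataD(1)[OF U] cyclic_dataD(1)[OF V]]) simp
      qed (use comm in simp)
      also have "\<dots> = bar_op q V (- 1) \<Delta>' (Suc n) n (bar_op q V 0 \<phi> (Suc n) (Suc n) v)"
        by (rule bar_op_conv[OF U V V fam dV _ _ v, symmetric]) auto
      finally show ?thesis .
    qed
    then show ?thesis
      using lin_neg[OF dsum_module[OF U] dsum_module[OF V] L lin_closed[OF LU v]] by (simp add: cyc_d2_def)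
  qed
qed

text \<open>The bicomplex homotopy carries a sign in odd columns because the horizontal differential
  there is \<open>-b'\<close>.\<close>

definition cyc_hty where
  "cyc_hty V H n (m :: nat) v = (if even m then bar_op 0 V 1 H n (Suc n) v
     else \<ominus>\<^bsub>dsum V (Suc n)\<^esub> bar_op 1 V 1 H n (Suc n) v)"

text \<open>In the column \<open>n = 0\<close> the composite of \<open>h\<close> with the differential is missing from the bicomplex formula, but
it is zero as it factors through modules of total degree \<open>-1\<close>.\<close>

theorem cyclic_bicomplex_homotopy:
  assumes U: "cyclic_data K U T" and V: "cyclic_data K V T'"
    and dU: "is_family K U U (- 1) \<Delta>" and dV: "is_family K V V (- 1) \<Delta>'"
    and f: "is_family K U V 0 \<phi>" and g: "is_family K U V 0 \<psi>"
    and h: "is_family K U V 1 H" and cyc: "is_cyclic U T T' 1 H"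
    and eq: "\<And>n p S x. adm n S \<Longrightarrow> x \<in> carrier (U n p) \<Longrightarrow>
      conv V 1 0 \<Delta>' H S n p x \<oplus>\<^bsub>V (n - card S) p\<^esub> conv V (- 1) 0 H \<Delta> S n p x =
      \<phi> S n p x \<ominus>\<^bsub>V (n - card S) p\<^esub> \<psi> S n p x"
  shows "is_bicomplex_homotopy K (dsum U) (cyc_d1 U T) (cyc_d2 U \<Delta>) (dsum V) (cyc_d1 V T') (cyc_d2 V \<Delta>')
    (\<lambda>n m. bar_op (if even m then 0 else 1) V 0 \<phi> n n) (\<lambda>n m. bar_op (if even m then 0 else 1) V 0 \<psi> n n) (cyc_hty V H)"
proof -
  note mU = cyclic_dataD(1)[OF U] and mV = cyclic_dataD(1)[OF V]
  have L: "bar_op q V 1 H n (Suc n) \<in> linear_maps K (dsum U n) (dsum V (Suc n))" for q n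
    by (rule bar_op_linear[OF U V h]) simp
  have LU: "bar_op q U (- 1) \<Delta> (Suc n) n \<in> linear_maps K (dsum U (Suc n)) (dsum U n)" for q n
    by (rule bar_op_linear[OF U U dU]) simp
  have LV: "bar_op q V (- 1) \<Delta>' (Suc n) n \<in> linear_maps K (dsum V (Suc n)) (dsum V n)" for q n
    by (rule bar_op_linear[OF V V dV]) simp
  have c1: "is_family K U V 0 (conv V 1 0 \<Delta>' H)" by (rule conv_family[OF h dV _ mU mV]) simp
  have c2: "is_family K U V 0 (conv V (- 1) 0 H \<Delta>)" by (rule conv_family[OF dU h _ mU mV]) simp
  have sum: "bar_op q V 0 (conv V 1 0 \<Delta>' H) n n v \<oplus>\<^bsub>dsum V n\<^esub> bar_op q V 0 (conv V (- 1) 0 H \<Delta>) n n v =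
      bar_op q V 0 \<phi> n n v \<ominus>\<^bsub>dsum V n\<^esub> bar_op q V 0 \<psi> n n v" if v: "v \<in> carrier (dsum U n)" for q n v
  proof (rule dsum_eqI[where n = n])
    have lf: "bar_op q V 0 \<phi> n n v \<in> carrier (dsum V n)" by (rule lin_closed[OF bar_op_linear[OF U V f] v]) simp
    have lg: "bar_op q V 0 \<psi> n n v \<in> carrier (dsum V n)" by (rule lin_closed[OF bar_op_linear[OF U V g] v]) simp
    interpret C: module K "dsum V n" by (rule dsum_module[OF V])
    show "bar_op q V 0 \<phi> n n v \<ominus>\<^bsub>dsum V n\<^esub> bar_op q V 0 \<psi> n n v \<in> extensional {..n}"
      using dsum_ext C.M.minus_closed[OF lf lg] by blast
    show "bar_op q V 0 (conv V 1 0 \<Delta>' H) n n v \<oplus>\<^bsub>dsum V n\<^esub> bar_op q V 0 (conv V (- 1) 0 H \<Delta>) n n v \<in> extensional {..n}"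
      by (simp add: dsum_def)
    fix j assume j: "j \<le> n"
    interpret M: module K "V j (int n)" by (rule mV)
    have cl: "\<theta> S k (int n) (v k) \<in> carrier (V j (int n))" if "(k, S) \<in> bar_index q n j" "is_family K U V 0 \<theta>" for k S \<theta>
      using lin_closed[OF bar_comp_term[OF that(2,1)] dsum_component[OF v]] bar_index_adm[OF that(1)] by simp
    have "bar_comp q V 0 (conv V 1 0 \<Delta>' H) n (int n) v j \<oplus>\<^bsub>V j (int n)\<^esub> bar_comp q V 0 (conv V (- 1) 0 H \<Delta>) n (int n) v j =
      finsum (V j (int n)) (\<lambda>x. (case x of (k, S) \<Rightarrow> conv V 1 0 \<Delta>' H S k (int n) (v k)) \<oplus>\<^bsub>V j (int n)\<^esub>
         (case x of (k, S) \<Rightarrow> conv V (- 1) 0 H \<Delta> S k (int n) (v k))) (bar_index q n j)"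
      unfolding bar_comp_def add_0_right using cl c1 c2 by (intro M.M.finsum_addf[symmetric]) auto
    also have "\<dots> = finsum (V j (int n)) (\<lambda>x. (case x of (k, S) \<Rightarrow> \<phi> S k (int n) (v k)) \<ominus>\<^bsub>V j (int n)\<^esub>
         (case x of (k, S) \<Rightarrow> \<psi> S k (int n) (v k))) (bar_index q n j)"
    proof (rule M.M.finsum_cong')
      fix i assume i: "i \<in> bar_index q n j"
      obtain k S where kS: "i = (k, S)" by (cases i)
      show "(case i of (k, S) \<Rightarrow> conv V 1 0 \<Delta>' H S k (int n) (v k)) \<oplus>\<^bsub>V j (int n)\<^esub>
         (case i of (k, S) \<Rightarrow> conv V (- 1) 0 H \<Delta> S k (int n) (v k)) =
         (case i of (k, S) \<Rightarrow> \<phi> S k (int n) (v k)) \<ominus>\<^bsub>V j (int n)\<^esub> (case i of (k, S) \<Rightarrow> \<psi> S k (int n) (v k))"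
        using eq[of k S "v k" "int n"] bar_index_adm[of k S q n j] i kS dsum_component[OF v, of k] by simp
    qed (use cl f g in \<open>auto intro!: M.M.minus_closed\<close>)
    also have "\<dots> = bar_comp q V 0 \<phi> n (int n) v j \<ominus>\<^bsub>V j (int n)\<^esub> bar_comp q V 0 \<psi> n (int n) v j"
      unfolding bar_comp_def add_0_right using cl f g by (intro M.M.finsum_difference) auto
    finally show "(bar_op q V 0 (conv V 1 0 \<Delta>' H) n n v \<oplus>\<^bsub>dsum V n\<^esub> bar_op q V 0 (conv V (- 1) 0 H \<Delta>) n n v) j =
      (bar_op q V 0 \<phi> n n v \<ominus>\<^bsub>dsum V n\<^esub> bar_op q V 0 \<psi> n n v) j"
      using j dsum_minus[OF V lf lg j] by (simp add: bar_op_def dsum_def)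
  qed
  have e1: "bar_op q V (- 1) \<Delta>' (Suc n) n (bar_op q V 1 H n (Suc n) v) = bar_op q V 0 (conv V 1 0 \<Delta>' H) n n v"
    if v: "v \<in> carrier (dsum U n)" for q n v
    by (rule bar_op_conv[OF U V V h dV _ _ v]) auto
  have e2: "bar_op q V 1 H n (Suc n) (bar_op q U (- 1) \<Delta> (Suc n) n v) = bar_op q V 0 (conv V (- 1) 0 H \<Delta>) (Suc n) (Suc n) v"
    if v: "v \<in> carrier (dsum U (Suc n))" for q n v
    by (rule bar_op_conv[OF U U V dU h _ _ v]) auto
  have e0: "bar_op q V 0 (conv V (- 1) 0 H \<Delta>) 0 0 v = \<zero>\<^bsub>dsum V 0\<^esub>" if v: "v \<in> carrier (dsum U 0)" for q v
  proof (rule bar_op_zero[OF V v])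
    fix k S x assume S: "adm k S" and x: "x \<in> carrier (U k (int 0))"
    show "conv V (- 1) 0 H \<Delta> S k (int 0) x = \<zero>\<^bsub>V (k - card S) (int 0 + 0)\<^esub>"
    proof -
      interpret M: module K "V (k - card S) (int 0 + 0)" by (rule mV)
      have "H (hatn B ` (S - B)) (k - card B) (int 0 + - 1) (\<Delta> B k (int 0) x) = \<zero>\<^bsub>V (k - card S) (int 0 + 0)\<^esub>"
        if B: "B \<subseteq> S" for B
      proof -
        note r = adm_rest[OF S B]
        have "\<Delta> B k (int 0) x \<in> carrier (U (k - card B) (int 0 + - 1))"
          using lin_closed[OF family_lin[OF dU adm_subset[OF S B]] x] by simp
        then have "\<Delta> B k (int 0) x = \<zero>\<^bsub>U (k - card B) (int 0 + - 1)\<^esub>"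
          using cyclic_dataD(2)[OF U, of "int 0 + - 1" "k - card B"] by simp
        moreover have "H (hatn B ` (S - B)) (k - card B) (int 0 + - 1) \<in>
            linear_maps K (U (k - card B) (int 0 + - 1)) (V (k - card S) (int 0 + 0))"
          using r by (intro family_lin[OF h]) auto
        ultimately show ?thesis using lin_zero[OF mU mV] by metis
      qed
      then show ?thesis unfolding conv_def by (intro M.M.add.finprod_one_eqI) auto
    qed
  qed simp
  show ?thesis
    unfolding is_bicomplex_homotopy_def
  proof (intro conjI allI ballI)
    fix n m :: nat
    interpret C: module K "dsum V (Suc n)" by (rule dsum_module[OF V])
    interpret C0: module K "dsum V n" by (rule dsum_module[OF V])
    show "cyc_hty V H n m \<in> linear_maps K (dsum U n) (dsum V (Suc n))"
      unfolding cyc_hty_def[abs_def] using L[of _ n]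
      by (cases "even m") (auto intro!: lin_negate C.module_axioms)
    show "cyc_d1 V T' (Suc n) (Suc m) (cyc_hty V H n (Suc m) v) \<oplus>\<^bsub>dsum V (Suc n)\<^esub> cyc_hty V H n m (cyc_d1 U T n (Suc m) v) =
        \<zero>\<^bsub>dsum V (Suc n)\<^esub>" if v: "v \<in> carrier (dsum U n)" for v
    proof (cases "even m")
      case True
      let ?w = "bar_op 1 V 1 H n (Suc n) v"
      have w: "?w \<in> carrier (dsum V (Suc n))" by (rule lin_closed[OF L v])
      have D: "(\<lambda>v. v \<ominus>\<^bsub>dsum V (Suc n)\<^esub> cyc_T T' (Suc n) v) \<in> linear_maps K (dsum V (Suc n)) (dsum V (Suc n))"
        by (intro lin_difference C.module_axioms lin_id cyc_T_linear[OF V])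
      have "\<ominus>\<^bsub>dsum V (Suc n)\<^esub> ?w \<ominus>\<^bsub>dsum V (Suc n)\<^esub> cyc_T T' (Suc n) (\<ominus>\<^bsub>dsum V (Suc n)\<^esub> ?w) =
          \<ominus>\<^bsub>dsum V (Suc n)\<^esub> (?w \<ominus>\<^bsub>dsum V (Suc n)\<^esub> cyc_T T' (Suc n) ?w)"
        using lin_neg[OF C.module_axioms C.module_axioms D w] .
      moreover have "bar_op 0 V 1 H n (Suc n) (v \<ominus>\<^bsub>dsum U n\<^esub> cyc_T T n v) =
          ?w \<ominus>\<^bsub>dsum V (Suc n)\<^esub> cyc_T T' (Suc n) ?w"
        by (rule bar_op_one_minus[OF U V h cyc _ v]) simp
      ultimately show ?thesis
        using True C.M.l_neg lin_closed[OF D w] by (simp add: cyc_d1_def cyc_hty_def)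
    next
      case False
      have "bar_op 1 V 1 H n (Suc n) (cyc_N U T n v) = cyc_N V T' (Suc n) (bar_op 0 V 1 H n (Suc n) v)"
        by (rule bar_op_norm[OF U V h cyc _ v]) simp
      then show ?thesis
        using False C.M.r_neg lin_closed[OF cyc_N_linear[OF V] lin_closed[OF L v]]
        by (simp add: cyc_d1_def cyc_hty_def)
    qed
    have sq: "cyc_d2 V \<Delta>' (Suc n) m (cyc_hty V H n m v) = bar_op (if even m then 0 else 1) V 0 (conv V 1 0 \<Delta>' H) n n v"
      if v: "v \<in> carrier (dsum U n)" for n v
    proof -
      interpret C0: module K "dsum V n" by (rule dsum_module[OF V])
      have "bar_op q V 0 (conv V 1 0 \<Delta>' H) n n v \<in> carrier (dsum V n)" for q
        by (rule lin_closed[OF bar_op_linear[OF U V c1] v]) simp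
      then show ?thesis
        using e1[OF v] lin_neg[OF dsum_module[OF V] dsum_module[OF V] LV lin_closed[OF L v]]
          lin_closed[OF LV lin_closed[OF L v]]
        by (simp add: cyc_d2_def cyc_hty_def C0.M.minus_minus)
    qed
    show "cyc_d2 V \<Delta>' (Suc (Suc n)) m (cyc_hty V H (Suc n) m v) \<oplus>\<^bsub>dsum V (Suc n)\<^esub> cyc_hty V H n m (cyc_d2 U \<Delta> (Suc n) m v) =
        bar_op (if even m then 0 else 1) V 0 \<phi> (Suc n) (Suc n) v \<ominus>\<^bsub>dsum V (Suc n)\<^esub>
        bar_op (if even m then 0 else 1) V 0 \<psi> (Suc n) (Suc n) v" if v: "v \<in> carrier (dsum U (Suc n))" for v
    proof -
      have cl2: "bar_op q V 0 (conv V (- 1) 0 H \<Delta>) (Suc n) (Suc n) v \<in> carrier (dsum V (Suc n))" for q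
        by (rule lin_closed[OF bar_op_linear[OF U V c2] v]) simp
      have "cyc_hty V H n m (cyc_d2 U \<Delta> (Suc n) m v) = bar_op (if even m then 0 else 1) V 0 (conv V (- 1) 0 H \<Delta>) (Suc n) (Suc n) v"
        using e2[OF v] cl2 lin_neg[OF dsum_module[OF U] dsum_module[OF V] L lin_closed[OF LU v]]
          lin_closed[OF L lin_closed[OF LU v]]
        by (simp add: cyc_d2_def cyc_hty_def C.M.minus_minus)
      then show ?thesis using sq[OF v] sum[OF v] by simp
    qed
  next
    fix m :: nat and v assume v: "v \<in> carrier (dsum U 0)"
    interpret C0: module K "dsum V 0" by (rule dsum_module[OF V])
    have cl1: "bar_op q V 0 (conv V 1 0 \<Delta>' H) 0 0 v \<in> carrier (dsum V 0)" for q
      by (rule lin_closed[OF bar_op_linear[OF U V c1] v]) simp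
    have "cyc_d2 V \<Delta>' (Suc 0) m (cyc_hty V H 0 m v) = bar_op (if even m then 0 else 1) V 0 (conv V 1 0 \<Delta>' H) 0 0 v"
      using e1[OF v] cl1 lin_neg[OF dsum_module[OF V] dsum_module[OF V] LV lin_closed[OF L v]]
      by (simp add: cyc_d2_def cyc_hty_def C0.M.minus_minus)
    then show "cyc_d2 V \<Delta>' (Suc 0) m (cyc_hty V H 0 m v) =
        bar_op (if even m then 0 else 1) V 0 \<phi> 0 0 v \<ominus>\<^bsub>dsum V 0\<^esub> bar_op (if even m then 0 else 1) V 0 \<psi> 0 0 v"
      using sum[OF v] e0[OF v] cl1 by simp
  qed
qed

section \<open>Signed families\<close>

text \<open>The modules of a \<open>CF\<^sub>\<infinity>\<close>-module, indexed by simplicial degree and total degree.\<close>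

definition tgrd :: "('k, 'a) CF_module \<Rightarrow> nat \<Rightarrow> int \<Rightarrow> ('k, 'a) module" where
  "tgrd X n p = grd X n (p - int n)"

text \<open>The factor \<open>(-1)\<^bsup>\<Sum>S\<^esup>\<close> is the one that appears in the sums \<open>d\<^sub>q\<^sup>k\<close> and \<open>f\<^sub>q\<^sup>k\<close>.\<close>

definition signed ::
  "('k, 'b) CF_module \<Rightarrow> int \<Rightarrow> (nat list \<Rightarrow> nat \<Rightarrow> int \<Rightarrow> 'a \<Rightarrow> 'b) \<Rightarrow> nat set \<Rightarrow> nat \<Rightarrow> int \<Rightarrow> 'a \<Rightarrow> 'b" where
  "signed Y b \<phi> S n p x =
     [((-1 :: int) ^ \<Sum> S)] \<cdot>\<^bsub>tgrd Y (n - card S) (p + b)\<^esub> \<phi> (sl S) n (p - int n) x"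

definition list_family ::
  "('k, 'r) ring_scheme \<Rightarrow> ('k, 'a) CF_module \<Rightarrow> ('k, 'b) CF_module \<Rightarrow> int \<Rightarrow>
   (nat list \<Rightarrow> nat \<Rightarrow> int \<Rightarrow> 'a \<Rightarrow> 'b) \<Rightarrow> bool" where
  "list_family K X Y b \<phi> \<longleftrightarrow> (\<forall>n m I. tuple n I \<longrightarrow>
     \<phi> I n m \<in> linear_maps K (grd X n m) (grd Y (n - length I) (m + int (length I) + b)))"

text \<open>With \<open>d\<close> as the component at the empty tuple, the commutators \<open>d(\<phi>)\<close> become the two terms of a
convolution in which one block is empty.\<close>

definition dfac :: "('k, 'a) CF_module \<Rightarrow> nat list \<Rightarrow> nat \<Rightarrow> int \<Rightarrow> 'a \<Rightarrow> 'a" where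
  "dfac X I = (if I = [] then dif X else fac X I)"

definition signed_cyc :: "('k, 'a) CF_module \<Rightarrow> nat \<Rightarrow> int \<Rightarrow> 'a \<Rightarrow> 'a" where
  "signed_cyc X n p = T_map X n (p - int n)"

definition modules :: "('k, 'r) ring_scheme \<Rightarrow> ('k, 'a) CF_module \<Rightarrow> bool" where
  "modules K X \<longleftrightarrow> (\<forall>n m. module K (grd X n m))"

lemma modulesD: "modules K X \<Longrightarrow> module K (grd X n m)" "modules K X \<Longrightarrow> module K (tgrd X n p)"
  by (auto simp: modules_def tgrd_def)

lemma tuple_set:
  assumes "tuple n I"
  shows "adm n (set I)" "card (set I) = length I" "sl (set I) = I" "sorted_wrt (<) I" "length I \<le> n"
proof -
  show s: "sorted_wrt (<) I" and l: "length I \<le> n" using assms by (auto simp: tuple_def)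
  have "distinct I" using s by (simp add: strict_sorted_iff)
  then show c: "card (set I) = length I" by (rule distinct_card)
  show "adm n (set I)" using assms c by (auto simp: adm_def tuple_def)
  show "sl (set I) = I" using sorted_less_eq_sl[OF s] by simp
qed

lemma adm_sl:
  assumes "adm n S"
  shows "tuple n (sl S)" "length (sl S) = card S" "set (sl S) = S"
  using assms adm_finite[OF assms] by (auto simp: adm_def tuple_def)

lemma tgrd_index: "k \<le> n \<Longrightarrow> tgrd Y (n - k) (p + b) = grd Y (n - k) (p - int n + int k + b)"
  by (simp add: tgrd_def of_nat_diff algebra_simps)

lemma list_family_lin:
  "list_family K X Y b \<phi> \<Longrightarrow> tuple n I \<Longrightarrow> n' = n - length I \<Longrightarrow> m' = m + int (length I) + b \<Longrightarrow>
     \<phi> I n m \<in> linear_maps K (grd X n m) (grd Y n' m')"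
  by (auto simp: list_family_def)

lemma signed_eq:
  assumes "tuple n I"
  shows "signed Y b \<phi> (set I) n (m + int n) x =
    [((-1 :: int) ^ \<Sum> (set I))] \<cdot>\<^bsub>grd Y (n - length I) (m + int (length I) + b)\<^esub> \<phi> I n m x"
  using tuple_set[OF assms] by (simp add: signed_def tgrd_index)

lemma signed_family:
  assumes "modules K X" "modules K Y" "list_family K X Y b \<phi>"
  shows "is_family K (tgrd X) (tgrd Y) b (signed Y b \<phi>)"
  unfolding is_family_def
proof (intro allI impI)
  fix n p S assume S: "adm n S"
  have "\<phi> (sl S) n (p - int n) \<in> linear_maps K (tgrd X n p) (tgrd Y (n - card S) (p + b))"
    using S adm_sl[OF S] unfolding tgrd_def
    by (intro list_family_lin[OF assms(3)]) (auto simp: adm_def)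
  then show "signed Y b \<phi> S n p \<in> linear_maps K (tgrd X n p) (tgrd Y (n - card S) (p + b))"
    unfolding signed_def[abs_def] by (rule lin_comp[OF _ int_act_linear[OF modulesD(2)[OF assms(2)]]])
qed

lemma sign_square: "(-1 :: int) ^ k * (-1) ^ k = 1"
  by (simp flip: power_add)

lemma sign_act_cancel:
  fixes M :: "('k, 'a) module"
  assumes "module K M" "u \<in> carrier M" "v \<in> carrier M"
  shows "[((-1 :: int) ^ k)] \<cdot>\<^bsub>M\<^esub> u = [((-1 :: int) ^ k)] \<cdot>\<^bsub>M\<^esub> v \<longleftrightarrow> u = v"
proof
  assume "[((-1 :: int) ^ k)] \<cdot>\<^bsub>M\<^esub> u = [((-1 :: int) ^ k)] \<cdot>\<^bsub>M\<^esub> v"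
  then have "[((-1 :: int) ^ k)] \<cdot>\<^bsub>M\<^esub> ([((-1 :: int) ^ k)] \<cdot>\<^bsub>M\<^esub> u) =
      [((-1 :: int) ^ k)] \<cdot>\<^bsub>M\<^esub> ([((-1 :: int) ^ k)] \<cdot>\<^bsub>M\<^esub> v)" by simp
  then show "u = v" using assms by (simp only: int_act_act sign_square int_act_one)
qed simp

lemma sign_act_zero:
  fixes M :: "('k, 'a) module"
  assumes "module K M"
  shows "[(c :: int)] \<cdot>\<^bsub>M\<^esub> \<zero>\<^bsub>M\<^esub> = \<zero>\<^bsub>M\<^esub>"
  using lin_zero[OF assms assms int_act_linear[OF assms]] .

subsection \<open>Permutation sums as convolutions\<close>

lemma crossings_empty [simp]: "crossings A {} = 0" "crossings {} B = 0"
  by (auto simp: crossings_def)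

lemma perm_sum_Nil:
  assumes "abelian_group M" "\<phi> [] [] \<in> carrier M"
  shows "perm_sum M splits' 1 [] \<phi> = \<phi> [] []"
proof -
  interpret abelian_group M by fact
  show ?thesis
    using assms by (subst perm_sum_splits') (auto simp: finsum_insert add.int_pow_1)
qed

text \<open>Passing from \<open>I'\<^sub>\<sigma>\<close> to \<open>I\<^sub>\<sigma>\<close> removes the two cuts with an empty block, both of which belong to the identity
permutation.\<close>

lemma perm_sum_split:
  assumes M: "abelian_group M" and I: "sorted_wrt (<) I" "I \<noteq> []"
    and \<phi>: "\<And>B. B \<subseteq> set I \<Longrightarrow> \<phi> (sl (hatn B ` (set I - B))) (sl B) \<in> carrier M"
  shows "perm_sum M splits' 1 I \<phi> = \<phi> I [] \<oplus>\<^bsub>M\<^esub> \<phi> [] I \<oplus>\<^bsub>M\<^esub> perm_sum M splits 1 I \<phi>"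
proof -
  interpret abelian_group M by fact
  let ?S = "set I"
  let ?g = "\<lambda>B. [((1::int) * (-1) ^ crossings (?S - B) B)] \<cdot>\<^bsub>M\<^esub> \<phi> (sl (hatn B ` (?S - B))) (sl B)"
  have gc: "?g B \<in> carrier M" if "B \<subseteq> ?S" for B using \<phi>[OF that] by (rule add.int_pow_closed)
  have sl: "sl ?S = I" using sorted_less_eq_sl[OF I(1)] by simp
  have "Pow ?S = insert {} (insert ?S (Pow ?S - {{}, ?S}))" by auto
  then have "finsum M ?g (Pow ?S) = finsum M ?g (insert {} (insert ?S (Pow ?S - {{}, ?S})))" by simp
  also have "\<dots> = ?g {} \<oplus>\<^bsub>M\<^esub> (?g ?S \<oplus>\<^bsub>M\<^esub> finsum M ?g (Pow ?S - {{}, ?S}))"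
    using gc I by (subst finsum_insert, simp, simp, blast, blast)+ simp
  also have "?g {} = \<phi> I []" using \<phi>[of "{}"] sl by (simp add: add.int_pow_1)
  also have "?g ?S = \<phi> [] I" using \<phi>[of ?S] sl by (simp add: add.int_pow_1)
  finally show ?thesis
    using perm_sum_splits'[OF M I(1) I(1), of \<phi> 1] perm_sum_splits[OF M I(1), of \<phi> 1] \<phi> gc[of "{}"] gc[of ?S] sl
      \<phi>[of "{}"] \<phi>[of ?S] finsum_closed[of ?g "Pow ?S - {{}, ?S}"] gc
    by (simp add: a_assoc Pi_iff)
qed

lemma perm_sum_splits_neg:
  fixes M :: "('k, 'a) module"
  assumes M: "module K M" and I: "sorted_wrt (<) I"
    and \<phi>: "\<And>B. B \<subseteq> set I \<Longrightarrow> \<phi> (sl (hatn B ` (set I - B))) (sl B) \<in> carrier M"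
  shows "perm_sum M splits (-1) I \<phi> = \<ominus>\<^bsub>M\<^esub> perm_sum M splits 1 I \<phi>"
    "perm_sum M splits 1 I \<phi> \<in> carrier M"
proof -
  interpret M: module K M by fact
  let ?S = "set I"
  let ?g = "\<lambda>B. [((1::int) * (-1) ^ crossings (?S - B) B)] \<cdot>\<^bsub>M\<^esub> \<phi> (sl (hatn B ` (?S - B))) (sl B)"
  have gc: "?g B \<in> carrier M" if "B \<subseteq> ?S" for B using \<phi>[OF that] by (rule int_act_closed[OF M])
  have fc: "finsum M ?g (Pow ?S - {{}, ?S}) \<in> carrier M" using gc by (intro M.M.finsum_closed) auto
  have "perm_sum M splits (-1) I \<phi> = finsum M (\<lambda>B. [(-1::int)] \<cdot>\<^bsub>M\<^esub> ?g B) (Pow ?S - {{}, ?S})"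
    using \<phi> gc
    by (subst perm_sum_splits[OF M.M.abelian_group_axioms I])
       (auto simp: int_act_act[OF M] intro!: M.M.finsum_cong' int_act_closed[OF M])
  also have "\<dots> = \<ominus>\<^bsub>M\<^esub> finsum M ?g (Pow ?S - {{}, ?S})"
    using gc fc by (subst M.M.finsum_int_act) (auto simp: int_act_neg_one[OF M])
  finally show "perm_sum M splits (-1) I \<phi> = \<ominus>\<^bsub>M\<^esub> perm_sum M splits 1 I \<phi>"
    using perm_sum_splits[where \<phi> = \<phi> and c = 1, OF M.M.abelian_group_axioms I \<phi>] by simp
  show "perm_sum M splits 1 I \<phi> \<in> carrier M"
    using fc perm_sum_splits[where \<phi> = \<phi> and c = 1, OF M.M.abelian_group_axioms I \<phi>] by simp
qed

lemma perm_sum_splits_add: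
  fixes M :: "('k, 'a) module"
  assumes M: "module K M" and I: "sorted_wrt (<) I"
    and \<phi>: "\<And>B. B \<subseteq> set I \<Longrightarrow> \<phi> (sl (hatn B ` (set I - B))) (sl B) \<in> carrier M"
    and \<psi>: "\<And>B. B \<subseteq> set I \<Longrightarrow> \<psi> (sl (hatn B ` (set I - B))) (sl B) \<in> carrier M"
  shows "perm_sum M splits 1 I (\<lambda>A B. \<phi> A B \<oplus>\<^bsub>M\<^esub> \<psi> A B) = perm_sum M splits 1 I \<phi> \<oplus>\<^bsub>M\<^esub> perm_sum M splits 1 I \<psi>"
    "perm_sum M splits 1 I (\<lambda>A B. \<phi> A B \<ominus>\<^bsub>M\<^esub> \<psi> A B) = perm_sum M splits 1 I \<phi> \<ominus>\<^bsub>M\<^esub> perm_sum M splits 1 I \<psi>"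
proof -
  interpret M: module K M by fact
  note ag = M.M.abelian_group_axioms
  have p\<phi>: "perm_sum M splits 1 I \<phi> = (\<Oplus>\<^bsub>M\<^esub>B \<in> Pow (set I) - {{}, set I}.
      [((1 :: int) * (-1) ^ crossings (set I - B) B)] \<cdot>\<^bsub>M\<^esub> \<phi> (sl (hatn B ` (set I - B))) (sl B))"
    by (rule perm_sum_splits[OF ag I], erule \<phi>)
  have p\<psi>: "perm_sum M splits 1 I \<psi> = (\<Oplus>\<^bsub>M\<^esub>B \<in> Pow (set I) - {{}, set I}.
      [((1 :: int) * (-1) ^ crossings (set I - B) B)] \<cdot>\<^bsub>M\<^esub> \<psi> (sl (hatn B ` (set I - B))) (sl B))"
    by (rule perm_sum_splits[OF ag I], erule \<psi>)
  have cl: "[(c :: int)] \<cdot>\<^bsub>M\<^esub> \<phi> (sl (hatn B ` (set I - B))) (sl B) \<in> carrier M"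
    "[(c :: int)] \<cdot>\<^bsub>M\<^esub> \<psi> (sl (hatn B ` (set I - B))) (sl B) \<in> carrier M" if "B \<subseteq> set I" for B c
    using \<phi>[OF that] \<psi>[OF that] by (auto intro: int_act_closed[OF M])
  have "perm_sum M splits 1 I (\<lambda>A B. \<phi> A B \<oplus>\<^bsub>M\<^esub> \<psi> A B) = (\<Oplus>\<^bsub>M\<^esub>B \<in> Pow (set I) - {{}, set I}.
      [((1 :: int) * (-1) ^ crossings (set I - B) B)] \<cdot>\<^bsub>M\<^esub> \<phi> (sl (hatn B ` (set I - B))) (sl B) \<oplus>\<^bsub>M\<^esub>
      [((1 :: int) * (-1) ^ crossings (set I - B) B)] \<cdot>\<^bsub>M\<^esub> \<psi> (sl (hatn B ` (set I - B))) (sl B))"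
  proof -
    have "perm_sum M splits 1 I (\<lambda>A B. \<phi> A B \<oplus>\<^bsub>M\<^esub> \<psi> A B) = (\<Oplus>\<^bsub>M\<^esub>B \<in> Pow (set I) - {{}, set I}.
        [((1 :: int) * (-1) ^ crossings (set I - B) B)] \<cdot>\<^bsub>M\<^esub>
          (\<phi> (sl (hatn B ` (set I - B))) (sl B) \<oplus>\<^bsub>M\<^esub> \<psi> (sl (hatn B ` (set I - B))) (sl B)))"
      by (rule perm_sum_splits[OF ag I]) (use \<phi> \<psi> in auto)
    then show ?thesis
      by (rule trans, intro M.M.finsum_cong') (use \<phi> \<psi> cl in \<open>auto simp: int_act_add[OF M]\<close>)
  qed
  also have "\<dots> = perm_sum M splits 1 I \<phi> \<oplus>\<^bsub>M\<^esub> perm_sum M splits 1 I \<psi>"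
    unfolding p\<phi> p\<psi>
    by (rule M.M.finsum_addf) (use cl in auto)
  finally show "perm_sum M splits 1 I (\<lambda>A B. \<phi> A B \<oplus>\<^bsub>M\<^esub> \<psi> A B) = perm_sum M splits 1 I \<phi> \<oplus>\<^bsub>M\<^esub> perm_sum M splits 1 I \<psi>" .
  have "perm_sum M splits 1 I (\<lambda>A B. \<phi> A B \<ominus>\<^bsub>M\<^esub> \<psi> A B) = (\<Oplus>\<^bsub>M\<^esub>B \<in> Pow (set I) - {{}, set I}.
      [((1 :: int) * (-1) ^ crossings (set I - B) B)] \<cdot>\<^bsub>M\<^esub> \<phi> (sl (hatn B ` (set I - B))) (sl B) \<ominus>\<^bsub>M\<^esub>
      [((1 :: int) * (-1) ^ crossings (set I - B) B)] \<cdot>\<^bsub>M\<^esub> \<psi> (sl (hatn B ` (set I - B))) (sl B))"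
    using \<phi> \<psi> cl
    by (subst perm_sum_splits[OF ag I])
       (auto simp: lin_minus[OF M M int_act_linear[OF M]] intro!: M.M.finsum_cong')
  also have "\<dots> = perm_sum M splits 1 I \<phi> \<ominus>\<^bsub>M\<^esub> perm_sum M splits 1 I \<psi>"
    unfolding p\<phi> p\<psi>
    by (rule M.M.finsum_difference) (use cl in auto)
  finally show "perm_sum M splits 1 I (\<lambda>A B. \<phi> A B \<ominus>\<^bsub>M\<^esub> \<psi> A B) = perm_sum M splits 1 I \<phi> \<ominus>\<^bsub>M\<^esub> perm_sum M splits 1 I \<psi>" .
qed

lemma perm_sum_splits_cong:
  assumes M: "abelian_group M" and I: "sorted_wrt (<) I"
    and \<phi>: "\<And>B. B \<subseteq> set I \<Longrightarrow> \<phi> (sl (hatn B ` (set I - B))) (sl B) \<in> carrier M"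
    and eq: "\<And>A B. A \<noteq> [] \<Longrightarrow> B \<noteq> [] \<Longrightarrow> \<psi> A B = \<phi> A B"
  shows "perm_sum M splits c I \<psi> = perm_sum M splits c I \<phi>"
proof -
  interpret abelian_group M by fact
  have e: "\<psi> (sl (hatn B ` (set I - B))) (sl B) = \<phi> (sl (hatn B ` (set I - B))) (sl B)"
    if B: "B \<in> Pow (set I) - {{}, set I}" for B
  proof (rule eq)
    have "finite B" using B finite_subset by auto
    then show "sl (hatn B ` (set I - B)) \<noteq> []" "sl B \<noteq> []" using B by auto
  qed
  have "perm_sum M splits c I \<psi> = (\<Oplus>\<^bsub>M\<^esub>B \<in> Pow (set I) - {{}, set I}.
    [(c * (-1) ^ crossings (set I - B) B)] \<cdot>\<^bsub>M\<^esub> \<psi> (sl (hatn B ` (set I - B))) (sl B))"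
    by (rule perm_sum_eq_subsets[OF M I bij_betw_splits_proper[OF I]])
       (use e \<phi> in \<open>auto simp: splits_def\<close>)
  also have "\<dots> = (\<Oplus>\<^bsub>M\<^esub>B \<in> Pow (set I) - {{}, set I}.
    [(c * (-1) ^ crossings (set I - B) B)] \<cdot>\<^bsub>M\<^esub> \<phi> (sl (hatn B ` (set I - B))) (sl B))"
    using e \<phi> by (intro finsum_cong') (auto intro!: add.int_pow_closed)
  also have "\<dots> = perm_sum M splits c I \<phi>"
    using perm_sum_splits[where \<phi> = \<phi>, OF M I \<phi>] by simp
  finally show ?thesis .
qed

text \<open>The degree \<open>b\<close> of \<open>f\<close> fixes where \<open>g\<close> has to start. For \<open>\<partial>\<close>, morphisms and homotopies this is the summand
  of the sums over cuts in the structure equations.\<close>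

definition comp_term where
  "comp_term g f n m b x A B = g A (n - length B) (m + int (length B) + b) (f B n (m :: int) x)"

lemma comp_term_closed:
  assumes f: "list_family K X Y b f" and g: "list_family K Y Z a g" and c: "c = a + b"
    and I: "tuple n I" and x: "x \<in> carrier (grd X n m)" and B: "B \<subseteq> set I"
  shows "comp_term g f n m b x (sl (hatn B ` (set I - B))) (sl B) \<in>
    carrier (grd Z (n - length I) (m + int (length I) + c))"
proof -
  note t = tuple_set[OF I]
  have aB: "adm n B" using adm_subset[OF t(1) B] .
  note sB = adm_sl[OF aB] and r = adm_rest[OF t(1) B]
  note sA = adm_sl[OF r(1)]
  have le: "card B \<le> length I" using B t(2) by (metis List.finite_set card_mono)
  have y: "f (sl B) n m x \<in> carrier (grd Y (n - length (sl B)) (m + int (length (sl B)) + b))"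
    by (rule lin_closed[OF list_family_lin[OF f sB(1) refl refl] x])
  have "g (sl (hatn B ` (set I - B))) (n - length (sl B)) (m + int (length (sl B)) + b) \<in>
    linear_maps K (grd Y (n - length (sl B)) (m + int (length (sl B)) + b))
      (grd Z (n - length I) (m + int (length I) + c))"
    using sA sB r t le c by (intro list_family_lin[OF g]) (auto simp: of_nat_diff)
  then show ?thesis unfolding comp_term_def using y by (rule lin_closed)
qed

text \<open>The sign \<open>(-1)\<^bsup>\<Sum>S\<^esup>\<close> times the sign of the unshuffle is the product of the signs of the two factors.\<close>

lemma perm_sum_conv:
  assumes mods: "modules K X" "modules K Y" "modules K Z"
    and f: "list_family K X Y b f" and g: "list_family K Y Z a g" and c: "c = a + b"
    and I: "tuple n I" and x: "x \<in> carrier (grd X n m)"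
  defines "M \<equiv> grd Z (n - length I) (m + int (length I) + c)"
  shows "conv (tgrd Z) b c (signed Z a g) (signed Y b f) (set I) n (m + int n) x =
    [((-1 :: int) ^ \<Sum> (set I))] \<cdot>\<^bsub>M\<^esub> perm_sum M splits' 1 I (comp_term g f n m b x)"
proof -
  let ?S = "set I" and ?\<phi> = "comp_term g f n m b x"
  note t = tuple_set[OF I]
  have M: "module K M" unfolding M_def by (rule modulesD(1)[OF mods(3)])
  interpret M: module K M by (rule M)
  have GM: "tgrd Z (n - card ?S) (m + int n + c) = M" using t by (simp add: M_def tgrd_index)
  have \<phi>: "?\<phi> (sl (hatn B ` (?S - B))) (sl B) \<in> carrier M" if "B \<subseteq> ?S" for B
    unfolding M_def by (rule comp_term_closed[OF f g c I x that])
  have tm: "signed Z a g (hatn B ` (?S - B)) (n - card B) (m + int n + b) (signed Y b f B n (m + int n) x) =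
      [((-1 :: int) ^ \<Sum> ?S)] \<cdot>\<^bsub>M\<^esub> ([(1 * (-1 :: int) ^ crossings (?S - B) B)] \<cdot>\<^bsub>M\<^esub> ?\<phi> (sl (hatn B ` (?S - B))) (sl B))"
    if B: "B \<subseteq> ?S" for B
  proof -
    let ?A = "hatn B ` (?S - B)"
    have aB: "adm n B" using adm_subset[OF t(1) B] .
    note sB = adm_sl[OF aB] and r = adm_rest[OF t(1) B]
    note sA = adm_sl[OF r(1)]
    have Bn: "card B \<le> n" using aB by (simp add: adm_def)
    have idx: "m + int n + b - int (n - card B) = m + int (card B) + b" using Bn by (simp add: of_nat_diff)
    have G2: "tgrd Z (n - card B - card ?A) (m + int n + b + a) = M"
      using r GM c by (simp add: add.assoc add.commute)
    let ?y = "f (sl B) n m x" and ?g = "g (sl ?A) (n - card B) (m + int (card B) + b)"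
    have N: "module K (grd Y (n - card B) (m + int (card B) + b))" by (rule modulesD(1)[OF mods(2)])
    have y: "?y \<in> carrier (grd Y (n - card B) (m + int (card B) + b))"
      using lin_closed[OF list_family_lin[OF f sB(1) refl refl] x] sB by simp
    have gl: "?g \<in> linear_maps K (grd Y (n - card B) (m + int (card B) + b)) M"
    proof -
      have "card B \<le> length I" using B t(2) by (metis List.finite_set card_mono)
      then show ?thesis
        unfolding M_def using sA sB r t c by (intro list_family_lin[OF g]) (auto simp: of_nat_diff)
    qed
    have gy: "?g ?y \<in> carrier M" using lin_closed[OF gl y] .
    have "signed Z a g ?A (n - card B) (m + int n + b) (signed Y b f B n (m + int n) x) =
        [((-1 :: int) ^ \<Sum> ?A)] \<cdot>\<^bsub>M\<^esub> ?g ([((-1 :: int) ^ \<Sum> B)] \<cdot>\<^bsub>grd Y (n - card B) (m + int (card B) + b)\<^esub> ?y)"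
      unfolding signed_def[of Z] G2 unfolding signed_def idx using Bn by (simp add: tgrd_index)
    also have "\<dots> = [((-1 :: int) ^ \<Sum> ?A * (-1) ^ \<Sum> B)] \<cdot>\<^bsub>M\<^esub> ?g ?y"
      using gy by (simp add: lin_int_act[OF N M gl y] int_act_act[OF M])
    also have "(-1 :: int) ^ \<Sum> ?A * (-1) ^ \<Sum> B = (-1) ^ \<Sum> ?S * (1 * (-1) ^ crossings (?S - B) B)"
      using crossings_sign[OF _ B] by simp
    also have "[\<dots>] \<cdot>\<^bsub>M\<^esub> ?g ?y = [((-1 :: int) ^ \<Sum> ?S)] \<cdot>\<^bsub>M\<^esub> ([(1 * (-1 :: int) ^ crossings (?S - B) B)] \<cdot>\<^bsub>M\<^esub> ?g ?y)"
      using gy by (simp add: int_act_act[OF M])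
    also have "?g ?y = ?\<phi> (sl ?A) (sl B)" using sB by (simp add: comp_term_def)
    finally show ?thesis .
  qed
  have "conv (tgrd Z) b c (signed Z a g) (signed Y b f) ?S n (m + int n) x =
      (\<Oplus>\<^bsub>M\<^esub>B \<in> Pow ?S. [((-1 :: int) ^ \<Sum> ?S)] \<cdot>\<^bsub>M\<^esub>
        ([(1 * (-1 :: int) ^ crossings (?S - B) B)] \<cdot>\<^bsub>M\<^esub> ?\<phi> (sl (hatn B ` (?S - B))) (sl B)))"
    unfolding conv_def GM using tm \<phi>
    by (intro M.M.finsum_cong') (auto intro!: int_act_closed[OF M])
  also have "\<dots> = [((-1 :: int) ^ \<Sum> ?S)] \<cdot>\<^bsub>M\<^esub>
      (\<Oplus>\<^bsub>M\<^esub>B \<in> Pow ?S. [(1 * (-1 :: int) ^ crossings (?S - B) B)] \<cdot>\<^bsub>M\<^esub> ?\<phi> (sl (hatn B ` (?S - B))) (sl B))"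
    using \<phi> by (intro M.M.finsum_int_act) (auto intro!: int_act_closed[OF M])
  also have "(\<Oplus>\<^bsub>M\<^esub>B \<in> Pow ?S. [(1 * (-1 :: int) ^ crossings (?S - B) B)] \<cdot>\<^bsub>M\<^esub> ?\<phi> (sl (hatn B ` (?S - B))) (sl B)) =
      perm_sum M splits' 1 I ?\<phi>"
    using perm_sum_splits'[where \<phi> = ?\<phi> and c = 1, OF M.M.abelian_group_axioms t(4) t(4)] \<phi> by simp
  finally show ?thesis .
qed

lemma perm_sum_comp_closed:
  assumes mods: "modules K Z" and f: "list_family K X Y b f" and g: "list_family K Y Z a g" and c: "c = a + b"
    and I: "tuple n I" and x: "x \<in> carrier (grd X n m)"
  defines "M \<equiv> grd Z (n - length I) (m + int (length I) + c)"
  shows "perm_sum M splits' 1 I (comp_term g f n m b x) \<in> carrier M"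
proof -
  have M: "module K M" unfolding M_def by (rule modulesD(1)[OF mods])
  interpret M: module K M by (rule M)
  note t = tuple_set[OF I]
  have \<phi>: "comp_term g f n m b x (sl (hatn B ` (set I - B))) (sl B) \<in> carrier M" if "B \<subseteq> set I" for B
    unfolding M_def by (rule comp_term_closed[OF f g c I x that])
  show ?thesis
    using \<phi> perm_sum_splits'[where \<phi> = "comp_term g f n m b x" and c = 1, OF M.M.abelian_group_axioms t(4) t(4)]
    by (auto intro!: M.M.finsum_closed int_act_closed[OF M])
qed

subsection \<open>The structure equations\<close>

lemma (in abelian_group) square_rearrange:
  assumes "u \<in> carrier G" "v \<in> carrier G" "P \<in> carrier G" "u \<ominus> (\<ominus> v) = \<ominus> P"
  shows "v \<oplus> u \<oplus> P = \<zero>"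
proof -
  have "v \<oplus> u = u \<ominus> (\<ominus> v)" using assms(1,2) by (simp add: minus_eq a_comm)
  then show ?thesis using assms by (simp add: l_neg)
qed

lemma (in abelian_group) morphism_rearrange:
  assumes "D \<in> carrier G" "E \<in> carrier G" "P \<in> carrier G" "Q \<in> carrier G" "R \<in> carrier G" "R' \<in> carrier G"
  shows "D \<ominus> E = (\<ominus> P) \<oplus> Q \<oplus> \<ominus> (R \<ominus> R') \<longleftrightarrow> P \<oplus> D \<oplus> R = E \<oplus> Q \<oplus> R'"
proof -
  have "(\<ominus> P) \<oplus> Q \<oplus> \<ominus> (R \<ominus> R') = (Q \<oplus> R') \<ominus> (P \<oplus> R)"
    using assms by (simp add: minus_eq minus_add a_ac)
  then have "D \<ominus> E = (\<ominus> P) \<oplus> Q \<oplus> \<ominus> (R \<ominus> R') \<longleftrightarrow> D = E \<oplus> ((Q \<oplus> R') \<ominus> (P \<oplus> R))"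
    using assms by (simp add: minus_eq_iff)
  also have "E \<oplus> ((Q \<oplus> R') \<ominus> (P \<oplus> R)) = (E \<oplus> Q \<oplus> R') \<ominus> (P \<oplus> R)"
    using assms by (simp add: minus_eq a_assoc)
  also have "D = (E \<oplus> Q \<oplus> R') \<ominus> (P \<oplus> R) \<longleftrightarrow> (E \<oplus> Q \<oplus> R') \<ominus> (P \<oplus> R) = D" by auto
  also have "\<dots> \<longleftrightarrow> E \<oplus> Q \<oplus> R' = P \<oplus> R \<oplus> D" using assms by (intro minus_eq_iff) auto
  also have "P \<oplus> R \<oplus> D = P \<oplus> D \<oplus> R" using assms by (simp add: a_ac)
  finally show ?thesis by auto
qed

lemma (in abelian_group) homotopy_rearrange:
  assumes "u \<in> carrier G" "v \<in> carrier G" "w \<in> carrier G" "a \<in> carrier G" "c \<in> carrier G" "R \<in> carrier G" "R' \<in> carrier G"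
    and eq: "u \<ominus> (\<ominus> v) = (w \<ominus> a \<ominus> c) \<oplus> \<ominus> (R \<oplus> R')"
  shows "(a \<oplus> u \<oplus> R) \<oplus> (v \<oplus> c \<oplus> R') = w"
proof -
  define q where "q = a \<oplus> c \<oplus> (R \<oplus> R')"
  have q: "q \<in> carrier G" using assms by (simp add: q_def)
  have "(w \<ominus> a \<ominus> c) \<oplus> \<ominus> (R \<oplus> R') = w \<ominus> q"
    using assms by (simp add: q_def minus_eq minus_add a_assoc)
  moreover have "u \<ominus> (\<ominus> v) = u \<oplus> v" using assms by (simp add: minus_eq)
  ultimately have uv: "u \<oplus> v = w \<ominus> q" using eq by simp
  have "(a \<oplus> u \<oplus> R) \<oplus> (v \<oplus> c \<oplus> R') = (u \<oplus> v) \<oplus> q"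
    using assms(1-7) by (simp add: q_def a_ac)
  also have "\<dots> = w" unfolding uv using q assms by (simp add: minus_eq a_assoc l_neg)
  finally show ?thesis .
qed

lemma dfac_simps [simp]: "dfac X [] = dif X" "I \<noteq> [] \<Longrightarrow> dfac X I = fac X I"
  by (simp_all add: dfac_def)

lemma F_module_modules: "is_F_module K X \<Longrightarrow> modules K X"
  by (auto simp: is_F_module_def is_diff_module_def modules_def)

lemma F_module_dfac:
  assumes "is_F_module K X"
  shows "list_family K X X (- 1) (dfac X)"
  using assms unfolding list_family_def is_F_module_def is_diff_module_def
  by (auto simp: dfac_def)

text \<open>The degree of \<open>\<partial>\<^sub>I\<close> is odd, so \<open>d(\<partial>\<^sub>I) = d \<partial>\<^sub>I + \<partial>\<^sub>I d\<close>; moved to the other side, the right-hand side of the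
structure equation completes these two terms to the full sum over cuts.\<close>

lemma F_module_square:
  assumes X: "is_F_module K X" and I: "tuple n I" and x: "x \<in> carrier (grd X n m)"
  shows "perm_sum (grd X (n - length I) (m + int (length I) - 2)) splits' 1 I (comp_term (dfac X) (dfac X) n m (- 1) x) =
    \<zero>\<^bsub>grd X (n - length I) (m + int (length I) - 2)\<^esub>"
proof -
  let ?k = "length I" and ?\<phi> = "comp_term (dfac X) (dfac X) n m (- 1) x"
  let ?M = "grd X (n - ?k) (m + int ?k - 2)"
  note mods = F_module_modules[OF X] and fam = F_module_dfac[OF X] and t = tuple_set[OF I]
  have M: "module K ?M" by (rule modulesD(1)[OF mods])
  interpret M: module K ?M by (rule M)
  note ag = M.M.abelian_group_axioms
  have \<phi>: "?\<phi> (sl (hatn B ` (set I - B))) (sl B) \<in> carrier ?M" if "B \<subseteq> set I" for B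
    using comp_term_closed[OF fam fam _ I x that, of "- 2"] by simp
  show ?thesis
  proof (cases "I = []")
    case True
    have "?\<phi> [] [] = \<zero>\<^bsub>grd X n (m - 2)\<^esub>"
      using X x by (simp add: comp_term_def is_F_module_def is_diff_module_def)
    then show ?thesis using True perm_sum_Nil[OF ag, of ?\<phi>] \<phi>[of "{}"] by simp
  next
    case False
    let ?u = "dif X (n - ?k) (m + int ?k - 1) (fac X I n m x)" and ?v = "fac X I n (m - 1) (dif X n m x)"
    have uv: "?\<phi> I [] = ?v" "?\<phi> [] I = ?u" using False by (simp_all add: comp_term_def)
    have cl: "?u \<in> carrier ?M" "?v \<in> carrier ?M"
      using \<phi>[of "{}"] \<phi>[of "set I"] t(3) uv by auto
    note P = perm_sum_splits_neg[where \<phi> = ?\<phi>, OF M t(4) \<phi>]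
    have odd: "\<not> even (int (n - ?k) - int n + (int ?k - 1))" using t(5) by (simp add: of_nat_diff)
    have "hom_diff X X n (n - ?k) (int ?k - 1) (fac X I n) m x = perm_sum ?M splits (- 1) I
          (\<lambda>A B. fac X A (n - length B) (m + int (length B) - 1) (fac X B n m x))"
      using X I False x unfolding is_F_module_def by blast
    also have "\<dots> = perm_sum ?M splits (- 1) I ?\<phi>"
      by (rule perm_sum_splits_cong[where \<phi> = ?\<phi>, OF ag t(4) \<phi>]) (auto simp: comp_term_def)
    also have "hom_diff X X n (n - ?k) (int ?k - 1) (fac X I n) m x = ?u \<ominus>\<^bsub>?M\<^esub> (\<ominus>\<^bsub>?M\<^esub> ?v)"
    proof -
      have i: "m + (int ?k - 1) = m + int ?k - 1" "m + int ?k - 1 - 1 = m + int ?k - 2" by simp_all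
      show ?thesis unfolding hom_diff_def i using odd cl(2) by (simp add: int_act_neg_one[OF M])
    qed
    finally have "?u \<ominus>\<^bsub>?M\<^esub> (\<ominus>\<^bsub>?M\<^esub> ?v) = \<ominus>\<^bsub>?M\<^esub> perm_sum ?M splits 1 I ?\<phi>"
      using P(1) by simp
    then have "?v \<oplus>\<^bsub>?M\<^esub> ?u \<oplus>\<^bsub>?M\<^esub> perm_sum ?M splits 1 I ?\<phi> = \<zero>\<^bsub>?M\<^esub>"
      using cl P(2) by (intro M.M.square_rearrange)
    then show ?thesis using perm_sum_split[where \<phi> = ?\<phi>, OF ag t(4) False \<phi>] uv by simp
  qed
qed

text \<open>The equivalence, and not just one implication, is needed: it is read forwards for given morphisms and
backwards to see that composites and identities are morphisms.\<close>

lemma F_morphism_iff: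
  assumes X: "is_F_module K X" and Y: "is_F_module K Y"
  shows "is_F_morphism K X Y f \<longleftrightarrow> list_family K X Y 0 f \<and>
    (\<forall>n m I. \<forall>x \<in> carrier (grd X n m). tuple n I \<longrightarrow>
      perm_sum (grd Y (n - length I) (m + int (length I) - 1)) splits' 1 I (comp_term (dfac Y) f n m 0 x) =
      perm_sum (grd Y (n - length I) (m + int (length I) - 1)) splits' 1 I (comp_term f (dfac X) n m (- 1) x))"
    (is "_ \<longleftrightarrow> _ \<and> ?eqs")
proof (cases "list_family K X Y 0 f")
  case False
  then show ?thesis by (auto simp: is_F_morphism_def list_family_def)
next
  case f: True
  note dX = F_module_dfac[OF X] and dY = F_module_dfac[OF Y] and mods = F_module_modules[OF Y]
  define E where "E n m I x \<longleftrightarrow>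
      perm_sum (grd Y (n - length I) (m + int (length I) - 1)) splits' 1 I (comp_term (dfac Y) f n m 0 x) =
      perm_sum (grd Y (n - length I) (m + int (length I) - 1)) splits' 1 I (comp_term f (dfac X) n m (- 1) x)"
    for n m I x
  have cl1: "comp_term (dfac Y) f n m 0 x (sl (hatn B ` (set I - B))) (sl B) \<in> carrier (grd Y (n - length I) (m + int (length I) - 1))"
    and cl2: "comp_term f (dfac X) n m (- 1) x (sl (hatn B ` (set I - B))) (sl B) \<in> carrier (grd Y (n - length I) (m + int (length I) - 1))"
    if "tuple n I" "x \<in> carrier (grd X n m)" "B \<subseteq> set I" for n m I B x
    using comp_term_closed[OF f dY _ that, of "- 1"] comp_term_closed[OF dX f _ that, of "- 1"] by auto
  have nil: "E n m [] x \<longleftrightarrow> hom_diff X Y n n 0 (f [] n) m x = \<zero>\<^bsub>grd Y n (m - 1)\<^esub>"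
    if x: "x \<in> carrier (grd X n m)" for n m x
  proof -
    have tup: "tuple n []" by (simp add: tuple_def)
    have M: "module K (grd Y n (m - 1))" by (rule modulesD(1)[OF mods])
    interpret M: module K "grd Y n (m - 1)" by (rule M)
    note c = cl1[OF tup x, of "{}"] cl2[OF tup x, of "{}"]
    show ?thesis
      using perm_sum_Nil[OF M.M.abelian_group_axioms, of "comp_term (dfac Y) f n m 0 x"]
        perm_sum_Nil[OF M.M.abelian_group_axioms, of "comp_term f (dfac X) n m (- 1) x"] c
      by (simp add: E_def comp_term_def hom_diff_def M.M.minus_eq_zero_iff)
  qed
  have cons: "E n m I x \<longleftrightarrow> (let k = length I; M = grd Y (n - k) (m + int k - 1) in
         hom_diff X Y n (n - k) (int k) (f I n) m x =
         (\<ominus>\<^bsub>M\<^esub> fac Y I n m (f [] n m x))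
         \<oplus>\<^bsub>M\<^esub> f [] (n - k) (m + int k - 1) (fac X I n m x)
         \<oplus>\<^bsub>M\<^esub> perm_sum M splits (- 1) I (\<lambda>A B.
             fac Y A (n - length B) (m + int (length B)) (f B n m x)
             \<ominus>\<^bsub>M\<^esub> f A (n - length B) (m + int (length B) - 1) (fac X B n m x)))"
    if I: "tuple n I" "I \<noteq> []" and x: "x \<in> carrier (grd X n m)" for n m I x
  proof -
    let ?k = "length I" and ?\<phi> = "comp_term (dfac Y) f n m 0 x" and ?\<psi> = "comp_term f (dfac X) n m (- 1) x"
    let ?M = "grd Y (n - ?k) (m + int ?k - 1)"
    note t = tuple_set[OF I(1)]
    have M: "module K ?M" by (rule modulesD(1)[OF mods])
    interpret M: module K ?M by (rule M)
    note ag = M.M.abelian_group_axioms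
    note \<phi> = cl1[OF I(1) x] and \<psi> = cl2[OF I(1) x]
    let ?D = "dif Y (n - ?k) (m + int ?k) (f I n m x)" and ?E = "f I n (m - 1) (dif X n m x)"
    let ?P = "fac Y I n m (f [] n m x)" and ?Q = "f [] (n - ?k) (m + int ?k - 1) (fac X I n m x)"
    have v: "?\<phi> I [] = ?P" "?\<phi> [] I = ?D" "?\<psi> I [] = ?E" "?\<psi> [] I = ?Q"
      using I by (simp_all add: comp_term_def)
    have c: "?P \<in> carrier ?M" "?D \<in> carrier ?M" "?E \<in> carrier ?M" "?Q \<in> carrier ?M"
      using \<phi>[of "{}"] \<phi>[of "set I"] \<psi>[of "{}"] \<psi>[of "set I"] t(3) v by auto
    have ev: "even (int (n - ?k) - int n + int ?k)" using t(5) by (simp add: of_nat_diff)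
    have diff: "?\<phi> (sl (hatn B ` (set I - B))) (sl B) \<ominus>\<^bsub>?M\<^esub> ?\<psi> (sl (hatn B ` (set I - B))) (sl B) \<in> carrier ?M"
      if "B \<subseteq> set I" for B using \<phi>[OF that] \<psi>[OF that] by (rule M.M.minus_closed)
    have "perm_sum ?M splits (- 1) I (\<lambda>A B.
             fac Y A (n - length B) (m + int (length B)) (f B n m x)
             \<ominus>\<^bsub>?M\<^esub> f A (n - length B) (m + int (length B) - 1) (fac X B n m x)) =
        perm_sum ?M splits (- 1) I (\<lambda>A B. ?\<phi> A B \<ominus>\<^bsub>?M\<^esub> ?\<psi> A B)"
      by (rule perm_sum_splits_cong[where \<phi> = "\<lambda>A B. ?\<phi> A B \<ominus>\<^bsub>?M\<^esub> ?\<psi> A B", OF ag t(4) diff]) (auto simp: comp_term_def)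
    also have "\<dots> = \<ominus>\<^bsub>?M\<^esub> perm_sum ?M splits 1 I (\<lambda>A B. ?\<phi> A B \<ominus>\<^bsub>?M\<^esub> ?\<psi> A B)"
      by (rule perm_sum_splits_neg(1)[where \<phi> = "\<lambda>A B. ?\<phi> A B \<ominus>\<^bsub>?M\<^esub> ?\<psi> A B", OF M t(4) diff])
    also have "perm_sum ?M splits 1 I (\<lambda>A B. ?\<phi> A B \<ominus>\<^bsub>?M\<^esub> ?\<psi> A B) =
        perm_sum ?M splits 1 I ?\<phi> \<ominus>\<^bsub>?M\<^esub> perm_sum ?M splits 1 I ?\<psi>"
      by (rule perm_sum_splits_add(2)[where \<phi> = ?\<phi> and \<psi> = ?\<psi>, OF M t(4) \<phi> \<psi>])
    finally have ps: "perm_sum ?M splits (- 1) I (\<lambda>A B.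
             fac Y A (n - length B) (m + int (length B)) (f B n m x)
             \<ominus>\<^bsub>?M\<^esub> f A (n - length B) (m + int (length B) - 1) (fac X B n m x)) =
        \<ominus>\<^bsub>?M\<^esub> (perm_sum ?M splits 1 I ?\<phi> \<ominus>\<^bsub>?M\<^esub> perm_sum ?M splits 1 I ?\<psi>)" .
    have hd: "hom_diff X Y n (n - ?k) (int ?k) (f I n) m x = ?D \<ominus>\<^bsub>?M\<^esub> ?E"
      using ev c(3) by (simp add: hom_diff_def)
    have s: "perm_sum ?M splits' 1 I ?\<phi> = ?\<phi> I [] \<oplus>\<^bsub>?M\<^esub> ?\<phi> [] I \<oplus>\<^bsub>?M\<^esub> perm_sum ?M splits 1 I ?\<phi>"
      "perm_sum ?M splits' 1 I ?\<psi> = ?\<psi> I [] \<oplus>\<^bsub>?M\<^esub> ?\<psi> [] I \<oplus>\<^bsub>?M\<^esub> perm_sum ?M splits 1 I ?\<psi>"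
      by (rule perm_sum_split[OF ag t(4) I(2)], erule \<phi>, rule perm_sum_split[OF ag t(4) I(2)], erule \<psi>)
    have R: "perm_sum ?M splits 1 I ?\<phi> \<in> carrier ?M" "perm_sum ?M splits 1 I ?\<psi> \<in> carrier ?M"
      by (rule perm_sum_splits_neg(2)[OF M t(4)], erule \<phi>, rule perm_sum_splits_neg(2)[OF M t(4)], erule \<psi>)
    show ?thesis
      unfolding E_def Let_def ps hd s v
      by (rule M.M.morphism_rearrange[symmetric, OF c(2,3,1,4) R])
  qed
  have "tuple n []" for n by (simp add: tuple_def)
  then have "(\<forall>n m I. \<forall>x \<in> carrier (grd X n m). tuple n I \<longrightarrow> E n m I x) \<longleftrightarrow>
      (\<forall>n m. \<forall>x \<in> carrier (grd X n m). E n m [] x) \<and>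
      (\<forall>n m I. \<forall>x \<in> carrier (grd X n m). tuple n I \<and> I \<noteq> [] \<longrightarrow> E n m I x)" by blast
  also have "\<dots> \<longleftrightarrow> is_F_morphism K X Y f"
    using f nil cons unfolding is_F_morphism_def list_family_def by auto
  finally show ?thesis using f by (simp add: E_def)
qed

lemma homotopy_equation:
  assumes X: "is_F_module K X" and Y: "is_F_module K Y" and h: "is_homotopy K X Y f g h"
    and f: "list_family K X Y 0 f" and g: "list_family K X Y 0 g"
    and I: "tuple n I" and x: "x \<in> carrier (grd X n m)"
  defines "M \<equiv> grd Y (n - length I) (m + int (length I))"
  shows "perm_sum M splits' 1 I (comp_term (dfac Y) h n m 1 x) \<oplus>\<^bsub>M\<^esub>
    perm_sum M splits' 1 I (comp_term h (dfac X) n m (- 1) x) = f I n m x \<ominus>\<^bsub>M\<^esub> g I n m x"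
proof -
  note dX = F_module_dfac[OF X] and dY = F_module_dfac[OF Y] and mods = F_module_modules[OF Y]
  have hf: "list_family K X Y 1 h" using h by (simp add: is_homotopy_def list_family_def)
  let ?k = "length I" and ?\<phi> = "comp_term (dfac Y) h n m 1 x" and ?\<psi> = "comp_term h (dfac X) n m (- 1) x"
  have M: "module K M" unfolding M_def by (rule modulesD(1)[OF mods])
  interpret M: module K M by (rule M)
  note ag = M.M.abelian_group_axioms and t = tuple_set[OF I]
  have \<phi>: "?\<phi> (sl (hatn B ` (set I - B))) (sl B) \<in> carrier M" if "B \<subseteq> set I" for B
    using comp_term_closed[OF hf dY _ I x that, of 0] by (simp add: M_def)
  have \<psi>: "?\<psi> (sl (hatn B ` (set I - B))) (sl B) \<in> carrier M" if "B \<subseteq> set I" for B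
    using comp_term_closed[OF dX hf _ I x that, of 0] by (simp add: M_def)
  have fc: "f I n m x \<in> carrier M" "g I n m x \<in> carrier M"
    using lin_closed[OF list_family_lin[OF f I refl refl] x] lin_closed[OF list_family_lin[OF g I refl refl] x]
    by (auto simp: M_def)
  show ?thesis
  proof (cases "I = []")
    case True
    have eq: "hom_diff X Y n n 1 (h [] n) m x = f [] n m x \<ominus>\<^bsub>grd Y n m\<^esub> g [] n m x"
      using h x by (simp add: is_homotopy_def)
    have c: "?\<phi> [] [] \<in> carrier M" "?\<psi> [] [] \<in> carrier M" using \<phi>[of "{}"] \<psi>[of "{}"] True by auto
    have "hom_diff X Y n n 1 (h [] n) m x = ?\<phi> [] [] \<ominus>\<^bsub>M\<^esub> (\<ominus>\<^bsub>M\<^esub> ?\<psi> [] [])"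
      using c(2) True int_act_neg_one[OF M] by (simp add: hom_diff_def comp_term_def M_def)
    also have "\<dots> = ?\<phi> [] [] \<oplus>\<^bsub>M\<^esub> ?\<psi> [] []" using c by (simp add: a_minus_def)
    finally show ?thesis
      using eq True perm_sum_Nil[where \<phi> = ?\<phi>, OF ag c(1)] perm_sum_Nil[where \<phi> = ?\<psi>, OF ag c(2)] by (simp add: M_def)
  next
    case False
    let ?u = "dif Y (n - ?k) (m + int ?k + 1) (h I n m x)" and ?v = "h I n (m - 1) (dif X n m x)"
    let ?a = "fac Y I n (m + 1) (h [] n m x)" and ?c = "h [] (n - ?k) (m + int ?k - 1) (fac X I n m x)"
    let ?R = "perm_sum M splits 1 I ?\<phi>" and ?R' = "perm_sum M splits 1 I ?\<psi>"
    have v: "?\<phi> I [] = ?a" "?\<phi> [] I = ?u" "?\<psi> I [] = ?v" "?\<psi> [] I = ?c"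
      using False by (simp_all add: comp_term_def)
    have c: "?a \<in> carrier M" "?u \<in> carrier M" "?v \<in> carrier M" "?c \<in> carrier M"
      using \<phi>[of "{}"] \<phi>[of "set I"] \<psi>[of "{}"] \<psi>[of "set I"] t(3) v by auto
    have odd: "\<not> even (int (n - ?k) - int n + (int ?k + 1))" using t(5) by (simp add: of_nat_diff)
    have add: "?\<phi> (sl (hatn B ` (set I - B))) (sl B) \<oplus>\<^bsub>M\<^esub> ?\<psi> (sl (hatn B ` (set I - B))) (sl B) \<in> carrier M"
      if "B \<subseteq> set I" for B using \<phi>[OF that] \<psi>[OF that] by (rule M.M.a_closed)
    have "perm_sum M splits (- 1) I (\<lambda>A B.
             fac Y A (n - length B) (m + int (length B) + 1) (h B n m x)
             \<oplus>\<^bsub>M\<^esub> h A (n - length B) (m + int (length B) - 1) (fac X B n m x)) =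
        perm_sum M splits (- 1) I (\<lambda>A B. ?\<phi> A B \<oplus>\<^bsub>M\<^esub> ?\<psi> A B)"
      by (rule perm_sum_splits_cong[where \<phi> = "\<lambda>A B. ?\<phi> A B \<oplus>\<^bsub>M\<^esub> ?\<psi> A B", OF ag t(4) add]) (auto simp: comp_term_def)
    also have "\<dots> = \<ominus>\<^bsub>M\<^esub> perm_sum M splits 1 I (\<lambda>A B. ?\<phi> A B \<oplus>\<^bsub>M\<^esub> ?\<psi> A B)"
      by (rule perm_sum_splits_neg(1)[where \<phi> = "\<lambda>A B. ?\<phi> A B \<oplus>\<^bsub>M\<^esub> ?\<psi> A B", OF M t(4) add])
    also have "perm_sum M splits 1 I (\<lambda>A B. ?\<phi> A B \<oplus>\<^bsub>M\<^esub> ?\<psi> A B) = ?R \<oplus>\<^bsub>M\<^esub> ?R'"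
      by (rule perm_sum_splits_add(1)[where \<phi> = ?\<phi> and \<psi> = ?\<psi>, OF M t(4) \<phi> \<psi>])
    finally have ps: "perm_sum M splits (- 1) I (\<lambda>A B.
             fac Y A (n - length B) (m + int (length B) + 1) (h B n m x)
             \<oplus>\<^bsub>M\<^esub> h A (n - length B) (m + int (length B) - 1) (fac X B n m x)) = \<ominus>\<^bsub>M\<^esub> (?R \<oplus>\<^bsub>M\<^esub> ?R')" .
    have "hom_diff X Y n (n - ?k) (int ?k + 1) (h I n) m x = ?u \<ominus>\<^bsub>M\<^esub> (\<ominus>\<^bsub>M\<^esub> ?v)"
    proof -
      have i: "m + (int ?k + 1) = m + int ?k + 1" "m + int ?k + 1 - 1 = m + int ?k" by simp_all
      show ?thesis unfolding hom_diff_def i M_def[symmetric] using odd c(3) by (simp add: int_act_neg_one[OF M])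
    qed
    moreover have "hom_diff X Y n (n - ?k) (int ?k + 1) (h I n) m x =
         (f I n m x \<ominus>\<^bsub>M\<^esub> g I n m x \<ominus>\<^bsub>M\<^esub> ?a \<ominus>\<^bsub>M\<^esub> ?c)
         \<oplus>\<^bsub>M\<^esub> perm_sum M splits (- 1) I (\<lambda>A B.
             fac Y A (n - length B) (m + int (length B) + 1) (h B n m x)
             \<oplus>\<^bsub>M\<^esub> h A (n - length B) (m + int (length B) - 1) (fac X B n m x))"
      using h I False x unfolding is_homotopy_def Let_def M_def by blast
    ultimately have "?u \<ominus>\<^bsub>M\<^esub> (\<ominus>\<^bsub>M\<^esub> ?v) =
        (f I n m x \<ominus>\<^bsub>M\<^esub> g I n m x \<ominus>\<^bsub>M\<^esub> ?a \<ominus>\<^bsub>M\<^esub> ?c) \<oplus>\<^bsub>M\<^esub> \<ominus>\<^bsub>M\<^esub> (?R \<oplus>\<^bsub>M\<^esub> ?R')"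
      unfolding ps by simp
    moreover have s: "perm_sum M splits' 1 I ?\<phi> = ?\<phi> I [] \<oplus>\<^bsub>M\<^esub> ?\<phi> [] I \<oplus>\<^bsub>M\<^esub> perm_sum M splits 1 I ?\<phi>"
      "perm_sum M splits' 1 I ?\<psi> = ?\<psi> I [] \<oplus>\<^bsub>M\<^esub> ?\<psi> [] I \<oplus>\<^bsub>M\<^esub> perm_sum M splits 1 I ?\<psi>"
      by (rule perm_sum_split[OF ag t(4) False], erule \<phi>, rule perm_sum_split[OF ag t(4) False], erule \<psi>)
    have R: "perm_sum M splits 1 I ?\<phi> \<in> carrier M" "perm_sum M splits 1 I ?\<psi> \<in> carrier M"
      by (rule perm_sum_splits_neg(2)[OF M t(4)], erule \<phi>, rule perm_sum_splits_neg(2)[OF M t(4)], erule \<psi>)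
    ultimately show ?thesis
      unfolding s v
      using M.M.homotopy_rearrange[OF c(2,3) M.M.minus_closed[OF fc] c(1,4) R] by simp
  qed
qed

subsection \<open>Cyclic compatibility\<close>

lemma sorted_decrement:
  assumes "sorted_wrt (<) I" "0 \<notin> set I"
  shows "sorted_wrt (<) (map (\<lambda>i. i - 1 :: nat) I)"
  unfolding sorted_wrt_map
proof (rule sorted_wrt_mono_rel[OF _ assms(1)])
  fix x y assume "x \<in> set I" "y \<in> set I" "x < y"
  moreover have "x \<noteq> 0" using \<open>x \<in> set I\<close> assms(2) by metis
  ultimately show "x - 1 < y - 1" by simp
qed

lemma sl_rot:
  assumes I: "tuple n I"
  shows "sl (rot n ` set I) = (if 0 \<in> set I then map (\<lambda>i. i - 1) (tl I) @ [n] else map (\<lambda>i. i - 1) I)"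
proof (cases "0 \<in> set I")
  case False
  have "sorted_wrt (<) (map (\<lambda>i. i - 1) I)" using tuple_set(4)[OF I] False by (rule sorted_decrement)
  moreover have "set (map (\<lambda>i. i - 1) I) = rot n ` set I"
    using False by (auto simp: rot_def intro!: image_cong gr0I)
  ultimately show ?thesis using False sorted_less_eq_sl by metis
next
  case True
  note t = tuple_set[OF I]
  obtain a J where J: "I = a # J" using True by (cases I) auto
  have a: "a = 0" and J0: "0 \<notin> set J" using True t(4) J by auto
  have "sorted_wrt (<) J" using t(4) J by simp
  then have "sorted_wrt (<) (map (\<lambda>i. i - 1) J)" using J0 by (rule sorted_decrement)
  moreover have "i - 1 < n" if "i \<in> set J" for i
    using that I J J0 by (cases i) (auto simp: tuple_def)
  ultimately have "sorted_wrt (<) (map (\<lambda>i. i - 1) J @ [n])"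
    by (auto simp: sorted_wrt_append)
  moreover have "set (map (\<lambda>i. i - 1) J @ [n]) = rot n ` set I"
  proof -
    have "rot n ` set J = (\<lambda>i. i - 1) ` set J"
      using J0 by (intro image_cong) (auto simp: rot_def)
    then show ?thesis using J a by (auto simp: rot_def[of n 0])
  qed
  ultimately show ?thesis using True J sorted_less_eq_sl by (metis list.sel(3))
qed

text \<open>Rotation lowers every letter by \<open>1\<close>, except that it replaces \<open>0\<close> by \<open>n\<close>.\<close>

lemma sum_rot:
  assumes "finite S" "S \<subseteq> {..n}"
  shows "\<Sum> (rot n ` S) + card S = \<Sum> S + (if 0 \<in> S then n + 1 else 0)"
proof -
  have "\<Sum> (rot n ` S) + card S = (\<Sum>i\<in>S. rot n i + 1)"
    using inj_on_rot[OF assms(2)] by (simp add: sum.reindex sum_Suc)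
  also have "\<dots> = (\<Sum>i\<in>S. i + (if i = 0 then n + 1 else 0))"
    by (intro sum.cong refl) (simp add: rot_def)
  also have "\<dots> = \<Sum> S + (if 0 \<in> S then n + 1 else 0)"
    using assms(1) by (simp add: sum.distrib sum.delta)
  finally show ?thesis .
qed

text \<open>The parity of the index sum changes under rotation by \<open>k\<close> if \<open>0\<close> is absent, and by \<open>k + n + 1\<close> otherwise.
Together with the signs \<open>(-1)\<^sup>n\<close> and \<open>(-1)\<^bsup>n-k\<^esup>\<close> of the two operators \<open>T\<close> this cancels all signs in the
first case and leaves \<open>(-1)\<^bsup>k-1\<^esup>\<close> in the second.\<close>

lemma cyclic_point:
  assumes mods: "modules K X" "modules K Y"
    and cX: "cyc X n m \<in> linear_maps K (grd X n m) (grd X n m)"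
    and cY: "\<And>n m. cyc Y n m \<in> linear_maps K (grd Y n m) (grd Y n m)"
    and \<phi>: "list_family K X Y b \<phi>" and I: "tuple n I" and x: "x \<in> carrier (grd X n m)"
  shows "signed Y b \<phi> (set I) n (m + int n) (signed_cyc X n (m + int n) x) =
      (if 0 \<in> set I then signed Y b \<phi> (rot n ` set I) n (m + int n) x
       else signed_cyc Y (n - card (set I)) (m + int n + b) (signed Y b \<phi> (rot n ` set I) n (m + int n) x)) \<longleftrightarrow>
    (if I = [] then \<phi> [] n m (cyc X n m x) = cyc Y n (m + b) (\<phi> [] n m x)
     else cyclic_compatible X Y b \<phi> I n m x)"
proof -
  note t = tuple_set[OF I]
  let ?S = "set I" and ?k = "length I" and ?I' = "sl (rot n ` set I)"
  let ?N = "grd Y (n - ?k) (m + int ?k + b)" and ?c = "cyc Y (n - ?k) (m + int ?k + b)"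
  have N: "module K ?N" and MX: "module K (grd X n m)" using modulesD(1)[OF mods(2)] modulesD(1)[OF mods(1)] by auto
  have R: "adm n (rot n ` ?S)" "card (rot n ` ?S) = ?k" using adm_rot[OF t(1)] t(2) by auto
  note I' = adm_sl[OF R(1)]
  have cx: "cyc X n m x \<in> carrier (grd X n m)" using lin_closed[OF cX x] .
  define u where "u = \<phi> I n m (cyc X n m x)"
  define v where "v = \<phi> ?I' n m x"
  have u: "u \<in> carrier ?N" unfolding u_def using lin_closed[OF list_family_lin[OF \<phi> I refl refl] cx] .
  have v: "v \<in> carrier ?N"
    unfolding v_def using lin_closed[OF list_family_lin[OF \<phi> I'(1) refl refl] x] I'(2) R(2) by simp
  have cv: "?c v \<in> carrier ?N" using lin_closed[OF cY v] .
  have T: "signed_cyc X n (m + int n) x = [((-1 :: int) ^ n)] \<cdot>\<^bsub>grd X n m\<^esub> cyc X n m x"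
    by (simp add: signed_cyc_def T_map_def)
  have L: "signed Y b \<phi> ?S n (m + int n) (signed_cyc X n (m + int n) x) = [((-1 :: int) ^ (\<Sum> ?S + n))] \<cdot>\<^bsub>?N\<^esub> u"
    unfolding T signed_eq[OF I] u_def
    using u lin_int_act[OF MX N list_family_lin[OF \<phi> I refl refl] cx] by (simp add: int_act_act[OF N] power_add u_def)
  have R1: "signed Y b \<phi> (rot n ` ?S) n (m + int n) x = [((-1 :: int) ^ \<Sum> (rot n ` ?S))] \<cdot>\<^bsub>?N\<^esub> v"
    using signed_eq[OF I'(1), of Y b \<phi> m x] I' R by (simp add: v_def)
  have TY: "signed_cyc Y (n - card ?S) (m + int n + b) y = [((-1 :: int) ^ (n - ?k))] \<cdot>\<^bsub>?N\<^esub> ?c y" for y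
  proof -
    have "m + int n + b - int (n - ?k) = m + int ?k + b" using t(5) by (simp add: of_nat_diff)
    then show ?thesis unfolding signed_cyc_def T_map_def t(2) by (simp only:)
  qed
  have R2: "signed_cyc Y (n - card ?S) (m + int n + b) (signed Y b \<phi> (rot n ` ?S) n (m + int n) x) =
      [((-1 :: int) ^ (n - ?k + \<Sum> (rot n ` ?S)))] \<cdot>\<^bsub>?N\<^esub> ?c v"
    unfolding R1 TY using cv by (simp add: lin_int_act[OF N N cY v] int_act_act[OF N] power_add)
  have Sn: "?S \<subseteq> {..n}" using t(1) by (simp add: adm_def)
  note sums = sum_rot[OF _ Sn, simplified t(2)]
  show ?thesis
  proof (cases "0 \<in> ?S")
    case True
    then have ne: "I \<noteq> []" by auto
    have hd: "hd I = 0" using True t(4) ne by (cases I) auto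
    have "\<Sum> ?S + n = \<Sum> (rot n ` ?S) + (?k - 1)" using sums True ne by (cases I) auto
    then have "signed Y b \<phi> ?S n (m + int n) (signed_cyc X n (m + int n) x) = signed Y b \<phi> (rot n ` ?S) n (m + int n) x \<longleftrightarrow>
      [((-1 :: int) ^ \<Sum> (rot n ` ?S))] \<cdot>\<^bsub>?N\<^esub> ([((-1 :: int) ^ (?k - 1))] \<cdot>\<^bsub>?N\<^esub> u) =
      [((-1 :: int) ^ \<Sum> (rot n ` ?S))] \<cdot>\<^bsub>?N\<^esub> v"
      unfolding L R1 using u by (simp add: int_act_act[OF N] power_add)
    also have "\<dots> \<longleftrightarrow> [((-1 :: int) ^ (?k - 1))] \<cdot>\<^bsub>?N\<^esub> u = v"
      by (rule sign_act_cancel[OF N int_act_closed[OF N u] v])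
    also have "\<dots> \<longleftrightarrow> [((-1 :: int) ^ (?k - 1))] \<cdot>\<^bsub>?N\<^esub> ([((-1 :: int) ^ (?k - 1))] \<cdot>\<^bsub>?N\<^esub> u) =
        [((-1 :: int) ^ (?k - 1))] \<cdot>\<^bsub>?N\<^esub> v"
      by (rule sign_act_cancel[OF N int_act_closed[OF N u] v, symmetric])
    also have "\<dots> \<longleftrightarrow> u = [((-1 :: int) ^ (?k - 1))] \<cdot>\<^bsub>?N\<^esub> v"
      using u by (simp add: int_act_act[OF N] sign_square int_act_one[OF N])
    also have "\<dots> \<longleftrightarrow> cyclic_compatible X Y b \<phi> I n m x"
      using hd True sl_rot[OF I] by (simp add: cyclic_compatible_def u_def v_def)
    finally show ?thesis using True ne by simp
  next
    case False
    have "\<Sum> ?S = \<Sum> (rot n ` ?S) + ?k" using sums False by simp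
    then have "\<Sum> ?S + n = (n - ?k + \<Sum> (rot n ` ?S)) + 2 * ?k" using t(5) by simp
    then have "(-1 :: int) ^ (\<Sum> ?S + n) = (-1) ^ (n - ?k + \<Sum> (rot n ` ?S))" by (simp add: power_add)
    then have "signed Y b \<phi> ?S n (m + int n) (signed_cyc X n (m + int n) x) =
        signed_cyc Y (n - card ?S) (m + int n + b) (signed Y b \<phi> (rot n ` ?S) n (m + int n) x) \<longleftrightarrow> u = ?c v"
      unfolding L R2 using sign_act_cancel[OF N u cv] by simp
    also have "\<dots> \<longleftrightarrow> (if I = [] then \<phi> [] n m (cyc X n m x) = cyc Y n (m + b) (\<phi> [] n m x)
     else cyclic_compatible X Y b \<phi> I n m x)"
    proof (cases "I = []")
      case False
      then have "hd I > 0" using \<open>0 \<notin> ?S\<close> by (metis gr0I hd_in_set)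
      then show ?thesis using \<open>0 \<notin> ?S\<close> sl_rot[OF I] False by (simp add: cyclic_compatible_def u_def v_def)
    qed (simp add: u_def v_def)
    finally show ?thesis using False by simp
  qed
qed

lemma cyclic_iff:
  assumes mods: "modules K X" "modules K Y"
    and cX: "\<And>n m. cyc X n m \<in> linear_maps K (grd X n m) (grd X n m)"
    and cY: "\<And>n m. cyc Y n m \<in> linear_maps K (grd Y n m) (grd Y n m)"
    and \<phi>: "list_family K X Y b \<phi>"
  shows "is_cyclic (tgrd X) (signed_cyc X) (signed_cyc Y) b (signed Y b \<phi>) \<longleftrightarrow>
    (\<forall>n m. \<forall>x \<in> carrier (grd X n m). \<phi> [] n m (cyc X n m x) = cyc Y n (m + b) (\<phi> [] n m x) \<and>
      (\<forall>I. tuple n I \<and> I \<noteq> [] \<longrightarrow> cyclic_compatible X Y b \<phi> I n m x))"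
    (is "?L \<longleftrightarrow> ?R")
proof
  assume L: ?L
  show ?R
  proof (intro allI ballI conjI impI)
    fix n m x assume x: "x \<in> carrier (grd X n m)"
    have *: "if I = [] then \<phi> [] n m (cyc X n m x) = cyc Y n (m + b) (\<phi> [] n m x)
        else cyclic_compatible X Y b \<phi> I n m x" if I: "tuple n I" for I
      using L x tuple_set(1)[OF I] cyclic_point[OF mods cX cY \<phi> I x] by (simp add: is_cyclic_def tgrd_def)
    show "\<phi> [] n m (cyc X n m x) = cyc Y n (m + b) (\<phi> [] n m x)"
      using *[of "[]"] by (simp add: tuple_def)
    show "cyclic_compatible X Y b \<phi> I n m x" if "tuple n I \<and> I \<noteq> []" for I
      using *[of I] that by auto
  qed
next
  assume R: ?R
  show ?L
    unfolding is_cyclic_def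
  proof (intro allI ballI impI)
    fix n p S x assume x: "x \<in> carrier (tgrd X n p)" and S: "adm n S"
    note I = adm_sl[OF S]
    have x': "x \<in> carrier (grd X n (p - int n))" using x by (simp add: tgrd_def)
    show "signed Y b \<phi> S n p (signed_cyc X n p x) = (if 0 \<in> S then signed Y b \<phi> (rot n ` S) n p x
        else signed_cyc Y (n - card S) (p + b) (signed Y b \<phi> (rot n ` S) n p x))"
      using cyclic_point[OF mods cX cY \<phi> I(1) x', unfolded I(3)] R x' I(1) by (simp split: if_splits)
  qed
qed

subsection \<open>Signed form of modules, morphisms and homotopies\<close>

abbreviation signed_fac :: "('k, 'a) CF_module \<Rightarrow> nat set \<Rightarrow> nat \<Rightarrow> int \<Rightarrow> 'a \<Rightarrow> 'a" where
  "signed_fac X \<equiv> signed X (- 1) (dfac X)"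

lemma CF_moduleD:
  assumes "is_CF_module K X"
  shows "is_F_module K X" "modules K X" "list_family K X X (- 1) (dfac X)"
    "cyc X n m \<in> linear_maps K (grd X n m) (grd X n m)"
    "is_family K (tgrd X) (tgrd X) (- 1) (signed_fac X)" "module K (tgrd X n p)"
  using assms F_module_modules[of K X] F_module_dfac[of K X] signed_family[of K X X "- 1" "dfac X"] modulesD(2)[of K X]
  by (auto simp: is_CF_module_def)

text \<open>The operator \<open>T = (-1)\<^sup>n t\<close> has the same period as \<open>t\<close>, since \<open>n (n + 1)\<close> is even.\<close>

lemma CF_cyclic_data:
  assumes X: "is_CF_module K X"
  shows "cyclic_data K (tgrd X) (signed_cyc X)"
proof -
  note mods = CF_moduleD(2)[OF X] and c = CF_moduleD(4)[OF X]
  have T: "signed_cyc X n p \<in> linear_maps K (tgrd X n p) (tgrd X n p)" for n p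
  proof -
    have M: "module K (tgrd X n p)" by (rule modulesD(2)[OF mods])
    show ?thesis
      unfolding signed_cyc_def T_map_def[abs_def] tgrd_def[symmetric]
      by (rule lin_comp[OF _ int_act_linear[OF M]]) (use c in \<open>simp add: tgrd_def\<close>)
  qed
  have period: "(signed_cyc X n p ^^ Suc n) x = x" if x: "x \<in> carrier (tgrd X n p)" for n p x
  proof -
    let ?M = "grd X n (p - int n)" and ?c = "cyc X n (p - int n)"
    have M: "module K ?M" by (rule modulesD(1)[OF mods])
    have x: "x \<in> carrier ?M" using x by (simp add: tgrd_def)
    have cj: "(?c ^^ j) x \<in> carrier ?M" for j using lin_closed[OF lin_funpow[OF c] x] .
    have "(signed_cyc X n p ^^ j) x = [((-1 :: int) ^ (n * j))] \<cdot>\<^bsub>?M\<^esub> (?c ^^ j) x" for j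
    proof (induction j)
      case 0
      then show ?case using int_act_one[OF M x] by simp
    next
      case (Suc j)
      then show ?case
        using cj[of j] cj[of "Suc j"] lin_int_act[OF M M c cj[of j]]
        by (simp add: signed_cyc_def T_map_def int_act_act[OF M] power_add)
    qed
    then have "(signed_cyc X n p ^^ Suc n) x = [((-1 :: int) ^ (n * Suc n))] \<cdot>\<^bsub>?M\<^esub> (?c ^^ Suc n) x" .
    moreover have "(-1 :: int) ^ (n * Suc n) = 1" by simp
    moreover have "(?c ^^ Suc n) x = x" using X x by (simp add: is_CF_module_def)
    ultimately show ?thesis using int_act_one[OF M x] by simp
  qed
  have zero: "carrier (tgrd X n p) = {\<zero>\<^bsub>tgrd X n p\<^esub>}" if "p < int n" for n p
    using CF_moduleD(1)[OF X] that by (simp add: is_F_module_def is_diff_module_def tgrd_def)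
  show ?thesis
    unfolding cyclic_data_def using modulesD(2)[OF mods] T period zero by auto
qed

lemma CF_cyclic_fac:
  assumes X: "is_CF_module K X"
  shows "is_cyclic (tgrd X) (signed_cyc X) (signed_cyc X) (- 1) (signed_fac X)"
proof -
  note c = CF_moduleD(4)[OF X]
  have comp: "cyclic_compatible X X (- 1) (dfac X) I n m x"
    if "tuple n I" "I \<noteq> []" "x \<in> carrier (grd X n m)" for I n m x
  proof -
    have "cyclic_compatible X X (- 1) (fac X) I n m x" using X that by (simp add: is_CF_module_def)
    then show ?thesis using that(2) by (simp add: cyclic_compatible_def)
  qed
  show ?thesis
    using X comp
    by (subst cyclic_iff[OF CF_moduleD(2)[OF X] CF_moduleD(2)[OF X] c c CF_moduleD(3)[OF X]])
       (auto simp: is_CF_module_def)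
qed

lemma conv_eq_perm_sum:
  assumes mods: "modules K X" "modules K Y" "modules K Z"
    and f: "list_family K X Y b f" and g: "list_family K Y Z a g" and c: "c = a + b"
    and S: "adm n S" and x: "x \<in> carrier (tgrd X n p)"
  shows "conv (tgrd Z) b c (signed Z a g) (signed Y b f) S n p x =
    [((-1 :: int) ^ \<Sum> S)] \<cdot>\<^bsub>tgrd Z (n - card S) (p + c)\<^esub>
      perm_sum (tgrd Z (n - card S) (p + c)) splits' 1 (sl S) (comp_term g f n (p - int n) b x)"
  using perm_sum_conv[OF mods f g c adm_sl(1)[OF S], of x "p - int n"] x adm_sl[OF S] S
  by (simp add: tgrd_def[of X] tgrd_index adm_def)

lemma perm_sum_carrier:
  assumes mods: "modules K Z"
    and f: "list_family K X Y b f" and g: "list_family K Y Z a g" and c: "c = a + b"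
    and S: "adm n S" and x: "x \<in> carrier (tgrd X n p)"
  shows "perm_sum (tgrd Z (n - card S) (p + c)) splits' 1 (sl S) (comp_term g f n (p - int n) b x) \<in>
    carrier (tgrd Z (n - card S) (p + c))"
  using perm_sum_comp_closed[OF mods f g c adm_sl(1)[OF S], of x "p - int n"] x adm_sl[OF S] S
  by (simp add: tgrd_def[of X] tgrd_index adm_def)

lemma CF_square:
  assumes X: "is_CF_module K X" and S: "adm n S" and x: "x \<in> carrier (tgrd X n p)"
  shows "conv (tgrd X) (- 1) (- 2) (signed_fac X) (signed_fac X) S n p x = \<zero>\<^bsub>tgrd X (n - card S) (p - 2)\<^esub>"
proof -
  note m = CF_moduleD(2)[OF X] and d = CF_moduleD(3)[OF X]
  have M: "module K (tgrd X (n - card S) (p + - 2))" by (rule modulesD(2)[OF m])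
  have Gi: "tgrd X (n - card S) (p + - 2) = grd X (n - length (sl S)) (p - int n + int (length (sl S)) - 2)"
    using S adm_sl[OF S] by (simp only: tgrd_index adm_def) simp
  have "perm_sum (tgrd X (n - card S) (p + - 2)) splits' 1 (sl S) (comp_term (dfac X) (dfac X) n (p - int n) (- 1) x) =
      \<zero>\<^bsub>tgrd X (n - card S) (p + - 2)\<^esub>"
    unfolding Gi using F_module_square[OF CF_moduleD(1)[OF X] adm_sl(1)[OF S]] x by (simp add: tgrd_def)
  then show ?thesis
    using conv_eq_perm_sum[OF m m m d d _ S x, of "- 2"] sign_act_zero[OF M] by simp
qed

lemma CF_morphism_iff:
  assumes X: "is_CF_module K X" and Y: "is_CF_module K Y"
  shows "is_CF_morphism K X Y f \<longleftrightarrow> list_family K X Y 0 f \<and>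
    (\<forall>n p S. \<forall>x \<in> carrier (tgrd X n p). adm n S \<longrightarrow>
      conv (tgrd Y) 0 (- 1) (signed_fac Y) (signed Y 0 f) S n p x = conv (tgrd Y) (- 1) (- 1) (signed Y 0 f) (signed_fac X) S n p x) \<and>
    is_cyclic (tgrd X) (signed_cyc X) (signed_cyc Y) 0 (signed Y 0 f)"
proof (cases "list_family K X Y 0 f")
  case False
  then show ?thesis by (auto simp: is_CF_morphism_def is_F_morphism_def list_family_def)
next
  case f: True
  note mX = CF_moduleD(2)[OF X] and mY = CF_moduleD(2)[OF Y]
  note dX = CF_moduleD(3)[OF X] and dY = CF_moduleD(3)[OF Y]
  have pt: "conv (tgrd Y) 0 (- 1) (signed_fac Y) (signed Y 0 f) S n p x = conv (tgrd Y) (- 1) (- 1) (signed Y 0 f) (signed_fac X) S n p x \<longleftrightarrow>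
      perm_sum (tgrd Y (n - card S) (p + - 1)) splits' 1 (sl S) (comp_term (dfac Y) f n (p - int n) 0 x) =
      perm_sum (tgrd Y (n - card S) (p + - 1)) splits' 1 (sl S) (comp_term f (dfac X) n (p - int n) (- 1) x)"
    if S: "adm n S" and x: "x \<in> carrier (tgrd X n p)" for n p S x
  proof -
    have M: "module K (tgrd Y (n - card S) (p + - 1))" by (rule modulesD(2)[OF mY])
    show ?thesis
      unfolding conv_eq_perm_sum[OF mX mY mY f dY, of "- 1", simplified, OF S x]
        conv_eq_perm_sum[OF mX mX mY dX f, of "- 1", simplified, OF S x]
      using perm_sum_carrier[OF mY f dY _ S x, of "- 1"] perm_sum_carrier[OF mY dX f _ S x, of "- 1"]
      by (subst sign_act_cancel[OF M, simplified]) simp_all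
  qed
  have Gi: "tgrd Y (n - card S) (p + - 1) = grd Y (n - card S) (p - int n + int (card S) - 1)" if "adm n S" for n p S
    using that by (simp only: tgrd_index adm_def) simp
  have 1: "is_F_morphism K X Y f \<longleftrightarrow> (\<forall>n p S. \<forall>x \<in> carrier (tgrd X n p). adm n S \<longrightarrow>
      conv (tgrd Y) 0 (- 1) (signed_fac Y) (signed Y 0 f) S n p x = conv (tgrd Y) (- 1) (- 1) (signed Y 0 f) (signed_fac X) S n p x)"
    (is "_ \<longleftrightarrow> ?R")
  proof
    assume F: "is_F_morphism K X Y f"
    show ?R
    proof (intro allI ballI impI)
      fix n p S x assume x: "x \<in> carrier (tgrd X n p)" and S: "adm n S"
      show "conv (tgrd Y) 0 (- 1) (signed_fac Y) (signed Y 0 f) S n p x = conv (tgrd Y) (- 1) (- 1) (signed Y 0 f) (signed_fac X) S n p x"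
        unfolding pt[OF S x] Gi[OF S]
        using F adm_sl[OF S] x unfolding F_morphism_iff[OF CF_moduleD(1)[OF X] CF_moduleD(1)[OF Y]]
        by (metis tgrd_def)
    qed
  next
    assume R: ?R
    show "is_F_morphism K X Y f"
      unfolding F_morphism_iff[OF CF_moduleD(1)[OF X] CF_moduleD(1)[OF Y]]
    proof (intro conjI f allI ballI impI)
      fix n m I x assume x: "x \<in> carrier (grd X n m)" and I: "tuple n I"
      note t = tuple_set[OF I]
      have x': "x \<in> carrier (tgrd X n (m + int n))" using x by (simp add: tgrd_def)
      show "perm_sum (grd Y (n - length I) (m + int (length I) - 1)) splits' 1 I (comp_term (dfac Y) f n m 0 x) =
        perm_sum (grd Y (n - length I) (m + int (length I) - 1)) splits' 1 I (comp_term f (dfac X) n m (- 1) x)"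
        using R x' t(1) pt[OF t(1) x'] Gi[OF t(1), of "m + int n"] t(2,3) by simp
    qed
  qed
  have "is_cyclic (tgrd X) (signed_cyc X) (signed_cyc Y) 0 (signed Y 0 f) \<longleftrightarrow>
    (\<forall>n m. \<forall>x \<in> carrier (grd X n m). f [] n m (cyc X n m x) = cyc Y n m (f [] n m x) \<and>
      (\<forall>I. tuple n I \<and> I \<noteq> [] \<longrightarrow> cyclic_compatible X Y 0 f I n m x))"
    using cyclic_iff[OF mX mY CF_moduleD(4)[OF X] CF_moduleD(4)[OF Y] f] by simp
  then show ?thesis using f 1 by (simp add: is_CF_morphism_def)
qed

lemma CF_homotopyD:
  assumes X: "is_CF_module K X" and Y: "is_CF_module K Y" and h: "is_homotopy K X Y f g h"
    and f: "list_family K X Y 0 f" and g: "list_family K X Y 0 g"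
  shows "is_family K (tgrd X) (tgrd Y) 1 (signed Y 1 h)" "is_cyclic (tgrd X) (signed_cyc X) (signed_cyc Y) 1 (signed Y 1 h)"
    "adm n S \<Longrightarrow> x \<in> carrier (tgrd X n p) \<Longrightarrow>
      conv (tgrd Y) 1 0 (signed_fac Y) (signed Y 1 h) S n p x \<oplus>\<^bsub>tgrd Y (n - card S) p\<^esub>
      conv (tgrd Y) (- 1) 0 (signed Y 1 h) (signed_fac X) S n p x =
      signed Y 0 f S n p x \<ominus>\<^bsub>tgrd Y (n - card S) p\<^esub> signed Y 0 g S n p x"
proof -
  note mX = CF_moduleD(2)[OF X] and mY = CF_moduleD(2)[OF Y]
  note dX = CF_moduleD(3)[OF X] and dY = CF_moduleD(3)[OF Y]
  have hf: "list_family K X Y 1 h" using h by (simp add: is_homotopy_def list_family_def)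
  show "is_family K (tgrd X) (tgrd Y) 1 (signed Y 1 h)" by (rule signed_family[OF mX mY hf])
  show "is_cyclic (tgrd X) (signed_cyc X) (signed_cyc Y) 1 (signed Y 1 h)"
    using cyclic_iff[OF mX mY CF_moduleD(4)[OF X] CF_moduleD(4)[OF Y] hf] h by (simp add: is_homotopy_def)
  assume S: "adm n S" and x: "x \<in> carrier (tgrd X n p)"
  let ?M = "tgrd Y (n - card S) p"
  have M: "module K ?M" by (rule modulesD(2)[OF mY])
  note I = adm_sl[OF S]
  have Mi: "grd Y (n - length (sl S)) (p - int n + int (length (sl S))) = ?M"
    using I S tgrd_index[of "card S" n Y p 0] by (simp add: adm_def)
  have x': "x \<in> carrier (grd X n (p - int n))" using x by (simp add: tgrd_def)
  have fc: "f (sl S) n (p - int n) x \<in> carrier ?M" "g (sl S) n (p - int n) x \<in> carrier ?M"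
    using lin_closed[OF list_family_lin[OF f I(1) refl refl] x'] lin_closed[OF list_family_lin[OF g I(1) refl refl] x'] Mi
    by simp_all
  have P: "perm_sum ?M splits' 1 (sl S) (comp_term (dfac Y) h n (p - int n) 1 x) \<in> carrier ?M"
     "perm_sum ?M splits' 1 (sl S) (comp_term h (dfac X) n (p - int n) (- 1) x) \<in> carrier ?M"
    using perm_sum_carrier[OF mY hf dY _ S x, of 0] perm_sum_carrier[OF mY dX hf _ S x, of 0] by simp_all
  have "conv (tgrd Y) 1 0 (signed_fac Y) (signed Y 1 h) S n p x \<oplus>\<^bsub>?M\<^esub> conv (tgrd Y) (- 1) 0 (signed Y 1 h) (signed_fac X) S n p x =
     [((-1 :: int) ^ \<Sum> S)] \<cdot>\<^bsub>?M\<^esub> (perm_sum ?M splits' 1 (sl S) (comp_term (dfac Y) h n (p - int n) 1 x) \<oplus>\<^bsub>?M\<^esub>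
       perm_sum ?M splits' 1 (sl S) (comp_term h (dfac X) n (p - int n) (- 1) x))"
    using conv_eq_perm_sum[OF mX mY mY hf dY _ S x, of 0] conv_eq_perm_sum[OF mX mX mY dX hf _ S x, of 0] P
    by (simp add: int_act_add[OF M])
  also have "\<dots> = [((-1 :: int) ^ \<Sum> S)] \<cdot>\<^bsub>?M\<^esub> (f (sl S) n (p - int n) x \<ominus>\<^bsub>?M\<^esub> g (sl S) n (p - int n) x)"
    using homotopy_equation[OF CF_moduleD(1)[OF X] CF_moduleD(1)[OF Y] h f g I(1) x'] Mi by simp
  also have "\<dots> = signed Y 0 f S n p x \<ominus>\<^bsub>?M\<^esub> signed Y 0 g S n p x"
    using lin_minus[OF M M int_act_linear[OF M] fc] by (simp add: signed_def)
  finally show "conv (tgrd Y) 1 0 (signed_fac Y) (signed Y 1 h) S n p x \<oplus>\<^bsub>?M\<^esub> conv (tgrd Y) (- 1) 0 (signed Y 1 h) (signed_fac X) S n p x =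
      signed Y 0 f S n p x \<ominus>\<^bsub>?M\<^esub> signed Y 0 g S n p x" .
qed

section \<open>The category of \<open>CF\<^sub>\<infinity>\<close>-modules\<close>

definition unit_fam :: "(nat \<Rightarrow> int \<Rightarrow> ('k, 'a) module) \<Rightarrow> nat set \<Rightarrow> nat \<Rightarrow> int \<Rightarrow> 'a \<Rightarrow> 'a" where
  "unit_fam U S n p x = (if S = {} then x else \<zero>\<^bsub>U (n - card S) p\<^esub>)"

lemma unit_fam_family:
  assumes "\<And>n p. module K (U n p)"
  shows "is_family K U U 0 (unit_fam U)"
  unfolding is_family_def
proof (intro allI impI)
  fix n p S
  show "unit_fam U S n p \<in> linear_maps K (U n p) (U (n - card S) (p + 0))"
    using lin_id[of K "U n p"] lin_const_zero[OF assms, of "n - card S" p "U n p"]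
    by (cases "S = {}") (simp_all add: unit_fam_def[abs_def])
qed

lemma unit_fam_cyclic:
  assumes "cyclic_data K U T"
  shows "is_cyclic U T T 0 (unit_fam U)"
  unfolding is_cyclic_def unit_fam_def
  using lin_zero[OF cyclic_dataD(1)[OF assms] cyclic_dataD(1)[OF assms] cyclic_dataD(3)[OF assms]]
  by (auto simp: adm_rot)

lemma conv_unit_right:
  assumes fam: "is_family K U V b \<phi>" and mods: "\<And>n p. module K (U n p)" "\<And>n p. module K (V n p)"
    and S: "adm n S" and x: "x \<in> carrier (U n p)"
  shows "conv V 0 b \<phi> (unit_fam U) S n p x = \<phi> S n p x"
proof -
  interpret V: module K "V (n - card S) (p + b)" by (rule mods)
  let ?g = "\<lambda>B. \<phi> (hatn B ` (S - B)) (n - card B) (p + 0) (unit_fam U B n p x)"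
  have gc: "?g B \<in> carrier (V (n - card S) (p + b))" if "B \<subseteq> S" for B
    using lin_closed[OF conv_term_linear[OF unit_fam_family[OF mods(1)] fam _ S that] x, of b] by simp
  have "?g B = \<zero>\<^bsub>V (n - card S) (p + b)\<^esub>" if B: "B \<subseteq> S" "B \<noteq> {}" for B
  proof -
    have "\<phi> (hatn B ` (S - B)) (n - card B) (p + 0) \<in> linear_maps K (U (n - card B) p) (V (n - card S) (p + b))"
      using family_lin[OF fam adm_rest(1)[OF S B(1)], of "n - card S" "p + b" p] adm_rest(3)[OF S B(1)] by simp
    then show ?thesis using lin_zero[OF mods] B by (simp add: unit_fam_def)
  qed
  then have "finsum (V (n - card S) (p + b)) ?g {{}} = finsum (V (n - card S) (p + b)) ?g (Pow S)"
    using gc adm_finite[OF S] by (intro V.M.finsum_neutral) auto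
  moreover have "?g {} = \<phi> S n p x" by (simp add: unit_fam_def)
  ultimately show ?thesis using gc[of "{}"] by (simp add: conv_def)
qed

lemma conv_unit_left:
  assumes fam: "is_family K U V b \<phi>" and mods: "\<And>n p. module K (U n p)" "\<And>n p. module K (V n p)"
    and S: "adm n S" and x: "x \<in> carrier (U n p)"
  shows "conv V b b (unit_fam V) \<phi> S n p x = \<phi> S n p x"
proof -
  interpret V: module K "V (n - card S) (p + b)" by (rule mods)
  let ?g = "\<lambda>B. unit_fam V (hatn B ` (S - B)) (n - card B) (p + b) (\<phi> B n p x)"
  have gc: "?g B \<in> carrier (V (n - card S) (p + b))" if "B \<subseteq> S" for B
    using lin_closed[OF conv_term_linear[OF fam unit_fam_family[OF mods(2)] _ S that] x, of b] by simp
  have "?g B = \<zero>\<^bsub>V (n - card S) (p + b)\<^esub>" if B: "B \<subseteq> S" "B \<noteq> S" for B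
    using adm_rest(3)[OF S B(1)] B by (auto simp: unit_fam_def)
  then have "finsum (V (n - card S) (p + b)) ?g {S} = finsum (V (n - card S) (p + b)) ?g (Pow S)"
    using gc adm_finite[OF S] by (intro V.M.finsum_neutral) auto
  moreover have "?g S = \<phi> S n p x" by (simp add: unit_fam_def)
  ultimately show ?thesis using gc[of S] by (simp add: conv_def)
qed

lemma is_cyclic_cong:
  assumes "is_cyclic U T T' b \<phi>" "\<And>n p. T n p \<in> linear_maps K (U n p) (U n p)"
    and "\<And>n p S x. adm n S \<Longrightarrow> x \<in> carrier (U n p) \<Longrightarrow> \<phi>' S n p x = \<phi> S n p x"
  shows "is_cyclic U T T' b \<phi>'"
  using assms(1) assms(3) adm_rot lin_closed[OF assms(2)] unfolding is_cyclic_def by simp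

lemma conv_cong_right:
  assumes "\<And>n p. module K (W n p)" "adm n S" "x \<in> carrier (U n p)"
    and "is_family K U V b \<psi>'" "is_family K V W a \<phi>" "c = a + b"
    and "\<And>B. B \<subseteq> S \<Longrightarrow> \<psi> B n p x = \<psi>' B n p x"
  shows "conv W b c \<phi> \<psi> S n p x = conv W b c \<phi> \<psi>' S n p x"
  using assms by (intro conv_cong) auto

lemma conv_cong_left:
  assumes "\<And>n p. module K (W n p)" "adm n S" "x \<in> carrier (U n p)"
    and "is_family K U V b \<psi>" "is_family K V W a \<phi>'" "c = a + b"
    and "\<And>A l q y. adm l A \<Longrightarrow> y \<in> carrier (V l q) \<Longrightarrow> \<phi> A l q y = \<phi>' A l q y"
  shows "conv W b c \<phi> \<psi> S n p x = conv W b c \<phi>' \<psi> S n p x"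
  using assms adm_rest(1)[OF assms(2)] by (intro conv_cong) auto

lemma CF_ident_eq:
  assumes "tuple n I" "x \<in> carrier (grd X n m)"
  shows "CF_ident X I n m x = (if I = [] then x else \<zero>\<^bsub>grd X (n - length I) (m + int (length I))\<^esub>)"
  using assms by (simp add: CF_ident_def normalise_def)

lemma CF_ident_family:
  assumes "modules K X"
  shows "list_family K X X 0 (CF_ident X)"
  unfolding list_family_def
proof (intro allI impI)
  fix n m I assume I: "tuple n I"
  note M = modulesD(1)[OF assms]
  have cong: "CF_ident X I n m \<in> linear_maps K (grd X n m) N \<longleftrightarrow>
      (\<lambda>x. if I = [] then x else \<zero>\<^bsub>grd X (n - length I) (m + int (length I))\<^esub>) \<in> linear_maps K (grd X n m) N" for N
    by (rule linear_maps_cong[OF M CF_ident_eq[OF I]])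
  show "CF_ident X I n m \<in> linear_maps K (grd X n m) (grd X (n - length I) (m + int (length I) + 0))"
    using cong lin_id[of K "grd X n m"]
      lin_const_zero[OF M, of "n - length I" "m + int (length I)" "grd X n m"]
    by (cases "I = []") simp_all
qed

lemma signed_ident:
  assumes "modules K X" "adm n S" "x \<in> carrier (tgrd X n p)"
  shows "signed X 0 (CF_ident X) S n p x = unit_fam (tgrd X) S n p x"
proof -
  have M: "module K (tgrd X (n - card S) p)" by (rule modulesD(2)[OF assms(1)])
  have "sl S = [] \<longleftrightarrow> S = {}" using adm_finite[OF assms(2)] by simp
  moreover have "grd X (n - card S) (p - int n + int (card S)) = tgrd X (n - card S) p"
    using assms(2) tgrd_index[of "card S" n X p 0] by (simp add: adm_def)
  ultimately show ?thesis
    using CF_ident_eq[OF adm_sl(1)[OF assms(2)], of x X "p - int n"] assms(3) adm_sl(2)[OF assms(2)]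
      sign_act_zero[OF M] int_act_one[OF M, of x]
    by (auto simp: signed_def unit_fam_def tgrd_def[of X n p])
qed

lemma CF_comp_eq:
  assumes mods: "modules K Z" and f: "list_family K X Y 0 f" and g: "list_family K Y Z 0 g"
    and I: "tuple n I" and x: "x \<in> carrier (grd X n m)"
  shows "CF_comp X Y Z g f I n m x =
    perm_sum (grd Z (n - length I) (m + int (length I))) splits' 1 I (comp_term g f n m 0 x)"
proof (cases "I = []")
  case True
  have M: "abelian_group (grd Z n m)" by (rule module_abelian_group[OF modulesD(1)[OF mods]])
  have "comp_term g f n m 0 x [] [] \<in> carrier (grd Z n m)"
    using comp_term_closed[OF f g _ I x, of 0 "{}"] True by simp
  then show ?thesis
    using True x I perm_sum_Nil[OF M, of "comp_term g f n m 0 x"]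
    by (simp add: CF_comp_def normalise_def comp_term_def)
next
  case False
  then show ?thesis
    using x I by (simp add: CF_comp_def normalise_def comp_term_def[abs_def])
qed

context
  fixes K :: "('k, 'r) ring_scheme" and X :: "('k, 'a) CF_module"
    and Y :: "('k, 'b) CF_module" and Z :: "('k, 'c) CF_module" and f g
  assumes mods: "modules K X" "modules K Y" "modules K Z"
    and f: "list_family K X Y 0 f" and g: "list_family K Y Z 0 g"
begin

lemma signed_comp:
  assumes S: "adm n S" and x: "x \<in> carrier (tgrd X n p)"
  shows "signed Z 0 (CF_comp X Y Z g f) S n p x = conv (tgrd Z) 0 0 (signed Z 0 g) (signed Y 0 f) S n p x"
proof -
  have "grd Z (n - card S) (p - int n + int (card S)) = tgrd Z (n - card S) p"
    using S tgrd_index[of "card S" n Z p 0] by (simp add: adm_def)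
  then show ?thesis
    using conv_eq_perm_sum[OF mods f g _ S x, of 0] CF_comp_eq[OF mods(3) f g adm_sl(1)[OF S], of x "p - int n"]
      adm_sl(2)[OF S] x
    by (simp add: signed_def tgrd_def[of X n p])
qed

lemma CF_comp_family: "list_family K X Z 0 (CF_comp X Y Z g f)"
  unfolding list_family_def
proof (intro allI impI)
  fix n m I assume I: "tuple n I"
  note t = tuple_set[OF I]
  let ?N = "grd Z (n - length I) (m + int (length I))"
  have N: "module K ?N" by (rule modulesD(1)[OF mods(3)])
  have MX: "module K (grd X n m)" by (rule modulesD(1)[OF mods(1)])
  have fam: "is_family K (tgrd X) (tgrd Z) 0 (conv (tgrd Z) 0 0 (signed Z 0 g) (signed Y 0 f))"
    by (rule conv_family[OF signed_family[OF mods(1,2) f] signed_family[OF mods(2,3) g]])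
       (auto intro: modulesD(2) mods)
  have lin: "conv (tgrd Z) 0 0 (signed Z 0 g) (signed Y 0 f) (set I) n (m + int n) \<in> linear_maps K (grd X n m) ?N"
    using family_lin[OF fam t(1) refl refl, of "m + int n"] t tgrd_index[of "length I" n Z "m + int n" 0]
    by (simp add: tgrd_def[of X])
  have "CF_comp X Y Z g f I n m x = [((-1 :: int) ^ \<Sum> (set I))] \<cdot>\<^bsub>?N\<^esub>
      conv (tgrd Z) 0 0 (signed Z 0 g) (signed Y 0 f) (set I) n (m + int n) x" if x: "x \<in> carrier (grd X n m)" for x
    using perm_sum_conv[OF mods f g _ I x, of 0] perm_sum_comp_closed[OF mods(3) f g _ I x, of 0]
      CF_comp_eq[OF mods(3) f g I x]
    by (simp add: int_act_act[OF N] sign_square int_act_one[OF N])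
  then have "CF_comp X Y Z g f I n m \<in> linear_maps K (grd X n m) ?N \<longleftrightarrow>
      (\<lambda>x. [((-1 :: int) ^ \<Sum> (set I))] \<cdot>\<^bsub>?N\<^esub>
        conv (tgrd Z) 0 0 (signed Z 0 g) (signed Y 0 f) (set I) n (m + int n) x) \<in> linear_maps K (grd X n m) ?N"
    by (rule linear_maps_cong[OF MX])
  then have "CF_comp X Y Z g f I n m \<in> linear_maps K (grd X n m) ?N"
    using lin_comp[OF lin int_act_linear[OF N]] by blast
  then show "CF_comp X Y Z g f I n m \<in> linear_maps K (grd X n m) (grd Z (n - length I) (m + int (length I) + 0))"
    by simp
qed

end

lemma CF_morphismD:
  assumes "is_CF_module K X" "is_CF_module K Y" "is_CF_morphism K X Y f"
  shows "list_family K X Y 0 f" "is_family K (tgrd X) (tgrd Y) 0 (signed Y 0 f)"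
    "adm n S \<Longrightarrow> x \<in> carrier (tgrd X n p) \<Longrightarrow>
      conv (tgrd Y) 0 (- 1) (signed_fac Y) (signed Y 0 f) S n p x = conv (tgrd Y) (- 1) (- 1) (signed Y 0 f) (signed_fac X) S n p x"
    "is_cyclic (tgrd X) (signed_cyc X) (signed_cyc Y) 0 (signed Y 0 f)"
  using assms(3) signed_family[OF CF_moduleD(2)[OF assms(1)] CF_moduleD(2)[OF assms(2)], of 0 f]
  unfolding CF_morphism_iff[OF assms(1,2)] by auto

lemma CF_ident_morphism:
  assumes X: "is_CF_module K X"
  shows "is_CF_morphism K X X (CF_ident X)"
proof -
  note m = CF_moduleD(2)[OF X] and mG = CF_moduleD(6)[OF X] and dl = CF_moduleD(5)[OF X]
  note i = unit_fam_family[of K "tgrd X", OF mG]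
  show ?thesis
    unfolding CF_morphism_iff[OF X X]
  proof (intro conjI allI ballI impI)
    show "list_family K X X 0 (CF_ident X)" by (rule CF_ident_family[OF m])
    show "is_cyclic (tgrd X) (signed_cyc X) (signed_cyc X) 0 (signed X 0 (CF_ident X))"
      by (rule is_cyclic_cong[OF unit_fam_cyclic[OF CF_cyclic_data[OF X]] cyclic_dataD(3)[OF CF_cyclic_data[OF X]]])
         (rule signed_ident[OF m])
    fix n p S x assume x: "x \<in> carrier (tgrd X n p)" and S: "adm n S"
    have "conv (tgrd X) 0 (- 1) (signed_fac X) (signed X 0 (CF_ident X)) S n p x = conv (tgrd X) 0 (- 1) (signed_fac X) (unit_fam (tgrd X)) S n p x"
      by (rule conv_cong_right[OF mG S x i dl]) (use signed_ident[OF m adm_subset[OF S] x] in auto)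
    also have "\<dots> = conv (tgrd X) (- 1) (- 1) (unit_fam (tgrd X)) (signed_fac X) S n p x"
      using conv_unit_right[OF dl mG mG S x] conv_unit_left[OF dl mG mG S x] by simp
    also have "\<dots> = conv (tgrd X) (- 1) (- 1) (signed X 0 (CF_ident X)) (signed_fac X) S n p x"
      by (rule conv_cong_left[OF mG S x dl signed_family[OF m m CF_ident_family[OF m]]])
         (use signed_ident[OF m] in auto)
    finally show "conv (tgrd X) 0 (- 1) (signed_fac X) (signed X 0 (CF_ident X)) S n p x =
      conv (tgrd X) (- 1) (- 1) (signed X 0 (CF_ident X)) (signed_fac X) S n p x" .
  qed
qed

text \<open>Associativity of convolution combines the equations for \<open>f\<close> and \<open>g\<close>:
\<open>\<partial> * (g * f) = (\<partial> * g) * f = (g * \<partial>) * f = g * (\<partial> * f) = g * (f * \<partial>) = (g * f) * \<partial>\<close>.\<close>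

lemma CF_comp_morphism:
  assumes X: "is_CF_module K X" and Y: "is_CF_module K Y" and Z: "is_CF_module K Z"
    and f: "is_CF_morphism K X Y f" and g: "is_CF_morphism K Y Z g"
  shows "is_CF_morphism K X Z (CF_comp X Y Z g f)"
proof -
  note mX = CF_moduleD(2)[OF X] and mY = CF_moduleD(2)[OF Y] and mZ = CF_moduleD(2)[OF Z]
  note gX = CF_moduleD(6)[OF X] and gY = CF_moduleD(6)[OF Y] and gZ = CF_moduleD(6)[OF Z]
  note dX = CF_moduleD(5)[OF X] and dY = CF_moduleD(5)[OF Y] and dZ = CF_moduleD(5)[OF Z]
  note f' = CF_morphismD[OF X Y f] and g' = CF_morphismD[OF Y Z g]
  let ?F = "signed Y 0 f" and ?H = "signed Z 0 g"
  note comp = signed_comp[OF mX mY mZ f'(1) g'(1)]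
  have c0: "is_family K (tgrd X) (tgrd Z) 0 (conv (tgrd Z) 0 0 ?H ?F)" by (rule conv_family[OF f'(2) g'(2) _ gX gZ]) simp
  have c1: "is_family K (tgrd X) (tgrd Y) (- 1) (conv (tgrd Y) (- 1) (- 1) ?F (signed_fac X))"
    by (rule conv_family[OF dX f'(2) _ gX gY]) simp
  show ?thesis
    unfolding CF_morphism_iff[OF X Z]
  proof (intro conjI allI ballI impI)
    show lf: "list_family K X Z 0 (CF_comp X Y Z g f)" by (rule CF_comp_family[OF mX mY mZ f'(1) g'(1)])
    have "is_cyclic (tgrd X) (signed_cyc X) (signed_cyc Z) 0 (conv (tgrd Z) 0 0 ?H ?F)"
      by (rule conv_cyclic[OF f'(2) g'(2) _ gX gY gZ
            cyclic_dataD(3)[OF CF_cyclic_data[OF X]] cyclic_dataD(3)[OF CF_cyclic_data[OF Y]]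
            cyclic_dataD(3)[OF CF_cyclic_data[OF Z]] f'(4) g'(4)]) simp
    then show "is_cyclic (tgrd X) (signed_cyc X) (signed_cyc Z) 0 (signed Z 0 (CF_comp X Y Z g f))"
      by (rule is_cyclic_cong[OF _ cyclic_dataD(3)[OF CF_cyclic_data[OF X]]]) (rule comp)
    fix n p S x assume x: "x \<in> carrier (tgrd X n p)" and S: "adm n S"
    have "conv (tgrd Z) 0 (- 1) (signed_fac Z) (signed Z 0 (CF_comp X Y Z g f)) S n p x =
        conv (tgrd Z) 0 (- 1) (signed_fac Z) (conv (tgrd Z) 0 0 ?H ?F) S n p x"
      by (rule conv_cong_right[OF gZ S x c0 dZ]) (use comp[OF adm_subset[OF S] x] in auto)
    also have "\<dots> = conv (tgrd Z) 0 (- 1) (conv (tgrd Z) 0 (- 1) (signed_fac Z) ?H) ?F S n p x"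
      by (rule conv_assoc[OF f'(2) g'(2) dZ _ _ _ gX gY gZ gZ S x]) auto
    also have "\<dots> = conv (tgrd Z) 0 (- 1) (conv (tgrd Z) (- 1) (- 1) ?H (signed_fac Y)) ?F S n p x"
    proof (rule conv_cong_left[OF gZ S x f'(2)])
      show "is_family K (tgrd Y) (tgrd Z) (- 1) (conv (tgrd Z) (- 1) (- 1) ?H (signed_fac Y))"
        by (rule conv_family[OF dY g'(2) _ gY gZ]) simp
    qed (use g'(3) in auto)
    also have "\<dots> = conv (tgrd Z) (- 1) (- 1) ?H (conv (tgrd Y) 0 (- 1) (signed_fac Y) ?F) S n p x"
      by (rule conv_assoc[OF f'(2) dY g'(2) _ _ _ gX gY gY gZ S x, symmetric]) auto
    also have "\<dots> = conv (tgrd Z) (- 1) (- 1) ?H (conv (tgrd Y) (- 1) (- 1) ?F (signed_fac X)) S n p x"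
      by (rule conv_cong_right[OF gZ S x c1 g'(2)]) (use f'(3)[OF adm_subset[OF S] x] in auto)
    also have "\<dots> = conv (tgrd Z) (- 1) (- 1) (conv (tgrd Z) 0 0 ?H ?F) (signed_fac X) S n p x"
      by (rule conv_assoc[OF dX f'(2) g'(2) _ _ _ gX gX gY gZ S x]) auto
    also have "\<dots> = conv (tgrd Z) (- 1) (- 1) (signed Z 0 (CF_comp X Y Z g f)) (signed_fac X) S n p x"
      by (rule conv_cong_left[OF gZ S x dX signed_family[OF mX mZ lf]]) (use comp in auto)
    finally show "conv (tgrd Z) 0 (- 1) (signed_fac Z) (signed Z 0 (CF_comp X Y Z g f)) S n p x =
        conv (tgrd Z) (- 1) (- 1) (signed Z 0 (CF_comp X Y Z g f)) (signed_fac X) S n p x" .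
  qed
qed

lemma normalised_normalise: "normalised X (normalise X f)"
  by (simp add: normalised_def normalise_def)

text \<open>The sign \<open>(-1)\<^bsup>\<Sum>S\<^esup>\<close> is invertible, so signed components determine a normalised family.\<close>

lemma normalised_ext:
  assumes mods: "modules K X" "modules K Y" and f: "list_family K X Y 0 f" "normalised X f"
    and g: "list_family K X Y 0 g" "normalised X g"
    and eq: "\<And>n p S x. adm n S \<Longrightarrow> x \<in> carrier (tgrd X n p) \<Longrightarrow> signed Y 0 f S n p x = signed Y 0 g S n p x"
  shows "f = g"
proof (intro ext)
  fix I n m x
  show "f I n m x = g I n m x"
  proof (cases "tuple n I \<and> x \<in> carrier (grd X n m)")
    case True
    then have I: "tuple n I" and x: "x \<in> carrier (grd X n m)" by auto
    let ?N = "grd Y (n - length I) (m + int (length I) + 0)"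
    have N: "module K ?N" by (rule modulesD(1)[OF mods(2)])
    have "f I n m x \<in> carrier ?N" "g I n m x \<in> carrier ?N"
      using lin_closed[OF list_family_lin[OF f(1) I refl refl] x] lin_closed[OF list_family_lin[OF g(1) I refl refl] x]
      by auto
    moreover have "signed Y 0 f (set I) n (m + int n) x = signed Y 0 g (set I) n (m + int n) x"
      using eq[OF tuple_set(1)[OF I], of x "m + int n"] x by (simp add: tgrd_def)
    ultimately show ?thesis unfolding signed_eq[OF I] using sign_act_cancel[OF N] by blast
  next
    case False
    note nf = f(2)[unfolded normalised_def, THEN spec[of _ n], THEN spec[of _ m], THEN spec[of _ I]]
      and ng = g(2)[unfolded normalised_def, THEN spec[of _ n], THEN spec[of _ m], THEN spec[of _ I]]
    show ?thesis
    proof (cases "tuple n I")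
      case True
      then have "x \<notin> carrier (grd X n m)" using False by simp
      then show ?thesis using nf ng True by (simp add: extensional_arb[of _ "carrier (grd X n m)"])
    next
      case False
      then show ?thesis using nf ng by simp
    qed
  qed
qed

theorem CF_category: "is_category (CF_cat K)"
  unfolding is_category_def
proof (intro conjI ballI)
  fix X :: "('a, 'b) CF_module" assume "X \<in> Obj (CF_cat K)"
  then have X: "is_CF_module K X" by (simp add: CF_cat_def)
  show "Ident (CF_cat K) X \<in> Hom (CF_cat K) X X"
    using CF_ident_morphism[OF X] by (simp add: CF_cat_def CF_ident_def normalised_normalise)
next
  fix X Y Z :: "('a, 'b) CF_module" and f g
  assume "X \<in> Obj (CF_cat K)" "Y \<in> Obj (CF_cat K)" "Z \<in> Obj (CF_cat K)"
    "f \<in> Hom (CF_cat K) X Y" "g \<in> Hom (CF_cat K) Y Z"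
  then show "Comp (CF_cat K) X Y Z g f \<in> Hom (CF_cat K) X Z"
    using CF_comp_morphism[of K X Y Z f g] by (simp add: CF_cat_def CF_comp_def normalised_normalise)
next
  fix X Y :: "('a, 'b) CF_module" and f
  assume "X \<in> Obj (CF_cat K)" "Y \<in> Obj (CF_cat K)" "f \<in> Hom (CF_cat K) X Y"
  then have X: "is_CF_module K X" and Y: "is_CF_module K Y" and f: "is_CF_morphism K X Y f" and nf: "normalised X f"
    by (auto simp: CF_cat_def)
  note mX = CF_moduleD(2)[OF X] and mY = CF_moduleD(2)[OF Y]
  note gX = CF_moduleD(6)[OF X] and gY = CF_moduleD(6)[OF Y]
  note f' = CF_morphismD[OF X Y f]
  note iX = CF_ident_family[OF mX] and iY = CF_ident_family[OF mY]
  show "Comp (CF_cat K) X X Y f (Ident (CF_cat K) X) = f"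
  proof -
    have "CF_comp X X Y f (CF_ident X) = f"
    proof (rule normalised_ext[OF mX mY CF_comp_family[OF mX mX mY iX f'(1)] _ f'(1) nf])
      show "normalised X (CF_comp X X Y f (CF_ident X))" by (simp add: CF_comp_def normalised_normalise)
      fix n p S x assume S: "adm n S" and x: "x \<in> carrier (tgrd X n p)"
      have "conv (tgrd Y) 0 0 (signed Y 0 f) (signed X 0 (CF_ident X)) S n p x = conv (tgrd Y) 0 0 (signed Y 0 f) (unit_fam (tgrd X)) S n p x"
        by (rule conv_cong_right[OF gY S x unit_fam_family[of K "tgrd X", OF gX] f'(2)]) (use signed_ident[OF mX adm_subset[OF S] x] in auto)
      then show "signed Y 0 (CF_comp X X Y f (CF_ident X)) S n p x = signed Y 0 f S n p x"
        using signed_comp[OF mX mX mY iX f'(1) S x] conv_unit_right[OF f'(2) gX gY S x] by simp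
    qed
    then show ?thesis by (simp add: CF_cat_def)
  qed
  show "Comp (CF_cat K) X Y Y (Ident (CF_cat K) Y) f = f"
  proof -
    have "CF_comp X Y Y (CF_ident Y) f = f"
    proof (rule normalised_ext[OF mX mY CF_comp_family[OF mX mY mY f'(1) iY] _ f'(1) nf])
      show "normalised X (CF_comp X Y Y (CF_ident Y) f)" by (simp add: CF_comp_def normalised_normalise)
      fix n p S x assume S: "adm n S" and x: "x \<in> carrier (tgrd X n p)"
      have "conv (tgrd Y) 0 0 (signed Y 0 (CF_ident Y)) (signed Y 0 f) S n p x = conv (tgrd Y) 0 0 (unit_fam (tgrd Y)) (signed Y 0 f) S n p x"
        by (rule conv_cong_left[OF gY S x f'(2) unit_fam_family[of K "tgrd Y", OF gY]]) (use signed_ident[OF mY] in auto)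
      then show "signed Y 0 (CF_comp X Y Y (CF_ident Y) f) S n p x = signed Y 0 f S n p x"
        using signed_comp[OF mX mY mY f'(1) iY S x] conv_unit_left[OF f'(2) gX gY S x] by simp
    qed
    then show ?thesis by (simp add: CF_cat_def)
  qed
next
  fix W X Y Z :: "('a, 'b) CF_module" and f g h
  assume "W \<in> Obj (CF_cat K)" "X \<in> Obj (CF_cat K)" "Y \<in> Obj (CF_cat K)" "Z \<in> Obj (CF_cat K)"
    "f \<in> Hom (CF_cat K) W X" "g \<in> Hom (CF_cat K) X Y" "h \<in> Hom (CF_cat K) Y Z"
  then have W: "is_CF_module K W" and X: "is_CF_module K X" and Y: "is_CF_module K Y" and Z: "is_CF_module K Z"
    and f: "is_CF_morphism K W X f" and g: "is_CF_morphism K X Y g" and h: "is_CF_morphism K Y Z h"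
    by (auto simp: CF_cat_def)
  note m = CF_moduleD(2)[OF W] CF_moduleD(2)[OF X] CF_moduleD(2)[OF Y] CF_moduleD(2)[OF Z]
  note gm = CF_moduleD(6)[OF W] CF_moduleD(6)[OF X] CF_moduleD(6)[OF Y] CF_moduleD(6)[OF Z]
  note f' = CF_morphismD[OF W X f] and g' = CF_morphismD[OF X Y g] and h' = CF_morphismD[OF Y Z h]
  note hg = CF_comp_family[OF m(2,3,4) g'(1) h'(1)] and gf = CF_comp_family[OF m(1,2,3) f'(1) g'(1)]
  have "CF_comp W X Z (CF_comp X Y Z h g) f = CF_comp W Y Z h (CF_comp W X Y g f)"
  proof (rule normalised_ext[OF m(1,4) CF_comp_family[OF m(1,2,4) f'(1) hg] _ CF_comp_family[OF m(1,3,4) gf h'(1)]])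
    show "normalised W (CF_comp W X Z (CF_comp X Y Z h g) f)" "normalised W (CF_comp W Y Z h (CF_comp W X Y g f))"
      by (simp_all add: CF_comp_def normalised_normalise)
    fix n p S x assume S: "adm n S" and x: "x \<in> carrier (tgrd W n p)"
    have "signed Z 0 (CF_comp W X Z (CF_comp X Y Z h g) f) S n p x =
        conv (tgrd Z) 0 0 (signed Z 0 (CF_comp X Y Z h g)) (signed X 0 f) S n p x"
      by (rule signed_comp[OF m(1,2,4) f'(1) hg S x])
    also have "\<dots> = conv (tgrd Z) 0 0 (conv (tgrd Z) 0 0 (signed Z 0 h) (signed Y 0 g)) (signed X 0 f) S n p x"
    proof (rule conv_cong_left[OF gm(4) S x f'(2)])
      show "is_family K (tgrd X) (tgrd Z) 0 (conv (tgrd Z) 0 0 (signed Z 0 h) (signed Y 0 g))"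
        by (rule conv_family[OF g'(2) h'(2) _ gm(2,4)]) simp
    qed (use signed_comp[OF m(2,3,4) g'(1) h'(1)] in auto)
    also have "\<dots> = conv (tgrd Z) 0 0 (signed Z 0 h) (conv (tgrd Y) 0 0 (signed Y 0 g) (signed X 0 f)) S n p x"
      by (rule conv_assoc[OF f'(2) g'(2) h'(2) _ _ _ gm S x, symmetric]) auto
    also have "\<dots> = conv (tgrd Z) 0 0 (signed Z 0 h) (signed Y 0 (CF_comp W X Y g f)) S n p x"
      by (rule conv_cong_right[OF gm(4) S x signed_family[OF m(1,3) gf] h'(2)])
         (use signed_comp[OF m(1,2,3) f'(1) g'(1) adm_subset[OF S] x] in auto)
    also have "\<dots> = signed Z 0 (CF_comp W Y Z h (CF_comp W X Y g f)) S n p x"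
      by (rule signed_comp[OF m(1,3,4) gf h'(1) S x, symmetric])
    finally show "signed Z 0 (CF_comp W X Z (CF_comp X Y Z h g) f) S n p x =
        signed Z 0 (CF_comp W Y Z h (CF_comp W X Y g f)) S n p x" .
  qed
  then show "Comp (CF_cat K) W X Z (Comp (CF_cat K) X Y Z h g) f = Comp (CF_cat K) W Y Z h (Comp (CF_cat K) W X Y g f)"
    by (simp add: CF_cat_def)
qed

section \<open>Cyclic homology as homology of the bicomplex of a cyclic family\<close>

lemma is_bicomplex_cong:
  assumes bi: "is_bicomplex K C d1 d2"
    and e1: "\<And>n m x. x \<in> carrier (C n) \<Longrightarrow> e1 n m x = d1 n m x"
    and e2: "\<And>n m x. x \<in> carrier (C (Suc n)) \<Longrightarrow> e2 (Suc n) m x = d2 (Suc n) m x"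
  shows "is_bicomplex K C e1 e2"
proof -
  have M: "module K (C n)" for n using bi by (simp add: is_bicomplex_def)
  have d1: "d1 n m \<in> linear_maps K (C n) (C n)" for n m using bi by (simp add: is_bicomplex_def)
  have d2: "d2 (Suc n) m \<in> linear_maps K (C (Suc n)) (C n)" for n m using bi by (simp add: is_bicomplex_def)
  have "e1 n m \<in> linear_maps K (C n) (C n)" for n m
    using linear_maps_cong[of K "C n" "e1 n m" "d1 n m" "C n"] M d1 e1 by simp
  moreover have "e2 (Suc n) m \<in> linear_maps K (C (Suc n)) (C n)" for n m
    using linear_maps_cong[of K "C (Suc n)" "e2 (Suc n) m" "d2 (Suc n) m" "C n"] M d2 e2 by simp
  ultimately show ?thesis
    using bi e1 e2 lin_closed[OF d1] lin_closed[OF d2] unfolding is_bicomplex_def by simp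
qed

lemma is_bicomplex_map_cong:
  assumes bi: "is_bicomplex K C d1 d2"
    and F: "is_bicomplex_map K C d1 d2 C' d1' d2' F"
    and e1: "\<And>n m x. x \<in> carrier (C n) \<Longrightarrow> e1 n m x = d1 n m x"
    and e2: "\<And>n m x. x \<in> carrier (C (Suc n)) \<Longrightarrow> e2 (Suc n) m x = d2 (Suc n) m x"
    and e1': "\<And>n m x. x \<in> carrier (C' n) \<Longrightarrow> e1' n m x = d1' n m x"
    and e2': "\<And>n m x. x \<in> carrier (C' (Suc n)) \<Longrightarrow> e2' (Suc n) m x = d2' (Suc n) m x"
    and F': "\<And>n m x. x \<in> carrier (C n) \<Longrightarrow> F' n m x = F n m x"
  shows "is_bicomplex_map K C e1 e2 C' e1' e2' F'"
proof -
  have M: "module K (C n)" for n using bi by (simp add: is_bicomplex_def)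
  have d1: "d1 n m \<in> linear_maps K (C n) (C n)" for n m using bi by (simp add: is_bicomplex_def)
  have d2: "d2 (Suc n) m \<in> linear_maps K (C (Suc n)) (C n)" for n m using bi by (simp add: is_bicomplex_def)
  have Fl: "F n m \<in> linear_maps K (C n) (C' n)" for n m using F by (simp add: is_bicomplex_map_def)
  have "F' n m \<in> linear_maps K (C n) (C' n)" for n m
    using linear_maps_cong[of K "C n" "F' n m" "F n m" "C' n"] M Fl F' by simp
  then show ?thesis
    using F e1 e2 e1' e2' F' lin_closed[OF d1] lin_closed[OF d2] lin_closed[OF Fl]
    unfolding is_bicomplex_map_def by simp
qed

lemma is_bicomplex_homotopy_cong:
  assumes bi: "is_bicomplex K C d1 d2"
    and H: "is_bicomplex_homotopy K C d1 d2 C' d1' d2' F F2 H"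
    and e1: "\<And>n m x. x \<in> carrier (C n) \<Longrightarrow> e1 n m x = d1 n m x"
    and e2: "\<And>n m x. x \<in> carrier (C (Suc n)) \<Longrightarrow> e2 (Suc n) m x = d2 (Suc n) m x"
    and e1': "\<And>n m x. x \<in> carrier (C' n) \<Longrightarrow> e1' n m x = d1' n m x"
    and e2': "\<And>n m x. x \<in> carrier (C' (Suc n)) \<Longrightarrow> e2' (Suc n) m x = d2' (Suc n) m x"
    and F': "\<And>n m x. x \<in> carrier (C n) \<Longrightarrow> F' n m x = F n m x"
    and F2': "\<And>n m x. x \<in> carrier (C n) \<Longrightarrow> F2' n m x = F2 n m x"
  shows "is_bicomplex_homotopy K C e1 e2 C' e1' e2' F' F2' H"
proof -
  have d1: "d1 n m \<in> linear_maps K (C n) (C n)" for n m using bi by (simp add: is_bicomplex_def)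
  have d2: "d2 (Suc n) m \<in> linear_maps K (C (Suc n)) (C n)" for n m using bi by (simp add: is_bicomplex_def)
  have Hl: "H n m \<in> linear_maps K (C n) (C' (Suc n))" for n m using H by (simp add: is_bicomplex_homotopy_def)
  show ?thesis
    using H e1 e2 e1' e2' F' F2' lin_closed[OF d1] lin_closed[OF d2] lin_closed[OF Hl]
    unfolding is_bicomplex_homotopy_def by simp
qed

lemma direct_sum_cong:
  assumes "\<And>i. i \<in> I \<Longrightarrow> M i = N i"
  shows "direct_sum I M = direct_sum I N"
proof -
  have "(\<Pi>\<^sub>E i \<in> I. carrier (M i)) = (\<Pi>\<^sub>E i \<in> I. carrier (N i))" using assms by (intro PiE_cong) simp
  moreover have "(\<lambda>i\<in>I. \<zero>\<^bsub>M i\<^esub>) = (\<lambda>i\<in>I. \<zero>\<^bsub>N i\<^esub>)" using assms by (intro restrict_ext) simp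
  moreover have "(\<lambda>x y. \<lambda>i\<in>I. x i \<oplus>\<^bsub>M i\<^esub> y i) = (\<lambda>x y. \<lambda>i\<in>I. x i \<oplus>\<^bsub>N i\<^esub> y i)"
    using assms by (intro ext) (auto simp: restrict_def)
  moreover have "(\<lambda>a x. \<lambda>i\<in>I. a \<odot>\<^bsub>M i\<^esub> x i) = (\<lambda>a x. \<lambda>i\<in>I. a \<odot>\<^bsub>N i\<^esub> x i)"
    using assms by (intro ext) (auto simp: restrict_def)
  ultimately show ?thesis by (simp add: direct_sum_def)
qed

lemma bar_eq: "bar X = dsum (tgrd X)"
proof
  fix n
  show "bar X n = dsum (tgrd X) n"
    unfolding bar_def dsum_def by (intro direct_sum_cong) (simp add: tgrd_def of_nat_diff)
qed

lemma tuples_ksub: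
  assumes "k \<le> n"
  shows "bij_betw set (tuples_upto q k n) (ksub q n k)"
    "I \<in> tuples_upto q k n \<Longrightarrow> tuple n I \<and> length I = k"
proof -
  show *: "tuple n I \<and> length I = k" if "I \<in> tuples_upto q k n" for I
    using that assms by (auto simp: tuples_upto_def tuple_def)
  have up: "set I \<subseteq> {..<n + 1 - q} \<longleftrightarrow> (\<forall>i \<in> set I. i + q \<le> n)" for I by auto
  show "bij_betw set (tuples_upto q k n) (ksub q n k)"
  proof (rule bij_betw_byWitness[where f' = sl])
    show "\<forall>I \<in> tuples_upto q k n. sl (set I) = I" using * tuple_set(3) by blast
    show "\<forall>S \<in> ksub q n k. set (sl S) = S" using ksub_adm[OF _ assms] adm_sl(3) by blast
    show "set ` tuples_upto q k n \<subseteq> ksub q n k"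
    proof (rule image_subsetI)
      fix I assume I: "I \<in> tuples_upto q k n"
      then show "set I \<in> ksub q n k"
        using *[OF I] tuple_set(2) unfolding ksub_def by (auto simp: tuples_upto_def)
    qed
    show "sl ` ksub q n k \<subseteq> tuples_upto q k n"
    proof (rule image_subsetI)
      fix S assume S: "S \<in> ksub q n k"
      then have "adm n S" using ksub_adm[OF S assms] by simp
      then show "sl S \<in> tuples_upto q k n"
        using S adm_sl[OF \<open>adm n S\<close>] by (auto simp: tuples_upto_def ksub_def)
    qed
  qed
qed

text \<open>The sums in \<open>d\<^sub>q\<^sup>k\<close> and \<open>f\<^sub>q\<^sup>k\<close> are sums of signed components over subsets of size \<open>k\<close>.\<close>

lemma tuple_sum:
  assumes mods: "modules K X" "modules K Y" and \<phi>: "list_family K X Y b \<phi>"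
    and k: "k \<le> n" and x: "x \<in> carrier (grd X n m)"
  defines "M \<equiv> grd Y (n - k) (m + int k + b)"
  shows "(\<Oplus>\<^bsub>M\<^esub>I \<in> tuples_upto q k n. [((-1 :: int) ^ sum_list I)] \<cdot>\<^bsub>M\<^esub> \<phi> I n m x) =
    (\<Oplus>\<^bsub>M\<^esub>S \<in> ksub q n k. signed Y b \<phi> S n (m + int n) x)"
    and "I \<in> tuples_upto q k n \<Longrightarrow> [((-1 :: int) ^ sum_list I)] \<cdot>\<^bsub>M\<^esub> \<phi> I n m x \<in> carrier M"
proof -
  have M: "module K M" unfolding M_def by (rule modulesD(1)[OF mods(2)])
  interpret M: module K M by (rule M)
  have c: "\<phi> I n m x \<in> carrier M" if "I \<in> tuples_upto q k n" for I
    using lin_closed[OF list_family_lin[OF \<phi> _ refl refl] x] tuples_ksub(2)[OF k that] unfolding M_def by auto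
  then show "[((-1 :: int) ^ sum_list I)] \<cdot>\<^bsub>M\<^esub> \<phi> I n m x \<in> carrier M" if "I \<in> tuples_upto q k n" for I
    using that by (intro int_act_closed[OF M])
  show "(\<Oplus>\<^bsub>M\<^esub>I \<in> tuples_upto q k n. [((-1 :: int) ^ sum_list I)] \<cdot>\<^bsub>M\<^esub> \<phi> I n m x) =
    (\<Oplus>\<^bsub>M\<^esub>S \<in> ksub q n k. signed Y b \<phi> S n (m + int n) x)"
  proof (rule M.M.finsum_bij[OF tuples_ksub(1)[OF k]])
    fix I assume I: "I \<in> tuples_upto q k n"
    have t: "tuple n I" "length I = k" using tuples_ksub(2)[OF k I] by auto
    have "distinct I" using tuple_set(4)[OF t(1)] by (simp add: strict_sorted_iff)
    then have "sum_list I = \<Sum> (set I)" by (rule distinct_sum_list_conv_Sum)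
    then show "signed Y b \<phi> (set I) n (m + int n) x = [((-1 :: int) ^ sum_list I)] \<cdot>\<^bsub>M\<^esub> \<phi> I n m x"
      unfolding signed_eq[OF t(1)] M_def t(2) by simp
    show "[((-1 :: int) ^ sum_list I)] \<cdot>\<^bsub>M\<^esub> \<phi> I n m x \<in> carrier M"
      using c[OF I] by (rule int_act_closed[OF M])
  qed
qed

lemma tuples_upto_0: "tuples_upto q 0 n = {[]}"
  by (auto simp: tuples_upto_def)

lemma (in abelian_group) finsum_one: "f a \<in> carrier G \<Longrightarrow> finsum G f {a} = f a"
  by (simp add: finsum_insert)

lemma dq_eq:
  assumes X: "is_CF_module K X" and k: "k \<le> n" and x: "x \<in> carrier (grd X n m)"
  shows "dq X q k n m x =
    (\<Oplus>\<^bsub>grd X (n - k) (m + int k - 1)\<^esub>S \<in> ksub q n k. signed_fac X S n (m + int n) x)"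
proof -
  note mods = CF_moduleD(2)[OF X] and d = CF_moduleD(3)[OF X]
  let ?M = "grd X (n - k) (m + int k - 1)"
  have M: "module K ?M" by (rule modulesD(1)[OF mods])
  interpret M: module K ?M by (rule M)
  note ts = tuple_sum(1)[OF mods mods d k x, of q, simplified]
  note c = tuple_sum(2)[OF mods mods d k x, of _ q, simplified]
  have "dq X q k n m x = (\<Oplus>\<^bsub>?M\<^esub>I \<in> tuples_upto q k n. [((-1 :: int) ^ sum_list I)] \<cdot>\<^bsub>?M\<^esub> dfac X I n m x)"
  proof (cases "k = 0")
    case True
    have "dif X n m x \<in> carrier ?M"
      using lin_closed[OF list_family_lin[OF d, of n "[]" n "m - 1" m] x] True by (simp add: tuple_def)
    moreover have M0: "module K (grd X n (m - 1))" by (rule modulesD(1)[OF mods])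
    ultimately show ?thesis
      using True
      by (simp add: dq_def tuples_upto_0 abelian_group.finsum_one[OF module_abelian_group[OF M0]] int_act_one[OF M0])
  next
    case False
    then have "[((-1 :: int) ^ sum_list I)] \<cdot>\<^bsub>?M\<^esub> fac X I n m x = [((-1 :: int) ^ sum_list I)] \<cdot>\<^bsub>?M\<^esub> dfac X I n m x"
      if "I \<in> tuples_upto q k n" for I using that by (cases "I = []") (auto simp: tuples_upto_def)
    then show ?thesis using False c unfolding dq_def by (simp, intro M.M.finsum_cong') auto
  qed
  then show ?thesis using ts by simp
qed

lemma fq_eq:
  assumes mods: "modules K X" "modules K Y" and f: "list_family K X Y 0 f"
    and k: "k \<le> n" and x: "x \<in> carrier (grd X n m)"
  shows "fq Y f q k n m x =
    (\<Oplus>\<^bsub>grd Y (n - k) (m + int k)\<^esub>S \<in> ksub q n k. signed Y 0 f S n (m + int n) x)"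
proof -
  let ?M = "grd Y (n - k) (m + int k)"
  have M: "module K ?M" by (rule modulesD(1)[OF mods(2)])
  interpret M: module K ?M by (rule M)
  have "fq Y f q k n m x = (\<Oplus>\<^bsub>?M\<^esub>I \<in> tuples_upto q k n. [((-1 :: int) ^ sum_list I)] \<cdot>\<^bsub>?M\<^esub> f I n m x)"
  proof (cases "k = 0")
    case True
    have "f [] n m x \<in> carrier ?M"
      using lin_closed[OF list_family_lin[OF f, of n "[]" n m] x] True by (simp add: tuple_def)
    moreover have M0: "module K (grd Y n m)" by (rule modulesD(1)[OF mods(2)])
    ultimately show ?thesis
      using True
      by (simp add: fq_def tuples_upto_0 abelian_group.finsum_one[OF module_abelian_group[OF M0]] int_act_one[OF M0])
  qed (simp add: fq_def)
  then show ?thesis using tuple_sum(1)[OF mods f k x, of q] by simp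
qed

lemma bar_comp_by_length:
  assumes fam: "is_family K U V b \<phi>" and V: "module K (V j (p + b))"
    and v: "\<And>k. k \<le> N \<Longrightarrow> v k \<in> carrier (U k p)" and j: "j \<le> N"
  shows "(\<Oplus>\<^bsub>V j (p + b)\<^esub>i \<in> {..N - j}. \<Oplus>\<^bsub>V j (p + b)\<^esub>S \<in> ksub q (j + i) i. \<phi> S (j + i) p (v (j + i))) =
    bar_comp q V b \<phi> N p v j"
    "\<And>i. i \<le> N - j \<Longrightarrow> (\<Oplus>\<^bsub>V j (p + b)\<^esub>S \<in> ksub q (j + i) i. \<phi> S (j + i) p (v (j + i))) \<in> carrier (V j (p + b))"
proof -
  interpret V: module K "V j (p + b)" by (rule V)
  have bij: "bij_betw (\<lambda>i. j + i) {..N - j} {j..N}"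
    by (rule bij_betw_byWitness[where f' = "\<lambda>k. k - j"]) (use j in auto)
  show c: "(\<Oplus>\<^bsub>V j (p + b)\<^esub>S \<in> ksub q (j + i) i. \<phi> S (j + i) p (v (j + i))) \<in> carrier (V j (p + b))" if "i \<le> N - j" for i
    using bar_comp_split(2)[where V = V and k = "j + i" and q = q and N = N, OF fam V v] that j by simp
  show "(\<Oplus>\<^bsub>V j (p + b)\<^esub>i \<in> {..N - j}. \<Oplus>\<^bsub>V j (p + b)\<^esub>S \<in> ksub q (j + i) i. \<phi> S (j + i) p (v (j + i))) =
    bar_comp q V b \<phi> N p v j"
    unfolding bar_comp_split(1)[where V = V and q = q and N = N and v = v, OF fam V v, simplified]
    by (rule V.M.finsum_bij[OF bij]) (use c in auto)
qed

lemma bar_b_eq: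
  assumes X: "is_CF_module K X" and v: "v \<in> carrier (dsum (tgrd X) (Suc n))"
  shows "bar_b X q (Suc n) v = bar_op q (tgrd X) (- 1) (signed_fac X) (Suc n) n v"
  unfolding bar_b_def bar_op_def diff_Suc_1
proof (rule restrict_ext)
  fix j assume j: "j \<in> {..n}"
  note dl = CF_moduleD(5)[OF X] and gX = CF_moduleD(6)[OF X]
  have N: "grd X j (int (n - j)) = tgrd X j (int (Suc n) + - 1)" using j by (simp add: tgrd_def of_nat_diff)
  interpret M: module K "tgrd X j (int (Suc n) + - 1)" by (rule gX)
  note vc = dsum_component[OF v]
  have bl: "(\<Oplus>\<^bsub>tgrd X j (int (Suc n) + - 1)\<^esub>i \<in> {..Suc n - j}. \<Oplus>\<^bsub>tgrd X j (int (Suc n) + - 1)\<^esub>S \<in> ksub q (j + i) i.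
      signed_fac X S (j + i) (int (Suc n)) (v (j + i))) = bar_comp q (tgrd X) (- 1) (signed_fac X) (Suc n) (int (Suc n)) v j"
    by (rule bar_comp_by_length(1)[OF dl gX vc]) (use j in auto)
  have blc: "(\<Oplus>\<^bsub>tgrd X j (int (Suc n) + - 1)\<^esub>S \<in> ksub q (j + i) i. signed_fac X S (j + i) (int (Suc n)) (v (j + i))) \<in>
      carrier (tgrd X j (int (Suc n) + - 1))" if "i \<le> Suc n - j" for i
    by (rule bar_comp_by_length(2)[OF dl gX vc]) (use j that in auto)
  have "dq X q i (j + i) (int (Suc n - j - i)) (v (j + i)) =
      (\<Oplus>\<^bsub>tgrd X j (int (Suc n) + - 1)\<^esub>S \<in> ksub q (j + i) i. signed_fac X S (j + i) (int (Suc n)) (v (j + i)))"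
    if i: "i \<le> Suc n - j" for i
  proof -
    have m: "int (Suc n - j - i) = int (Suc n) - int (j + i)" using i j by (simp add: of_nat_diff)
    have "v (j + i) \<in> carrier (grd X (j + i) (int (Suc n) - int (j + i)))"
      using vc[of "j + i"] i j by (simp add: tgrd_def)
    then show ?thesis
      unfolding m by (subst dq_eq[OF X]) (simp_all add: tgrd_def algebra_simps)
  qed
  then show "(\<Oplus>\<^bsub>grd X j (int (n - j))\<^esub>i \<in> {..Suc n - j}. dq X q i (j + i) (int (Suc n - j - i)) (v (j + i))) =
      bar_comp q (tgrd X) (- 1) (signed_fac X) (Suc n) (int (Suc n)) v j"
    unfolding N bl[symmetric]
    by (intro M.M.finsum_cong') (use blc in auto)
qed

lemma bar_map_eq:
  assumes mods: "modules K X" "modules K Y" and f: "list_family K X Y 0 f"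
    and v: "v \<in> carrier (dsum (tgrd X) n)"
  shows "bar_map Y f q n v = bar_op q (tgrd Y) 0 (signed Y 0 f) n n v"
  unfolding bar_map_def bar_op_def
proof (rule restrict_ext)
  fix j assume j: "j \<in> {..n}"
  have gY: "module K (tgrd Y j (int n + 0))" by (rule modulesD(2)[OF mods(2)])
  have N: "grd Y j (int (n - j)) = tgrd Y j (int n + 0)" using j by (simp add: tgrd_def of_nat_diff)
  interpret M: module K "tgrd Y j (int n + 0)" by (rule gY)
  note vc = dsum_component[OF v]
  have bl: "(\<Oplus>\<^bsub>tgrd Y j (int n + 0)\<^esub>i \<in> {..n - j}. \<Oplus>\<^bsub>tgrd Y j (int n + 0)\<^esub>S \<in> ksub q (j + i) i.
      signed Y 0 f S (j + i) (int n) (v (j + i))) = bar_comp q (tgrd Y) 0 (signed Y 0 f) n (int n) v j"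
    by (rule bar_comp_by_length(1)[OF signed_family[OF mods f] gY vc]) (use j in auto)
  have blc: "(\<Oplus>\<^bsub>tgrd Y j (int n + 0)\<^esub>S \<in> ksub q (j + i) i. signed Y 0 f S (j + i) (int n) (v (j + i))) \<in>
      carrier (tgrd Y j (int n + 0))" if "i \<le> n - j" for i
    by (rule bar_comp_by_length(2)[OF signed_family[OF mods f] gY vc]) (use j that in auto)
  have "fq Y f q i (j + i) (int (n - j - i)) (v (j + i)) =
      (\<Oplus>\<^bsub>tgrd Y j (int n + 0)\<^esub>S \<in> ksub q (j + i) i. signed Y 0 f S (j + i) (int n) (v (j + i)))"
    if i: "i \<le> n - j" for i
  proof -
    have m: "int (n - j - i) = int n - int (j + i)" using i j by (simp add: of_nat_diff)
    have "v (j + i) \<in> carrier (grd X (j + i) (int n - int (j + i)))"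
      using vc[of "j + i"] i j by (simp add: tgrd_def)
    then show ?thesis
      unfolding m by (subst fq_eq[OF mods f]) (simp_all add: tgrd_def algebra_simps)
  qed
  then show "(\<Oplus>\<^bsub>grd Y j (int (n - j))\<^esub>i \<in> {..n - j}. fq Y f q i (j + i) (int (n - j - i)) (v (j + i))) =
      bar_comp q (tgrd Y) 0 (signed Y 0 f) n (int n) v j"
    unfolding N bl[symmetric]
    by (intro M.M.finsum_cong') (use blc in auto)
qed

lemma D1_eq: "D1 X n m v = cyc_d1 (tgrd X) (signed_cyc X) n m v"
proof -
  have T: "T_map X k (int n - int k) = signed_cyc X k (int n)" "grd X k (int n - int k) = tgrd X k (int n)" for k
    by (simp_all add: signed_cyc_def tgrd_def)
  have "bar_T X n v = cyc_T (signed_cyc X) n v"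
    unfolding bar_T_def cyc_T_def by (rule restrict_ext) (simp add: T of_nat_diff)
  moreover have "bar_N X n v = cyc_N (tgrd X) (signed_cyc X) n v"
    unfolding bar_N_def cyc_N_def by (rule restrict_ext) (simp add: N_map_def norm_op_def T of_nat_diff)
  ultimately show ?thesis by (simp add: D1_def cyc_d1_def bar_eq)
qed

lemma D2_eq:
  assumes X: "is_CF_module K X" and v: "v \<in> carrier (dsum (tgrd X) (Suc n))"
  shows "D2 X (Suc n) m v = cyc_d2 (tgrd X) (signed_fac X) (Suc n) m v"
  unfolding D2_def cyc_d2_def using bar_b_eq[OF X v] by (simp add: bar_eq)

lemma CF_signed_bicomplex:
  assumes X: "is_CF_module K X"
  shows "is_bicomplex K (dsum (tgrd X)) (cyc_d1 (tgrd X) (signed_cyc X)) (cyc_d2 (tgrd X) (signed_fac X))"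
  by (rule cyclic_bicomplex[OF CF_cyclic_data[OF X] CF_moduleD(5)[OF X] CF_square[OF X] CF_cyclic_fac[OF X]])

lemma CF_bicomplex:
  assumes X: "is_CF_module K X"
  shows "is_bicomplex K (bar X) (D1 X) (D2 X)"
  unfolding bar_eq
  by (rule is_bicomplex_cong[OF CF_signed_bicomplex[OF X] D1_eq D2_eq[OF X]])

lemma CF_bicomplex_map:
  assumes X: "is_CF_module K X" and Y: "is_CF_module K Y" and f: "is_CF_morphism K X Y f"
  shows "is_bicomplex_map K (bar X) (D1 X) (D2 X) (bar Y) (D1 Y) (D2 Y)
    (\<lambda>n m. bar_map Y f (if even m then 0 else 1) n)"
proof -
  note f' = CF_morphismD[OF X Y f]
  show ?thesis
    unfolding bar_eq
    by (rule is_bicomplex_map_cong[OF CF_signed_bicomplex[OF X]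
          cyclic_bicomplex_map[OF CF_cyclic_data[OF X] CF_cyclic_data[OF Y] CF_moduleD(5)[OF X] CF_moduleD(5)[OF Y] f'(2,4,3)]
          D1_eq D2_eq[OF X] D1_eq D2_eq[OF Y] bar_map_eq[OF CF_moduleD(2)[OF X] CF_moduleD(2)[OF Y] f'(1)]])
qed

lemma CF_bicomplex_homotopy:
  assumes X: "is_CF_module K X" and Y: "is_CF_module K Y"
    and f: "is_CF_morphism K X Y f" and g: "is_CF_morphism K X Y g" and h: "is_homotopy K X Y f g h"
  shows "is_bicomplex_homotopy K (bar X) (D1 X) (D2 X) (bar Y) (D1 Y) (D2 Y)
    (\<lambda>n m. bar_map Y f (if even m then 0 else 1) n) (\<lambda>n m. bar_map Y g (if even m then 0 else 1) n)
    (cyc_hty (tgrd Y) (signed Y 1 h))"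
proof -
  note f' = CF_morphismD[OF X Y f] and g' = CF_morphismD[OF X Y g]
  note h' = CF_homotopyD[OF X Y h f'(1) g'(1)]
  note m = CF_moduleD(2)[OF X] CF_moduleD(2)[OF Y]
  show ?thesis
    unfolding bar_eq
    by (rule is_bicomplex_homotopy_cong[OF CF_signed_bicomplex[OF X]
          cyclic_bicomplex_homotopy[OF CF_cyclic_data[OF X] CF_cyclic_data[OF Y] CF_moduleD(5)[OF X] CF_moduleD(5)[OF Y] f'(2) g'(2) h']
          D1_eq D2_eq[OF X] D1_eq D2_eq[OF Y] bar_map_eq[OF m f'(1)] bar_map_eq[OF m g'(1)]])
qed

lemma Tot_eq: "Tot X = tot (bar X)" "Tot_diff X = tot_diff (bar X) (D1 X) (D2 X)"
  "Tot_map Y f = tot_map (\<lambda>n m. bar_map Y f (if even m then 0 else 1) n)"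
  by (simp_all add: fun_eq_iff Tot_def tot_def Tot_diff_def tot_diff_def Tot_map_def tot_map_def)

lemma Tot_complex: "is_CF_module K X \<Longrightarrow> is_complex K (Tot X) (Tot_diff X)"
  unfolding Tot_eq by (rule tot_complex[OF CF_bicomplex])

lemma Tot_chain_map:
  "is_CF_module K X \<Longrightarrow> is_CF_module K Y \<Longrightarrow> is_CF_morphism K X Y f \<Longrightarrow>
    is_chain_map K (Tot X) (Tot_diff X) (Tot Y) (Tot_diff Y) (Tot_map Y f)"
  unfolding Tot_eq by (rule tot_chain_map[OF CF_bicomplex CF_bicomplex CF_bicomplex_map])

lemma Tot_component: "v \<in> carrier (Tot X r) \<Longrightarrow> n \<le> r \<Longrightarrow> v n \<in> carrier (dsum (tgrd X) n)"
  by (auto simp: Tot_def bar_eq)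

lemma HC_map_homotopic:
  assumes X: "is_CF_module K X" and Y: "is_CF_module K Y"
    and f: "is_CF_morphism K X Y f" and g: "is_CF_morphism K X Y g" and h: "homotopic K X Y f g"
  shows "HC_map X Y f = HC_map X Y g"
proof
  fix r
  obtain h where h: "is_homotopy K X Y f g h" using h by (auto simp: homotopic_def)
  show "HC_map X Y f r = HC_map X Y g r"
    unfolding HC_map_def
    by (rule homology_map_eq[OF Tot_complex[OF X] Tot_complex[OF Y] Tot_chain_map[OF X Y f] Tot_chain_map[OF X Y g]])
       (unfold Tot_eq, rule tot_homotopy[OF CF_bicomplex[OF X] CF_bicomplex[OF Y]
          CF_bicomplex_map[OF X Y f] CF_bicomplex_map[OF X Y g] CF_bicomplex_homotopy[OF X Y f g h]])
qed

lemma bar_op_unit: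
  assumes U: "cyclic_data K U T" and v: "v \<in> carrier (dsum U n)"
  shows "bar_op q U 0 (unit_fam U) n n v = v"
proof (rule dsum_eqI[where n = n])
  show "v \<in> extensional {..n}" by (rule dsum_ext[OF v])
  fix j assume j: "j \<le> n"
  note mods = cyclic_dataD(1)[OF U]
  interpret M: module K "U j (int n)" by (rule mods)
  have vj: "v j \<in> carrier (U j (int n))" using dsum_component[OF v j] .
  have c: "unit_fam U S k (int n) (v k) = (if S = {} then v j else \<zero>\<^bsub>U j (int n)\<^esub>)" if "(k, S) \<in> bar_index q n j" for k S
    using that bar_index_adm[OF that] by (auto simp: unit_fam_def)
  have j0: "(j, {}) \<in> bar_index q n j" using j by (simp add: bar_index_def)
  have e: "S \<noteq> {}" if "(k, S) \<in> bar_index q n j" "(k, S) \<noteq> (j, {})" for k S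
    using that by (auto simp: bar_index_def)
  have "finsum (U j (int n)) (\<lambda>(k, S). unit_fam U S k (int n) (v k)) {(j, {})} =
      finsum (U j (int n)) (\<lambda>(k, S). unit_fam U S k (int n) (v k)) (bar_index q n j)"
  proof (rule M.M.finsum_neutral)
    show "{(j, {})} \<subseteq> bar_index q n j" using j0 by simp
    fix i assume i: "i \<in> bar_index q n j - {(j, {})}"
    obtain k S where kS: "i = (k, S)" by (cases i)
    then have kS': "(k, S) \<in> bar_index q n j" "(k, S) \<noteq> (j, {})" using i by auto
    show "(case i of (k, S) \<Rightarrow> unit_fam U S k (int n) (v k)) = \<zero>\<^bsub>U j (int n)\<^esub>"
      using c[OF kS'(1)] e[OF kS'] kS by simp
  next
    fix i assume i: "i \<in> bar_index q n j"
    then show "(case i of (k, S) \<Rightarrow> unit_fam U S k (int n) (v k)) \<in> carrier (U j (int n))"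
      using c vj by (cases i) auto
  qed simp
  then show "bar_op q U 0 (unit_fam U) n n v j = v j"
    using j vj by (simp add: bar_op_def bar_comp_def unit_fam_def)
qed (simp add: bar_op_def)

lemma Tot_map_ident:
  assumes X: "is_CF_module K X" and v: "v \<in> carrier (Tot X r)"
  shows "Tot_map X (CF_ident X) r v = v"
proof (rule extensionalityI[of _ "{..r}"])
  note m = CF_moduleD(2)[OF X]
  show "Tot_map X (CF_ident X) r v \<in> extensional {..r}" by (simp add: Tot_map_def)
  show "v \<in> extensional {..r}" using v by (auto simp: Tot_def PiE_iff)
  fix n assume n: "n \<in> {..r}"
  have vn: "v n \<in> carrier (dsum (tgrd X) n)" using Tot_component[OF v] n by simp
  have "bar_map X (CF_ident X) q n (v n) = v n" for q
  proof -
    have "bar_map X (CF_ident X) q n (v n) = bar_op q (tgrd X) 0 (signed X 0 (CF_ident X)) n n (v n)"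
      by (rule bar_map_eq[OF m m CF_ident_family[OF m] vn])
    also have "\<dots> = bar_op q (tgrd X) 0 (unit_fam (tgrd X)) n n (v n)"
      by (rule bar_op_cong[OF unit_fam_family[of K "tgrd X", OF modulesD(2)[OF m]] CF_cyclic_data[OF X] vn]) (rule signed_ident[OF m])
    also have "\<dots> = v n" by (rule bar_op_unit[OF CF_cyclic_data[OF X] vn])
    finally show ?thesis .
  qed
  then show "Tot_map X (CF_ident X) r v n = v n" using n by (simp add: Tot_map_def)
qed

lemma Tot_map_comp:
  assumes X: "is_CF_module K X" and Y: "is_CF_module K Y" and Z: "is_CF_module K Z"
    and f: "is_CF_morphism K X Y f" and g: "is_CF_morphism K Y Z g" and v: "v \<in> carrier (Tot X r)"
  shows "Tot_map Z (CF_comp X Y Z g f) r v = Tot_map Z g r (Tot_map Y f r v)"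
  unfolding Tot_map_def
proof (rule restrict_ext)
  fix n assume n: "n \<in> {..r}"
  note m = CF_moduleD(2)[OF X] CF_moduleD(2)[OF Y] CF_moduleD(2)[OF Z]
  note f' = CF_morphismD[OF X Y f] and g' = CF_morphismD[OF Y Z g]
  note cX = CF_cyclic_data[OF X] and cY = CF_cyclic_data[OF Y] and cZ = CF_cyclic_data[OF Z]
  have vn: "v n \<in> carrier (dsum (tgrd X) n)" using Tot_component[OF v] n by simp
  let ?q = "if even (r - n) then 0 else 1"
  let ?w = "bar_op ?q (tgrd Y) 0 (signed Y 0 f) n n (v n)"
  have fv: "bar_map Y f ?q n (v n) = ?w" by (rule bar_map_eq[OF m(1,2) f'(1) vn])
  have w: "?w \<in> carrier (dsum (tgrd Y) n)"
    by (rule lin_closed[OF bar_op_linear[OF cX cY f'(2)] vn]) simp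
  have "bar_map Z (CF_comp X Y Z g f) ?q n (v n) = bar_op ?q (tgrd Z) 0 (signed Z 0 (CF_comp X Y Z g f)) n n (v n)"
    by (rule bar_map_eq[OF m(1,3) CF_comp_family[OF m f'(1) g'(1)] vn])
  also have "\<dots> = bar_op ?q (tgrd Z) 0 (conv (tgrd Z) 0 0 (signed Z 0 g) (signed Y 0 f)) n n (v n)"
    by (rule bar_op_cong[OF conv_family[OF f'(2) g'(2) _ modulesD(2)[OF m(1)] modulesD(2)[OF m(3)]] cZ vn])
       (simp_all add: signed_comp[OF m f'(1) g'(1)])
  also have "\<dots> = bar_op ?q (tgrd Z) 0 (signed Z 0 g) n n ?w"
    by (rule bar_op_conv[OF cX cY cZ f'(2) g'(2) _ _ vn, symmetric]) simp_all
  also have "\<dots> = bar_map Z g ?q n ?w" by (rule bar_map_eq[OF m(2,3) g'(1) w, symmetric])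
  finally show "bar_map Z (CF_comp X Y Z g f) ?q n (v n) = bar_map Z g ?q n ((\<lambda>n\<in>{..r}. bar_map Y f (if even (r - n) then 0 else 1) n (v n)) n)"
    using n fv by simp
qed

theorem HC_functor:
  fixes K :: "('k, 'r) ring_scheme"
  shows "is_functor (CF_cat K :: (('k, 'a) CF_module, nat list \<Rightarrow> nat \<Rightarrow> int \<Rightarrow> 'a \<Rightarrow> 'a) category)
    (GrM_cat K) HC HC_map"
  unfolding is_functor_def
proof (intro conjI ballI)
  show "is_category (CF_cat K :: (('k, 'a) CF_module, nat list \<Rightarrow> nat \<Rightarrow> int \<Rightarrow> 'a \<Rightarrow> 'a) category)"
    by (rule CF_category)
  show "is_category (GrM_cat K :: (nat \<Rightarrow> ('k, (nat \<Rightarrow> nat \<Rightarrow> 'a) set) module, _) category)"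
    by (rule GrM_category)
next
  fix X :: "('k, 'a) CF_module" assume "X \<in> Obj (CF_cat K)"
  then have X: "is_CF_module K X" by (simp add: CF_cat_def)
  show "HC X \<in> Obj (GrM_cat K)"
    using homology_module[OF Tot_complex[OF X]] by (simp add: GrM_cat_def HC_def)
  have "HC_map X X (CF_ident X) r = (\<lambda>U \<in> carrier (HC X r). U)" for r
    unfolding HC_map_def HC_def
    by (rule homology_map_ident[OF Tot_complex[OF X]]) (rule Tot_map_ident[OF X])
  then show "HC_map X X (Ident (CF_cat K) X) = Ident (GrM_cat K) (HC X)"
    by (simp add: CF_cat_def GrM_cat_def fun_eq_iff)
next
  fix X Y :: "('k, 'a) CF_module" and f
  assume "X \<in> Obj (CF_cat K)" "Y \<in> Obj (CF_cat K)" "f \<in> Hom (CF_cat K) X Y"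
  then have X: "is_CF_module K X" and Y: "is_CF_module K Y" and f: "is_CF_morphism K X Y f"
    by (auto simp: CF_cat_def)
  show "HC_map X Y f \<in> Hom (GrM_cat K) (HC X) (HC Y)"
    using homology_map_linear[OF Tot_complex[OF X] Tot_complex[OF Y] Tot_chain_map[OF X Y f]]
    by (simp add: GrM_cat_def HC_def HC_map_def)
next
  fix X Y Z :: "('k, 'a) CF_module" and f g
  assume "X \<in> Obj (CF_cat K)" "Y \<in> Obj (CF_cat K)" "Z \<in> Obj (CF_cat K)"
    "f \<in> Hom (CF_cat K) X Y" "g \<in> Hom (CF_cat K) Y Z"
  then have X: "is_CF_module K X" and Y: "is_CF_module K Y" and Z: "is_CF_module K Z"
    and f: "is_CF_morphism K X Y f" and g: "is_CF_morphism K Y Z g"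
    by (auto simp: CF_cat_def)
  have "HC_map X Z (CF_comp X Y Z g f) r = (\<lambda>U \<in> carrier (HC X r). HC_map Y Z g r (HC_map X Y f r U))" for r
    unfolding HC_map_def HC_def
    by (rule homology_map_comp[OF Tot_complex[OF X] Tot_complex[OF Y] Tot_complex[OF Z] Tot_chain_map[OF X Y f]
          Tot_chain_map[OF Y Z g] Tot_chain_map[OF X Z CF_comp_morphism[OF X Y Z f g]]])
       (rule Tot_map_comp[OF X Y Z f g])
  then show "HC_map X Z (Comp (CF_cat K) X Y Z g f) =
      Comp (GrM_cat K) (HC X) (HC Y) (HC Z) (HC_map Y Z g) (HC_map X Y f)"
    by (simp add: CF_cat_def GrM_cat_def fun_eq_iff)
qed

text \<open>If a functor identifies both composites of \<open>f\<close> and \<open>g\<close> with identities, it inverts \<open>f\<close>.\<close>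

lemma functor_inverse:
  assumes F: "is_functor C D F0 F1" and X: "X \<in> Obj C" and Y: "Y \<in> Obj C"
    and f: "f \<in> Hom C X Y" and g: "g \<in> Hom C Y X"
    and gf: "F1 X X (Comp C X Y X g f) = F1 X X (Ident C X)"
    and fg: "F1 Y Y (Comp C Y X Y f g) = F1 Y Y (Ident C Y)"
  shows "is_isomorphism D (F0 X) (F0 Y) (F1 X Y f)"
  unfolding is_isomorphism_def
proof (intro conjI bexI[of _ "F1 Y X g"])
  show "F0 X \<in> Obj D" "F0 Y \<in> Obj D" "F1 X Y f \<in> Hom D (F0 X) (F0 Y)" "F1 Y X g \<in> Hom D (F0 Y) (F0 X)"
    using F X Y f g by (auto simp: is_functor_def)
  have "F1 X X (Comp C X Y X g f) = Comp D (F0 X) (F0 Y) (F0 X) (F1 Y X g) (F1 X Y f)"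
    "F1 Y Y (Comp C Y X Y f g) = Comp D (F0 Y) (F0 X) (F0 Y) (F1 X Y f) (F1 Y X g)"
    "F1 X X (Ident C X) = Ident D (F0 X)" "F1 Y Y (Ident C Y) = Ident D (F0 Y)"
    using F X Y f g unfolding is_functor_def by blast+
  then show "Comp D (F0 X) (F0 Y) (F0 X) (F1 Y X g) (F1 X Y f) = Ident D (F0 X)"
    "Comp D (F0 Y) (F0 X) (F0 Y) (F1 X Y f) (F1 Y X g) = Ident D (F0 Y)"
    using gf fg by simp_all
qed

theorem theorem2p1:
  fixes K :: "('k, 'r) ring_scheme"
  assumes "cring K"
  shows "is_functor
           (CF_cat K :: (('k, 'a) CF_module, nat list \<Rightarrow> nat \<Rightarrow> int \<Rightarrow> 'a \<Rightarrow> 'a) category)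
           (GrM_cat K) HC HC_map \<and>
         (\<forall>(X :: ('k, 'a) CF_module) Y f. is_homotopy_equivalence K X Y f \<longrightarrow>
            is_isomorphism (GrM_cat K) (HC X) (HC Y) (HC_map X Y f))"
proof (intro conjI allI impI)
  show F: "is_functor (CF_cat K :: (('k, 'a) CF_module, nat list \<Rightarrow> nat \<Rightarrow> int \<Rightarrow> 'a \<Rightarrow> 'a) category)
      (GrM_cat K) HC HC_map"
    by (rule HC_functor)
  fix X Y :: "('k, 'a) CF_module" and f
  assume "is_homotopy_equivalence K X Y f"
  then obtain g where ob: "X \<in> Obj (CF_cat K)" "Y \<in> Obj (CF_cat K)" "f \<in> Hom (CF_cat K) X Y" "g \<in> Hom (CF_cat K) Y X"
    and gf: "homotopic K X X (CF_comp X Y X g f) (CF_ident X)"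
    and fg: "homotopic K Y Y (CF_comp Y X Y f g) (CF_ident Y)"
    unfolding is_homotopy_equivalence_def by blast
  then have X: "is_CF_module K X" and Y: "is_CF_module K Y" and f: "is_CF_morphism K X Y f" and g: "is_CF_morphism K Y X g"
    by (auto simp: CF_cat_def)
  show "is_isomorphism (GrM_cat K) (HC X) (HC Y) (HC_map X Y f)"
  proof (rule functor_inverse[OF F ob])
    show "HC_map X X (Comp (CF_cat K) X Y X g f) = HC_map X X (Ident (CF_cat K) X)"
      using HC_map_homotopic[OF X X CF_comp_morphism[OF X Y X f g] CF_ident_morphism[OF X] gf]
      by (simp add: CF_cat_def)
    show "HC_map Y Y (Comp (CF_cat K) Y X Y f g) = HC_map Y Y (Ident (CF_cat K) Y)"
      using HC_map_homotopic[OF Y Y CF_comp_morphism[OF Y X Y g f] CF_ident_morphism[OF Y] fg]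
      by (simp add: CF_cat_def)
  qed
qed

end
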